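(* Suppose that for each $n$ the alternative $H_{1n}(\rho)$ holds, i.e. the innovations $\{\varepsilon_t\}$ are i.i.d. with distribution function $A_n(x)=(1-\rho_n)G_0(x)+\rho_nH(x)$, $\rho_n=\min(1,\rho n^{-1/2})$. Suppose that random variables with distribution functions $G_0$ and $H$ have zero means and finite variances, that $G_0$ and $H$ are twice differentiable with bounded second derivatives, and that $G_0$ and $H$ are symmetric about zero. Let $\hat\mu_n$ and $\hat{\boldsymbol{\beta}}_n$ be any estimators such that $n^{1/2}(\hat\mu_n-\mu)=O_P(1)$ and $n^{1/2}(\hat{\boldsymbol{\beta}}_n-\boldsymbol{\beta})=O_P(1)$ as $n\to\infty$ under $H_{1n}(\rho)$, uniformly in $\gamma\le\Gamma$, $\rho\le R$, for any finite $\Gamma,R\ge0$. Let $0<\alpha<1$, let $\chi_{m-1}(1-\alpha)$ be the $(1-\alpha)$-quantile of the (central) chi-square distribution with $m-1$ degrees of freedom, and let $$ W_n(\rho,\gamma,\Pi)=\mathsf{P}\big(\hat\chi_n^2>\chi_{m-1}(1-\alpha)\big) $$ be the power of the test that rejects when $\hat\chi_n^2>\chi_{m-1}(1-\alpha)$. Then, for any finite $\Gamma,R\ge0$, as $n\to\infty$, $W_n(\rho,\gamma,\Pi)$ converges uniformly in $0\le\gamma\le\Gamma$, $0\le\rho\le R$ to $$ W(\rho,\gamma,\Pi)=1-F_{m-1}\big(\chi_{m-1}(1-\alpha),\hat\lambda^2(\rho,\gamma,\Pi)\big),\qquad W(0,0,\Pi)=\alpha, $$ where $F_{m-1}(\cdot,\lambda^2)$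 is the distribution function of the noncentral chi-square distribution with $m-1$ degrees of freedom and noncentrality parameter $\lambda^2$ and $\hat\lambda^2(\rho,\gamma,\Pi)=\big|\boldsymbol{P}_0^{-1/2}[\rho(\boldsymbol{p}^H-\boldsymbol{p}^0)+\gamma\boldsymbol{\delta}(\Pi)]\big|^2$. Moreover, the test is asymptotically qualitatively robust: $$ \sup_{\Pi,\;\rho\ge0}\big|W(\rho,\gamma,\Pi)-W(\rho,0,\Pi)\big|\to0,\qquad\gamma\to0, $$ the supremum being over all probability distributions $\Pi$ on $\mathbb{R}$ and all $\rho\ge0$.
   Context: Model. Fix $p\ge1$, $\boldsymbol{\beta}=(\beta_1,\dots,\beta_p)^T\in\mathbb{R}^p$ such that all roots of the characteristic equation $\lambda^p-\beta_1\lambda^{p-1}-\dots-\beta_p=0$ are less than one in modulus, and $\nu\in\mathbb{R}$. Let $\{v_t\}_{t\in\mathbb{Z}}$ be the stationary solution of $v_t=\beta_1v_{t-1}+\dots+\beta_pv_{t-p}+\nu+\varepsilon_t$, where the innovations $\{\varepsilon_t\}$ are i.i.d. with zero mean and finite positive variance. Let $\mu$ be defined by $\nu=(1-\beta_1-\dots-\beta_p)\mu$. Outliers. $\{z_t^{\gamma_n}\}$ are i.i.d. random variables taking value $1$ with probability $\gamma_n=\min(1,\gamma n^{-1/2})$ and $0$ with probability $1-\gamma_n$, where $\gamma\ge0$; $\{\xi_t\}$ are i.i.d. with an arbitrary distribution $\Pi$ on $\mathbb{R}$. The sequences $\{\varepsilon_t\}$, $\{z_t^{\gamma_n}\}$,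 $\{\xi_t\}$ are mutually independent. The observations are $y_t=v_t+z_t^{\gamma_n}\xi_t$, $t=1-p,\dots,n$. $G_0$ and $H$ are fixed distribution functions, $\rho\ge0$. Under $H_{1n}(\rho)$ the innovations (hence $v_t$) depend on $n$ through their distribution $A_n$; $\mathsf{P}$ is the probability in the model with parameters $n,\gamma,\rho$. A distribution function $F$ is symmetric about zero if a random variable $X$ with distribution function $F$ has the same distribution as $-X$. Estimators and residuals. $\hat\mu_n$ is a real-valued and $\hat{\boldsymbol{\beta}}_n=(\hat\beta_{1n},\dots,\hat\beta_{pn})^T$ an $\mathbb{R}^p$-valued sequence of estimators constructed from the observations. "$X_n=O_P(1)$ uniformly in $\gamma\le\Gamma,\rho\le R$" means $\lim_{C\to\infty}\limsup_{n\to\infty}\sup_{0\le\gamma\le\Gamma,0\le\rho\le R}\mathsf{P}(|X_n|>C)=0$. Put $\hat u_t=y_t-\hat\mu_n$ for $t=1-p,\dots,n$, and define the residuals $\hat\varepsilon_t=\hat u_t-\hat\beta_{1n}\hat u_{t-1}-\dots-\hat\beta_{pn}\hat u_{t-p}$, $t=1,\dots,n$. Test statistic. Fix $m>1$ and $0=x_0<x_1<\dots<x_m=\infty$. Let $B_j^+=(x_{j-1},x_j]$, $B_j^-=(-x_j,-x_{j-1}]$, $j=1,\dots,m$, and assume $G_0(x_j)-G_0(x_{j-1})>0$ for all $j$. Put $p_j^0=2(G_0(x_j)-G_0(x_{j-1}))$ (so $\sum_jp_j^0=1$), and let $\hat\nu_j$ be the number of $t\in\{1,\dots,n\}$ with $\hat\varepsilon_t\in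 B_j^+\cup B_j^-$. The symmetrized Pearson statistic is $$\hat\chi_n^2=\sum_{j=1}^m\frac{(\hat\nu_j-np_j^0)^2}{np_j^0}.$$ Parameters of the limit. $\boldsymbol{P}_0=\mathrm{diag}\{p_1^0,\dots,p_m^0\}$, $\boldsymbol{p}^0=(p_1^0,\dots,p_m^0)^T$, $\boldsymbol{p}^H=(p_1^H,\dots,p_m^H)^T$ with $p_j^H=2(H(x_j)-H(x_{j-1}))$; $\boldsymbol{\delta}(\Pi)=(\delta_1(\Pi),\dots,\delta_m(\Pi))^T$ with $\delta_j(\Pi)=2[\Delta_S(x_j,\Pi)-\Delta_S(x_{j-1},\Pi)]$, where $$\Delta_S(x,\Pi)=\frac{\Delta(x,\Pi)-\Delta(-x,\Pi)}{2},\qquad\Delta(x,\Pi)=\sum_{j=0}^p\big[\mathsf{E}\,G_0(x+\beta_j\xi_1)-G_0(x)\big],\quad\beta_0=-1,$$ and $\Delta_S(\infty,\Pi)=0$ (the limit as $x\to\infty$). $|\cdot|$ is the Euclidean norm. The noncentral chi-square distribution with $k$ degrees of freedom and noncentrality parameter $\lambda^2$ is the law of $\sum_{i=1}^k(Z_i+a_i)^2$ with $Z_i$ i.i.d. standard normal and $\sum_ia_i^2=\lambda^2$. *)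

theory Defs
  imports "HOL-Probability.Probability"
begin

definition distribution_function :: "(real \<Rightarrow> real) \<Rightarrow> bool" where
  "distribution_function F \<longleftrightarrow>
     mono F \<and> (\<forall>x. continuous (at_right x) F) \<and> (F \<longlongrightarrow> 0) at_bot \<and> (F \<longlongrightarrow> 1) at_top"

text \<open>For a distribution function \<open>F\<close>, \<open>interval_measure F\<close> is the law on \<open>\<real>\<close> with
  distribution function \<open>F\<close>.\<close>

definition centered_finite_variance :: "(real \<Rightarrow> real) \<Rightarrow> bool" where
  "centered_finite_variance F \<longleftrightarrow>
     integrable (interval_measure F) (\<lambda>x. x) \<and> (LINT x|interval_measure F. x) = 0 \<and>
     integrable (interval_measure F) (\<lambda>x. x\<^sup>2)"

definition symmetric_about_zero :: "(real \<Rightarrow> real) \<Rightarrow> bool" where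
  "symmetric_about_zero F \<longleftrightarrow> distr (interval_measure F) borel uminus = interval_measure F"

definition twice_diff_bounded :: "(real \<Rightarrow> real) \<Rightarrow> bool" where
  "twice_diff_bounded F \<longleftrightarrow>
     (\<exists>f f'. (\<forall>x. (F has_real_derivative f x) (at x)) \<and>
             (\<forall>x. (f has_real_derivative f' x) (at x)) \<and> bounded (range f'))"


section \<open>The contaminated autoregression\<close>

text \<open>Vectors indexed by \<open>1,\<dots>,p\<close> are functions on \<open>nat\<close> of which only the values on \<open>{1..p}\<close>
  are used.\<close>

definition stable_coefficients :: "nat \<Rightarrow> (nat \<Rightarrow> real) \<Rightarrow> bool" where
  "stable_coefficients p \<beta> \<longleftrightarrow>
     (\<forall>l::complex. l ^ p - (\<Sum>j=1..p. of_real (\<beta> j) * l ^ (p - j)) = 0 \<longrightarrow> norm l < 1)"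

definition iid_sequence :: "'a measure \<Rightarrow> (int \<Rightarrow> 'a \<Rightarrow> real) \<Rightarrow> bool" where
  "iid_sequence M X \<longleftrightarrow>
     prob_space.indep_vars M (\<lambda>_. borel) X UNIV \<and>
     (\<forall>s t. distr M borel (X s) = distr M borel (X t))"

definition strictly_stationary :: "'a measure \<Rightarrow> (int \<Rightarrow> 'a \<Rightarrow> real) \<Rightarrow> bool" where
  "strictly_stationary M v \<longleftrightarrow>
     (\<forall>t. v t \<in> borel_measurable M) \<and>
     (\<forall>h. distr M (PiM UNIV (\<lambda>_. borel)) (\<lambda>\<omega> t. v (t + h) \<omega>)
        = distr M (PiM UNIV (\<lambda>_. borel)) (\<lambda>\<omega> t. v t \<omega>))"

text \<open>For stable coefficients a strictly stationary solution is almost surely unique, so the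
  conditions on \<open>v\<close> below single out the stationary solution; its independence of \<open>(z, \<xi>)\<close>
  is then a consequence.\<close>

definition ar_outlier_model ::
  "'a measure \<Rightarrow> nat \<Rightarrow> (nat \<Rightarrow> real) \<Rightarrow> real \<Rightarrow> (real \<Rightarrow> real) \<Rightarrow> real \<Rightarrow> real measure \<Rightarrow>
   (int \<Rightarrow> 'a \<Rightarrow> real) \<Rightarrow> (int \<Rightarrow> 'a \<Rightarrow> real) \<Rightarrow> (int \<Rightarrow> 'a \<Rightarrow> real) \<Rightarrow> (int \<Rightarrow> 'a \<Rightarrow> real) \<Rightarrow> bool"
  where
  "ar_outlier_model M p \<beta> \<nu> A g Q \<epsilon> z \<xi> v \<longleftrightarrow>
     prob_space M \<and>
     iid_sequence M \<epsilon> \<and> iid_sequence M z \<and> iid_sequence M \<xi> \<and>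
     prob_space.indep_vars M (\<lambda>_. PiM UNIV (\<lambda>_. borel))
       (\<lambda>k \<omega> t. ([\<epsilon>, z, \<xi>] ! k) t \<omega>) {..<3::nat} \<and>
     (\<forall>t. cdf (distr M borel (\<epsilon> t)) = A) \<and>
     (\<forall>t. integrable M (\<epsilon> t) \<and> (LINT \<omega>|M. \<epsilon> t \<omega>) = 0 \<and>
          integrable M (\<lambda>\<omega>. (\<epsilon> t \<omega>)\<^sup>2) \<and> (LINT \<omega>|M. (\<epsilon> t \<omega>)\<^sup>2) > 0) \<and>
     (\<forall>t. measure M {\<omega> \<in> space M. z t \<omega> = 1} = g \<and>
          measure M {\<omega> \<in> space M. z t \<omega> = 0} = 1 - g) \<and>
     (\<forall>t. distr M borel (\<xi> t) = Q) \<and>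
     strictly_stationary M v \<and>
     (\<forall>t. AE \<omega> in M. v t \<omega> = (\<Sum>j=1..p. \<beta> j * v (t - int j) \<omega>) + \<nu> + \<epsilon> t \<omega>)"

definition local_rate :: "real \<Rightarrow> nat \<Rightarrow> real" where
  "local_rate c n = min 1 (c / sqrt (real n))"

definition local_alternative :: "(real \<Rightarrow> real) \<Rightarrow> (real \<Rightarrow> real) \<Rightarrow> real \<Rightarrow> nat \<Rightarrow> real \<Rightarrow> real" where
  "local_alternative G\<^sub>0 H \<rho> n x = (1 - local_rate \<rho> n) * G\<^sub>0 x + local_rate \<rho> n * H x"

definition obs_times :: "nat \<Rightarrow> nat \<Rightarrow> int set" where
  "obs_times p n = {1 - int p..int n}"

definition observations ::
  "nat \<Rightarrow> nat \<Rightarrow> (int \<Rightarrow> 'a \<Rightarrow> real) \<Rightarrow> (int \<Rightarrow> 'a \<Rightarrow> real) \<Rightarrow> (int \<Rightarrow> 'a \<Rightarrow> real) \<Rightarrow> 'a \<Rightarrow> int \<Rightarrow> real"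
  where
  "observations p n v z \<xi> \<omega> = (\<lambda>t\<in>obs_times p n. v t \<omega> + z t \<omega> * \<xi> t \<omega>)"

text \<open>A statistic: a measurable function of the observed sample.\<close>

definition sample_statistic :: "nat \<Rightarrow> nat \<Rightarrow> ((int \<Rightarrow> real) \<Rightarrow> real) \<Rightarrow> bool" where
  "sample_statistic p n T \<longleftrightarrow> T \<in> borel_measurable (PiM (obs_times p n) (\<lambda>_. borel))"

text \<open>\<open>X\<^sub>n = O\<^sub>P(1)\<close> uniformly in \<open>0 \<le> \<gamma> \<le> \<Gamma>\<close>, \<open>0 \<le> \<rho> \<le> R\<close>, where \<open>M n \<gamma> \<rho>\<close> carries the model
  with parameters \<open>n, \<gamma>, \<rho>\<close>.\<close>

definition uniformly_OP1 ::
  "(nat \<Rightarrow> real \<Rightarrow> real \<Rightarrow> 'a measure) \<Rightarrow> (nat \<Rightarrow> real \<Rightarrow> real \<Rightarrow> 'a \<Rightarrow> real) \<Rightarrow> real \<Rightarrow> real \<Rightarrow> bool"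
  where
  "uniformly_OP1 M X \<Gamma> R \<longleftrightarrow>
     ((\<lambda>C::real. limsup (\<lambda>n. SUP \<gamma>\<in>{0..\<Gamma>}. SUP \<rho>\<in>{0..R}.
          ereal (measure (M n \<gamma> \<rho>) {\<omega> \<in> space (M n \<gamma> \<rho>). \<bar>X n \<gamma> \<rho> \<omega>\<bar> > C}))) \<longlongrightarrow> 0) at_top"


section \<open>The symmetrized Pearson statistic\<close>

definition residual ::
  "nat \<Rightarrow> real \<Rightarrow> (nat \<Rightarrow> real) \<Rightarrow> (int \<Rightarrow> real) \<Rightarrow> int \<Rightarrow> real" where
  "residual p m\<^sub>0 b y t = (y t - m\<^sub>0) - (\<Sum>j=1..p. b j * (y (t - int j) - m\<^sub>0))"

text \<open>The cell boundaries \<open>x\<^sub>0,\<dots>,x\<^sub>m\<close> are extended reals since \<open>x\<^sub>m = \<infinity>\<close>.\<close>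

definition cell_boundaries :: "nat \<Rightarrow> (nat \<Rightarrow> ereal) \<Rightarrow> bool" where
  "cell_boundaries m x \<longleftrightarrow> x 0 = 0 \<and> (\<forall>j<m. x j < x (Suc j)) \<and> x m = \<infinity>"

definition symmetric_cell :: "(nat \<Rightarrow> ereal) \<Rightarrow> nat \<Rightarrow> real set" where
  "symmetric_cell x j =
     {s. x (j - 1) < ereal s \<and> ereal s \<le> x j} \<union> {s. - x j < ereal s \<and> ereal s \<le> - x (j - 1)}"

definition df_at :: "(real \<Rightarrow> real) \<Rightarrow> ereal \<Rightarrow> real" where
  "df_at F x = (if x = \<infinity> then 1 else F (real_of_ereal x))"

definition cell_prob :: "(real \<Rightarrow> real) \<Rightarrow> (nat \<Rightarrow> ereal) \<Rightarrow> nat \<Rightarrow> real" where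
  "cell_prob F x j = 2 * (df_at F (x j) - df_at F (x (j - 1)))"

definition cell_count ::
  "nat \<Rightarrow> nat \<Rightarrow> (nat \<Rightarrow> ereal) \<Rightarrow> real \<Rightarrow> (nat \<Rightarrow> real) \<Rightarrow> (int \<Rightarrow> real) \<Rightarrow> nat \<Rightarrow> nat" where
  "cell_count p n x m\<^sub>0 b y j = card {t \<in> {1..int n}. residual p m\<^sub>0 b y t \<in> symmetric_cell x j}"

definition pearson_statistic ::
  "(real \<Rightarrow> real) \<Rightarrow> nat \<Rightarrow> (nat \<Rightarrow> ereal) \<Rightarrow> nat \<Rightarrow> nat \<Rightarrow> real \<Rightarrow> (nat \<Rightarrow> real) \<Rightarrow> (int \<Rightarrow> real) \<Rightarrow> real"
  where
  "pearson_statistic G\<^sub>0 m x p n m\<^sub>0 b y =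
     (\<Sum>j=1..m. (real (cell_count p n x m\<^sub>0 b y j) - real n * cell_prob G\<^sub>0 x j)\<^sup>2
                / (real n * cell_prob G\<^sub>0 x j))"


section \<open>The limiting power\<close>

definition noncentral_chi_square :: "nat \<Rightarrow> (nat \<Rightarrow> real) \<Rightarrow> real measure" where
  "noncentral_chi_square k a =
     distr (PiM {..<k} (\<lambda>_. density lborel std_normal_density)) borel (\<lambda>Z. \<Sum>i<k. (Z i + a i)\<^sup>2)"

text \<open>The law depends on the shift \<open>a\<close> only through \<open>\<Sum>i<k. (a i)\<^sup>2\<close>, here taken to be \<open>l\<close>
  by putting the whole shift into the first coordinate (\<open>k \<ge> 1\<close>, \<open>l \<ge> 0\<close>).\<close>

definition noncentral_chi_square_cdf :: "nat \<Rightarrow> real \<Rightarrow> real \<Rightarrow> real" where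
  "noncentral_chi_square_cdf k q l =
     cdf (noncentral_chi_square k (\<lambda>i. if i = 0 then sqrt l else 0)) q"

definition chi_square_quantile :: "nat \<Rightarrow> real \<Rightarrow> real" where
  "chi_square_quantile k u = Inf {q. u \<le> noncentral_chi_square_cdf k q 0}"

definition outlier_shift ::
  "(real \<Rightarrow> real) \<Rightarrow> nat \<Rightarrow> (nat \<Rightarrow> real) \<Rightarrow> real measure \<Rightarrow> real \<Rightarrow> real" where
  "outlier_shift G\<^sub>0 p \<beta> Q x =
     (\<Sum>j=0..p. (LINT s|Q. G\<^sub>0 (x + (if j = 0 then - 1 else \<beta> j) * s)) - G\<^sub>0 x)"

definition outlier_shift_sym ::
  "(real \<Rightarrow> real) \<Rightarrow> nat \<Rightarrow> (nat \<Rightarrow> real) \<Rightarrow> real measure \<Rightarrow> ereal \<Rightarrow> real" where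
  "outlier_shift_sym G\<^sub>0 p \<beta> Q x =
     (if x = \<infinity> then 0
      else (outlier_shift G\<^sub>0 p \<beta> Q (real_of_ereal x) - outlier_shift G\<^sub>0 p \<beta> Q (- real_of_ereal x)) / 2)"

definition cell_shift ::
  "(real \<Rightarrow> real) \<Rightarrow> nat \<Rightarrow> (nat \<Rightarrow> real) \<Rightarrow> (nat \<Rightarrow> ereal) \<Rightarrow> real measure \<Rightarrow> nat \<Rightarrow> real" where
  "cell_shift G\<^sub>0 p \<beta> x Q j =
     2 * (outlier_shift_sym G\<^sub>0 p \<beta> Q (x j) - outlier_shift_sym G\<^sub>0 p \<beta> Q (x (j - 1)))"

definition noncentrality ::
  "(real \<Rightarrow> real) \<Rightarrow> (real \<Rightarrow> real) \<Rightarrow> nat \<Rightarrow> (nat \<Rightarrow> real) \<Rightarrow> nat \<Rightarrow> (nat \<Rightarrow> ereal) \<Rightarrow>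
   real \<Rightarrow> real \<Rightarrow> real measure \<Rightarrow> real" where
  "noncentrality G\<^sub>0 H p \<beta> m x \<rho> \<gamma> Q =
     (L2_set (\<lambda>j. (\<rho> * (cell_prob H x j - cell_prob G\<^sub>0 x j) + \<gamma> * cell_shift G\<^sub>0 p \<beta> x Q j)
                  / sqrt (cell_prob G\<^sub>0 x j)) {1..m})\<^sup>2"

definition limit_power ::
  "(real \<Rightarrow> real) \<Rightarrow> (real \<Rightarrow> real) \<Rightarrow> nat \<Rightarrow> (nat \<Rightarrow> real) \<Rightarrow> nat \<Rightarrow> (nat \<Rightarrow> ereal) \<Rightarrow>
   real \<Rightarrow> real \<Rightarrow> real \<Rightarrow> real measure \<Rightarrow> real" where
  "limit_power G\<^sub>0 H p \<beta> m x \<alpha> \<rho> \<gamma> Q =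
     1 - noncentral_chi_square_cdf (m - 1) (chi_square_quantile (m - 1) (1 - \<alpha>))
           (noncentrality G\<^sub>0 H p \<beta> m x \<rho> \<gamma> Q)"

end

theory Submission
  imports Defs "HOL-Complex_Analysis.Cauchy_Integral_Formula"
begin

text \<open>Write the residual counts as functions of the scaled estimation errors \<open>\<tau>\<close>. For deterministic
  \<open>\<tau>\<close> the count of residuals below \<open>x\<close> differs from that of the innovations by a martingale of
  negligible variance, a drift \<open>a(x) \<tau>\<^sub>0 + \<dots>\<close> and the outlier term \<open>\<gamma> \<Delta>(x, \<Pi>)\<close>; since the density \<open>a\<close> is
  even, the drift cancels in the symmetric cells, and monotonicity in \<open>\<tau>\<close> together with a finite grid
  transfers this to the estimated \<open>\<tau>\<close>. What remains is a multinomial vector \<open>S\<close> with a constant shift.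
  Writing \<open>exp (- l |S|\<^sup>2)\<close> as the expectation of \<open>exp (i \<surd>(2 l) S \<cdot> W)\<close> over an independent Gaussian \<open>W\<close>
  reduces the limit of the Laplace transform of the statistic to one-dimensional characteristic
  functions. Uniformity follows from convergence along convergent sequences of parameters, robustness
  from the Lipschitz dependence of the noncentral chi-square distribution function on the square root
  of the noncentrality.\<close>

section \<open>Laplace transforms of Gaussian quadratic forms\<close>

text \<open>Three features of the problem shape the proof. The law \<open>Q\<close> of the outlier
  sizes is arbitrary, so \<open>\<xi>\<close> need not have moments: every estimate that meets
  \<open>\<xi>\<close> is taken under \<open>min 1\<close> or averages a bounded function of it. The
  estimators may depend on the whole sample, so residual indicators built from them are adapted to
  no filtration. The martingale argument is therefore carried out for fixed coefficients only, with
  a margin \<open>d * lag_abs\<close> added to the linear form so that one grid point brackets all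
  coefficient vectors within \<open>d\<close> of it. Finally, the cell counts add up to
  \<open>n\<close>, so the normalized vector lives in a hyperplane and its limit covariance is
  singular; the lost dimension turns \<open>m\<close> into \<open>m - 1\<close> degrees of freedom.
  The rate \<open>n powr (-1/2)\<close> of contamination is critical: single outliers among
  \<open>p + 1\<close> consecutive times shift the normalized counts by a finite amount, while two
  of them have frequency of order \<open>1 / n\<close> and disappear in the limit.\<close>

abbreviation gauss_product :: "'i set \<Rightarrow> ('i \<Rightarrow> real) measure" where
  "gauss_product I \<equiv> PiM I (\<lambda>_. std_normal_distribution)"

lemma prob_space_std_normal: "prob_space std_normal_distribution"
  using real_dist_normal_dist by (simp add: real_distribution_def)

lemma prob_space_gauss_product: "prob_space (gauss_product I)"
  by (rule prob_space_PiM) (rule prob_space_std_normal)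

lemma product_sigma_finite_gauss: "product_sigma_finite (\<lambda>_. std_normal_distribution)"
  by (simp add: product_sigma_finite_def prob_space_imp_sigma_finite prob_space_std_normal)

text \<open>Rescaling \<open>w = c * y\<close> with \<open>c\<^sup>2 * (1 + 2 * l) = 1\<close>
  absorbs the damping into the density, which becomes standard normal in \<open>y\<close>. What
  remains is the normal characteristic function at \<open>a * c\<close>; the Jacobian
  \<open>c\<close> is the factor \<open>1 / sqrt (1 + 2 * l)\<close>.\<close>

lemma integral_iexp_exp_square:
  assumes "l \<ge> 0"
  shows "(LINT w|std_normal_distribution. iexp (a * w) * of_real (exp (- l * w\<^sup>2)))
    = of_real (exp (- a\<^sup>2 / (2 * (1 + 2 * l))) / sqrt (1 + 2 * l))"
proof -
  define c where "c = 1 / sqrt (1 + 2 * l)"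
  have c: "c > 0" "c\<^sup>2 * (1 + 2 * l) = 1"
    using assms by (auto simp: c_def power_divide)
  have dens: "std_normal_density (c * y) * exp (- l * (c * y)\<^sup>2) = std_normal_density y" for y
  proof -
    have "- (c * y)\<^sup>2 / 2 + - l * (c * y)\<^sup>2 = - (c\<^sup>2 * (1 + 2 * l)) * y\<^sup>2 / 2"
      by (simp add: field_simps power_mult_distrib)
    then show ?thesis
      by (simp add: std_normal_density_def c exp_add[symmetric])
  qed
  have "(LINT w|std_normal_distribution. iexp (a * w) * of_real (exp (- l * w\<^sup>2)))
    = (LINT w|lborel. std_normal_density w *\<^sub>R (iexp (a * w) * of_real (exp (- l * w\<^sup>2))))"
    by (subst integral_density) auto
  also have "\<dots> = c *\<^sub>R (LINT y|lborel. std_normal_density (c * y) *\<^sub>R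
       (iexp (a * (c * y)) * of_real (exp (- l * (c * y)\<^sup>2))))"
    using c by (subst lborel_integral_real_affine[where c = c and t = 0]) auto
  also have "(\<lambda>y. std_normal_density (c * y) *\<^sub>R (iexp (a * (c * y)) * of_real (exp (- l * (c * y)\<^sup>2))))
      = (\<lambda>y. std_normal_density y *\<^sub>R iexp ((a * c) * y))"
  proof
    fix y
    have "std_normal_density (c * y) *\<^sub>R (iexp (a * (c * y)) * of_real (exp (- l * (c * y)\<^sup>2)))
      = of_real (std_normal_density (c * y) * exp (- l * (c * y)\<^sup>2)) * iexp (a * (c * y))"
      by (simp add: scaleR_conv_of_real mult_ac del: of_real_exp)
    then show "std_normal_density (c * y) *\<^sub>R (iexp (a * (c * y)) * of_real (exp (- l * (c * y)\<^sup>2)))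
      = std_normal_density y *\<^sub>R iexp ((a * c) * y)"
      unfolding dens by (simp add: scaleR_conv_of_real mult_ac)
  qed
  also have "(LINT y|lborel. std_normal_density y *\<^sub>R iexp ((a * c) * y)) = char std_normal_distribution (a * c)"
    unfolding char_def by (subst integral_density) auto
  also have "\<dots> = of_real (exp (- (a * c)\<^sup>2 / 2))"
    by (simp add: char_std_normal_distribution)
  also have "(a * c)\<^sup>2 = a\<^sup>2 / (1 + 2 * l)"
    using assms by (simp add: c_def power_mult_distrib power_divide)
  finally show ?thesis by (simp add: c_def scaleR_conv_of_real)
qed

text \<open>The Gaussian linearization (Hubbard-Stratonovich) identity: the exponential of a square
  becomes an average of exponentials of linear forms. It is the undamped case of the lemma above,
  read from right to left.\<close>

lemma exp_square_eq_integral_iexp: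
  assumes "l \<ge> 0"
  shows "of_real (exp (- l * y\<^sup>2)) = (LINT w|std_normal_distribution. iexp (sqrt (2 * l) * y * w))"
proof -
  have "(LINT w|std_normal_distribution. iexp (sqrt (2 * l) * y * w))
      = (LINT w|std_normal_distribution. iexp (sqrt (2 * l) * y * w) * of_real (exp (- 0 * w\<^sup>2)))"
    by simp
  also have "\<dots> = of_real (exp (- (sqrt (2 * l) * y)\<^sup>2 / (2 * (1 + 2 * 0))) / sqrt (1 + 2 * 0))"
    by (rule integral_iexp_exp_square) simp
  finally show ?thesis using assms by (simp add: power_mult_distrib)
qed

lemma iexp_sum: "finite I \<Longrightarrow> iexp (\<Sum>i\<in>I. f i) = (\<Prod>i\<in>I. iexp (f i))"
  by (simp add: sum_distrib_left exp_sum)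

lemma integral_gauss_product_iexp:
  assumes "finite I" "l \<ge> 0"
  shows "(LINT w|gauss_product I. iexp (\<Sum>i\<in>I. a i * w i) * of_real (exp (- l * (\<Sum>i\<in>I. (w i)\<^sup>2))))
    = of_real (\<Prod>i\<in>I. exp (- (a i)\<^sup>2 / (2 * (1 + 2 * l))) / sqrt (1 + 2 * l))"
proof -
  interpret product_sigma_finite "\<lambda>_. std_normal_distribution" by (rule product_sigma_finite_gauss)
  interpret N: prob_space std_normal_distribution by (rule prob_space_std_normal)
  have int: "integrable std_normal_distribution (\<lambda>w. iexp (a i * w) * of_real (exp (- l * w\<^sup>2)))" for i
    using assms by (intro N.integrable_const_bound[where B = 1]) (auto simp: norm_mult)
  have "(LINT w|gauss_product I. iexp (\<Sum>i\<in>I. a i * w i) * of_real (exp (- l * (\<Sum>i\<in>I. (w i)\<^sup>2))))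
     = (LINT w|gauss_product I. (\<Prod>i\<in>I. iexp (a i * w i) * of_real (exp (- l * (w i)\<^sup>2))))"
    using assms by (simp add: prod.distrib iexp_sum sum_distrib_left exp_sum sum_negf[symmetric]
        del: of_real_exp of_real_mult of_real_sum of_real_minus)
  also have "\<dots> = (\<Prod>i\<in>I. LINT w|std_normal_distribution. iexp (a i * w) * of_real (exp (- l * w\<^sup>2)))"
    using assms int by (intro product_integral_prod) auto
  also have "\<dots> = of_real (\<Prod>i\<in>I. exp (- (a i)\<^sup>2 / (2 * (1 + 2 * l))) / sqrt (1 + 2 * l))"
    unfolding integral_iexp_exp_square[OF assms(2)] by simp
  finally show ?thesis .
qed

lemma exp_sum_squares_eq_integral_iexp:
  assumes "finite I" "l \<ge> 0"
  shows "of_real (exp (- l * (\<Sum>i\<in>I. (y i)\<^sup>2))) = (LINT w|gauss_product I. iexp (\<Sum>i\<in>I. sqrt (2 * l) * y i * w i))"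
proof -
  have "(LINT w|gauss_product I. iexp (\<Sum>i\<in>I. (sqrt (2 * l) * y i) * w i) * of_real (exp (- 0 * (\<Sum>i\<in>I. (w i)\<^sup>2))))
    = of_real (\<Prod>i\<in>I. exp (- (sqrt (2 * l) * y i)\<^sup>2 / (2 * (1 + 2 * 0))) / sqrt (1 + 2 * 0))"
    by (rule integral_gauss_product_iexp) (use assms in auto)
  also have "(\<Prod>i\<in>I. exp (- (sqrt (2 * l) * y i)\<^sup>2 / (2 * (1 + 2 * 0))) / sqrt (1 + 2 * 0))
    = (\<Prod>i\<in>I. exp (- l * (y i)\<^sup>2))"
    using assms by (simp add: power_mult_distrib)
  also have "\<dots> = exp (- l * (\<Sum>i\<in>I. (y i)\<^sup>2))"
    using assms by (simp add: exp_sum sum_distrib_left sum_negf[symmetric])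
  finally show ?thesis by (simp del: of_real_exp)
qed

text \<open>Linearizing the square allows the integral over \<open>z\<close> to be done first; it
  returns a Gaussian factor in \<open>w\<close> and leaves the damped oscillating integral computed
  before.\<close>

lemma integral_exp_shifted_square:
  assumes "l \<ge> 0"
  shows "(LINT z|std_normal_distribution. exp (- l * (z + a)\<^sup>2))
    = exp (- l * a\<^sup>2 / (1 + 2 * l)) / sqrt (1 + 2 * l)"
proof -
  interpret N: prob_space std_normal_distribution by (rule prob_space_std_normal)
  interpret NN: pair_prob_space std_normal_distribution std_normal_distribution ..
  have "complex_of_real (LINT z|std_normal_distribution. exp (- l * (z + a)\<^sup>2))
    = (LINT z|std_normal_distribution. LINT w|std_normal_distribution. iexp (sqrt (2 * l) * (z + a) * w))"
    unfolding exp_square_eq_integral_iexp[OF assms, symmetric] by (simp del: of_real_exp)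
  also have "\<dots> = (LINT w|std_normal_distribution. LINT z|std_normal_distribution. iexp (sqrt (2 * l) * (z + a) * w))"
    by (intro NN.Fubini_integral NN.P.integrable_const_bound[where B = 1]) (auto simp: case_prod_beta)
  also have "\<dots> = (LINT w|std_normal_distribution. iexp (sqrt (2 * l) * a * w) * of_real (exp (- l * w\<^sup>2)))"
    unfolding exp_square_eq_integral_iexp[OF assms]
    by (subst integral_mult_right_zero[symmetric]) (simp add: exp_add[symmetric] algebra_simps)
  also have "\<dots> = of_real (exp (- (sqrt (2 * l) * a)\<^sup>2 / (2 * (1 + 2 * l))) / sqrt (1 + 2 * l))"
    by (rule integral_iexp_exp_square[OF assms])
  also have "- (sqrt (2 * l) * a)\<^sup>2 / (2 * (1 + 2 * l)) = - l * a\<^sup>2 / (1 + 2 * l)"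
    using assms by (simp add: power_mult_distrib divide_simps)
  finally show ?thesis unfolding of_real_eq_iff .
qed

lemma real_distribution_noncentral_chi_square: "real_distribution (noncentral_chi_square k a)"
proof -
  interpret prob_space "gauss_product {..<k}" by (rule prob_space_gauss_product)
  show ?thesis
    unfolding noncentral_chi_square_def by (intro real_distribution_distr) measurable
qed

text \<open>The coordinates are independent, so the transform is a product. It sees \<open>a\<close>
  only through the sum of squares, which is why the whole shift may be placed in a single
  coordinate.\<close>

lemma noncentral_chi_square_laplace:
  assumes "l \<ge> 0"
  shows "(LINT x|noncentral_chi_square k a. exp (- l * x))
    = exp (- l * (\<Sum>i<k. (a i)\<^sup>2) / (1 + 2 * l)) / sqrt (1 + 2 * l) ^ k"
proof -
  interpret product_sigma_finite "\<lambda>_. std_normal_distribution" by (rule product_sigma_finite_gauss)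
  interpret N: prob_space std_normal_distribution by (rule prob_space_std_normal)
  have "(LINT x|noncentral_chi_square k a. exp (- l * x))
     = (LINT z|gauss_product {..<k}. exp (- l * (\<Sum>i<k. (z i + a i)\<^sup>2)))"
    unfolding noncentral_chi_square_def by (subst integral_distr) auto
  also have "\<dots> = (LINT z|gauss_product {..<k}. (\<Prod>i<k. exp (- l * (z i + a i)\<^sup>2)))"
    by (simp add: exp_sum sum_distrib_left sum_negf[symmetric])
  also have "\<dots> = (\<Prod>i<k. LINT z|std_normal_distribution. exp (- l * (z + a i)\<^sup>2))"
    using assms by (intro product_integral_prod N.integrable_const_bound[where B = 1]) auto
  also have "\<dots> = (\<Prod>i<k. exp (- l * (a i)\<^sup>2 / (1 + 2 * l)) / sqrt (1 + 2 * l))"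
    by (simp only: integral_exp_shifted_square[OF assms])
  also have "\<dots> = exp (- l * (\<Sum>i<k. (a i)\<^sup>2) / (1 + 2 * l)) / sqrt (1 + 2 * l) ^ k"
    by (simp add: prod_dividef exp_sum[symmetric] sum_distrib_left sum_divide_distrib sum_negf[symmetric])
  finally show ?thesis .
qed

text \<open>A further normal variable \<open>u\<close> linearizes the damping along \<open>s\<close>
  and changes the coefficient vector from \<open>y\<close> to \<open>y + u * s\<close>. As
  \<open>s\<close> is a unit vector orthogonal to \<open>y\<close>, Pythagoras separates the two,
  and the integral over \<open>u\<close> gives the extra root.\<close>

lemma integral_iexp_linear_form_square:
  fixes y s :: "'i \<Rightarrow> real"
  assumes I: "finite I" and l: "l \<ge> 0" and s: "(\<Sum>i\<in>I. (s i)\<^sup>2) = 1" and ys: "(\<Sum>i\<in>I. s i * y i) = 0"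
  shows "(LINT w|gauss_product I. iexp (\<Sum>i\<in>I. sqrt (2 * l) * y i * w i) * of_real (exp (- l * (\<Sum>i\<in>I. s i * w i)\<^sup>2)))
    = of_real (exp (- l * (\<Sum>i\<in>I. (y i)\<^sup>2)) / sqrt (1 + 2 * l))"
proof -
  interpret N: prob_space std_normal_distribution by (rule prob_space_std_normal)
  interpret P: prob_space "gauss_product I" by (rule prob_space_gauss_product)
  interpret NN: pair_prob_space "gauss_product I" std_normal_distribution ..
  have norm1: "(\<Sum>i\<in>I. (y i + u * s i)\<^sup>2) = (\<Sum>i\<in>I. (y i)\<^sup>2) + u\<^sup>2" for u
  proof -
    have "(\<Sum>i\<in>I. (y i + u * s i)\<^sup>2) = (\<Sum>i\<in>I. (y i)\<^sup>2) + 2 * u * (\<Sum>i\<in>I. s i * y i) + u\<^sup>2 * (\<Sum>i\<in>I. (s i)\<^sup>2)"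
      by (simp add: power2_sum sum.distrib sum_distrib_left algebra_simps power_mult_distrib)
    then show ?thesis using s ys by simp
  qed
  have "(LINT w|gauss_product I. iexp (\<Sum>i\<in>I. sqrt (2 * l) * y i * w i) * of_real (exp (- l * (\<Sum>i\<in>I. s i * w i)\<^sup>2)))
     = (LINT w|gauss_product I. LINT u|std_normal_distribution.
          iexp (\<Sum>i\<in>I. sqrt (2 * l) * (y i + u * s i) * w i))"
    unfolding exp_square_eq_integral_iexp[OF l]
    by (subst integral_mult_right_zero[symmetric])
       (simp add: exp_add[symmetric] algebra_simps sum.distrib sum_distrib_left)
  also have "\<dots> = (LINT u|std_normal_distribution. LINT w|gauss_product I.
          iexp (\<Sum>i\<in>I. sqrt (2 * l) * (y i + u * s i) * w i))"
    by (intro NN.Fubini_integral[symmetric] NN.P.integrable_const_bound[where B = 1]) (auto simp: case_prod_beta)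
  also have "\<dots> = (LINT u|std_normal_distribution. of_real (exp (- l * (\<Sum>i\<in>I. (y i)\<^sup>2)) * exp (- l * (u + 0)\<^sup>2)))"
    unfolding exp_sum_squares_eq_integral_iexp[OF I l, symmetric] norm1
    by (simp add: exp_add[symmetric] algebra_simps del: of_real_exp)
  also have "\<dots> = of_real (exp (- l * (\<Sum>i\<in>I. (y i)\<^sup>2)) / sqrt (1 + 2 * l))"
    using integral_exp_shifted_square[OF l, of 0] by (simp del: of_real_exp)
  finally show ?thesis .
qed

text \<open>Each \<open>S k\<close> is confined to the hyperplane orthogonal to \<open>s\<close>, so multiplying
  \<open>exp (- l |S k|\<^sup>2)\<close> by the Laplace transform of an independent \<open>N(0,1)\<close> component along \<open>s\<close> turns
  the degenerate covariance \<open>I - s s\<^sup>T\<close> into \<open>I\<close>.\<close>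

lemma laplace_transform_degenerate_gauss_limit:
  fixes S :: "nat \<Rightarrow> 'i \<Rightarrow> 'a \<Rightarrow> real" and s D :: "'i \<Rightarrow> real"
  assumes I: "finite I" and l: "l \<ge> 0"
    and P: "\<And>k. prob_space (P k)"
    and meas: "\<And>k i. i \<in> I \<Longrightarrow> S k i \<in> borel_measurable (P k)"
    and s: "(\<Sum>i\<in>I. (s i)\<^sup>2) = 1" and D: "(\<Sum>i\<in>I. s i * D i) = 0"
    and orth: "\<And>k \<omega>. \<omega> \<in> space (P k) \<Longrightarrow> (\<Sum>i\<in>I. s i * S k i \<omega>) = 0"
    and cf: "\<And>w. (\<lambda>k. LINT \<omega>|P k. iexp (\<Sum>i\<in>I. w i * S k i \<omega>)) \<longlonglongrightarrow>
        iexp (\<Sum>i\<in>I. w i * D i) * of_real (exp (- ((\<Sum>i\<in>I. (w i)\<^sup>2) - (\<Sum>i\<in>I. s i * w i)\<^sup>2) / 2))"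
  shows "(\<lambda>k. LINT \<omega>|P k. exp (- l * (\<Sum>i\<in>I. (S k i \<omega>)\<^sup>2))) \<longlonglongrightarrow>
    exp (- l * (\<Sum>i\<in>I. (D i)\<^sup>2) / (1 + 2 * l)) / sqrt (1 + 2 * l) ^ (card I - 1)"
proof -
  define r where "r = sqrt (2 * l)"
  define c where "c = sqrt (1 + 2 * l)"
  have c0: "c > 0" using l by (simp add: c_def)
  have r2: "r\<^sup>2 = 2 * l" using l by (simp add: r_def)
  have "card I > 0" using s I by (auto simp: card_gt_0_iff)
  interpret G: prob_space "gauss_product I" by (rule prob_space_gauss_product)
  let ?q = "\<lambda>w. of_real (exp (- l * (\<Sum>i\<in>I. s i * w i)\<^sup>2)) :: complex"
  let ?phi = "\<lambda>k w. LINT \<omega>|P k. iexp (\<Sum>i\<in>I. r * S k i \<omega> * w i)"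
  \<comment> \<open>The factor \<open>c\<close> compensates the root introduced by damping along
    \<open>s\<close>, so the identity is exact before any limit is taken.\<close>
  have eq: "of_real (LINT \<omega>|P k. exp (- l * (\<Sum>i\<in>I. (S k i \<omega>)\<^sup>2)))
      = of_real c * (LINT w|gauss_product I. ?q w * ?phi k w)" for k
  proof -
    interpret Pk: prob_space "P k" by (rule P)
    interpret NN: pair_prob_space "gauss_product I" "P k" ..
    note meas[measurable]
    have "of_real (LINT \<omega>|P k. exp (- l * (\<Sum>i\<in>I. (S k i \<omega>)\<^sup>2)))
      = (LINT \<omega>|P k. of_real (exp (- l * (\<Sum>i\<in>I. (S k i \<omega>)\<^sup>2))) :: complex)"
      by (simp del: of_real_exp)
    also have "\<dots> = (LINT \<omega>|P k. of_real c * (LINT w|gauss_product I. iexp (\<Sum>i\<in>I. r * S k i \<omega> * w i) * ?q w))"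
      unfolding r_def
      by (intro Bochner_Integration.integral_cong refl, subst integral_iexp_linear_form_square[OF I l s orth])
         (use c0 in \<open>auto simp: c_def simp del: of_real_exp\<close>)
    also have "\<dots> = of_real c * (LINT \<omega>|P k. (LINT w|gauss_product I. iexp (\<Sum>i\<in>I. r * S k i \<omega> * w i) * ?q w))"
      by simp
    also have "(LINT \<omega>|P k. (LINT w|gauss_product I. iexp (\<Sum>i\<in>I. r * S k i \<omega> * w i) * ?q w))
      = (LINT w|gauss_product I. (LINT \<omega>|P k. iexp (\<Sum>i\<in>I. r * S k i \<omega> * w i) * ?q w))"
      using I l by (intro NN.Fubini_integral NN.P.integrable_const_bound[where B = 1])
        (auto simp: case_prod_beta norm_mult)
    also have "\<dots> = (LINT w|gauss_product I. ?q w * ?phi k w)"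
      by (simp add: mult.commute)
    finally show ?thesis .
  qed
  \<comment> \<open>The damping along \<open>s\<close> fills the deficit of the singular limit
    covariance in that direction, because \<open>r\<^sup>2 = 2 * l\<close>; the limit is
    isotropic.\<close>
  have pw: "(\<lambda>k. ?q w * ?phi k w) \<longlonglongrightarrow>
      iexp (\<Sum>i\<in>I. (r * D i) * w i) * of_real (exp (- l * (\<Sum>i\<in>I. (w i)\<^sup>2)))" for w
  proof -
    have "(\<lambda>k. ?q w * ?phi k w) \<longlonglongrightarrow> ?q w * (iexp (\<Sum>i\<in>I. (r * w i) * D i) *
        of_real (exp (- ((\<Sum>i\<in>I. (r * w i)\<^sup>2) - (\<Sum>i\<in>I. s i * (r * w i))\<^sup>2) / 2)))"
      using cf[of "\<lambda>i. r * w i"] by (intro tendsto_mult tendsto_const) (simp add: mult_ac)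
    also have "(\<Sum>i\<in>I. s i * (r * w i)) = r * (\<Sum>i\<in>I. s i * w i)"
      by (simp add: sum_distrib_left mult_ac)
    also have "(\<Sum>i\<in>I. (r * w i)\<^sup>2) = r\<^sup>2 * (\<Sum>i\<in>I. (w i)\<^sup>2)"
      by (simp add: sum_distrib_left power_mult_distrib)
    also have "?q w * (iexp (\<Sum>i\<in>I. (r * w i) * D i) *
        of_real (exp (- (r\<^sup>2 * (\<Sum>i\<in>I. (w i)\<^sup>2) - (r * (\<Sum>i\<in>I. s i * w i))\<^sup>2) / 2)))
       = iexp (\<Sum>i\<in>I. (r * w i) * D i) * of_real (exp (- l * (\<Sum>i\<in>I. s i * w i)\<^sup>2) *
           exp (- (r\<^sup>2 * (\<Sum>i\<in>I. (w i)\<^sup>2) - (r * (\<Sum>i\<in>I. s i * w i))\<^sup>2) / 2))"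
      by (simp del: of_real_exp)
    also have "exp (- l * (\<Sum>i\<in>I. s i * w i)\<^sup>2) *
           exp (- (r\<^sup>2 * (\<Sum>i\<in>I. (w i)\<^sup>2) - (r * (\<Sum>i\<in>I. s i * w i))\<^sup>2) / 2)
         = exp (- l * (\<Sum>i\<in>I. (w i)\<^sup>2))"
      unfolding exp_add[symmetric] by (simp add: r2 power_mult_distrib algebra_simps add_divide_distrib diff_divide_distrib)
    finally show ?thesis by (simp add: mult_ac)
  qed
  have "(\<lambda>k. LINT w|gauss_product I. ?q w * ?phi k w) \<longlonglongrightarrow>
      (LINT w|gauss_product I. iexp (\<Sum>i\<in>I. (r * D i) * w i) * of_real (exp (- l * (\<Sum>i\<in>I. (w i)\<^sup>2))))"
  proof (rule integral_dominated_convergence[where w = "\<lambda>_. 1"])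
    show "(\<lambda>w. ?q w * ?phi k w) \<in> borel_measurable (gauss_product I)" for k
    proof -
      interpret Pk: prob_space "P k" by (rule P)
      note meas[measurable]
      show ?thesis by measurable
    qed
    show "AE w in gauss_product I. norm (?q w * ?phi k w) \<le> 1" for k
    proof (rule AE_I2)
      fix w
      interpret Pk: prob_space "P k" by (rule P)
      note meas[measurable]
      have "norm (?phi k w) \<le> (LINT \<omega>|P k. norm (iexp (\<Sum>i\<in>I. r * S k i \<omega> * w i)))"
        by (rule integral_norm_bound)
      also have "\<dots> \<le> 1" by (simp add: Pk.prob_space)
      finally show "norm (?q w * ?phi k w) \<le> 1"
        using l by (simp add: norm_mult mult_le_one)
    qed
    show "(\<lambda>w. iexp (\<Sum>i\<in>I. (r * D i) * w i) * of_real (exp (- l * (\<Sum>i\<in>I. (w i)\<^sup>2)))) \<in> borel_measurable (gauss_product I)"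
      by measurable
  qed (use pw in auto)
  also have "(LINT w|gauss_product I. iexp (\<Sum>i\<in>I. (r * D i) * w i) * of_real (exp (- l * (\<Sum>i\<in>I. (w i)\<^sup>2))))
     = of_real (\<Prod>i\<in>I. exp (- (r * D i)\<^sup>2 / (2 * (1 + 2 * l))) / c)"
    unfolding c_def by (rule integral_gauss_product_iexp[OF I l])
  also have "(\<Prod>i\<in>I. exp (- (r * D i)\<^sup>2 / (2 * (1 + 2 * l))) / c) = (\<Prod>i\<in>I. exp (- l * (D i)\<^sup>2 / (1 + 2 * l))) / c ^ card I"
  proof -
    have "(r * D i)\<^sup>2 / (2 * (1 + 2 * l)) = l * (D i)\<^sup>2 / (1 + 2 * l)" for i
      using l by (simp add: r2 power_mult_distrib divide_simps)
    then show ?thesis by (simp add: prod_dividef)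
  qed
  also have "(\<Prod>i\<in>I. exp (- l * (D i)\<^sup>2 / (1 + 2 * l))) = exp (- l * (\<Sum>i\<in>I. (D i)\<^sup>2) / (1 + 2 * l))"
    using I by (simp add: exp_sum[symmetric] sum_distrib_left sum_divide_distrib sum_negf[symmetric])
  finally have "(\<lambda>k. of_real c * (LINT w|gauss_product I. ?q w * ?phi k w)) \<longlonglongrightarrow>
     of_real c * of_real (exp (- l * (\<Sum>i\<in>I. (D i)\<^sup>2) / (1 + 2 * l)) / c ^ card I)"
    by (intro tendsto_mult tendsto_const)
  then have "(\<lambda>k. complex_of_real (LINT \<omega>|P k. exp (- l * (\<Sum>i\<in>I. (S k i \<omega>)\<^sup>2)))) \<longlonglongrightarrow>
     of_real (c * (exp (- l * (\<Sum>i\<in>I. (D i)\<^sup>2) / (1 + 2 * l)) / c ^ card I))"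
    unfolding eq of_real_mult .
  then have "(\<lambda>k. LINT \<omega>|P k. exp (- l * (\<Sum>i\<in>I. (S k i \<omega>)\<^sup>2))) \<longlonglongrightarrow>
     c * (exp (- l * (\<Sum>i\<in>I. (D i)\<^sup>2) / (1 + 2 * l)) / c ^ card I)"
    unfolding tendsto_of_real_iff .
  \<comment> \<open>The isotropic Gaussian contributes one factor \<open>1 / c\<close> per
    coordinate. The prefactor \<open>c\<close> removes one of them: this is the lost degree of
    freedom.\<close>
  also have "c * (exp (- l * (\<Sum>i\<in>I. (D i)\<^sup>2) / (1 + 2 * l)) / c ^ card I)
     = exp (- l * (\<Sum>i\<in>I. (D i)\<^sup>2) / (1 + 2 * l)) / c ^ (card I - 1)"
    using c0 \<open>card I > 0\<close> by (cases "card I") auto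
  finally show ?thesis unfolding c_def .
qed

section \<open>Weak convergence from moments and from Laplace transforms\<close>

lemma moments_weak_convergence:
  fixes a b :: real
  assumes Mk: "\<And>k. real_distribution (Mk k)" "\<And>k. AE x in Mk k. x \<in> {a..b}"
    and N: "real_distribution N" "AE x in N. x \<in> {a..b}"
    and mom: "\<And>i::nat. (\<lambda>k. LINT x|Mk k. x ^ i) \<longlonglongrightarrow> (LINT x|N. x ^ i)"
  shows "weak_conv_m Mk N"
proof (rule integral_cts_step_conv_imp_weak_conv[OF Mk(1) N(1)])
  fix u v :: real assume uv: "u < v"
  define f where "f = cts_step u v"
  have f: "continuous_on UNIV f"
    using cts_step_uniformly_continuous[OF uv] uniformly_continuous_imp_continuous
    by (auto simp: f_def)
  have f1: "\<bar>f x\<bar> \<le> 1" for x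
    using uv by (auto simp: f_def cts_step_def)
  have fm[measurable]: "f \<in> borel_measurable borel"
    using f by (rule borel_measurable_continuous_onI)
  have bound: "integrable R (\<lambda>x. x ^ i)" if R: "real_distribution R" "AE x in R. x \<in> {a..b}" for R and i :: nat
  proof -
    interpret R: real_distribution R by (rule R)
    show ?thesis
    proof (rule R.integrable_const_bound[where B = "max \<bar>a\<bar> \<bar>b\<bar> ^ i"])
      show "AE x in R. norm (x ^ i) \<le> max \<bar>a\<bar> \<bar>b\<bar> ^ i"
        using R(2) by eventually_elim (auto simp: power_abs intro!: power_mono)
    qed measurable
  qed
  show "(\<lambda>k. integral\<^sup>L (Mk k) (cts_step u v)) \<longlonglongrightarrow> integral\<^sup>L N (cts_step u v)"
    unfolding f_def[symmetric]
  proof (rule LIMSEQ_I)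
    fix e :: real assume e: "e > 0"
    obtain g :: "real \<Rightarrow> real" where g: "real_polynomial_function g" "\<And>x. x \<in> {a..b} \<Longrightarrow> \<bar>f x - g x\<bar> < e / 3"
      using Stone_Weierstrass_real_polynomial_function[of "{a..b}" f "e/3"] e
        continuous_on_subset[OF f] by auto
    obtain c n where gs: "g = (\<lambda>x. \<Sum>i\<le>n. c i * x ^ i)"
      using g(1) real_polynomial_function_iff_sum by auto
    \<comment> \<open>The polynomial approximation is uniform on the interval, so the same error
      bound serves all laws carried by it, every \<open>Mk k\<close> as well as
      \<open>N\<close>.\<close>
    have close: "\<bar>(LINT x|R. f x) - (LINT x|R. g x)\<bar> \<le> e / 3"
      if R: "real_distribution R" "AE x in R. x \<in> {a..b}" for R
    proof -
      interpret R: real_distribution R by (rule R)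
      have fi: "integrable R f"
        using f1 by (intro R.integrable_const_bound[where B = 1]) auto
      have gi: "integrable R g"
        unfolding gs using bound[OF R] by auto
      have "\<bar>(LINT x|R. f x) - (LINT x|R. g x)\<bar> = \<bar>LINT x|R. f x - g x\<bar>"
        using fi gi by simp
      also have "\<dots> \<le> (LINT x|R. \<bar>f x - g x\<bar>)"
        by (rule integral_abs_bound)
      also have "\<dots> \<le> (LINT x|R. e / 3)"
      proof (rule integral_mono_AE)
        show "AE x in R. \<bar>f x - g x\<bar> \<le> e / 3"
          using R(2) by eventually_elim (use g(2) in force)
      qed (use fi gi in auto)
      finally show ?thesis by (simp add: R.prob_space[simplified])
    qed
    have "(\<lambda>k. LINT x|Mk k. g x) \<longlonglongrightarrow> (LINT x|N. g x)"
    proof -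
      have expand: "(LINT x|R. g x) = (\<Sum>i\<le>n. c i * (LINT x|R. x ^ i))"
        if R: "real_distribution R" "AE x in R. x \<in> {a..b}" for R
        using bound[OF R] unfolding gs by (subst Bochner_Integration.integral_sum) auto
      have "(\<lambda>k. \<Sum>i\<le>n. c i * (LINT x|Mk k. x ^ i)) \<longlonglongrightarrow> (\<Sum>i\<le>n. c i * (LINT x|N. x ^ i))"
        by (intro tendsto_intros mom)
      then show ?thesis
        using expand[OF Mk] expand[OF N] by simp
    qed
    from LIMSEQ_D[OF this, of "e/3"] e
    obtain K where K: "\<And>k. k \<ge> K \<Longrightarrow> \<bar>(LINT x|Mk k. g x) - (LINT x|N. g x)\<bar> < e / 3"
      by auto
    show "\<exists>no. \<forall>k\<ge>no. norm ((LINT x|Mk k. f x) - (LINT x|N. f x)) < e"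
    proof (intro exI[of _ K] allI impI)
      fix k assume "k \<ge> K"
      then show "norm ((LINT x|Mk k. f x) - (LINT x|N. f x)) < e"
        using K[of k] close[OF Mk, of k] close[OF N] unfolding real_norm_def abs_le_iff abs_less_iff
        by linarith
    qed
  qed
qed

text \<open>Since \<open>- exp (- T k)\<close> takes values in \<open>[-1, 0]\<close>, the Laplace transform at the natural numbers
  gives all its moments, which determine the limit law by Weierstrass' theorem.\<close>

lemma laplace_transform_continuity:
  fixes T :: "nat \<Rightarrow> 'a \<Rightarrow> real"
  assumes P: "\<And>k. prob_space (P k)" and meas: "\<And>k. T k \<in> borel_measurable (P k)"
    and pos: "\<And>k \<omega>. \<omega> \<in> space (P k) \<Longrightarrow> T k \<omega> \<ge> 0"
    and N: "real_distribution N" "AE x in N. x \<ge> 0"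
    and lap: "\<And>i. (\<lambda>k. LINT \<omega>|P k. exp (- real i * T k \<omega>)) \<longlonglongrightarrow> (LINT x|N. exp (- real i * x))"
    and q: "measure N {q} = 0"
  shows "(\<lambda>k. measure (P k) {\<omega> \<in> space (P k). T k \<omega> > q}) \<longlonglongrightarrow> 1 - cdf N q"
proof -
  interpret N: real_distribution N by (rule N)
  \<comment> \<open>The minus sign makes \<open>h\<close> increasing, so
    \<open>{T k \<le> q}\<close> is the event \<open>{h (T k) \<le> h q}\<close> and distribution
    functions carry over without reflection.\<close>
  define h :: "real \<Rightarrow> real" where "h = (\<lambda>x. - exp (- x))"
  have h[measurable]: "h \<in> borel_measurable borel" by (simp add: h_def)
  define Mk where "Mk = (\<lambda>k. distr (P k) borel (\<lambda>\<omega>. h (T k \<omega>)))"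
  define N' where "N' = distr N borel h"
  have rdk: "real_distribution (Mk k)" for k
  proof -
    interpret prob_space "P k" by (rule P)
    note meas[measurable]
    show ?thesis unfolding Mk_def by (rule real_distribution_distr) measurable
  qed
  have rdN: "real_distribution N'"
    unfolding N'_def by (rule N.real_distribution_distr) measurable
  have pw: "h x ^ i = (- 1) ^ i * exp (- real i * x)" for x i
    by (simp add: h_def power_minus[of "exp _"] exp_of_nat_mult[symmetric])
  have hr: "h x \<in> {-1..0}" if "x \<ge> 0" for x
    using that by (auto simp: h_def)
  have "weak_conv_m Mk N'"
  proof (rule moments_weak_convergence[where a = "-1" and b = 0])
    show "AE x in Mk k. x \<in> {-1..0}" for k
      unfolding Mk_def using meas pos hr by (subst AE_distr_iff) auto
    show "AE x in N'. x \<in> {-1..0}"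
      unfolding N'_def
    proof (subst AE_distr_iff)
      show "AE x in N. h x \<in> {-1..0}"
        using N(2) by eventually_elim (rule hr)
    qed auto
    show "(\<lambda>k. LINT x|Mk k. x ^ i) \<longlonglongrightarrow> (LINT x|N'. x ^ i)" for i
    proof -
      have "(LINT x|Mk k. x ^ i) = (- 1) ^ i * (LINT \<omega>|P k. exp (- real i * T k \<omega>))" for k
        unfolding Mk_def using meas by (subst integral_distr) (simp_all add: pw)
      moreover have "(LINT x|N'. x ^ i) = (- 1) ^ i * (LINT x|N. exp (- real i * x))"
        unfolding N'_def by (subst integral_distr) (simp_all add: pw)
      ultimately show ?thesis
        using tendsto_mult[OF tendsto_const lap] by simp
    qed
  qed (rule rdk rdN)+
  moreover have hi: "h x = h y \<longleftrightarrow> x = y" "h x \<le> h y \<longleftrightarrow> x \<le> y" for x y by (auto simp: h_def)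
  have "isCont (cdf N') (h q)"
  proof -
    interpret N': real_distribution N' by (rule rdN)
    have "measure N' {h q} = measure N {q}"
      unfolding N'_def by (subst measure_distr) (auto simp: hi intro!: arg_cong[where f = "measure N"])
    then show ?thesis using q by (simp add: N'.isCont_cdf)
  qed
  ultimately have "(\<lambda>k. cdf (Mk k) (h q)) \<longlonglongrightarrow> cdf N' (h q)"
    unfolding weak_conv_m_def weak_conv_def by blast
  moreover have "cdf N' (h q) = cdf N q"
    unfolding cdf_def N'_def by (subst measure_distr) (auto simp: hi intro!: arg_cong[where f = "measure N"])
  moreover have "cdf (Mk k) (h q) = 1 - measure (P k) {\<omega> \<in> space (P k). T k \<omega> > q}" for k
  proof -
    interpret Pk: prob_space "P k" by (rule P)
    note meas[measurable]
    have "cdf (Mk k) (h q) = measure (P k) {\<omega> \<in> space (P k). T k \<omega> \<le> q}"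
      unfolding cdf_def Mk_def by (subst measure_distr) (auto simp: hi intro!: arg_cong[where f = "measure (P k)"])
    also have "{\<omega> \<in> space (P k). T k \<omega> \<le> q} = space (P k) - {\<omega> \<in> space (P k). T k \<omega> > q}" by auto
    finally show ?thesis by (subst (asm) Pk.prob_compl) auto
  qed
  ultimately have "(\<lambda>k. 1 - measure (P k) {\<omega> \<in> space (P k). T k \<omega> > q}) \<longlonglongrightarrow> cdf N q" by simp
  from tendsto_diff[OF tendsto_const[of 1] this] show ?thesis by simp
qed

section \<open>Noncentral chi-square distribution functions\<close>

lemma measure_std_normal_singleton: "measure std_normal_distribution {c} = 0"
proof -
  have "emeasure std_normal_distribution {c} = 0"
    by (subst emeasure_density) (auto simp: nn_integral_cmult_indicator intro!: nn_integral_0_iff_AE[THEN iffD2] AE_I[where N = "{c}"])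
  then show ?thesis by (simp add: measure_def)
qed

lemma measure_std_normal_Icc_le:
  assumes "h \<ge> 0"
  shows "measure std_normal_distribution {c..c + h} \<le> h"
proof -
  have "std_normal_density x \<le> 1" for x
  proof -
    have "1 \<le> sqrt (2 * pi)" using pi_ge_two by (intro real_le_rsqrt) auto
    then show ?thesis
      by (auto simp: std_normal_density_def divide_simps intro!: order_trans[OF _ \<open>1 \<le> sqrt (2 * pi)\<close>])
  qed
  then have le: "ennreal (std_normal_density x) * indicator {c..c + h} x \<le> indicator {c..c + h} x" for x
    by (simp add: indicator_def)
  have "emeasure std_normal_distribution {c..c + h} = (\<integral>\<^sup>+x. ennreal (std_normal_density x) * indicator {c..c + h} x \<partial>lborel)"
    by (subst emeasure_density) simp_all
  also have "\<dots> \<le> (\<integral>\<^sup>+x. indicator {c..c + h} x \<partial>lborel)"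
    by (intro nn_integral_mono le)
  also have "\<dots> = ennreal h" using assms by simp
  finally show ?thesis using assms by (simp add: measure_def enn2real_leI)
qed

text \<open>A translation by \<open>h\<close> removes a piece of length \<open>h\<close> at one end
  and adds one at the other. Each of the two inequalities pays for one end only, which keeps the
  constant at 1.\<close>

lemma measure_std_normal_Icc_shift:
  "\<bar>measure std_normal_distribution {c - a..d - a} - measure std_normal_distribution {c - b..d - b}\<bar> \<le> \<bar>a - b\<bar>"
proof -
  interpret N: prob_space std_normal_distribution by (rule prob_space_std_normal)
  have *: "measure std_normal_distribution {u..v} \<le> measure std_normal_distribution {u - h..v - h} + h"
    "measure std_normal_distribution {u - h..v - h} \<le> measure std_normal_distribution {u..v} + h" if "h \<ge> 0" for u v h :: real
  proof -
    have "measure std_normal_distribution {u..v} \<le> measure std_normal_distribution ({u - h..v - h} \<union> {v - h..v - h + h})"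
      using that by (intro N.finite_measure_mono) auto
    also have "\<dots> \<le> measure std_normal_distribution {u - h..v - h} + measure std_normal_distribution {v - h..v - h + h}"
      by (rule measure_Un_le) auto
    finally show "measure std_normal_distribution {u..v} \<le> measure std_normal_distribution {u - h..v - h} + h"
      using measure_std_normal_Icc_le[OF that, of "v - h"] by simp
    have "measure std_normal_distribution {u - h..v - h} \<le> measure std_normal_distribution ({u..v} \<union> {u - h..u - h + h})"
      using that by (intro N.finite_measure_mono) auto
    also have "\<dots> \<le> measure std_normal_distribution {u..v} + measure std_normal_distribution {u - h..u - h + h}"
      by (rule measure_Un_le) auto
    finally show "measure std_normal_distribution {u - h..v - h} \<le> measure std_normal_distribution {u..v} + h"
      using measure_std_normal_Icc_le[OF that, of "u - h"] by simp
  qed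
  show ?thesis
    using *[of "a - b" "c - b" "d - b"] *[of "b - a" "c - a" "d - a"]
    by (cases "a \<ge> b") (auto simp: abs_le_iff algebra_simps)
qed

lemma shifted_square_le_eq_Icc:
  "{y. (y + a)\<^sup>2 \<le> r} = (if r \<ge> 0 then {- sqrt r - a..sqrt r - a} else {})" for r :: real
proof (cases "r \<ge> 0")
  case True
  have "(y + a)\<^sup>2 \<le> r \<longleftrightarrow> y \<in> {- sqrt r - a..sqrt r - a}" for y
  proof -
    have "(y + a)\<^sup>2 \<le> r \<longleftrightarrow> \<bar>y + a\<bar> \<le> sqrt r"
      by (subst real_sqrt_le_iff[symmetric]) (simp only: real_sqrt_abs)
    also have "\<dots> \<longleftrightarrow> y \<in> {- sqrt r - a..sqrt r - a}"
      unfolding abs_le_iff atLeastAtMost_iff by linarith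
    finally show ?thesis .
  qed
  then show ?thesis using True by (simp add: set_eq_iff)
next
  case False
  have "\<not> (y + a)\<^sup>2 \<le> r" for y using False zero_le_power2[of "y + a"] by linarith
  then show ?thesis using False by simp
qed

text \<open>Coordinate 0 is singled out because \<open>noncentral_chi_square_cdf\<close> puts the
  whole shift there: given the other coordinates, the shift merely translates a one-dimensional
  normal event.\<close>

lemma measure_noncentral_chi_square:
  assumes k: "k \<ge> 1" and B[measurable]: "B \<in> sets borel"
  shows "measure (noncentral_chi_square k a) B =
    (LINT x|gauss_product {1..<k}. measure std_normal_distribution {y. (y + a 0)\<^sup>2 + (\<Sum>i=1..<k. (x i + a i)\<^sup>2) \<in> B})"
proof -
  interpret product_sigma_finite "\<lambda>_. std_normal_distribution" by (rule product_sigma_finite_gauss)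
  interpret P: prob_space "gauss_product {..<k}" by (rule prob_space_gauss_product)
  have I: "{..<k} = insert 0 {1..<k}" using k by auto
  let ?f = "\<lambda>z. \<Sum>i<k. (z i + a i)\<^sup>2 :: real"
  have "measure (noncentral_chi_square k a) B = measure (gauss_product {..<k}) (?f -` B \<inter> space (gauss_product {..<k}))"
    unfolding noncentral_chi_square_def by (subst measure_distr) auto
  also have "\<dots> = (LINT z|gauss_product {..<k}. indicator (?f -` B \<inter> space (gauss_product {..<k})) z)"
    by simp
  also have "\<dots> = (LINT z|gauss_product {..<k}. indicator B (?f z))"
    by (intro Bochner_Integration.integral_cong) (auto simp: indicator_def)
  also have "\<dots> = (LINT z|gauss_product (insert 0 {1..<k}). indicator B (?f z))"
    unfolding I ..
  also have "\<dots> = (LINT x|gauss_product {1..<k}. LINT y|std_normal_distribution. indicator B (?f (x(0 := y))))"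
  proof (rule product_integral_insert)
    show "integrable (gauss_product (insert 0 {1..<k})) (\<lambda>z. indicator B (?f z) :: real)"
      unfolding I[symmetric] by (intro P.integrable_const_bound[where B = 1]) (auto simp: indicator_def)
  qed auto
  also have "\<dots> = (LINT x|gauss_product {1..<k}. measure std_normal_distribution {y. (y + a 0)\<^sup>2 + (\<Sum>i=1..<k. (x i + a i)\<^sup>2) \<in> B})"
  proof (intro Bochner_Integration.integral_cong refl)
    fix x
    have "?f (x(0 := y)) = (y + a 0)\<^sup>2 + (\<Sum>i=1..<k. (x i + a i)\<^sup>2)" for y
      unfolding I by (subst sum.insert) auto
    then have "(LINT y|std_normal_distribution. indicator B (?f (x(0 := y))) :: real) =
        (LINT y|std_normal_distribution. indicator {y. (y + a 0)\<^sup>2 + (\<Sum>i=1..<k. (x i + a i)\<^sup>2) \<in> B} y)"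
      by (intro Bochner_Integration.integral_cong) (simp_all add: indicator_def)
    then show "(LINT y|std_normal_distribution. indicator B (?f (x(0 := y)))) =
        measure std_normal_distribution {y. (y + a 0)\<^sup>2 + (\<Sum>i=1..<k. (x i + a i)\<^sup>2) \<in> B}"
      by simp
  qed
  finally show ?thesis .
qed

lemma noncentral_chi_square_singleton:
  assumes "k \<ge> 1"
  shows "measure (noncentral_chi_square k a) {q} = 0"
proof -
  have "measure std_normal_distribution {y. (y + b)\<^sup>2 + R \<in> {q}} = 0" for b R :: real
  proof -
    interpret N: prob_space std_normal_distribution by (rule prob_space_std_normal)
    have "y = sqrt (q - R) - b \<or> y = - sqrt (q - R) - b" if "(y + b)\<^sup>2 + R = q" for y
    proof -
      have "q - R = (y + b)\<^sup>2" using that by simp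
      then have "sqrt (q - R) = \<bar>y + b\<bar>" by simp
      then show ?thesis by linarith
    qed
    then have "measure std_normal_distribution {y. (y + b)\<^sup>2 + R \<in> {q}}
        \<le> measure std_normal_distribution ({sqrt (q - R) - b} \<union> {- sqrt (q - R) - b})"
      by (intro N.finite_measure_mono) auto
    also have "\<dots> \<le> measure std_normal_distribution {sqrt (q - R) - b} + measure std_normal_distribution {- sqrt (q - R) - b}"
      by (rule measure_Un_le) auto
    finally show ?thesis by (simp add: measure_std_normal_singleton measure_le_0_iff)
  qed
  then show ?thesis by (subst measure_noncentral_chi_square[OF assms]) auto
qed

text \<open>Given the other coordinates, the event is a normal interval translated by
  \<open>sqrt l\<close>; hence a bound in the root of the noncentrality. That root is the Euclidean
  norm of a shift vector, so the bound combines with the triangle inequality.\<close>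

lemma noncentral_chi_square_cdf_lipschitz:
  assumes k: "k \<ge> 1"
  shows "\<bar>noncentral_chi_square_cdf k q l - noncentral_chi_square_cdf k q l'\<bar> \<le> \<bar>sqrt l - sqrt l'\<bar>"
proof -
  interpret P: prob_space "gauss_product {1..<k}" by (rule prob_space_gauss_product)
  interpret N: prob_space std_normal_distribution by (rule prob_space_std_normal)
  define F where "F = (\<lambda>b x. measure std_normal_distribution {y. (y + b)\<^sup>2 + (\<Sum>i=1..<k. (x i)\<^sup>2) \<in> {..q}})"
  have cdf: "noncentral_chi_square_cdf k q l = (LINT x|gauss_product {1..<k}. F (sqrt l) x)" for l
    unfolding noncentral_chi_square_cdf_def cdf_def F_def
    by (subst measure_noncentral_chi_square[OF k]) auto
  have FL: "\<bar>F b x - F b' x\<bar> \<le> \<bar>b - b'\<bar>" for b b' x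
  proof -
    define r where "r = q - (\<Sum>i=1..<k. (x i)\<^sup>2)"
    have "{y. (y + b)\<^sup>2 + (\<Sum>i=1..<k. (x i)\<^sup>2) \<in> {..q}} = {y. (y + b)\<^sup>2 \<le> r}" for b
      by (auto simp: r_def)
    then show ?thesis
      unfolding F_def using measure_std_normal_Icc_shift[of "- sqrt r" b "sqrt r" b']
      by (simp add: shifted_square_le_eq_Icc)
  qed
  have [measurable]: "F b \<in> borel_measurable (gauss_product {1..<k})" for b
  proof -
    have "(\<lambda>x. measure std_normal_distribution {y \<in> space std_normal_distribution. (y + b)\<^sup>2 + (\<Sum>i=1..<k. (x i)\<^sup>2) \<le> q})
       \<in> borel_measurable (gauss_product {1..<k})"
      by measurable
    then show ?thesis by (simp add: F_def[abs_def])
  qed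
  have int: "integrable (gauss_product {1..<k}) (F b)" for b
    by (intro P.integrable_const_bound[where B = 1]) (auto simp: F_def)
  have "\<bar>noncentral_chi_square_cdf k q l - noncentral_chi_square_cdf k q l'\<bar>
     = \<bar>LINT x|gauss_product {1..<k}. F (sqrt l) x - F (sqrt l') x\<bar>"
    unfolding cdf using int by simp
  also have "\<dots> \<le> (LINT x|gauss_product {1..<k}. \<bar>F (sqrt l) x - F (sqrt l') x\<bar>)"
    by (rule integral_abs_bound)
  also have "\<dots> \<le> (LINT x|gauss_product {1..<k}. \<bar>sqrt l - sqrt l'\<bar>)"
    by (intro integral_mono integrable_abs Bochner_Integration.integrable_diff int FL P.integrable_const)
  finally show ?thesis by (simp add: P.prob_space del: One_nat_def)
qed

lemma noncentral_chi_square_nonneg: "AE x in noncentral_chi_square k a. x \<ge> 0"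
  unfolding noncentral_chi_square_def by (subst AE_distr_iff) (auto intro!: sum_nonneg)

text \<open>The law has no atoms, so its distribution function is continuous: the value
  \<open>u\<close> is attained, and the level set defining the quantile is closed and contains its
  infimum.\<close>

lemma noncentral_chi_square_cdf_quantile:
  assumes k: "k \<ge> 1" and u: "0 < u" "u < 1"
  shows "noncentral_chi_square_cdf k (chi_square_quantile k u) 0 = u"
proof -
  define N where "N = noncentral_chi_square k (\<lambda>i. if i = 0 then sqrt 0 else 0)"
  interpret N: real_distribution N unfolding N_def by (rule real_distribution_noncentral_chi_square)
  have cont: "isCont (cdf N) x" for x
    unfolding N.isCont_cdf by (simp add: noncentral_chi_square_singleton[OF k] N_def)
  define S where "S = {q. u \<le> cdf N q}"
  have "eventually (\<lambda>x. cdf N x > u) at_top"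
    using N.cdf_lim_at_top_prob u by (intro order_tendstoD)
  then obtain b where b: "cdf N b > u" by (auto simp: eventually_at_top_linorder)
  have "eventually (\<lambda>x. cdf N x < u) at_bot"
    using N.cdf_lim_at_bot u by (intro order_tendstoD)
  then obtain a where a: "\<And>x. x \<le> a \<Longrightarrow> cdf N x < u" by (auto simp: eventually_at_bot_linorder)
  have ab: "a \<le> b"
  proof (rule ccontr)
    assume "\<not> a \<le> b" then show False using a[of b] b by simp
  qed
  obtain c where c: "cdf N c = u"
    using IVT[of "cdf N" a u b] a[of a] b cont ab by auto
  have ne: "S \<noteq> {}" and bdd: "bdd_below S"
    using c a by (auto simp: S_def intro!: bdd_belowI[of _ a]) (meson linorder_le_cases not_le)
  have "closed S"
    unfolding S_def using cont by (intro closed_Collect_le continuous_intros) (auto simp: continuous_on_eq_continuous_at)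
  then have "Inf S \<in> S" using ne bdd by (intro closed_contains_Inf)
  moreover have "cdf N (Inf S) \<le> cdf N c"
    using bdd c by (intro N.cdf_nondecreasing cInf_lower) (auto simp: S_def)
  ultimately have "cdf N (Inf S) = u" using c by (auto simp: S_def)
  then show ?thesis
    by (simp add: noncentral_chi_square_cdf_def chi_square_quantile_def N_def S_def)
qed

section \<open>Characteristic functions of triangular arrays\<close>

text \<open>Comparison with \<open>exp (c / n k)\<close> avoids a complex logarithm: for two numbers
  in the closed unit disc, the \<open>n\<close>-th powers differ by at most \<open>n\<close> times
  the distance. \<open>Re c \<le> 0\<close> places the exponential in the disc.\<close>

lemma tendsto_power_exp:
  fixes z :: "nat \<Rightarrow> complex" and n :: "nat \<Rightarrow> nat"
  assumes n: "filterlim n at_top sequentially"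
    and z: "\<And>k. norm (z k) \<le> 1" and c: "Re c \<le> 0"
    and lim: "(\<lambda>k. of_nat (n k) * (z k - 1)) \<longlonglongrightarrow> c"
  shows "(\<lambda>k. z k ^ n k) \<longlonglongrightarrow> exp c"
proof -
  define w where "w = (\<lambda>k. exp (c / of_nat (n k)))"
  have inv: "(\<lambda>k. 1 / of_nat (n k) :: complex) \<longlonglongrightarrow> 0"
    using filterlim_compose[OF lim_inverse_n n] by (simp add: inverse_eq_divide)
  have ev: "eventually (\<lambda>k. n k > 0) sequentially"
    using eventually_compose_filterlim[OF eventually_gt_at_top n] .
  have w: "(\<lambda>k. of_nat (n k) * (w k - 1)) \<longlonglongrightarrow> c"
  proof (cases "c = 0")
    case False
    have "((\<lambda>h::complex. (exp h - 1) / h) \<longlongrightarrow> 1) (at 0)"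
      using DERIV_exp[of "0::complex"] by (simp add: DERIV_def)
    moreover have "filterlim (\<lambda>k. c / of_nat (n k)) (at 0) sequentially"
      unfolding filterlim_at
      using tendsto_mult[OF tendsto_const[of c] inv] False ev
      by (auto elim!: eventually_mono)
    ultimately have "(\<lambda>k. (exp (c / of_nat (n k)) - 1) / (c / of_nat (n k))) \<longlonglongrightarrow> 1"
      by (rule filterlim_compose)
    from tendsto_mult[OF tendsto_const[of c] this]
    have "(\<lambda>k. c * ((exp (c / of_nat (n k)) - 1) / (c / of_nat (n k)))) \<longlonglongrightarrow> c" by simp
    then show ?thesis
      by (rule Lim_transform_eventually) (use ev False in \<open>auto simp: w_def field_simps elim!: eventually_mono\<close>)
  qed (simp add: w_def)
  have "(\<lambda>k. z k ^ n k - w k ^ n k) \<longlonglongrightarrow> 0"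
  proof (rule Lim_null_comparison)
    show "eventually (\<lambda>k. norm (z k ^ n k - w k ^ n k) \<le> norm (of_nat (n k) * (z k - 1) - of_nat (n k) * (w k - 1))) sequentially"
    proof (intro always_eventually allI)
      fix k
      have "norm (w k) \<le> 1"
        using c by (simp add: w_def norm_exp_eq_Re divide_nonpos_nonneg Re_divide_of_nat)
      then have "norm (z k ^ n k - w k ^ n k) \<le> real (n k) * norm (z k - w k)"
        using z by (intro norm_power_diff)
      also have "\<dots> = norm (of_nat (n k) * (z k - w k))"
        by (simp add: norm_mult)
      also have "of_nat (n k) * (z k - w k) = of_nat (n k) * (z k - 1) - of_nat (n k) * (w k - 1)"
        by (simp add: algebra_simps)
      finally show "norm (z k ^ n k - w k ^ n k) \<le> norm (of_nat (n k) * (z k - 1) - of_nat (n k) * (w k - 1))" .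
    qed
    show "(\<lambda>k. norm (of_nat (n k) * (z k - 1) - of_nat (n k) * (w k - 1))) \<longlonglongrightarrow> 0"
      using tendsto_diff[OF lim w] by (simp add: tendsto_norm_zero)
  qed
  moreover have "(\<lambda>k. w k ^ n k) \<longlonglongrightarrow> exp c"
    by (rule tendsto_eventually, rule eventually_mono[OF ev]) (simp add: w_def exp_of_nat_mult[symmetric])
  ultimately show ?thesis
    using tendsto_add by fastforce
qed

lemma tendsto_inverse_sqrt:
  assumes n: "filterlim n at_top sequentially"
  shows "(\<lambda>k. 1 / sqrt (real (n k))) \<longlonglongrightarrow> 0"
proof -
  have "(\<lambda>k. sqrt (inverse (real (n k)))) \<longlonglongrightarrow> sqrt 0"
    by (intro tendsto_real_sqrt filterlim_compose[OF lim_inverse_n n])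
  then show ?thesis by (simp add: real_sqrt_divide inverse_eq_divide)
qed

text \<open>The remainder after the quadratic Taylor term is of the order of the cube of
  \<open>v / sqrt (n k)\<close>, and multiplied by \<open>n k\<close> it still decays like
  \<open>1 / sqrt (n k)\<close>.\<close>

lemma tendsto_iexp_second_order:
  fixes n :: "nat \<Rightarrow> nat" and v :: real
  assumes n: "filterlim n at_top sequentially"
  shows "(\<lambda>k. of_nat (n k) * (iexp (v / sqrt (n k)) - 1 - \<i> * of_real (v / sqrt (n k)))) \<longlonglongrightarrow> - of_real (v\<^sup>2 / 2)"
proof -
  have ev: "eventually (\<lambda>k. n k > 0) sequentially"
    using eventually_compose_filterlim[OF eventually_gt_at_top n] .
  note inv = tendsto_inverse_sqrt[OF n]
  have "(\<lambda>k. of_nat (n k) * (iexp (v / sqrt (n k)) - 1 - \<i> * of_real (v / sqrt (n k))) + of_real (v\<^sup>2 / 2)) \<longlonglongrightarrow> 0"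
  proof (rule Lim_null_comparison)
    show "eventually (\<lambda>k. norm (of_nat (n k) * (iexp (v / sqrt (n k)) - 1 - \<i> * of_real (v / sqrt (n k))) + of_real (v\<^sup>2 / 2))
        \<le> \<bar>v\<bar> ^ 3 * (1 / sqrt (n k))) sequentially"
    proof (rule eventually_mono[OF ev])
      fix k assume nk: "n k > 0"
      define x where "x = v / sqrt (n k)"
      have x2: "real (n k) * x\<^sup>2 = v\<^sup>2"
        using nk by (simp add: x_def power_divide)
      have "of_nat (n k) * (iexp x - 1 - \<i> * of_real x) + of_real (v\<^sup>2 / 2)
        = of_nat (n k) * (iexp x - (\<Sum>k\<le>2. (\<i> * x) ^ k / fact k))"
        unfolding x2[symmetric] by (simp add: numeral_2_eq_2 algebra_simps power2_eq_square)
      also have "norm \<dots> \<le> real (n k) * (\<bar>x\<bar> ^ Suc 2 / fact (Suc 2))"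
        unfolding norm_mult norm_of_nat by (intro mult_left_mono iexp_approx1) auto
      also have "\<dots> \<le> real (n k) * (\<bar>x\<bar> ^ 3)"
      proof (intro mult_left_mono)
        have "(fact (Suc 2) :: real) = 6" by (simp add: fact_numeral)
        then show "\<bar>x\<bar> ^ Suc 2 / fact (Suc 2) \<le> \<bar>x\<bar> ^ 3"
          using zero_le_power[of "\<bar>x\<bar>" 3] by (simp del: zero_le_power)
      qed simp
      also have "\<dots> = \<bar>v\<bar> ^ 3 * (1 / sqrt (n k))"
        using nk x2 by (simp add: x_def power_divide power3_eq_cube)
      finally show "norm (of_nat (n k) * (iexp (v / sqrt (n k)) - 1 - \<i> * of_real (v / sqrt (n k))) + of_real (v\<^sup>2 / 2))
        \<le> \<bar>v\<bar> ^ 3 * (1 / sqrt (n k))" unfolding x_def .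
    qed
    show "(\<lambda>k. \<bar>v\<bar> ^ 3 * (1 / sqrt (n k))) \<longlonglongrightarrow> 0"
      using tendsto_mult[OF tendsto_const inv] by simp
  qed
  from tendsto_diff[OF this tendsto_const[of "of_real (v\<^sup>2 / 2)"]] show ?thesis by simp
qed

text \<open>Every observation falls into exactly one cell, so a linear form in the counts is a sum
  of independent terms \<open>\<eta> (e k t \<omega>) / sqrt (n k)\<close> and its characteristic
  function is a power \<open>z k ^ n k\<close>. The quadratic form in the limit is the variance of
  \<open>v\<close> under \<open>p\<close>; the scaled deviations \<open>pk - p\<close> produce the
  phase.\<close>

lemma multinomial_cf_tendsto:
  fixes P :: "nat \<Rightarrow> 'a measure" and e :: "nat \<Rightarrow> 'i \<Rightarrow> 'a \<Rightarrow> real" and T :: "nat \<Rightarrow> 'i set"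
    and B :: "'j \<Rightarrow> real set" and p d w :: "'j \<Rightarrow> real"
  assumes n: "filterlim (\<lambda>k. card (T k)) at_top sequentially" and T: "\<And>k. finite (T k)"
    and P: "\<And>k. prob_space (P k)"
    and ind: "\<And>k. prob_space.indep_vars (P k) (\<lambda>_. borel) (e k) (T k)"
    and J: "finite J" and B: "\<And>j. j \<in> J \<Longrightarrow> B j \<in> sets borel" "disjoint_family_on B J" "(\<Union>j\<in>J. B j) = UNIV"
    and law: "\<And>k t j. t \<in> T k \<Longrightarrow> j \<in> J \<Longrightarrow> measure (P k) {\<omega> \<in> space (P k). e k t \<omega> \<in> B j} = pk k j"
    and p: "\<And>j. j \<in> J \<Longrightarrow> p j > 0" "(\<Sum>j\<in>J. p j) = 1" and pk: "\<And>k. (\<Sum>j\<in>J. pk k j) = 1"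
    and d: "\<And>j. j \<in> J \<Longrightarrow> (\<lambda>k. sqrt (card (T k)) * (pk k j - p j)) \<longlonglongrightarrow> d j"
  shows "(\<lambda>k. LINT \<omega>|P k. iexp (\<Sum>j\<in>J. w j * ((real (card {t \<in> T k. e k t \<omega> \<in> B j}) - card (T k) * p j)
            / sqrt (card (T k) * p j)))) \<longlonglongrightarrow>
    iexp (\<Sum>j\<in>J. w j * (d j / sqrt (p j))) *
      of_real (exp (- ((\<Sum>j\<in>J. (w j)\<^sup>2) - (\<Sum>j\<in>J. sqrt (p j) * w j)\<^sup>2) / 2))"
proof -
  define n where "n = (\<lambda>k. card (T k))"
  have nlim: "filterlim n at_top sequentially" using n by (simp add: n_def)
  have ev: "eventually (\<lambda>k. n k > 0) sequentially"
    using eventually_compose_filterlim[OF eventually_gt_at_top nlim] .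
  define \<theta> where "\<theta> = (\<lambda>j. w j / sqrt (p j))"
  define m where "m = (\<Sum>j\<in>J. \<theta> j * p j)"
  \<comment> \<open>Centering under the limit probabilities: the constant \<open>m\<close> is what
    subtracting \<open>card (T k) * p j\<close> from the counts amounts to per observation.\<close>
  define v where "v = (\<lambda>j. \<theta> j - m)"
  define \<eta> where "\<eta> = (\<lambda>x. \<Sum>j\<in>J. v j * indicator (B j) x)"
  define z where "z = (\<lambda>k. \<Sum>j\<in>J. pk k j * iexp (v j / sqrt (n k)))"
  note B(1)[measurable]
  have [measurable]: "\<eta> \<in> borel_measurable borel"
    unfolding \<eta>_def by (intro borel_measurable_sum borel_measurable_times borel_measurable_const borel_measurable_indicator B(1))
  have cell: "(\<Sum>j\<in>J. f j * indicator (B j) x) = f i" if "i \<in> J" "x \<in> B i" for f :: "'j \<Rightarrow> 'c::real_normed_field" and i x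
  proof -
    have "indicator (B j) x = (if j = i then 1 else 0 :: 'c)" if "j \<in> J" for j
      using B(2) that \<open>i \<in> J\<close> \<open>x \<in> B i\<close> by (auto simp: disjoint_family_on_def indicator_def)
    then have "(\<Sum>j\<in>J. f j * indicator (B j) x) = (\<Sum>j\<in>J. if j = i then f j else 0)"
      by (intro sum.cong) auto
    then show ?thesis using J that by simp
  qed
  have part: "\<exists>i\<in>J. x \<in> B i" for x using B(3) by auto
  \<comment> \<open>Both probability vectors sum to 1, so the limits of their scaled differences sum
    to 0. Hence the centering constant \<open>m\<close> drops out of the phase.\<close>
  have d0: "(\<Sum>j\<in>J. d j) = 0"
  proof -
    have "(\<lambda>k. \<Sum>j\<in>J. sqrt (card (T k)) * (pk k j - p j)) \<longlonglongrightarrow> (\<Sum>j\<in>J. d j)"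
      using d by (intro tendsto_sum)
    moreover have "(\<Sum>j\<in>J. sqrt (card (T k)) * (pk k j - p j)) = 0" for k
      by (simp add: sum_distrib_left[symmetric] sum_subtractf p pk)
    ultimately show ?thesis using LIMSEQ_unique by simp blast
  qed
  have v0: "(\<Sum>j\<in>J. p j * v j) = 0"
    by (simp add: v_def m_def algebra_simps sum_subtractf sum_distrib_right[symmetric] p)
  have cf: "(LINT \<omega>|P k. iexp (\<Sum>j\<in>J. w j * ((real (card {t \<in> T k. e k t \<omega> \<in> B j}) - card (T k) * p j)
            / sqrt (card (T k) * p j)))) = z k ^ n k" if nk: "n k > 0" for k
  proof -
    interpret Pk: prob_space "P k" by (rule P)
    have [measurable]: "e k t \<in> borel_measurable (P k)" if "t \<in> T k" for t
      using ind[of k] that by (simp add: Pk.indep_vars_def)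
    have pkm: "pk k j = (LINT \<omega>|P k. indicator (B j) (e k t \<omega>))" if "t \<in> T k" "j \<in> J" for t j
    proof -
      have "(LINT \<omega>|P k. indicator (B j) (e k t \<omega>) :: real) = (LINT \<omega>|P k. indicator {\<omega> \<in> space (P k). e k t \<omega> \<in> B j} \<omega>)"
        by (intro Bochner_Integration.integral_cong) (auto simp: indicator_def)
      also have "\<dots> = pk k j"
        using that B(1)[of j] by (simp add: law[symmetric])
      finally show ?thesis ..
    qed
    have one: "(LINT \<omega>|P k. iexp (\<eta> (e k t \<omega>) / sqrt (n k))) = z k" if t: "t \<in> T k" for t
    proof -
      have "iexp (\<eta> x / sqrt (n k)) = (\<Sum>j\<in>J. iexp (v j / sqrt (n k)) * indicator (B j) x)" for x
      proof -
        obtain i where i: "i \<in> J" "x \<in> B i" using part by blast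
        show ?thesis unfolding \<eta>_def cell[OF i] ..
      qed
      then have "(LINT \<omega>|P k. iexp (\<eta> (e k t \<omega>) / sqrt (n k)))
        = (LINT \<omega>|P k. (\<Sum>j\<in>J. iexp (v j / sqrt (n k)) * of_real (indicator (B j) (e k t \<omega>))))"
        by (simp add: of_real_indicator)
      also have "\<dots> = (\<Sum>j\<in>J. LINT \<omega>|P k. iexp (v j / sqrt (n k)) * of_real (indicator (B j) (e k t \<omega>)))"
        using t B(1) by (intro Bochner_Integration.integral_sum Pk.integrable_const_bound[where B = 1])
          (auto simp: norm_mult indicator_def)
      also have "\<dots> = (\<Sum>j\<in>J. iexp (v j / sqrt (n k)) * of_real (pk k j))"
        using pkm[OF t] by (intro sum.cong) simp_all
      finally show ?thesis by (simp add: z_def mult.commute)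
    qed
    have sumform: "(\<Sum>j\<in>J. w j * ((real (card {t \<in> T k. e k t \<omega> \<in> B j}) - card (T k) * p j) / sqrt (card (T k) * p j)))
        = (\<Sum>t\<in>T k. \<eta> (e k t \<omega>) / sqrt (n k))" for \<omega>
    proof -
      have \<eta>': "\<eta> x = (\<Sum>j\<in>J. \<theta> j * (indicator (B j) x - p j))" for x
      proof -
        obtain i where i: "i \<in> J" "x \<in> B i" using part by blast
        have "(\<Sum>j\<in>J. \<theta> j * (indicator (B j) x - p j)) = (\<Sum>j\<in>J. \<theta> j * indicator (B j) x) - m"
          by (simp add: right_diff_distrib sum_subtractf m_def)
        then show ?thesis unfolding \<eta>_def cell[OF i] by (simp add: v_def)
      qed
      have "w j * ((real (card {t \<in> T k. e k t \<omega> \<in> B j}) - card (T k) * p j) / sqrt (card (T k) * p j))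
         = (\<Sum>t\<in>T k. \<theta> j * (indicator (B j) (e k t \<omega>) - p j) / sqrt (n k))" if "j \<in> J" for j
      proof -
        have "real (card {t \<in> T k. e k t \<omega> \<in> B j}) = (\<Sum>t\<in>T k. indicator (B j) (e k t \<omega>))"
          using T by (simp add: indicator_def sum.If_cases Int_def)
        then have "real (card {t \<in> T k. e k t \<omega> \<in> B j}) - card (T k) * p j = (\<Sum>t\<in>T k. indicator (B j) (e k t \<omega>) - p j)"
          by (simp add: sum_subtractf)
        then show ?thesis
          by (simp add: \<theta>_def n_def real_sqrt_mult sum_divide_distrib[symmetric] sum_distrib_left[symmetric] mult_ac)
      qed
      then have "(\<Sum>j\<in>J. w j * ((real (card {t \<in> T k. e k t \<omega> \<in> B j}) - card (T k) * p j) / sqrt (card (T k) * p j)))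
         = (\<Sum>j\<in>J. \<Sum>t\<in>T k. \<theta> j * (indicator (B j) (e k t \<omega>) - p j) / sqrt (n k))"
        by (rule sum.cong[OF refl])
      also have "\<dots> = (\<Sum>t\<in>T k. \<Sum>j\<in>J. \<theta> j * (indicator (B j) (e k t \<omega>) - p j) / sqrt (n k))"
        by (rule sum.swap)
      finally show ?thesis by (simp add: \<eta>' sum_divide_distrib)
    qed
    have "Pk.indep_vars (\<lambda>_. borel) (\<lambda>t \<omega>. iexp (\<eta> (e k t \<omega>) / sqrt (n k))) (T k)"
      by (rule Pk.indep_vars_compose2[OF ind]) measurable
    then have "(LINT \<omega>|P k. (\<Prod>t\<in>T k. iexp (\<eta> (e k t \<omega>) / sqrt (n k))))
        = (\<Prod>t\<in>T k. LINT \<omega>|P k. iexp (\<eta> (e k t \<omega>) / sqrt (n k)))"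
      by (rule Pk.indep_vars_lebesgue_integral[OF T]) (rule Pk.integrable_const_bound[where B = 1], auto)
    then show ?thesis
      unfolding sumform iexp_sum[OF T] using one by (simp add: n_def)
  qed
  define c where "c = \<i> * of_real (\<Sum>j\<in>J. d j * v j) - of_real ((\<Sum>j\<in>J. p j * (v j)\<^sup>2) / 2)"
  note inv = tendsto_inverse_sqrt[OF nlim]
  have pklim: "(\<lambda>k. pk k j) \<longlonglongrightarrow> p j" if "j \<in> J" for j
  proof -
    have "(\<lambda>k. sqrt (n k) * (pk k j - p j) * (1 / sqrt (n k)) + p j) \<longlonglongrightarrow> d j * 0 + p j"
      using d[OF that] inv by (intro tendsto_intros) (simp add: n_def)
    then have "(\<lambda>k. sqrt (n k) * (pk k j - p j) * (1 / sqrt (n k)) + p j) \<longlonglongrightarrow> p j"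
      unfolding mult_zero_right add_0_left .
    then show ?thesis
      by (rule Lim_transform_eventually) (use ev in \<open>auto elim!: eventually_mono\<close>)
  qed
  \<comment> \<open>The second-order parts, weighted by \<open>pk k j\<close>, converge directly.
    The first-order parts carry a factor \<open>sqrt (n k)\<close>, but their mean under
    \<open>p\<close> vanishes by \<open>v0\<close>, so only the differences
    \<open>pk k j - p j\<close> remain.\<close>
  have zn: "(\<lambda>k. of_nat (n k) * (z k - 1)) \<longlonglongrightarrow> c"
  proof -
    have "(\<lambda>k. (\<Sum>j\<in>J. of_real (pk k j) * (of_nat (n k) * (iexp (v j / sqrt (n k)) - 1 - \<i> * of_real (v j / sqrt (n k)))))
        + \<i> * of_real (\<Sum>j\<in>J. (sqrt (n k) * (pk k j - p j)) * v j))
       \<longlonglongrightarrow> (\<Sum>j\<in>J. of_real (p j) * (- of_real ((v j)\<^sup>2 / 2))) + \<i> * of_real (\<Sum>j\<in>J. d j * v j)"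
      using pklim d by (intro tendsto_intros tendsto_iexp_second_order nlim) (auto simp: n_def)
    also have "(\<Sum>j\<in>J. of_real (p j) * (- of_real ((v j)\<^sup>2 / 2))) + \<i> * of_real (\<Sum>j\<in>J. d j * v j) = c"
      by (simp add: c_def sum_negf sum_divide_distrib)
    finally show ?thesis
    proof (rule Lim_transform_eventually)
      show "eventually (\<lambda>k. (\<Sum>j\<in>J. of_real (pk k j) * (of_nat (n k) * (iexp (v j / sqrt (n k)) - 1 - \<i> * of_real (v j / sqrt (n k)))))
        + \<i> * of_real (\<Sum>j\<in>J. (sqrt (n k) * (pk k j - p j)) * v j) = of_nat (n k) * (z k - 1)) sequentially"
      proof (rule eventually_mono[OF ev])
        fix k assume nk: "n k > 0"
        have q: "of_nat (n k) * (\<i> * complex_of_real (v j / sqrt (n k))) = \<i> * of_real (sqrt (n k) * v j)" for j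
        proof -
          have "real (n k) * (v j / sqrt (n k)) = sqrt (n k) * v j"
            using nk by (simp add: real_div_sqrt mult.commute[of "real (n k)"] times_divide_eq_right[symmetric] del: times_divide_eq_right)
          then show ?thesis by (metis mult.left_commute of_real_mult of_real_of_nat_eq)
        qed
        have "(\<Sum>j\<in>J. of_real (pk k j) * (of_nat (n k) * (iexp (v j / sqrt (n k)) - 1 - \<i> * of_real (v j / sqrt (n k)))))
          = (\<Sum>j\<in>J. of_nat (n k) * (of_real (pk k j) * iexp (v j / sqrt (n k)))) - of_nat (n k) * of_real (\<Sum>j\<in>J. pk k j)
            - (\<Sum>j\<in>J. \<i> * of_real (pk k j * (sqrt (n k) * v j)))"
          unfolding right_diff_distrib q
          by (simp add: sum_subtractf sum.distrib sum_distrib_left algebra_simps)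
        moreover have "(\<Sum>j\<in>J. (sqrt (n k) * (pk k j - p j)) * v j) = (\<Sum>j\<in>J. pk k j * (sqrt (n k) * v j)) - sqrt (n k) * (\<Sum>j\<in>J. p j * v j)"
          by (simp add: sum_subtractf sum_distrib_left algebra_simps)
        ultimately show "(\<Sum>j\<in>J. of_real (pk k j) * (of_nat (n k) * (iexp (v j / sqrt (n k)) - 1 - \<i> * of_real (v j / sqrt (n k)))))
          + \<i> * of_real (\<Sum>j\<in>J. (sqrt (n k) * (pk k j - p j)) * v j) = of_nat (n k) * (z k - 1)"
          by (simp add: v0 pk z_def sum_distrib_left[symmetric] right_diff_distrib)
      qed
    qed
  qed
  have nz: "norm (z k) \<le> 1" for k
  proof -
    \<comment> \<open>For empty \<open>T k\<close> the assumption \<open>law\<close> gives no sign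
      for \<open>pk k j\<close>. In that case \<open>n k = 0\<close>, division by zero makes all
      phases equal to 1, and \<open>z k\<close> is the sum of the weights.\<close>
    have "pk k j \<ge> 0" if "j \<in> J" "T k \<noteq> {}" for j
      using law[of _ k j] that measure_nonneg by (metis all_not_in_conv)
    then have "norm (z k) \<le> (\<Sum>j\<in>J. pk k j)" if "T k \<noteq> {}"
      unfolding z_def using that by (intro order_trans[OF norm_sum] sum_mono) (auto simp: norm_mult)
    moreover have "z k = (\<Sum>j\<in>J. of_real (pk k j))" if "T k = {}"
      using that by (simp add: z_def n_def)
    ultimately show ?thesis
      using pk[of k] by (cases "T k = {}") (auto simp flip: of_real_sum)
  qed
  have "(\<lambda>k. z k ^ n k) \<longlonglongrightarrow> exp c"
  proof (rule tendsto_power_exp[OF nlim nz _ zn])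
    show "Re c \<le> 0"
      unfolding c_def using sum_nonneg[of J "\<lambda>j. p j * (v j)\<^sup>2"] p(1) by (simp add: less_imp_le)
  qed
  moreover have "exp c = iexp (\<Sum>j\<in>J. w j * (d j / sqrt (p j))) *
      of_real (exp (- ((\<Sum>j\<in>J. (w j)\<^sup>2) - (\<Sum>j\<in>J. sqrt (p j) * w j)\<^sup>2) / 2))"
  proof -
    have "(\<Sum>j\<in>J. d j * v j) = (\<Sum>j\<in>J. d j * \<theta> j) - m * (\<Sum>j\<in>J. d j)"
      by (simp add: v_def sum_subtractf sum_distrib_left algebra_simps)
    also have "\<dots> = (\<Sum>j\<in>J. w j * (d j / sqrt (p j)))"
      by (simp add: d0 \<theta>_def mult_ac)
    finally have 1: "(\<Sum>j\<in>J. d j * v j) = (\<Sum>j\<in>J. w j * (d j / sqrt (p j)))" .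
    have "(\<Sum>j\<in>J. p j * (v j)\<^sup>2) = (\<Sum>j\<in>J. p j * (\<theta> j)\<^sup>2) - 2 * m * (\<Sum>j\<in>J. \<theta> j * p j) + m\<^sup>2 * (\<Sum>j\<in>J. p j)"
      by (simp add: v_def power2_diff sum.distrib sum_subtractf sum_distrib_left algebra_simps)
        (simp add: sum_distrib_right)
    also have "\<dots> = (\<Sum>j\<in>J. p j * (\<theta> j)\<^sup>2) - m\<^sup>2"
      unfolding m_def[symmetric] p by (simp add: power2_eq_square)
    also have "(\<Sum>j\<in>J. p j * (\<theta> j)\<^sup>2) = (\<Sum>j\<in>J. (w j)\<^sup>2)"
    proof (intro sum.cong refl)
      fix j assume "j \<in> J"
      with p(1)[of j] show "p j * (\<theta> j)\<^sup>2 = (w j)\<^sup>2" by (simp add: \<theta>_def power_divide)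
    qed
    also have "m = (\<Sum>j\<in>J. sqrt (p j) * w j)"
      unfolding m_def
    proof (intro sum.cong refl)
      fix j assume "j \<in> J"
      with p(1)[of j] show "\<theta> j * p j = sqrt (p j) * w j"
        by (simp add: \<theta>_def field_simps)
    qed
    finally have 2: "(\<Sum>j\<in>J. p j * (v j)\<^sup>2) = (\<Sum>j\<in>J. (w j)\<^sup>2) - (\<Sum>j\<in>J. sqrt (p j) * w j)\<^sup>2" .
    show ?thesis
      unfolding c_def 1 2
      by (simp only: diff_conv_add_uminus exp_add of_real_minus[symmetric] exp_of_real minus_divide_left)
  qed
  ultimately have "(\<lambda>k. z k ^ n k) \<longlonglongrightarrow> iexp (\<Sum>j\<in>J. w j * (d j / sqrt (p j))) *
      of_real (exp (- ((\<Sum>j\<in>J. (w j)\<^sup>2) - (\<Sum>j\<in>J. sqrt (p j) * w j)\<^sup>2) / 2))" by simp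
  then show ?thesis
    by (rule Lim_transform_eventually) (rule eventually_mono[OF ev], rule cf[symmetric])
qed

section \<open>The causal representation of the stationary solution\<close>

text \<open>\<open>\<psi>\<close> is the coefficient sequence of \<open>1 / P\<close> for the
  reciprocal characteristic polynomial \<open>P\<close>. Stability puts the zeros of
  \<open>P\<close> outside the closed unit disc, so the series converges on a disc of radius above 1
  and is absolutely summable at 1. The recursion is \<open>P * G = 1\<close> read coefficient by
  coefficient.\<close>

lemma stable_coefficients_impulse_response:
  assumes "stable_coefficients p \<beta>"
  obtains \<psi> :: "nat \<Rightarrow> real" where "\<And>k. \<psi> k = (if k = 0 then 1 else 0) + (\<Sum>j=1..p. if j \<le> k then \<beta> j * \<psi> (k - j) else 0)"
    "summable (\<lambda>k. \<bar>\<psi> k\<bar>)"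
proof -
  define P :: "complex poly" where "P = 1 - (\<Sum>j=1..p. monom (of_real (\<beta> j)) j)"
  define G where "G = inverse (fps_of_poly P)"
  have evalP: "poly P z = 1 - (\<Sum>j=1..p. of_real (\<beta> j) * z ^ j)" for z
    by (simp add: P_def poly_sum poly_monom)
  have root: "norm z > 1" if "poly P z = 0" for z
  proof -
    have z0: "z \<noteq> 0"
    proof
      assume "z = 0"
      then have "(\<Sum>j=1..p. of_real (\<beta> j) * z ^ j) = 0" by (intro sum.neutral) auto
      then show False using that evalP[of z] by simp
    qed
    have "(1 / z) ^ p - (\<Sum>j=1..p. of_real (\<beta> j) * (1 / z) ^ (p - j)) = (1 / z) ^ p * poly P z"
    proof -
      have "(1 / z) ^ p * (of_real (\<beta> j) * z ^ j) = of_real (\<beta> j) * (1 / z) ^ (p - j)" if "j \<in> {1..p}" for j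
        using that z0 by (simp add: power_diff power_divide)
      then have "(\<Sum>j=1..p. (1 / z) ^ p * (of_real (\<beta> j) * z ^ j)) = (\<Sum>j=1..p. of_real (\<beta> j) * (1 / z) ^ (p - j))"
        by (intro sum.cong refl)
      then show ?thesis
        by (simp add: evalP right_diff_distrib sum_distrib_left)
    qed
    then have "norm (1 / z) < 1"
      using that assms unfolding stable_coefficients_def by simp
    then show ?thesis using z0 by (simp add: norm_divide field_simps)
  qed
  have P0: "P \<noteq> 0" using root[of 0] by auto
  \<comment> \<open>The element 2 keeps the minimum meaningful when \<open>P\<close> has no
    zeros.\<close>
  define R where "R = Min (insert 2 (norm ` {z. poly P z = 0}))"
  have fin: "finite {z. poly P z = 0}" using poly_roots_finite[OF P0] .
  have R: "R > 1" unfolding R_def using fin root by (subst Min_gr_iff) auto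
  have "eval_fps (fps_of_poly P) z \<noteq> 0" if "ereal (norm z) < ereal R" for z
  proof
    assume "eval_fps (fps_of_poly P) z = 0"
    then have "R \<le> norm z" unfolding R_def using fin by (intro Min_le) auto
    then show False using that by simp
  qed
  then have "fps_conv_radius G \<ge> min (ereal R) (fps_conv_radius (fps_of_poly P))"
    unfolding G_def by (rule fps_conv_radius_inverse)
  then have "fps_conv_radius G \<ge> ereal R" by simp
  then have GR: "ereal R \<le> conv_radius (fps_nth G)" by (simp add: fps_conv_radius_def)
  have "ereal (norm (1::complex)) < ereal R" using R by simp
  from less_le_trans[OF this GR] have "ereal (norm (1::complex)) < conv_radius (fps_nth G)" .
  from abs_summable_in_conv_radius[OF this]
  have sG: "summable (\<lambda>k. norm (fps_nth G k))" by simp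
  have "(\<Sum>j=1..p. of_real (\<beta> j) * (0::complex) ^ j) = 0" by (intro sum.neutral) auto
  then have "fps_nth (fps_of_poly P) 0 = 1"
    using evalP[of 0] by (simp add: poly_0_coeff_0)
  then have GP: "fps_of_poly P * G = 1"
    unfolding G_def by (intro inverse_mult_eq_1') simp
  have fP: "fps_of_poly P = 1 - (\<Sum>j=1..p. fps_const (of_real (\<beta> j)) * fps_X ^ j)"
    by (simp add: P_def fps_of_poly_diff fps_of_poly_sum fps_of_poly_monom)
  have "G = 1 + (\<Sum>j=1..p. fps_const (of_real (\<beta> j)) * (fps_X ^ j * G))"
    using GP unfolding fP by (simp add: algebra_simps sum_distrib_left)
  then have Gk: "fps_nth G k = fps_nth (1 + (\<Sum>j=1..p. fps_const (of_real (\<beta> j)) * (fps_X ^ j * G))) k" for k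
    by (rule arg_cong)
  have rec: "fps_nth G k = (if k = 0 then 1 else 0) + (\<Sum>j=1..p. of_real (\<beta> j) * (if k < j then 0 else fps_nth G (k - j)))" for k
    by (rule trans[OF Gk]) (simp only: fps_add_nth fps_one_nth fps_sum_nth fps_mult_left_const_nth fps_X_power_mult_nth)
  show ?thesis
  proof
    \<comment> \<open>The power series is complex. Since the \<open>\<beta> j\<close> are real, the
      real parts satisfy the same recursion, and they inherit summability.\<close>
    show "Re (fps_nth G k) = (if k = 0 then 1 else 0) + (\<Sum>j=1..p. if j \<le> k then \<beta> j * Re (fps_nth G (k - j)) else 0)" for k
      by (subst rec) (auto simp: Re_sum intro!: sum.cong)
    show "summable (\<lambda>k. \<bar>Re (fps_nth G k)\<bar>)"
      by (rule summable_comparison_test'[OF sG]) (simp add: abs_Re_le_cmod)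
  qed
qed

text \<open>Repeated substitution leaves a remainder in \<open>p\<close> consecutive past values.
  Its coefficients are written out in terms of \<open>\<psi>\<close> at indices growing with
  \<open>K\<close>, so that their decay can be read off. The guard \<open>j \<le> Suc K + i\<close>
  treats \<open>\<psi>\<close> as zero at negative indices, where subtraction of naturals would be
  cut off.\<close>

lemma ar_iterate:
  fixes \<psi> \<beta> :: "nat \<Rightarrow> real" and u e :: "int \<Rightarrow> real"
  assumes \<psi>: "\<And>k. \<psi> k = (if k = 0 then 1 else 0) + (\<Sum>j=1..p. if j \<le> k then \<beta> j * \<psi> (k - j) else 0)"
    and p: "p \<ge> 1"
    and u: "\<And>t. u t = (\<Sum>j=1..p. \<beta> j * u (t - int j)) + e t"
  shows "u t = (\<Sum>k\<le>K. \<psi> k * e (t - int k)) +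
     (\<Sum>i<p. (\<Sum>j=i+1..p. if j \<le> Suc K + i then \<beta> j * \<psi> (Suc K + i - j) else 0) * u (t - int (Suc K) - int i))"
proof -
  define c where "c = (\<lambda>K i. \<Sum>j=i+1..p. if j \<le> Suc K + i then \<beta> j * \<psi> (Suc K + i - j) else 0)"
  have psi0: "\<psi> 0 = 1" by (subst \<psi>) (auto intro!: sum.neutral)
  have u': "u t = (\<Sum>i<p. \<beta> (Suc i) * u (t - 1 - int i)) + e t" for t
  proof -
    have "(\<Sum>j=1..p. \<beta> j * u (t - int j)) = (\<Sum>i<p. \<beta> (Suc i) * u (t - int (Suc i)))"
      by (rule sum.reindex_bij_witness[of _ Suc "\<lambda>j. j - 1"]) auto
    then show ?thesis by (subst u) (simp add: algebra_simps)
  qed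
  have c0: "c K 0 = \<psi> (Suc K)" for K
    unfolding c_def by (subst \<psi>[of "Suc K"]) (auto intro!: sum.cong)
  have cp: "c K p = 0" for K by (simp add: c_def)
  \<comment> \<open>Replacing the most recent remaining value by its recursion moves the other
    coefficients up by one place and adds a multiple of the \<open>\<beta>\<close> vector.\<close>
  have cS: "c (Suc K) i = c K (Suc i) + \<psi> (Suc K) * \<beta> (Suc i)" if "i < p" for K i
  proof -
    have ins: "{i+1..p} = insert (Suc i) {Suc i + 1..p}" using that by auto
    have "c (Suc K) i = (if Suc i \<le> Suc (Suc K) + i then \<beta> (Suc i) * \<psi> (Suc (Suc K) + i - Suc i) else 0)
        + (\<Sum>j=Suc i+1..p. if j \<le> Suc (Suc K) + i then \<beta> j * \<psi> (Suc (Suc K) + i - j) else 0)"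
      using ins unfolding c_def by simp
    also have "Suc (Suc K) + i = Suc K + Suc i" by simp
    also have "(\<Sum>j=Suc i+1..p. if j \<le> Suc K + Suc i then \<beta> j * \<psi> (Suc K + Suc i - j) else 0) = c K (Suc i)"
      by (simp only: c_def)
    finally show ?thesis by simp
  qed
  have "u t = (\<Sum>k\<le>K. \<psi> k * e (t - int k)) + (\<Sum>i<p. c K i * u (t - int (Suc K) - int i))"
  proof (induction K)
    case 0
    have "c 0 i = \<beta> (Suc i)" if "i < p" for i
    proof -
      have "{i+1..p} = insert (Suc i) {Suc i + 1..p}" using that by auto
      then show ?thesis by (auto simp: c_def psi0 intro!: sum.neutral)
    qed
    then show ?case by (subst u') (simp add: psi0)
  next
    case (Suc K)
    have p': "p = Suc (p - 1)" using p by simp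
    have "(\<Sum>i<p. c K i * u (t - int (Suc K) - int i))
       = c K 0 * u (t - int (Suc K)) + (\<Sum>i<p-1. c K (Suc i) * u (t - int (Suc K) - int (Suc i)))"
      by (subst p', subst sum.lessThan_Suc_shift) simp
    also have "(\<Sum>i<p-1. c K (Suc i) * u (t - int (Suc K) - int (Suc i))) = (\<Sum>i<p. c K (Suc i) * u (t - int (Suc (Suc K)) - int i))"
    proof -
      have "(\<Sum>i<p. c K (Suc i) * u (t - int (Suc (Suc K)) - int i)) = (\<Sum>i<Suc (p-1). c K (Suc i) * u (t - int (Suc (Suc K)) - int i))"
        using p'[symmetric] by (simp only:)
      also have "\<dots> = (\<Sum>i<p-1. c K (Suc i) * u (t - int (Suc (Suc K)) - int i))"
        unfolding sum.lessThan_Suc unfolding p'[symmetric] cp by simp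
      finally show ?thesis by (simp add: algebra_simps)
    qed
    also have "c K 0 * u (t - int (Suc K)) = \<psi> (Suc K) * e (t - int (Suc K)) + (\<Sum>i<p. (\<psi> (Suc K) * \<beta> (Suc i)) * u (t - int (Suc (Suc K)) - int i))"
      unfolding c0 by (subst u') (simp add: distrib_left sum_distrib_left mult_ac algebra_simps)
    also have "\<psi> (Suc K) * e (t - int (Suc K)) + (\<Sum>i<p. (\<psi> (Suc K) * \<beta> (Suc i)) * u (t - int (Suc (Suc K)) - int i))
        + (\<Sum>i<p. c K (Suc i) * u (t - int (Suc (Suc K)) - int i))
      = \<psi> (Suc K) * e (t - int (Suc K)) + (\<Sum>i<p. c (Suc K) i * u (t - int (Suc (Suc K)) - int i))"
      by (simp add: cS sum.distrib[symmetric] distrib_right add_ac)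
    finally show ?case using Suc.IH by simp
  qed
  then show ?thesis unfolding c_def .
qed

section \<open>Convergence and moments of the infinite moving average\<close>

lemma tendsto_integral_min_scaled:
  fixes X :: "'a \<Rightarrow> real"
  assumes N: "prob_space N" and X[measurable]: "X \<in> borel_measurable N" and a: "a \<longlonglongrightarrow> (0::real)"
  shows "(\<lambda>k. LINT x|N. min 1 \<bar>a k * X x\<bar>) \<longlonglongrightarrow> 0"
proof -
  interpret prob_space N by (rule N)
  have "(\<lambda>k. LINT x|N. min 1 \<bar>a k * X x\<bar>) \<longlonglongrightarrow> (LINT x|N. 0)"
  proof (rule integral_dominated_convergence[where w = "\<lambda>_. 1"])
    show "AE x in N. (\<lambda>k. min 1 \<bar>a k * X x\<bar>) \<longlonglongrightarrow> 0"
    proof (intro AE_I2)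
      fix x
      have "(\<lambda>k. min 1 \<bar>a k * X x\<bar>) \<longlonglongrightarrow> min 1 \<bar>0 * X x\<bar>"
        by (intro tendsto_intros a)
      then show "(\<lambda>k. min 1 \<bar>a k * X x\<bar>) \<longlonglongrightarrow> 0" by simp
    qed
  qed auto
  then show ?thesis by simp
qed

lemma (in prob_space) AE_summable_linear_process:
  fixes e :: "nat \<Rightarrow> 'a \<Rightarrow> real"
  assumes [measurable]: "\<And>k. e k \<in> borel_measurable M"
    and int: "\<And>k. integrable M (e k)" and C: "\<And>k. (LINT \<omega>|M. \<bar>e k \<omega>\<bar>) \<le> C"
    and \<psi>: "summable (\<lambda>k. \<bar>\<psi> k\<bar>)"
  shows "AE \<omega> in M. summable (\<lambda>k. \<psi> k * e k \<omega>)"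
proof -
  have "(\<integral>\<^sup>+\<omega>. (\<Sum>k. ennreal \<bar>\<psi> k * e k \<omega>\<bar>) \<partial>M) = (\<Sum>k. \<integral>\<^sup>+\<omega>. ennreal \<bar>\<psi> k * e k \<omega>\<bar> \<partial>M)"
    by (rule nn_integral_suminf) measurable
  also have "\<dots> \<le> (\<Sum>k. ennreal (\<bar>\<psi> k\<bar> * C))"
  proof (intro suminf_le)
    fix k
    have "(\<integral>\<^sup>+\<omega>. ennreal \<bar>\<psi> k * e k \<omega>\<bar> \<partial>M) = ennreal (LINT \<omega>|M. \<bar>\<psi> k * e k \<omega>\<bar>)"
      using int[of k] by (intro nn_integral_eq_integral) auto
    also have "(LINT \<omega>|M. \<bar>\<psi> k * e k \<omega>\<bar>) = \<bar>\<psi> k\<bar> * (LINT \<omega>|M. \<bar>e k \<omega>\<bar>)"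
      by (simp add: abs_mult)
    also have "ennreal \<dots> \<le> ennreal (\<bar>\<psi> k\<bar> * C)"
      using C[of k] by (intro ennreal_leI mult_left_mono) auto
    finally show "(\<integral>\<^sup>+\<omega>. ennreal \<bar>\<psi> k * e k \<omega>\<bar> \<partial>M) \<le> ennreal (\<bar>\<psi> k\<bar> * C)" .
  qed auto
  also have "\<dots> < \<infinity>"
  proof -
    have "0 \<le> (LINT \<omega>|M. \<bar>e 0 \<omega>\<bar>)" by (rule Bochner_Integration.integral_nonneg) simp
    then have "C \<ge> 0" using C[of 0] by (rule order_trans)
    then have "(\<Sum>k. ennreal (\<bar>\<psi> k\<bar> * C)) = ennreal (\<Sum>k. \<bar>\<psi> k\<bar> * C)"
      using \<psi> by (intro suminf_ennreal2 summable_mult2) auto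
    then show ?thesis by simp
  qed
  finally have "AE \<omega> in M. (\<Sum>k. ennreal \<bar>\<psi> k * e k \<omega>\<bar>) \<noteq> \<infinity>"
    by (intro nn_integral_PInf_AE) (auto simp: less_top)
  then show ?thesis
  proof eventually_elim
    case (elim \<omega>)
    then have "summable (\<lambda>k. \<bar>\<psi> k * e k \<omega>\<bar>)"
      by (intro summable_suminf_not_top) auto
    then show ?case by (rule summable_rabs_cancel)
  qed
qed

text \<open>The bound on the partial sums is uniform, and Fatou's lemma carries it to the series. It
  involves \<open>\<psi>\<close> and \<open>V\<close> only, so it is common to all models along a
  sequence of parameters.\<close>

lemma (in prob_space) linear_process_second_moment:
  fixes e :: "nat \<Rightarrow> 'a \<Rightarrow> real"
  assumes [measurable]: "\<And>k. e k \<in> borel_measurable M"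
    and sq: "\<And>k. integrable M (\<lambda>\<omega>. (e k \<omega>)\<^sup>2)" "\<And>k. (LINT \<omega>|M. (e k \<omega>)\<^sup>2) \<le> V"
    and \<psi>: "summable (\<lambda>k. \<bar>\<psi> k\<bar>)"
    and sm: "AE \<omega> in M. summable (\<lambda>k. \<psi> k * e k \<omega>)"
  shows "integrable M (\<lambda>\<omega>. (\<Sum>k. \<psi> k * e k \<omega>)\<^sup>2)"
    and "(LINT \<omega>|M. (\<Sum>k. \<psi> k * e k \<omega>)\<^sup>2) \<le> (\<Sum>k. \<bar>\<psi> k\<bar>)\<^sup>2 * V"
proof -
  define Psi where "Psi = (\<Sum>k. \<bar>\<psi> k\<bar>)"
  have "0 \<le> (LINT \<omega>|M. (e 0 \<omega>)\<^sup>2)" by (rule Bochner_Integration.integral_nonneg) simp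
  then have V0: "V \<ge> 0" using sq(2)[of 0] by (rule order_trans)
  have Psi0: "Psi \<ge> 0" unfolding Psi_def by (rule suminf_nonneg[OF \<psi>]) simp
  have part: "(\<integral>\<^sup>+\<omega>. ennreal ((\<Sum>k<K. \<psi> k * e k \<omega>)\<^sup>2) \<partial>M) \<le> ennreal (Psi\<^sup>2 * V)" for K
  proof -
    have PK: "(\<Sum>k<K. \<bar>\<psi> k\<bar>) \<le> Psi" unfolding Psi_def by (rule sum_le_suminf[OF \<psi>]) auto
    have cs: "(\<Sum>k<K. \<psi> k * e k \<omega>)\<^sup>2 \<le> Psi * (\<Sum>k<K. \<bar>\<psi> k\<bar> * (e k \<omega>)\<^sup>2)" for \<omega>
    proof -
      \<comment> \<open>Splitting \<open>\<bar>\<psi> k\<bar>\<close> into two equal roots lets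
        Cauchy-Schwarz produce its finite sum as a factor while keeping
        \<open>\<bar>\<psi> k\<bar>\<close> as a weight for the squares.\<close>
      have "(\<Sum>k<K. \<psi> k * e k \<omega>)\<^sup>2 \<le> (\<Sum>k<K. sqrt \<bar>\<psi> k\<bar> * (sqrt \<bar>\<psi> k\<bar> * \<bar>e k \<omega>\<bar>))\<^sup>2"
      proof (rule power2_le_iff_abs_le[THEN iffD2])
        show "\<bar>\<Sum>k<K. \<psi> k * e k \<omega>\<bar> \<le> (\<Sum>k<K. sqrt \<bar>\<psi> k\<bar> * (sqrt \<bar>\<psi> k\<bar> * \<bar>e k \<omega>\<bar>))"
          by (rule order_trans[OF sum_abs]) (simp add: abs_mult mult.assoc[symmetric])
      qed (auto intro!: sum_nonneg)
      also have "\<dots> \<le> (\<Sum>k<K. (sqrt \<bar>\<psi> k\<bar>)\<^sup>2) * (\<Sum>k<K. (sqrt \<bar>\<psi> k\<bar> * \<bar>e k \<omega>\<bar>)\<^sup>2)"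
        by (rule Cauchy_Schwarz_ineq_sum)
      also have "\<dots> = (\<Sum>k<K. \<bar>\<psi> k\<bar>) * (\<Sum>k<K. \<bar>\<psi> k\<bar> * (e k \<omega>)\<^sup>2)"
        by (simp add: power_mult_distrib)
      also have "\<dots> \<le> Psi * (\<Sum>k<K. \<bar>\<psi> k\<bar> * (e k \<omega>)\<^sup>2)"
        using PK by (intro mult_right_mono sum_nonneg) auto
      finally show ?thesis .
    qed
    have "(\<integral>\<^sup>+\<omega>. ennreal ((\<Sum>k<K. \<psi> k * e k \<omega>)\<^sup>2) \<partial>M) \<le> (\<integral>\<^sup>+\<omega>. ennreal (Psi * (\<Sum>k<K. \<bar>\<psi> k\<bar> * (e k \<omega>)\<^sup>2)) \<partial>M)"
      by (intro nn_integral_mono ennreal_leI cs)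
    also have "\<dots> = ennreal (LINT \<omega>|M. Psi * (\<Sum>k<K. \<bar>\<psi> k\<bar> * (e k \<omega>)\<^sup>2))"
      using sq(1) Psi0 by (intro nn_integral_eq_integral) (auto intro!: mult_nonneg_nonneg sum_nonneg)
    also have "(LINT \<omega>|M. Psi * (\<Sum>k<K. \<bar>\<psi> k\<bar> * (e k \<omega>)\<^sup>2)) = Psi * (\<Sum>k<K. \<bar>\<psi> k\<bar> * (LINT \<omega>|M. (e k \<omega>)\<^sup>2))"
      using sq(1) by simp
    also have "\<dots> \<le> Psi * (\<Sum>k<K. \<bar>\<psi> k\<bar> * V)"
      using Psi0 sq(2) by (intro mult_left_mono sum_mono) auto
    also have "\<dots> \<le> Psi * (Psi * V)"
      using PK V0 Psi0 by (auto simp: sum_distrib_right[symmetric] intro!: mult_left_mono mult_right_mono)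
    finally show ?thesis by (simp add: power2_eq_square mult.assoc ennreal_leI)
  qed
  have "(\<integral>\<^sup>+\<omega>. ennreal ((\<Sum>k. \<psi> k * e k \<omega>)\<^sup>2) \<partial>M) \<le> (\<integral>\<^sup>+\<omega>. liminf (\<lambda>K. ennreal ((\<Sum>k<K. \<psi> k * e k \<omega>)\<^sup>2)) \<partial>M)"
  proof (rule nn_integral_mono_AE)
    show "AE \<omega> in M. ennreal ((\<Sum>k. \<psi> k * e k \<omega>)\<^sup>2) \<le> liminf (\<lambda>K. ennreal ((\<Sum>k<K. \<psi> k * e k \<omega>)\<^sup>2))"
      using sm
    proof eventually_elim
      case (elim \<omega>)
      have "(\<lambda>K. ennreal ((\<Sum>k<K. \<psi> k * e k \<omega>)\<^sup>2)) \<longlonglongrightarrow> ennreal ((\<Sum>k. \<psi> k * e k \<omega>)\<^sup>2)"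
        by (intro tendsto_intros summable_LIMSEQ elim)
      from lim_imp_Liminf[OF sequentially_bot this] show ?case by (rule eq_refl[OF sym])
    qed
  qed
  also have "\<dots> \<le> liminf (\<lambda>K. \<integral>\<^sup>+\<omega>. ennreal ((\<Sum>k<K. \<psi> k * e k \<omega>)\<^sup>2) \<partial>M)"
    by (rule nn_integral_liminf) measurable
  also have "\<dots> \<le> ennreal (Psi\<^sup>2 * V)"
    using part by (intro Liminf_le) (auto intro!: always_eventually)
  finally have le: "(\<integral>\<^sup>+\<omega>. ennreal ((\<Sum>k. \<psi> k * e k \<omega>)\<^sup>2) \<partial>M) \<le> ennreal (Psi\<^sup>2 * V)" .
  show int: "integrable M (\<lambda>\<omega>. (\<Sum>k. \<psi> k * e k \<omega>)\<^sup>2)"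
    using le by (intro integrableI_bounded) (auto intro: le_less_trans)
  have "ennreal (LINT \<omega>|M. (\<Sum>k. \<psi> k * e k \<omega>)\<^sup>2) \<le> ennreal (Psi\<^sup>2 * V)"
    using le int by (subst nn_integral_eq_integral[symmetric]) auto
  then show "(LINT \<omega>|M. (\<Sum>k. \<psi> k * e k \<omega>)\<^sup>2) \<le> (\<Sum>k. \<bar>\<psi> k\<bar>)\<^sup>2 * V"
    using V0 by (simp add: Psi_def ennreal_le_iff)
qed

text \<open>The mean of \<open>min 1 \<bar>X\<bar>\<close> is a subadditive gauge of convergence in
  probability which is finite for every law. It is applied to the stationary solution, whose moments
  are not known beforehand, and to the scaled counts.\<close>

lemma (in prob_space) integral_min_one_le_add:
  fixes X Y W :: "'a \<Rightarrow> real"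
  assumes [measurable]: "X \<in> borel_measurable M" "Y \<in> borel_measurable M" "W \<in> borel_measurable M"
    and le: "AE \<omega> in M. \<bar>W \<omega>\<bar> \<le> \<bar>X \<omega>\<bar> + \<bar>Y \<omega>\<bar>"
  shows "(LINT \<omega>|M. min 1 \<bar>W \<omega>\<bar>) \<le> (LINT \<omega>|M. min 1 \<bar>X \<omega>\<bar>) + (LINT \<omega>|M. min 1 \<bar>Y \<omega>\<bar>)"
proof -
  have int: "integrable M (\<lambda>\<omega>. min 1 \<bar>F \<omega>\<bar>)" if [measurable]: "F \<in> borel_measurable M" for F :: "'a \<Rightarrow> real"
    by (rule integrable_const_bound[where B = 1]) auto
  have "(LINT \<omega>|M. min 1 \<bar>W \<omega>\<bar>) \<le> (LINT \<omega>|M. min 1 \<bar>X \<omega>\<bar> + min 1 \<bar>Y \<omega>\<bar>)"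
  proof (rule integral_mono_AE)
    show "AE \<omega> in M. min 1 \<bar>W \<omega>\<bar> \<le> min 1 \<bar>X \<omega>\<bar> + min 1 \<bar>Y \<omega>\<bar>"
      using le by eventually_elim linarith
  qed (auto intro!: int Bochner_Integration.integrable_add)
  then show ?thesis by (simp add: int)
qed

lemma (in prob_space) integral_min_one_sum_le:
  fixes X :: "'i \<Rightarrow> 'a \<Rightarrow> real"
  assumes "finite I" "\<And>i. i \<in> I \<Longrightarrow> X i \<in> borel_measurable M"
  shows "(LINT \<omega>|M. min 1 \<bar>\<Sum>i\<in>I. X i \<omega>\<bar>) \<le> (\<Sum>i\<in>I. LINT \<omega>|M. min 1 \<bar>X i \<omega>\<bar>)"
  using assms
proof (induction I)
  case (insert i I)
  have "(LINT \<omega>|M. min 1 \<bar>\<Sum>i\<in>insert i I. X i \<omega>\<bar>) \<le> (LINT \<omega>|M. min 1 \<bar>X i \<omega>\<bar>) + (LINT \<omega>|M. min 1 \<bar>\<Sum>i\<in>I. X i \<omega>\<bar>)"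
    using insert by (intro integral_min_one_le_add borel_measurable_sum) auto
  then show ?case using insert by fastforce
qed simp

text \<open>After \<open>K\<close> substitutions the remainder combines \<open>p\<close> past
  values, each with the law of \<open>u 0\<close>, with coefficients tending to 0. Stationarity thus
  makes it vanish in probability, while the partial sums converge almost surely to the series; the
  two limits coincide.\<close>

lemma (in prob_space) ar_causal_representation:
  fixes u e :: "int \<Rightarrow> 'a \<Rightarrow> real" and \<beta> \<psi> :: "nat \<Rightarrow> real"
  assumes \<psi>: "\<And>k. \<psi> k = (if k = 0 then 1 else 0) + (\<Sum>j=1..p. if j \<le> k then \<beta> j * \<psi> (k - j) else 0)"
    and sm: "summable (\<lambda>k. \<bar>\<psi> k\<bar>)" and p: "p \<ge> 1"
    and e[measurable]: "\<And>t. e t \<in> borel_measurable M" and u[measurable]: "\<And>t. u t \<in> borel_measurable M"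
    and int: "\<And>t. integrable M (e t)" and C: "\<And>t. (LINT \<omega>|M. \<bar>e t \<omega>\<bar>) \<le> C"
    and stat: "\<And>t. distr M borel (u t) = distr M borel (u 0)"
    and rec: "\<And>t. AE \<omega> in M. u t \<omega> = (\<Sum>j=1..p. \<beta> j * u (t - int j) \<omega>) + e t \<omega>"
  shows "AE \<omega> in M. u t \<omega> = (\<Sum>k. \<psi> k * e (t - int k) \<omega>)"
proof -
  define c where "c = (\<lambda>K i. \<Sum>j=i+1..p. if j \<le> Suc K + i then \<beta> j * \<psi> (Suc K + i - j) else 0)"
  define S where "S = (\<lambda>K \<omega>. \<Sum>k\<le>K. \<psi> k * e (t - int k) \<omega>)"
  define U where "U = (\<lambda>\<omega>. \<Sum>k. \<psi> k * e (t - int k) \<omega>)"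
  have [measurable]: "S K \<in> borel_measurable M" "U \<in> borel_measurable M" for K
    unfolding S_def U_def by measurable
  have "AE \<omega> in M. \<forall>t. u t \<omega> = (\<Sum>j=1..p. \<beta> j * u (t - int j) \<omega>) + e t \<omega>"
    using rec by (simp add: AE_all_countable)
  then have iter: "AE \<omega> in M. \<forall>K. u t \<omega> - S K \<omega> = (\<Sum>i<p. c K i * u (t - int (Suc K) - int i) \<omega>)"
  proof eventually_elim
    case (elim \<omega>)
    show ?case
    proof
      fix K
      show "u t \<omega> - S K \<omega> = (\<Sum>i<p. c K i * u (t - int (Suc K) - int i) \<omega>)"
        using ar_iterate[OF \<psi> p, where u = "\<lambda>t. u t \<omega>" and e = "\<lambda>t. e t \<omega>" and t = t and K = K, OF elim[rule_format]]
        unfolding S_def c_def by linarith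
    qed
  qed
  have \<psi>0: "\<psi> \<longlonglongrightarrow> 0"
    using summable_LIMSEQ_zero[OF sm] by (rule tendsto_rabs_zero_cancel)
  have c0: "(\<lambda>K. c K i) \<longlonglongrightarrow> 0" for i
  proof -
    have "(\<lambda>K. if j \<le> Suc K + i then \<beta> j * \<psi> (Suc K + i - j) else 0) \<longlonglongrightarrow> 0" for j
    proof -
      have "(\<lambda>K. \<beta> j * \<psi> K) \<longlonglongrightarrow> 0" using tendsto_mult[OF tendsto_const \<psi>0] by simp
      then have "(\<lambda>K. if j \<le> K then \<beta> j * \<psi> (K - j) else 0) \<longlonglongrightarrow> 0"
        by (intro LIMSEQ_offset[where k = j and f = "\<lambda>K. if j \<le> K then \<beta> j * \<psi> (K - j) else 0"]) simp
      from LIMSEQ_ignore_initial_segment[OF this, of "Suc i"] show ?thesis unfolding add_Suc_right add_Suc .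
    qed
    then show ?thesis unfolding c_def using tendsto_sum[of "{i+1..p}" "\<lambda>j K. if j \<le> Suc K + i then \<beta> j * \<psi> (Suc K + i - j) else 0" "\<lambda>_. 0"]
      by simp
  qed
  have marg: "(LINT \<omega>|M. min 1 \<bar>a * u s \<omega>\<bar>) = (LINT \<omega>|M. min 1 \<bar>a * u 0 \<omega>\<bar>)" for a s
  proof -
    have "(LINT \<omega>|M. min 1 \<bar>a * u s \<omega>\<bar>) = (LINT x|distr M borel (u s). min 1 \<bar>a * x\<bar>)" for s
      by (subst integral_distr) auto
    then show ?thesis using stat[of s] by simp
  qed
  have lim1: "(\<lambda>K. LINT \<omega>|M. min 1 \<bar>u t \<omega> - S K \<omega>\<bar>) \<longlonglongrightarrow> 0"
  proof (rule Lim_null_comparison)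
    show "eventually (\<lambda>K. norm (LINT \<omega>|M. min 1 \<bar>u t \<omega> - S K \<omega>\<bar>) \<le> (\<Sum>i<p. LINT \<omega>|M. min 1 \<bar>c K i * u 0 \<omega>\<bar>)) sequentially"
    proof (intro always_eventually allI)
      fix K
      have "(LINT \<omega>|M. min 1 \<bar>u t \<omega> - S K \<omega>\<bar>) = (LINT \<omega>|M. min 1 \<bar>\<Sum>i<p. c K i * u (t - int (Suc K) - int i) \<omega>\<bar>)"
        by (rule integral_cong_AE) (use iter in \<open>auto elim!: eventually_mono\<close>)
      also have "\<dots> \<le> (\<Sum>i<p. LINT \<omega>|M. min 1 \<bar>c K i * u (t - int (Suc K) - int i) \<omega>\<bar>)"
        by (rule integral_min_one_sum_le) auto
      also have "\<dots> = (\<Sum>i<p. LINT \<omega>|M. min 1 \<bar>c K i * u 0 \<omega>\<bar>)"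
        by (subst marg) simp
      finally show "norm (LINT \<omega>|M. min 1 \<bar>u t \<omega> - S K \<omega>\<bar>) \<le> (\<Sum>i<p. LINT \<omega>|M. min 1 \<bar>c K i * u 0 \<omega>\<bar>)"
        by (simp add: Bochner_Integration.integral_nonneg)
    qed
    have "(\<lambda>K. \<Sum>i<p. LINT \<omega>|M. min 1 \<bar>c K i * u 0 \<omega>\<bar>) \<longlonglongrightarrow> (\<Sum>i<p. 0)"
      by (intro tendsto_sum tendsto_integral_min_scaled prob_space_axioms u c0)
    then show "(\<lambda>K. \<Sum>i<p. LINT \<omega>|M. min 1 \<bar>c K i * u 0 \<omega>\<bar>) \<longlonglongrightarrow> 0" by simp
  qed
  have lim2: "(\<lambda>K. LINT \<omega>|M. min 1 \<bar>S K \<omega> - U \<omega>\<bar>) \<longlonglongrightarrow> (LINT \<omega>|M. 0)"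
  proof (rule integral_dominated_convergence[where w = "\<lambda>_. 1"])
    have "AE \<omega> in M. summable (\<lambda>k. \<psi> k * e (t - int k) \<omega>)"
      by (rule AE_summable_linear_process[OF _ int C sm]) measurable
    then show "AE \<omega> in M. (\<lambda>K. min 1 \<bar>S K \<omega> - U \<omega>\<bar>) \<longlonglongrightarrow> 0"
    proof eventually_elim
      case (elim \<omega>)
      have "(\<lambda>K. S K \<omega>) \<longlonglongrightarrow> U \<omega>"
        unfolding S_def U_def by (rule summable_LIMSEQ'[OF elim])
      then have "(\<lambda>K. min 1 \<bar>S K \<omega> - U \<omega>\<bar>) \<longlonglongrightarrow> min 1 \<bar>U \<omega> - U \<omega>\<bar>"
        by (intro tendsto_intros)
      then show ?case by simp
    qed
  qed auto
  have "(LINT \<omega>|M. min 1 \<bar>u t \<omega> - U \<omega>\<bar>) \<le> 0"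
  proof (rule LIMSEQ_le_const)
    show "(\<lambda>K. (LINT \<omega>|M. min 1 \<bar>u t \<omega> - S K \<omega>\<bar>) + (LINT \<omega>|M. min 1 \<bar>S K \<omega> - U \<omega>\<bar>)) \<longlonglongrightarrow> 0"
      using tendsto_add[OF lim1 lim2] by simp
    show "\<exists>N. \<forall>K\<ge>N. (LINT \<omega>|M. min 1 \<bar>u t \<omega> - U \<omega>\<bar>) \<le>
        (LINT \<omega>|M. min 1 \<bar>u t \<omega> - S K \<omega>\<bar>) + (LINT \<omega>|M. min 1 \<bar>S K \<omega> - U \<omega>\<bar>)"
      by (intro exI allI impI integral_min_one_le_add) auto
  qed
  then have "(LINT \<omega>|M. min 1 \<bar>u t \<omega> - U \<omega>\<bar>) = 0"
    by (intro antisym Bochner_Integration.integral_nonneg) auto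
  then have "AE \<omega> in M. min 1 \<bar>u t \<omega> - U \<omega>\<bar> = 0"
    by (subst (asm) integral_nonneg_eq_0_iff_AE) (auto intro!: integrable_const_bound[where B = 1])
  then show ?thesis by eventually_elim (auto simp: U_def min_def split: if_splits)
qed

text \<open>A finite set of index pairs splits into fibres over \<open>k\<close>, and the events
  over one fibre form a cylinder in the path space of the \<open>k\<close>-th sequence. Independence
  of the sequences multiplies across fibres, independence within a sequence multiplies inside
  each.\<close>

lemma (in prob_space) indep_vars_blocks:
  fixes Z :: "'k \<Rightarrow> 't \<Rightarrow> 'a \<Rightarrow> 'b"
  assumes outer: "indep_vars (\<lambda>_. PiM UNIV (\<lambda>_. N)) (\<lambda>k \<omega> t. Z k t \<omega>) K"
    and inner: "\<And>k. k \<in> K \<Longrightarrow> indep_vars (\<lambda>_. N) (Z k) UNIV"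
  shows "indep_vars (\<lambda>_. N) (\<lambda>(k, t). Z k t) (K \<times> UNIV)"
proof -
  let ?X = "\<lambda>(k, t). Z k t"
  have meas: "?X i \<in> measurable M N" if "i \<in> K \<times> UNIV" for i
    using that inner by (auto simp: indep_vars_def)
  have "indep_sets (\<lambda>i. {?X i -` A \<inter> space M |A. A \<in> sets N}) (K \<times> UNIV)"
  proof (rule indep_setsI)
    fix i assume "i \<in> K \<times> (UNIV :: 't set)"
    then show "{?X i -` A \<inter> space M |A. A \<in> sets N} \<subseteq> events"
      using meas[of i] by (auto simp: measurable_sets)
  next
    fix A J assume J: "J \<noteq> {}" "J \<subseteq> K \<times> (UNIV :: 't set)" "finite J"
      and "\<forall>j\<in>J. A j \<in> {?X j -` A \<inter> space M |A. A \<in> sets N}"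
    then have "\<forall>j\<in>J. \<exists>B. B \<in> sets N \<and> A j = ?X j -` B \<inter> space M" by blast
    from bchoice[OF this] obtain B where B: "\<And>j. j \<in> J \<Longrightarrow> B j \<in> sets N" "\<And>j. j \<in> J \<Longrightarrow> A j = ?X j -` B j \<inter> space M"
      by blast
    define L where "L = fst ` J"
    define T where "T = (\<lambda>k. {t. (k, t) \<in> J})"
    have L: "L \<noteq> {}" "finite L" "L \<subseteq> K" using J by (auto simp: L_def)
    have T: "T k \<noteq> {}" "finite (T k)" if "k \<in> L" for k
    proof -
      have "T k \<subseteq> snd ` J" by (force simp: T_def image_iff)
      then show "finite (T k)" using J(3) by (simp add: finite_subset)
      show "T k \<noteq> {}" using that by (auto simp: L_def T_def)
    qed
    have Jeq: "J = (SIGMA k:L. T k)" by (force simp: L_def T_def image_iff)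
    define cyl where "cyl = (\<lambda>k. {f \<in> space (PiM UNIV (\<lambda>_. N)). \<forall>t\<in>T k. f t \<in> B (k, t)})"
    have cyl: "cyl k \<in> sets (PiM UNIV (\<lambda>_. N))" if "k \<in> L" for k
      unfolding cyl_def
    proof (rule sets.sets_Collect_finite_All[OF _ T(2)[OF that]])
      fix t assume "t \<in> T k"
      then have "B (k, t) \<in> sets N" using B(1) by (auto simp: T_def)
      then show "{f \<in> space (Pi\<^sub>M UNIV (\<lambda>_. N)). f t \<in> B (k, t)} \<in> sets (Pi\<^sub>M UNIV (\<lambda>_. N))"
        by measurable
    qed
    have pre: "(\<lambda>\<omega> t. Z k t \<omega>) -` cyl k \<inter> space M = (\<Inter>t\<in>T k. Z k t -` B (k, t) \<inter> space M)" if "k \<in> L" for k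
    proof -
      have "Z k t \<omega> \<in> space N" if "\<omega> \<in> space M" for t \<omega>
        using meas[of "(k, t)"] \<open>k \<in> L\<close> L(3) that by (auto dest: measurable_space)
      then show ?thesis using T(1)[OF that] by (auto simp: cyl_def space_PiM)
    qed
    have "prob (\<Inter>j\<in>J. A j) = prob (\<Inter>k\<in>L. (\<lambda>\<omega> t. Z k t \<omega>) -` cyl k \<inter> space M)"
    proof (rule arg_cong[where f = prob])
      have "(\<Inter>j\<in>J. A j) = (\<Inter>k\<in>L. \<Inter>t\<in>T k. A (k, t))"
        unfolding Jeq by auto
      also have "\<dots> = (\<Inter>k\<in>L. (\<lambda>\<omega> t. Z k t \<omega>) -` cyl k \<inter> space M)"
        using pre B(2) by (intro INF_cong refl) (auto simp: T_def)
      finally show "(\<Inter>j\<in>J. A j) = (\<Inter>k\<in>L. (\<lambda>\<omega> t. Z k t \<omega>) -` cyl k \<inter> space M)" .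
    qed
    also have "\<dots> = (\<Prod>k\<in>L. prob ((\<lambda>\<omega> t. Z k t \<omega>) -` cyl k \<inter> space M))"
      using L cyl by (intro indep_varsD[OF outer]) auto
    also have "\<dots> = (\<Prod>k\<in>L. \<Prod>t\<in>T k. prob (A (k, t)))"
    proof (intro prod.cong refl)
      fix k assume k: "k \<in> L"
      have "prob ((\<lambda>\<omega> t. Z k t \<omega>) -` cyl k \<inter> space M) = (\<Prod>t\<in>T k. prob (Z k t -` B (k, t) \<inter> space M))"
        unfolding pre[OF k] using T[OF k] L(3) k B(1) by (intro indep_varsD[OF inner]) (auto simp: T_def)
      then show "prob ((\<lambda>\<omega> t. Z k t \<omega>) -` cyl k \<inter> space M) = (\<Prod>t\<in>T k. prob (A (k, t)))"
        using B(2) by (simp add: T_def)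
    qed
    also have "\<dots> = (\<Prod>j\<in>J. prob (A j))"
      unfolding Jeq using L T by (subst prod.Sigma) auto
    finally show "prob (\<Inter>j\<in>J. A j) = (\<Prod>j\<in>J. prob (A j))" .
  qed
  then show ?thesis unfolding indep_vars_def2 using meas by auto
qed

text \<open>The mixture is realized by a Bernoulli choice between \<open>G\<close> and
  \<open>H\<close>, and its distribution function identifies it with \<open>N\<close>. The purpose
  is a bound on the second moment of the innovations that is uniform over the local
  alternatives.\<close>

lemma nn_integral_mixture:
  assumes N: "real_distribution N" and cdf: "cdf N = (\<lambda>x. (1 - r) * cdf G x + r * cdf H x)"
    and G: "real_distribution G" and H: "real_distribution H" and r: "0 \<le> r" "r \<le> 1"
    and f[measurable]: "f \<in> borel_measurable borel"
  shows "(\<integral>\<^sup>+x. f x \<partial>N) = ennreal (1 - r) * (\<integral>\<^sup>+x. f x \<partial>G) + ennreal r * (\<integral>\<^sup>+x. f x \<partial>H)"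
proof -
  interpret G: real_distribution G by (rule G)
  interpret H: real_distribution H by (rule H)
  define K where "K = (\<lambda>b. if b then H else G)"
  define N' where "N' = bind (measure_pmf (bernoulli_pmf r)) K"
  have K: "K \<in> measurable (measure_pmf (bernoulli_pmf r)) (subprob_algebra borel)"
    unfolding K_def measurable_pmf_measure1
    by (simp add: space_subprob_algebra Pi_iff prob_space_imp_subprob_space G.prob_space_axioms H.prob_space_axioms
        G.events_eq_borel H.events_eq_borel)
  have nn: "(\<integral>\<^sup>+x. F x \<partial>N') = ennreal (1 - r) * (\<integral>\<^sup>+x. F x \<partial>G) + ennreal r * (\<integral>\<^sup>+x. F x \<partial>H)"
    if F: "F \<in> borel_measurable borel" for F
    unfolding N'_def using r by (subst nn_integral_bind[OF F K]) (simp add: K_def mult.commute add.commute)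
  have sets: "sets N' = sets borel"
    unfolding N'_def by (rule sets_bind[where N = borel]) (auto simp: K_def)
  have em: "emeasure N' B = ennreal ((1 - r) * measure G B + r * measure H B)" if "B \<in> sets borel" for B
    using nn[of "indicator B"] that r sets
    by (simp add: G.emeasure_eq_measure H.emeasure_eq_measure ennreal_mult)
  have rd: "real_distribution N'"
  proof -
    have "emeasure N' (space N') = 1"
      using em[of UNIV] sets_eq_imp_space_eq[OF sets] G.prob_space H.prob_space by simp
    then show ?thesis
      using sets sets_eq_imp_space_eq[OF sets] by (auto simp: real_distribution_def real_distribution_axioms_def intro: prob_spaceI)
  qed
  have "N = N'"
  proof (rule cdf_unique[OF N rd], rule ext)
    fix x
    have "measure N' {..x} = (1 - r) * measure G {..x} + r * measure H {..x}"
      unfolding measure_def[of N'] em[of "{..x}", OF borel_closed[OF closed_atMost]]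
      using r by (intro enn2real_ennreal) simp
    then show "cdf N x = cdf N' x" by (simp add: cdf) (simp add: cdf_def)
  qed
  then show ?thesis using nn[OF f] by simp
qed

section \<open>Independence of functions of disjoint blocks\<close>

text \<open>The sigma-algebra generated by the variables with index in \<open>K\<close>, packaged as
  a measure so that being determined by these variables is an ordinary \<open>measurable\<close>
  statement.\<close>

definition generated :: "'a measure \<Rightarrow> ('i \<Rightarrow> 'a \<Rightarrow> real) \<Rightarrow> 'i set \<Rightarrow> 'a measure" where
  "generated M X K = vimage_algebra (space M) (\<lambda>\<omega>. \<lambda>i\<in>K. X i \<omega>) (PiM K (\<lambda>_. borel))"

lemma space_generated [simp]: "space (generated M X K) = space M"
  by (simp add: generated_def)

lemma measurable_generated_component:
  assumes "i \<in> K"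
  shows "X i \<in> borel_measurable (generated M X K)"
proof -
  have "(\<lambda>\<omega>. \<lambda>i\<in>K. X i \<omega>) \<in> measurable (generated M X K) (PiM K (\<lambda>_. borel))"
    unfolding generated_def by (rule measurable_vimage_algebra1) (auto simp: space_PiM)
  from measurable_compose[OF this measurable_component_singleton[OF assms]]
  show ?thesis using assms by simp
qed

text \<open>Minimality of the generated sigma-algebra: it is contained in every \<open>F\<close> on
  the same space that makes the generators measurable. This gives both the passage to larger index
  sets and the passage to \<open>M\<close>.\<close>

lemma measurable_generatedI:
  assumes f: "f \<in> measurable (generated M X K) N"
    and X: "\<And>i. i \<in> K \<Longrightarrow> X i \<in> borel_measurable F" and sp: "space F = space M"
  shows "f \<in> measurable F N"
proof -
  have R: "(\<lambda>\<omega>. \<lambda>i\<in>K. X i \<omega>) \<in> measurable F (PiM K (\<lambda>_. borel))"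
    using X by (rule measurable_restrict)
  have "id \<in> measurable F (generated M X K)"
    unfolding generated_def
    by (rule measurable_vimage_algebra2) (use sp R in \<open>auto simp: id_def\<close>)
  from measurable_compose[OF this f] show ?thesis by simp
qed

lemma measurable_generated_mono:
  assumes "f \<in> measurable (generated M X K) N" "K \<subseteq> K'"
  shows "f \<in> measurable (generated M X K') N"
  by (rule measurable_generatedI[OF assms(1)]) (use assms(2) in \<open>auto intro: measurable_generated_component\<close>)

text \<open>The library's \<open>indep_var\<close> requires both variables to have the same range type, hence the
  formulation by the joint law.\<close>

lemma (in prob_space) joint_law_generated:
  assumes ind: "indep_vars (\<lambda>_. borel) X I" and KL: "K \<subseteq> I" "L \<subseteq> I" "K \<inter> L = {}"
    and f: "f \<in> measurable (generated M X K) N" and h: "h \<in> measurable (generated M X L) N'"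
  shows "distr M N f \<Otimes>\<^sub>M distr M N' h = distr M (N \<Otimes>\<^sub>M N') (\<lambda>\<omega>. (f \<omega>, h \<omega>))"
proof -
  let ?R = "\<lambda>K \<omega>. \<lambda>i\<in>K. X i \<omega>"
  have X: "X i \<in> borel_measurable M" if "i \<in> I" for i using ind that by (simp add: indep_vars_def)
  have iR: "indep_set (sigma_sets (space M) {?R K -` A \<inter> space M |A. A \<in> sets (PiM K (\<lambda>_. borel))})
     (sigma_sets (space M) {?R L -` A \<inter> space M |A. A \<in> sets (PiM L (\<lambda>_. borel))})"
    using indep_var_restrict[OF ind KL(3) KL(1,2)] unfolding indep_var_eq by simp
  have fm[measurable]: "f \<in> measurable M N" and hm[measurable]: "h \<in> measurable M N'"
    using KL X by (auto intro!: measurable_generatedI[OF f] measurable_generatedI[OF h])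
  interpret F: prob_space "distr M N f" by (rule prob_space_distr) measurable
  interpret H: prob_space "distr M N' h" by (rule prob_space_distr) measurable
  show ?thesis
  proof (rule pair_measure_eqI)
    fix A B assume "A \<in> sets (distr M N f)" "B \<in> sets (distr M N' h)"
    then have AB[measurable]: "A \<in> sets N" "B \<in> sets N'" by auto
    have "f -` A \<inter> space M \<in> sigma_sets (space M) {?R K -` A \<inter> space M |A. A \<in> sets (PiM K (\<lambda>_. borel))}"
      using measurable_sets[OF f AB(1)] by (simp add: generated_def sets_vimage_algebra)
    moreover have "h -` B \<inter> space M \<in> sigma_sets (space M) {?R L -` A \<inter> space M |A. A \<in> sets (PiM L (\<lambda>_. borel))}"
      using measurable_sets[OF h AB(2)] by (simp add: generated_def sets_vimage_algebra)
    ultimately have "prob ((f -` A \<inter> space M) \<inter> (h -` B \<inter> space M)) = prob (f -` A \<inter> space M) * prob (h -` B \<inter> space M)"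
      using iR unfolding indep_sets2_eq by blast
    moreover have "(\<lambda>\<omega>. (f \<omega>, h \<omega>)) -` (A \<times> B) \<inter> space M = (f -` A \<inter> space M) \<inter> (h -` B \<inter> space M)" by auto
    ultimately show "emeasure (distr M N f) A * emeasure (distr M N' h) B =
        emeasure (distr M (N \<Otimes>\<^sub>M N') (\<lambda>\<omega>. (f \<omega>, h \<omega>))) (A \<times> B)"
      by (simp add: emeasure_distr emeasure_eq_measure ennreal_mult)
  qed (auto intro: prob_space_imp_sigma_finite F.prob_space_axioms H.prob_space_axioms)
qed

text \<open>Takes the place of conditioning on \<open>R\<close>: by independence and Fubini,
  \<open>e\<close> is integrated out with \<open>R\<close> frozen.\<close>

lemma (in prob_space) integral_indep_conditional:
  fixes f :: "'b \<times> 'c \<Rightarrow> real"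
  assumes [measurable]: "e \<in> measurable M S" "R \<in> measurable M N"
    and eq: "distr M S e \<Otimes>\<^sub>M distr M N R = distr M (S \<Otimes>\<^sub>M N) (\<lambda>\<omega>. (e \<omega>, R \<omega>))"
    and f[measurable]: "f \<in> borel_measurable (S \<Otimes>\<^sub>M N)" and C: "\<And>x. \<bar>f x\<bar> \<le> C"
  shows "(LINT \<omega>|M. f (e \<omega>, R \<omega>)) = (LINT \<omega>|M. LINT a|distr M S e. f (a, R \<omega>))"
proof -
  interpret E: prob_space "distr M S e" by (rule prob_space_distr) measurable
  interpret R: prob_space "distr M N R" by (rule prob_space_distr) measurable
  interpret P: pair_prob_space "distr M S e" "distr M N R" ..
  have [measurable]: "(\<lambda>r. LINT a|distr M S e. f (a, r)) \<in> borel_measurable N"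
    by measurable
  have "(LINT \<omega>|M. f (e \<omega>, R \<omega>)) = (LINT x|(distr M (S \<Otimes>\<^sub>M N) (\<lambda>\<omega>. (e \<omega>, R \<omega>))). f x)"
    by (subst integral_distr) auto
  also have "\<dots> = (LINT x|(distr M S e \<Otimes>\<^sub>M distr M N R). (\<lambda>(a, r). f (a, r)) x)"
    unfolding eq by simp
  also have "\<dots> = (LINT r|distr M N R. LINT a|distr M S e. f (a, r))"
    using C by (intro P.integral_snd[symmetric] P.P.integrable_const_bound[where B = C]) auto
  also have "\<dots> = (LINT \<omega>|M. LINT a|distr M S e. f (a, R \<omega>))"
    by (subst integral_distr) auto
  finally show ?thesis .
qed

lemma (in prob_space) integral_indicator_le_indep:
  assumes [measurable]: "e \<in> borel_measurable M" "y \<in> borel_measurable M" "s \<in> borel_measurable M"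
    and eq: "distr M borel e \<Otimes>\<^sub>M distr M (borel \<Otimes>\<^sub>M borel) (\<lambda>\<omega>. (y \<omega>, s \<omega>))
      = distr M (borel \<Otimes>\<^sub>M (borel \<Otimes>\<^sub>M borel)) (\<lambda>\<omega>. (e \<omega>, y \<omega>, s \<omega>))" and s: "\<And>\<omega>. \<bar>s \<omega>\<bar> \<le> (C::real)"
  shows "(LINT \<omega>|M. indicator {..y \<omega>} (e \<omega>) * s \<omega>) = (LINT \<omega>|M. cdf (distr M borel e) (y \<omega>) * s \<omega>)"
proof -
  interpret E: real_distribution "distr M borel e" by (rule real_distribution_distr) measurable
  \<comment> \<open>Clipping makes \<open>f\<close> bounded on the whole product space; on the
    values of \<open>s\<close> it changes nothing.\<close>
  define f where "f = (\<lambda>(a::real, y::real, s). indicator {..y} a * max (- C) (min C s))"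
  have f[measurable]: "f \<in> borel_measurable (borel \<Otimes>\<^sub>M (borel \<Otimes>\<^sub>M borel))"
  proof -
    have "f = (\<lambda>x. (if fst x \<le> fst (snd x) then 1 else 0) * max (- C) (min C (snd (snd x))))"
      by (auto simp: f_def indicator_def fun_eq_iff)
    then show ?thesis by simp
  qed
  have C0: "C \<ge> 0" using s[of undefined] by linarith
  have clip: "max (- C) (min C (s \<omega>)) = s \<omega>" for \<omega> using s[of \<omega>] by linarith
  have "(LINT \<omega>|M. f (e \<omega>, y \<omega>, s \<omega>)) = (LINT \<omega>|M. LINT a|distr M borel e. f (a, y \<omega>, s \<omega>))"
    by (rule integral_indep_conditional[OF _ _ eq f, where C = C]) (use C0 in \<open>auto simp: f_def indicator_def\<close>)
  then show ?thesis
    by (simp add: f_def clip cdf_def)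
qed

lemma (in prob_space) integral_abs_le_sqrt:
  fixes X :: "'a \<Rightarrow> real"
  assumes [measurable]: "X \<in> borel_measurable M" and int: "integrable M (\<lambda>\<omega>. (X \<omega>)\<^sup>2)" and le: "(LINT \<omega>|M. (X \<omega>)\<^sup>2) \<le> c"
  shows "(LINT \<omega>|M. \<bar>X \<omega>\<bar>) \<le> sqrt c" "integrable M X"
proof -
  show i: "integrable M X"
  proof (rule Bochner_Integration.integrable_bound[where f = "\<lambda>\<omega>. 1 + (X \<omega>)\<^sup>2"])
    show "AE \<omega> in M. norm (X \<omega>) \<le> norm (1 + (X \<omega>)\<^sup>2)"
    proof (intro AE_I2)
      fix \<omega>
      have "0 \<le> (\<bar>X \<omega>\<bar> - 1)\<^sup>2" by simp
      then have "2 * \<bar>X \<omega>\<bar> \<le> 1 + (X \<omega>)\<^sup>2" unfolding power2_diff by simp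
      then show "norm (X \<omega>) \<le> norm (1 + (X \<omega>)\<^sup>2)" by simp
    qed
  qed (use int in auto)
  have "(LINT \<omega>|M. \<bar>X \<omega>\<bar>)\<^sup>2 \<le> (LINT \<omega>|M. \<bar>X \<omega>\<bar>\<^sup>2)"
    using variance_positive[of "\<lambda>\<omega>. \<bar>X \<omega>\<bar>"] variance_eq[of "\<lambda>\<omega>. \<bar>X \<omega>\<bar>"] i int by simp
  also have "\<dots> \<le> c" using le by simp
  finally show "(LINT \<omega>|M. \<bar>X \<omega>\<bar>) \<le> sqrt c" by (rule real_le_rsqrt)
qed

lemma (in prob_space) integral_abs_sum_uncorrelated:
  fixes X :: "'i \<Rightarrow> 'a \<Rightarrow> real" and c C :: real
  assumes T: "finite T" and [measurable]: "\<And>t. t \<in> T \<Longrightarrow> X t \<in> borel_measurable M"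
    and b: "\<And>t \<omega>. t \<in> T \<Longrightarrow> \<bar>X t \<omega>\<bar> \<le> C"
    and unc: "\<And>s t. s \<in> T \<Longrightarrow> t \<in> T \<Longrightarrow> s \<noteq> t \<Longrightarrow> (LINT \<omega>|M. X s \<omega> * X t \<omega>) = 0"
    and sq: "\<And>t. t \<in> T \<Longrightarrow> (LINT \<omega>|M. (X t \<omega>)\<^sup>2) \<le> (c::real)"
  shows "(LINT \<omega>|M. \<bar>\<Sum>t\<in>T. X t \<omega>\<bar>) \<le> sqrt (card T * c)"
proof -
  have int: "integrable M (\<lambda>\<omega>. X s \<omega> * X t \<omega>)" if "s \<in> T" "t \<in> T" for s t
  proof (rule integrable_const_bound[where B = "C * C"])
    show "AE \<omega> in M. norm (X s \<omega> * X t \<omega>) \<le> C * C"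
    proof (intro AE_I2)
      fix \<omega>
      have "0 \<le> C" using b[OF that(1), of \<omega>] by linarith
      then show "norm (X s \<omega> * X t \<omega>) \<le> C * C"
        unfolding real_norm_def abs_mult using b that by (intro mult_mono) auto
    qed
  qed (use that in auto)
  have sqe: "(\<Sum>t\<in>T. X t \<omega>)\<^sup>2 = (\<Sum>s\<in>T. \<Sum>t\<in>T. X s \<omega> * X t \<omega>)" for \<omega>
    by (simp add: power2_eq_square sum_product)
  have "(LINT \<omega>|M. (\<Sum>t\<in>T. X t \<omega>)\<^sup>2) = (\<Sum>s\<in>T. \<Sum>t\<in>T. LINT \<omega>|M. X s \<omega> * X t \<omega>)"
    unfolding sqe using int by (simp add: Bochner_Integration.integral_sum Bochner_Integration.integrable_sum)
  also have "\<dots> = (\<Sum>s\<in>T. \<Sum>t\<in>T. if t = s then LINT \<omega>|M. (X s \<omega>)\<^sup>2 else 0)"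
    using unc by (intro sum.cong refl) (auto simp: power2_eq_square)
  also have "\<dots> = (\<Sum>s\<in>T. LINT \<omega>|M. (X s \<omega>)\<^sup>2)"
    using T by simp
  also have "\<dots> \<le> (\<Sum>s\<in>T. c)" using sq by (rule sum_mono)
  finally have "(LINT \<omega>|M. (\<Sum>t\<in>T. X t \<omega>)\<^sup>2) \<le> card T * c" by simp
  moreover have "integrable M (\<lambda>\<omega>. (\<Sum>t\<in>T. X t \<omega>)\<^sup>2)"
    unfolding sqe using int by auto
  ultimately show ?thesis
    by (intro integral_abs_le_sqrt(1)) auto
qed

section \<open>Linearization of the residual counts\<close>

text \<open>One model at a fixed sample size, with all quantitative information in \<open>B\<close>,
  \<open>L\<close>, \<open>V\<close> and \<open>g\<close>, so that the bounds are uniform along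
  sequences of models. In an index \<open>(k, t)\<close> the values \<open>k = 0, 1, 2\<close> stand
  for innovations, contamination indicators and outlier sizes. Here \<open>z\<close> takes its
  values 0 and 1 everywhere, and \<open>u\<close>, which stands for the centred autoregression, is
  determined by the innovations up to time \<open>t\<close>.\<close>

locale contaminated_ar = prob_space M for M :: "'a measure" +
  fixes p :: nat and \<beta> :: "nat \<Rightarrow> real" and e z \<xi> u :: "int \<Rightarrow> 'a \<Rightarrow> real"
    and A a :: "real \<Rightarrow> real" and B L V g :: real and Q :: "real measure"
  assumes ind: "indep_vars (\<lambda>_. borel) (\<lambda>(k, t). ([e, z, \<xi>] ! k) t) ({..<3} \<times> UNIV)"
    and cdf_e: "\<And>t. cdf (distr M borel (e t)) = A"
    and A_deriv: "\<And>x. (A has_real_derivative a x) (at x)"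
    and a_bound: "\<And>x. \<bar>a x\<bar> \<le> B" and a_lipschitz: "\<And>x y. \<bar>a x - a y\<bar> \<le> L * \<bar>x - y\<bar>"
    and z01: "\<And>t \<omega>. z t \<omega> \<in> {0, 1}" and z_mean: "\<And>t. (LINT \<omega>|M. z t \<omega>) = g"
    and law_\<xi>: "\<And>t. distr M borel (\<xi> t) = Q"
    and u_causal: "\<And>t. u t \<in> borel_measurable (generated M (\<lambda>(k, t). ([e, z, \<xi>] ! k) t) ({0} \<times> {..t}))"
    and u_square: "\<And>t. integrable M (\<lambda>\<omega>. (u t \<omega>)\<^sup>2)" and u_var: "\<And>t. (LINT \<omega>|M. (u t \<omega>)\<^sup>2) \<le> V"
begin

abbreviation "X \<equiv> \<lambda>(k, t). ([e, z, \<xi>] ! k) t"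
abbreviation "gen K \<equiv> generated M X K"

lemma gen_e: "(0, t) \<in> K \<Longrightarrow> e t \<in> borel_measurable (gen K)"
  and gen_z: "(1, t) \<in> K \<Longrightarrow> z t \<in> borel_measurable (gen K)"
  and gen_\<xi>: "(2, t) \<in> K \<Longrightarrow> \<xi> t \<in> borel_measurable (gen K)"
  using measurable_generated_component[of "(0, t)" K X M] measurable_generated_component[of "(1, t)" K X M]
    measurable_generated_component[of "(2, t)" K X M] by simp_all

lemma gen_u: "{0} \<times> {..t} \<subseteq> K \<Longrightarrow> u t \<in> borel_measurable (gen K)"
  using measurable_generated_mono[OF u_causal] .

lemma gen_M: "f \<in> measurable (gen K) N \<Longrightarrow> K \<subseteq> {..<3} \<times> UNIV \<Longrightarrow> f \<in> measurable M N"
  using ind by (intro measurable_generatedI[of f M X K N M]) (auto simp: indep_vars_def)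

lemma meas_e [measurable]: "e t \<in> borel_measurable M"
  and meas_z [measurable]: "z t \<in> borel_measurable M"
  and meas_\<xi> [measurable]: "\<xi> t \<in> borel_measurable M"
  and meas_u [measurable]: "u t \<in> borel_measurable M"
  by (rule gen_M[OF gen_e[of t "{(0, t)}"]] gen_M[OF gen_z[of t "{(1, t)}"]] gen_M[OF gen_\<xi>[of t "{(2, t)}"]]
      gen_M[OF u_causal], auto)+

lemma indep_gen:
  assumes "K \<subseteq> {..<3} \<times> UNIV" "K' \<subseteq> {..<3} \<times> UNIV" "K \<inter> K' = {}"
    "f \<in> measurable (gen K) N" "h \<in> measurable (gen K') N'"
  shows "distr M N f \<Otimes>\<^sub>M distr M N' h = distr M (N \<Otimes>\<^sub>M N') (\<lambda>\<omega>. (f \<omega>, h \<omega>))"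
  using joint_law_generated[OF ind assms] .

lemma integral_mult_gen:
  fixes f h :: "'a \<Rightarrow> real"
  assumes K: "K \<subseteq> {..<3} \<times> UNIV" "K' \<subseteq> {..<3} \<times> UNIV" "K \<inter> K' = {}"
    and f: "f \<in> borel_measurable (gen K)" "integrable M f" and h: "h \<in> borel_measurable (gen K')" "integrable M h"
  shows "(LINT \<omega>|M. f \<omega> * h \<omega>) = (LINT \<omega>|M. f \<omega>) * (LINT \<omega>|M. h \<omega>)" "integrable M (\<lambda>\<omega>. f \<omega> * h \<omega>)"
proof -
  have "indep_var borel f borel h"
    unfolding indep_var_distribution_eq using indep_gen[OF K f(1) h(1)] gen_M f(1) h(1) K by blast
  then show "(LINT \<omega>|M. f \<omega> * h \<omega>) = (LINT \<omega>|M. f \<omega>) * (LINT \<omega>|M. h \<omega>)" "integrable M (\<lambda>\<omega>. f \<omega> * h \<omega>)"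
    using f(2) h(2) by (rule indep_var_lebesgue_integral indep_var_integrable)+
qed

lemma A_range: "0 \<le> A x" "A x \<le> 1" and A_meas [measurable]: "A \<in> borel_measurable borel"
proof -
  interpret E: real_distribution "distr M borel (e 0)" by (rule real_distribution_distr) measurable
  show "0 \<le> A x" "A x \<le> 1" using E.cdf_nonneg[of x] E.cdf_bounded_prob[of x] by (simp_all add: cdf_e)
  show "A \<in> borel_measurable borel"
    using A_deriv by (intro borel_measurable_continuous_onI DERIV_continuous_on) (auto intro: has_field_derivative_at_within)
qed

lemma z_nonneg: "0 \<le> z t \<omega>" and z_le_1: "z t \<omega> \<le> 1" and z_square: "z t \<omega> * z t \<omega> = z t \<omega>"
  using z01[of t \<omega>] by auto

lemma int_z: "integrable M (z t)"
  by (rule integrable_const_bound[where B = 1]) (use z_nonneg z_le_1 in auto)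

lemma g_range: "0 \<le> g" "g \<le> 1"
proof -
  show "0 \<le> g" unfolding z_mean[of 0, symmetric] using z_nonneg by (intro Bochner_Integration.integral_nonneg) auto
  have "(LINT \<omega>|M. z 0 \<omega>) \<le> (LINT \<omega>|M. 1)" using z_le_1 int_z by (intro integral_mono) auto
  then show "g \<le> 1" by (simp add: z_mean prob_space)
qed

lemma B_nonneg: "0 \<le> B" and L_nonneg: "0 \<le> L" and V_nonneg: "0 \<le> V"
  using a_bound[of 0] a_lipschitz[of 0 1] order_trans[OF Bochner_Integration.integral_nonneg u_var[of 0]]
  by auto

lemma A_mvt: obtains \<theta> where "A (x + h) - A x = a \<theta> * h" "\<bar>\<theta> - x\<bar> \<le> \<bar>h\<bar>"
proof (cases h "0 :: real" rule: linorder_cases)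
  case greater
  then obtain \<theta> where "x < \<theta>" "\<theta> < x + h" "A (x + h) - A x = (x + h - x) * a \<theta>"
    using MVT2[of x "x + h" A a] A_deriv by auto
  then show ?thesis using that[of \<theta>] by (simp add: mult.commute)
next
  case less
  then obtain \<theta> where "x + h < \<theta>" "\<theta> < x" "A x - A (x + h) = (x - (x + h)) * a \<theta>"
    using MVT2[of "x + h" x A a] A_deriv by auto
  then show ?thesis using that[of \<theta>] by (simp add: algebra_simps)
qed (use that[of x] in simp)

lemma A_lipschitz: "\<bar>A (x + h) - A x\<bar> \<le> B * \<bar>h\<bar>"
proof -
  obtain \<theta> where "A (x + h) - A x = a \<theta> * h" using A_mvt .
  then show ?thesis using a_bound[of \<theta>] by (simp add: abs_mult mult_right_mono)
qed

lemma A_diff_le_1: "\<bar>A x - A y\<bar> \<le> 1"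
  using A_range[of x] A_range[of y] by linarith

lemma A_taylor: "\<bar>A (x + h) - A x - a x * h\<bar> \<le> L * h\<^sup>2"
proof -
  obtain \<theta> where \<theta>: "A (x + h) - A x = a \<theta> * h" "\<bar>\<theta> - x\<bar> \<le> \<bar>h\<bar>" using A_mvt .
  have "\<bar>A (x + h) - A x - a x * h\<bar> = \<bar>a \<theta> - a x\<bar> * \<bar>h\<bar>"
    unfolding \<theta>(1) by (simp add: abs_mult[symmetric] algebra_simps)
  also have "\<dots> \<le> (L * \<bar>h\<bar>) * \<bar>h\<bar>"
    using order_trans[OF a_lipschitz mult_left_mono[OF \<theta>(2) L_nonneg]] by (intro mult_right_mono) auto
  finally show ?thesis by (simp add: power2_eq_square mult.assoc)
qed

end

section \<open>Linear forms in lagged values\<close>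

definition lag_abs :: "nat \<Rightarrow> (int \<Rightarrow> 'a \<Rightarrow> real) \<Rightarrow> int \<Rightarrow> 'a \<Rightarrow> real" where
  "lag_abs p f t \<omega> = 1 + (\<Sum>j=1..p. \<bar>f (t - int j) \<omega>\<bar>)"

text \<open>\<open>c 0\<close> stands for the scaled error in the level, \<open>c j\<close> for that
  in the \<open>j\<close>-th coefficient. The last term is a margin: when the coefficients vary
  within \<open>d\<close> of \<open>c\<close>, the unmargined form stays between the forms with
  \<open>- d\<close> and \<open>d\<close>.\<close>

definition lag_lin :: "nat \<Rightarrow> (nat \<Rightarrow> real) \<Rightarrow> real \<Rightarrow> (int \<Rightarrow> 'a \<Rightarrow> real) \<Rightarrow> int \<Rightarrow> 'a \<Rightarrow> real" where
  "lag_lin p c d f t \<omega> = c 0 + (\<Sum>j=1..p. c j * f (t - int j) \<omega>) + d * lag_abs p f t \<omega>"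

lemma lag_abs_ge_1: "1 \<le> lag_abs p f t \<omega>"
  by (simp add: lag_abs_def sum_nonneg)

lemma abs_lag_lin_le:
  assumes "\<And>j. j \<le> p \<Longrightarrow> \<bar>c j\<bar> + \<bar>d\<bar> \<le> C"
  shows "\<bar>lag_lin p c d f t \<omega>\<bar> \<le> C * lag_abs p f t \<omega>"
proof -
  have "\<bar>lag_lin p c d f t \<omega>\<bar> \<le> \<bar>c 0\<bar> + \<bar>\<Sum>j=1..p. c j * f (t - int j) \<omega>\<bar> + \<bar>d * lag_abs p f t \<omega>\<bar>"
    unfolding lag_lin_def by linarith
  also have "\<dots> \<le> \<bar>c 0\<bar> + (\<Sum>j=1..p. \<bar>c j\<bar> * \<bar>f (t - int j) \<omega>\<bar>) + \<bar>d\<bar> * lag_abs p f t \<omega>"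
    using lag_abs_ge_1[of p f t \<omega>] sum_abs[of "\<lambda>j. c j * f (t - int j) \<omega>" "{1..p}"]
    by (simp add: abs_mult)
  also have "\<dots> = (\<bar>c 0\<bar> + \<bar>d\<bar>) + (\<Sum>j=1..p. (\<bar>c j\<bar> + \<bar>d\<bar>) * \<bar>f (t - int j) \<omega>\<bar>)"
    by (simp add: lag_abs_def algebra_simps sum.distrib sum_distrib_left)
  also have "\<dots> \<le> C + (\<Sum>j=1..p. C * \<bar>f (t - int j) \<omega>\<bar>)"
    using assms by (intro add_mono sum_mono mult_right_mono) auto
  also have "\<dots> = C * lag_abs p f t \<omega>"
    by (simp add: lag_abs_def algebra_simps sum_distrib_left)
  finally show ?thesis .
qed

lemma lag_abs_square_le: "(lag_abs p f t \<omega>)\<^sup>2 \<le> (real p + 1) * (1 + (\<Sum>j=1..p. (f (t - int j) \<omega>)\<^sup>2))"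
proof -
  define v where "v = (\<lambda>j. if j = 0 then 1 else \<bar>f (t - int j) \<omega>\<bar>)"
  have I: "{0..p} = insert 0 {1..p}" by auto
  have "lag_abs p f t \<omega> = (\<Sum>j=0..p. 1 * v j)"
    unfolding I lag_abs_def v_def by simp
  then have "(lag_abs p f t \<omega>)\<^sup>2 \<le> (\<Sum>j=0..p. 1\<^sup>2) * (\<Sum>j=0..p. (v j)\<^sup>2)"
    using Cauchy_Schwarz_ineq_sum[of "\<lambda>_. 1" v "{0..p}"] by simp
  also have "(\<Sum>j=0..p. (v j)\<^sup>2) = 1 + (\<Sum>j=1..p. (f (t - int j) \<omega>)\<^sup>2)"
    unfolding I v_def by simp
  finally show ?thesis by (simp add: algebra_simps)
qed

context contaminated_ar
begin

text \<open>The information at time \<open>t\<close> consists of the innovations strictly before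
  \<open>t\<close> and of the outliers of all times, future ones included. Outliers are independent
  of innovations, so \<open>e t\<close> remains independent of it, and the outlier shift at time
  \<open>t\<close> is already known.\<close>

definition past :: "int \<Rightarrow> (nat \<times> int) set" where
  "past t = {0} \<times> {..<t} \<union> {1, 2} \<times> UNIV"

definition b :: "nat \<Rightarrow> real" where "b j = (if j = 0 then - 1 else \<beta> j)"

definition w :: "int \<Rightarrow> 'a \<Rightarrow> real" where "w t \<omega> = u t \<omega> + z t \<omega> * \<xi> t \<omega>"

text \<open>The effect of outliers with the sign for which it moves the threshold: the residual is
  at most \<open>x\<close> when the innovation is at most \<open>x\<close> plus estimation error
  plus this shift. Hence the weight \<open>b 0 = - 1\<close> at lag 0.\<close>

definition shift :: "int \<Rightarrow> 'a \<Rightarrow> real" where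
  "shift t \<omega> = (\<Sum>j=0..p. b j * \<xi> (t - int j) \<omega> * z (t - int j) \<omega>)"

definition outliers :: "int \<Rightarrow> 'a \<Rightarrow> nat set" where
  "outliers t \<omega> = {j \<in> {0..p}. z (t - int j) \<omega> = 1}"

definition Zc :: "int \<Rightarrow> 'a \<Rightarrow> real" where "Zc t \<omega> = (\<Sum>j=0..p. z (t - int j) \<omega>)"

lemma sum_z: "(\<Sum>j=0..p. f j * z (t - int j) \<omega>) = (\<Sum>j\<in>outliers t \<omega>. f j)"
proof -
  have "(\<Sum>j=0..p. f j * z (t - int j) \<omega>) = (\<Sum>j=0..p. if z (t - int j) \<omega> = 1 then f j else 0)"
  proof (intro sum.cong refl)
    fix j
    show "f j * z (t - int j) \<omega> = (if z (t - int j) \<omega> = 1 then f j else 0)"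
      using z01[of "t - int j" \<omega>] by auto
  qed
  also have "\<dots> = (\<Sum>j\<in>outliers t \<omega>. f j)"
    unfolding outliers_def by (subst sum.inter_filter) auto
  finally show ?thesis .
qed

lemma finite_outliers [simp]: "finite (outliers t \<omega>)" by (simp add: outliers_def)

lemma Zc_card: "Zc t \<omega> = real (card (outliers t \<omega>))"
  using sum_z[of "\<lambda>_. 1" t \<omega>] by (simp add: Zc_def)

lemma Zc_cases:
  obtains "Zc t \<omega> = 0" "\<And>j. j \<le> p \<Longrightarrow> z (t - int j) \<omega> = 0" | "1 \<le> Zc t \<omega>"
proof (cases "outliers t \<omega> = {}")
  case True
  then have "z (t - int j) \<omega> = 0" if "j \<le> p" for j
    using that z01[of "t - int j" \<omega>] by (auto simp: outliers_def)
  then show ?thesis using that(1) True by (simp add: Zc_card)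
next
  case False
  then have "card (outliers t \<omega>) > 0" by (simp add: card_gt_0_iff)
  then show ?thesis using that(2) by (simp add: Zc_card)
qed

lemma integral_indicator_past:
  assumes y: "y \<in> borel_measurable (gen (past t))" and s: "s \<in> borel_measurable (gen (past t))" "\<And>\<omega>. \<bar>s \<omega>\<bar> \<le> C"
  shows "(LINT \<omega>|M. indicator {..y \<omega>} (e t \<omega>) * s \<omega>) = (LINT \<omega>|M. A (y \<omega>) * s \<omega>)"
proof -
  have past: "past t \<subseteq> {..<3} \<times> UNIV" by (auto simp: past_def)
  have eq: "distr M borel (e t) \<Otimes>\<^sub>M distr M (borel \<Otimes>\<^sub>M borel) (\<lambda>\<omega>. (y \<omega>, s \<omega>))
      = distr M (borel \<Otimes>\<^sub>M (borel \<Otimes>\<^sub>M borel)) (\<lambda>\<omega>. (e t \<omega>, y \<omega>, s \<omega>))"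
    by (rule indep_gen[OF _ past, where K = "{(0, t)}"]) (use y s in \<open>auto simp: past_def intro!: gen_e\<close>)
  show ?thesis
    using integral_indicator_le_indep[OF meas_e gen_M[OF y past] gen_M[OF s(1) past] eq s(2)] by (simp add: cdf_e)
qed

text \<open>The summands are martingale differences with respect to \<open>past\<close>, hence
  orthogonal. The square of an indicator difference is the indicator that \<open>e t\<close> lies
  between the two thresholds, so its mean is that of
  \<open>\<bar>A (x + y t \<omega>) - A x\<bar>\<close>. With small perturbations the sum is thus of
  smaller order than \<open>sqrt (card T)\<close>.\<close>

lemma integral_abs_martingale_count:
  fixes c :: real
  assumes T: "finite T" and y: "\<And>t. t \<in> T \<Longrightarrow> y t \<in> borel_measurable (gen (past t))"
    and c: "\<And>t. t \<in> T \<Longrightarrow> (LINT \<omega>|M. \<bar>A (x + y t \<omega>) - A x\<bar>) \<le> c"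
  shows "(LINT \<omega>|M. \<bar>\<Sum>t\<in>T. indicator {..x + y t \<omega>} (e t \<omega>) - indicator {..x} (e t \<omega>) - (A (x + y t \<omega>) - A x)\<bar>) \<le> sqrt (card T * c)"
proof -
  define I where "I = (\<lambda>t \<omega>. indicator {..x + y t \<omega>} (e t \<omega>) - indicator {..x} (e t \<omega>) :: real)"
  define m where "m = (\<lambda>t \<omega>. A (x + y t \<omega>) - A x)"
  define D where "D = (\<lambda>t \<omega>. I t \<omega> - m t \<omega>)"
  have past: "past t \<subseteq> {..<3} \<times> UNIV" for t by (auto simp: past_def)
  have yM[measurable]: "y t \<in> borel_measurable M" if "t \<in> T" for t using gen_M[OF y[OF that] past] .
  have I_eq: "I t \<omega> = (if e t \<omega> \<le> x + y t \<omega> then 1 else 0) - (if e t \<omega> \<le> x then 1 else 0)" for t \<omega>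
    by (simp add: I_def indicator_def)
  have IM[measurable]: "I t \<in> borel_measurable M" if "t \<in> T" for t
    unfolding I_eq[abs_def] using yM[OF that] by measurable
  have mM[measurable]: "m t \<in> borel_measurable M" if "t \<in> T" for t
    unfolding m_def using yM[OF that] by measurable
  have DM[measurable]: "D t \<in> borel_measurable M" if "t \<in> T" for t
    unfolding D_def using IM[OF that] mM[OF that] by measurable
  have bI: "\<bar>I t \<omega>\<bar> \<le> 1" and bm: "\<bar>m t \<omega>\<bar> \<le> 1" for t \<omega>
    using A_diff_le_1 by (auto simp: I_eq m_def)
  have bD: "\<bar>D t \<omega>\<bar> \<le> 2" for t \<omega> using bI[of t \<omega>] bm[of t \<omega>] by (simp add: D_def)
  \<comment> \<open>Given the past, the indicator difference has conditional mean
    \<open>m t\<close>; the bounded past-measurable \<open>s\<close> serves as test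
    function.\<close>
  have key: "(LINT \<omega>|M. I t \<omega> * s \<omega>) = (LINT \<omega>|M. m t \<omega> * s \<omega>)"
    if t: "t \<in> T" and s: "s \<in> borel_measurable (gen (past t))" "\<And>\<omega>. \<bar>s \<omega>\<bar> \<le> C" for t s C
  proof -
    have sM[measurable]: "s \<in> borel_measurable M" using gen_M[OF s(1) past] .
    note [measurable] = yM[OF t] y[OF t]
    have C0: "0 \<le> C" using s(2)[of undefined] by linarith
    have int: "integrable M (\<lambda>\<omega>. F \<omega> * s \<omega>)" if "F \<in> borel_measurable M" "\<And>\<omega>. \<bar>F \<omega>\<bar> \<le> 1" for F :: "'a \<Rightarrow> real"
    proof (rule integrable_const_bound[where B = C])
      show "AE \<omega> in M. norm (F \<omega> * s \<omega>) \<le> C"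
        using mult_mono[OF that(2) s(2)] by (simp add: abs_mult)
    qed (use that in measurable)
    have ind1: "(\<lambda>\<omega>. indicator {..x + y t \<omega>} (e t \<omega>) :: real) \<in> borel_measurable M"
      "(\<lambda>\<omega>. indicator {..x} (e t \<omega>) :: real) \<in> borel_measurable M"
      unfolding indicator_def atMost_iff by measurable
    have "(LINT \<omega>|M. I t \<omega> * s \<omega>) = (LINT \<omega>|M. indicator {..x + y t \<omega>} (e t \<omega>) * s \<omega>) - (LINT \<omega>|M. indicator {..x} (e t \<omega>) * s \<omega>)"
      unfolding I_def left_diff_distrib
      by (intro Bochner_Integration.integral_diff int ind1) (auto simp: indicator_def)
    also have "\<dots> = (LINT \<omega>|M. A (x + y t \<omega>) * s \<omega>) - (LINT \<omega>|M. A x * s \<omega>)"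
      by (subst (1 2) integral_indicator_past[OF _ s]) measurable
    also have "\<dots> = (LINT \<omega>|M. m t \<omega> * s \<omega>)"
      unfolding m_def left_diff_distrib using A_range
      by (intro Bochner_Integration.integral_diff[symmetric] int) (auto simp: abs_le_iff intro: order_trans[of _ 0])
    finally show ?thesis .
  qed
  have prod_int: "integrable M (\<lambda>\<omega>. F \<omega> * G \<omega>)" if "F \<in> borel_measurable M" "G \<in> borel_measurable M"
    "\<And>\<omega>. \<bar>F \<omega>\<bar> \<le> 2" "\<And>\<omega>. \<bar>G \<omega>\<bar> \<le> 2" for F G :: "'a \<Rightarrow> real"
  proof (rule integrable_const_bound[where B = "2 * 2"])
    show "AE \<omega> in M. norm (F \<omega> * G \<omega>) \<le> 2 * 2"
      unfolding real_norm_def abs_mult using that(3,4) by (intro AE_I2 mult_mono) auto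
  qed (use that in measurable)
  have bI2: "\<bar>I t \<omega>\<bar> \<le> 2" and bm2: "\<bar>m t \<omega>\<bar> \<le> 2" for t \<omega>
    using bI[of t \<omega>] bm[of t \<omega>] by linarith+
  have unc: "(LINT \<omega>|M. D s \<omega> * D t \<omega>) = 0" if st: "s \<in> T" "t \<in> T" "s < t" for s t
  proof -
    have "y s \<in> borel_measurable (gen (past t))"
      using st by (intro measurable_generated_mono[OF y[OF st(1)]]) (auto simp: past_def)
    moreover have "e s \<in> borel_measurable (gen (past t))" using st by (intro gen_e) (simp add: past_def)
    ultimately have Ds: "D s \<in> borel_measurable (gen (past t))"
      unfolding D_def I_eq[abs_def] m_def by measurable
    have "(LINT \<omega>|M. D s \<omega> * D t \<omega>) = (LINT \<omega>|M. I t \<omega> * D s \<omega> - m t \<omega> * D s \<omega>)"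
      by (simp add: D_def algebra_simps)
    also have "\<dots> = (LINT \<omega>|M. I t \<omega> * D s \<omega>) - (LINT \<omega>|M. m t \<omega> * D s \<omega>)"
      using st IM mM DM bI bm bD
      by (intro Bochner_Integration.integral_diff prod_int) (auto intro: order_trans[of _ 1])
    also have "\<dots> = 0" using key[OF st(2) Ds bD] by simp
    finally show ?thesis .
  qed
  have "(LINT \<omega>|M. \<bar>\<Sum>t\<in>T. D t \<omega>\<bar>) \<le> sqrt (card T * c)"
  proof (rule integral_abs_sum_uncorrelated[OF T DM bD])
    fix s t assume "s \<in> T" "t \<in> T" "s \<noteq> t"
    then show "(LINT \<omega>|M. D s \<omega> * D t \<omega>) = 0"
      using unc[of s t] unc[of t s] by (cases "s < t") (auto simp: mult.commute)
  next
    fix t assume t: "t \<in> T"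
    note [measurable] = y[OF t] IM[OF t] mM[OF t] yM[OF t]
    have mp: "m t \<in> borel_measurable (gen (past t))" unfolding m_def by measurable
    \<comment> \<open>The sign of \<open>y t\<close> is known from the past and satisfies \<open>I t
      \<omega> * I t \<omega> = I t \<omega> * sgn (y t \<omega>)\<close>. This makes the square
      linear in \<open>I t\<close>, so that \<open>key\<close> applies.\<close>
    have sp: "(\<lambda>\<omega>. sgn (y t \<omega>)) \<in> borel_measurable (gen (past t))" by measurable
    have sg: "\<bar>sgn (y t \<omega>)\<bar> \<le> 1" for \<omega> by (simp add: abs_sgn_eq)
    have Amono: "A x1 \<le> A x2" if "x1 \<le> x2" for x1 x2
    proof -
      interpret E: real_distribution "distr M borel (e t)" by (rule real_distribution_distr) measurable
      show ?thesis using E.cdf_nondecreasing[OF that] by (simp add: cdf_e)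
    qed
    have "(LINT \<omega>|M. (D t \<omega>)\<^sup>2) = (LINT \<omega>|M. I t \<omega> * I t \<omega> - (2 * (I t \<omega> * m t \<omega>) - m t \<omega> * m t \<omega>))"
      by (simp add: D_def power2_eq_square algebra_simps)
    also have "\<dots> = (LINT \<omega>|M. I t \<omega> * I t \<omega>) - (2 * (LINT \<omega>|M. I t \<omega> * m t \<omega>) - (LINT \<omega>|M. m t \<omega> * m t \<omega>))"
      using prod_int[OF IM[OF t] IM[OF t] bI2 bI2] prod_int[OF IM[OF t] mM[OF t] bI2 bm2]
        prod_int[OF mM[OF t] mM[OF t] bm2 bm2] by simp
    also have "\<dots> = (LINT \<omega>|M. I t \<omega> * I t \<omega>) - (LINT \<omega>|M. m t \<omega> * m t \<omega>)"
      using key[OF t mp bm] by simp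
    also have "\<dots> \<le> (LINT \<omega>|M. I t \<omega> * I t \<omega>)"
      using Bochner_Integration.integral_nonneg[of M "\<lambda>\<omega>. m t \<omega> * m t \<omega>"] by simp
    also have "(LINT \<omega>|M. I t \<omega> * I t \<omega>) = (LINT \<omega>|M. I t \<omega> * sgn (y t \<omega>))"
      by (intro Bochner_Integration.integral_cong refl) (auto simp: I_eq sgn_if)
    also have "\<dots> = (LINT \<omega>|M. m t \<omega> * sgn (y t \<omega>))"
      by (rule key[OF t sp sg])
    also have "\<dots> = (LINT \<omega>|M. \<bar>A (x + y t \<omega>) - A x\<bar>)"
    proof (intro Bochner_Integration.integral_cong refl)
      fix \<omega>
      show "m t \<omega> * sgn (y t \<omega>) = \<bar>A (x + y t \<omega>) - A x\<bar>"
        using Amono[of x "x + y t \<omega>"] Amono[of "x + y t \<omega>" x] by (auto simp: m_def sgn_if)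
    qed
    also have "\<dots> \<le> c" by (rule c[OF t])
    finally show "(LINT \<omega>|M. (D t \<omega>)\<^sup>2) \<le> c" .
  qed
  then show ?thesis by (simp add: D_def I_def m_def)
qed

subsection \<open>Moments of the perturbations\<close>

lemma int_u: "integrable M (u t)" and u_abs: "(LINT \<omega>|M. \<bar>u t \<omega>\<bar>) \<le> sqrt V"
  using integral_abs_le_sqrt[OF meas_u u_square u_var] by auto

lemma int_lag_abs: "integrable M (lag_abs p u t)"
  and lag_abs_mean: "(LINT \<omega>|M. lag_abs p u t \<omega>) \<le> 1 + p * sqrt V"
proof -
  show "integrable M (lag_abs p u t)" unfolding lag_abs_def using int_u by auto
  have "(LINT \<omega>|M. lag_abs p u t \<omega>) = 1 + (\<Sum>j=1..p. LINT \<omega>|M. \<bar>u (t - int j) \<omega>\<bar>)"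
    unfolding lag_abs_def using int_u by (simp add: prob_space)
  also have "\<dots> \<le> 1 + (\<Sum>j=1..p. sqrt V)" using u_abs by (intro add_mono sum_mono) auto
  finally show "(LINT \<omega>|M. lag_abs p u t \<omega>) \<le> 1 + p * sqrt V" by simp
qed

lemma int_lag_abs_square: "integrable M (\<lambda>\<omega>. (lag_abs p u t \<omega>)\<^sup>2)"
  and lag_abs_square_mean: "(LINT \<omega>|M. (lag_abs p u t \<omega>)\<^sup>2) \<le> (real p + 1) * (1 + p * V)"
proof -
  have [measurable]: "lag_abs p u t \<in> borel_measurable M" unfolding lag_abs_def by measurable
  have int: "integrable M (\<lambda>\<omega>. (real p + 1) * (1 + (\<Sum>j=1..p. (u (t - int j) \<omega>)\<^sup>2)))"
    using u_square by auto
  show i: "integrable M (\<lambda>\<omega>. (lag_abs p u t \<omega>)\<^sup>2)"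
    by (rule Bochner_Integration.integrable_bound[OF int])
      (auto intro!: AE_I2 order_trans[OF lag_abs_square_le abs_ge_self] simp del: abs_mult One_nat_def)
  have "(LINT \<omega>|M. (lag_abs p u t \<omega>)\<^sup>2) \<le> (LINT \<omega>|M. (real p + 1) * (1 + (\<Sum>j=1..p. (u (t - int j) \<omega>)\<^sup>2)))"
    by (intro integral_mono i int lag_abs_square_le)
  also have "\<dots> = (real p + 1) * (1 + (\<Sum>j=1..p. LINT \<omega>|M. (u (t - int j) \<omega>)\<^sup>2))"
    using u_square by (simp add: prob_space)
  also have "\<dots> \<le> (real p + 1) * (1 + (\<Sum>j=1..p. V))"
    using u_var by (intro mult_left_mono add_mono sum_mono) auto
  finally show "(LINT \<omega>|M. (lag_abs p u t \<omega>)\<^sup>2) \<le> (real p + 1) * (1 + p * V)" by simp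
qed

lemma meas_Zc [measurable]: "Zc t \<in> borel_measurable M"
  and meas_shift [measurable]: "shift t \<in> borel_measurable M"
  and meas_w [measurable]: "w t \<in> borel_measurable M"
  unfolding Zc_def shift_def w_def by measurable

lemma meas_lag [measurable]:
  "(\<And>t. f t \<in> borel_measurable N) \<Longrightarrow> lag_abs p f t \<in> borel_measurable N"
  "(\<And>t. f t \<in> borel_measurable N) \<Longrightarrow> lag_lin p c d f t \<in> borel_measurable N"
  unfolding lag_abs_def[abs_def] lag_lin_def[abs_def]
  by (intro borel_measurable_add borel_measurable_sum borel_measurable_times borel_measurable_const borel_measurable_abs, simp)+

lemma int_Zc: "integrable M (Zc t)" and Zc_mean: "(LINT \<omega>|M. Zc t \<omega>) = (real p + 1) * g"
  unfolding Zc_def using int_z by (auto simp: z_mean)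

lemma Zc_nonneg: "0 \<le> Zc t \<omega>" by (simp add: Zc_card)

lemma Zc_le: "Zc t \<omega> \<le> real p + 1"
proof -
  have "Zc t \<omega> \<le> (\<Sum>j=0..p. 1)" unfolding Zc_def using z_le_1 by (intro sum_mono)
  then show ?thesis by simp
qed

text \<open>The integrand counts ordered pairs of distinct outliers among \<open>p + 1\<close>
  consecutive times. Each pair has probability \<open>g\<^sup>2\<close>; for \<open>g\<close> of
  order \<open>n powr (-1/2)\<close> this is negligible even after summation over \<open>n\<close>
  times and division by \<open>sqrt n\<close>.\<close>

lemma Zc_pair_mean: "(LINT \<omega>|M. (Zc t \<omega>)\<^sup>2 - Zc t \<omega>) \<le> (real p + 1)\<^sup>2 * g\<^sup>2"
proof -
  have zz: "(LINT \<omega>|M. z s \<omega> * z t \<omega>) = g\<^sup>2" if "s \<noteq> t" for s t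
    using that int_z by (subst integral_mult_gen(1)[where K = "{(1, s)}" and K' = "{(1, t)}"])
      (auto intro!: gen_z simp: z_mean power2_eq_square)
  have izz: "integrable M (\<lambda>\<omega>. z s \<omega> * z t \<omega>)" for s t
    by (rule integrable_const_bound[where B = 1]) (use z_nonneg z_le_1 in \<open>auto intro!: mult_le_one\<close>)
  have "(LINT \<omega>|M. (Zc t \<omega>)\<^sup>2) = (\<Sum>i=0..p. \<Sum>j=0..p. LINT \<omega>|M. z (t - int i) \<omega> * z (t - int j) \<omega>)"
    unfolding Zc_def power2_eq_square sum_product using izz by simp
  also have "\<dots> \<le> (\<Sum>i=0..p. \<Sum>j=0..p. (if j = i then g else 0) + g\<^sup>2)"
    using zz g_range by (intro sum_mono) (auto simp: z_square z_mean)
  also have "\<dots> = (real p + 1) * g + (real p + 1)\<^sup>2 * g\<^sup>2"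
    by (simp add: sum.distrib power2_eq_square algebra_simps)
  finally have "(LINT \<omega>|M. (Zc t \<omega>)\<^sup>2) \<le> (real p + 1) * g + (real p + 1)\<^sup>2 * g\<^sup>2" .
  moreover have "integrable M (\<lambda>\<omega>. (Zc t \<omega>)\<^sup>2)"
    unfolding Zc_def power2_eq_square sum_product using izz by auto
  ultimately show ?thesis using int_Zc Zc_mean by simp
qed

end

text \<open>The terms bound, in this order: the martingale part, the Taylor remainder together with the
  perturbation at contaminated times, the contribution of two or more outliers among \<open>p + 1\<close>
  consecutive times, and the fluctuation of the single-outlier terms.\<close>

definition linearization_bound :: "nat \<Rightarrow> real \<Rightarrow> real \<Rightarrow> real \<Rightarrow> real \<Rightarrow> real \<Rightarrow> nat \<Rightarrow> real \<Rightarrow> real" where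
  "linearization_bound p B L V g C n \<phi> =
     sqrt ((real p + 1) * g + B * (C * (1 + p * sqrt V)) / sqrt n) +
     sqrt n * (L * (C\<^sup>2 * ((real p + 1) * (1 + p * V))) / n +
       (real p + 1) * g * (2 * B * (C * (1 + p * sqrt V)) / sqrt n + p * \<phi>)) +
     sqrt n * (2 * ((real p + 1)\<^sup>2 * g\<^sup>2)) +
     (real p + 1) * sqrt g"

text \<open>Separates an integrable part \<open>X\<close>, which loses its truncation, from parts
  \<open>Y i\<close> possibly without moments, which stay truncated one by one.\<close>

lemma min_one_add_sum_le:
  fixes X :: real
  assumes "finite I" "X \<ge> 0" "\<And>i. i \<in> I \<Longrightarrow> Y i \<ge> 0"
  shows "min 1 (X + (\<Sum>i\<in>I. Y i)) \<le> X + (\<Sum>i\<in>I. min 1 (Y i))"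
proof (cases "\<exists>i\<in>I. Y i \<ge> 1")
  case True
  then obtain i where i: "i \<in> I" "Y i \<ge> 1" by blast
  have "min 1 (Y i) \<le> (\<Sum>i\<in>I. min 1 (Y i))"
    using assms i by (intro member_le_sum) auto
  then show ?thesis using i assms(2) by simp
next
  case False
  then have "(\<Sum>i\<in>I. min 1 (Y i)) = (\<Sum>i\<in>I. Y i)" by (intro sum.cong) auto
  then show ?thesis by simp
qed

section \<open>Expansion of the residual counts for fixed coefficients\<close>

context contaminated_ar
begin

lemma no_outliers:
  assumes "\<And>j. j \<le> p \<Longrightarrow> z (t - int j) \<omega> = 0"
  shows "lag_lin p c d w t \<omega> = lag_lin p c d u t \<omega>" "shift t \<omega> = 0"
  using assms by (simp_all add: lag_lin_def lag_abs_def w_def shift_def)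

text \<open>Distinguishing times with and without nearby outliers keeps the sizes
  \<open>\<xi>\<close> out of the bound: without outliers \<open>w\<close> may be replaced by
  \<open>u\<close> and the Lipschitz estimate applies, otherwise the trivial bound 1 is at most
  \<open>Zc t \<omega>\<close>.\<close>

lemma A_increment_bound:
  "\<bar>A (x + (s * lag_lin p c d w t \<omega> + shift t \<omega>)) - A x\<bar> \<le> Zc t \<omega> + B * \<bar>s * lag_lin p c d u t \<omega>\<bar>"
proof (cases t \<omega> rule: Zc_cases)
  case 1
  then show ?thesis using A_lipschitz[of x "s * lag_lin p c d u t \<omega>"] by (simp add: no_outliers)
next
  case 2
  have "0 \<le> B * \<bar>s * lag_lin p c d u t \<omega>\<bar>" using B_nonneg by simp
  then show ?thesis using 2 A_diff_le_1[of "x + (s * lag_lin p c d w t \<omega> + shift t \<omega>)" x] by linarith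
qed

text \<open>Without outliers this is the second-order Taylor bound. With outliers a first-order
  bound is enough, because the factor \<open>Zc t \<omega>\<close>, at least 1 there, brings in
  \<open>g\<close> on average. The 2 arises from bounding the increment of \<open>A\<close> and the
  linear term separately.\<close>

lemma A_taylor_bound:
  assumes s: "s \<ge> 0" and C: "\<And>j. j \<le> p \<Longrightarrow> \<bar>c j\<bar> + \<bar>d\<bar> \<le> C"
  shows "\<bar>A (x + (s * lag_lin p c d w t \<omega> + shift t \<omega>)) - A (x + shift t \<omega>) - a x * (s * lag_lin p c d u t \<omega>)\<bar>
    \<le> L * (s\<^sup>2 * (C\<^sup>2 * (lag_abs p u t \<omega>)\<^sup>2)) +
      Zc t \<omega> * (2 * (B * (s * C)) * lag_abs p u t \<omega> + (\<Sum>j=1..p. min 1 \<bar>B * (s * C) * \<xi> (t - int j) \<omega>\<bar>))"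
proof -
  define hu where "hu = s * lag_lin p c d u t \<omega>"
  define hw where "hw = s * lag_lin p c d w t \<omega>"
  define Y where "Y = (\<Sum>j=1..p. min 1 \<bar>B * (s * C) * \<xi> (t - int j) \<omega>\<bar>)"
  have C0: "C \<ge> 0" using C[of 0] by linarith
  have l0: "0 \<le> lag_abs p u t \<omega>" using lag_abs_ge_1[of p u t \<omega>] by linarith
  have Y0: "0 \<le> Y" unfolding Y_def by (intro sum_nonneg) auto
  have hu: "\<bar>hu\<bar> \<le> s * C * lag_abs p u t \<omega>"
    using mult_left_mono[OF abs_lag_lin_le[OF C, where f = u and t = t and \<omega> = \<omega>] s] s by (simp add: hu_def abs_mult mult.assoc)
  have hu2: "L * hu\<^sup>2 \<le> L * (s\<^sup>2 * (C\<^sup>2 * (lag_abs p u t \<omega>)\<^sup>2))"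
    using power_mono[OF hu, of 2] L_nonneg by (intro mult_left_mono) (auto simp: power_mult_distrib mult.assoc)
  show ?thesis
  proof (cases t \<omega> rule: Zc_cases)
    case 1
    then have "\<bar>A (x + (hw + shift t \<omega>)) - A (x + shift t \<omega>) - a x * hu\<bar> \<le> L * hu\<^sup>2"
      using A_taylor[of x hu] by (simp add: hw_def hu_def no_outliers)
    also note hu2
    finally show ?thesis using 1 by (simp add: hw_def hu_def)
  next
    case 2
    have Bhu: "\<bar>a x * hu\<bar> \<le> B * (s * C) * lag_abs p u t \<omega>"
      using mult_mono[OF a_bound[of x] hu] B_nonneg by (simp add: abs_mult mult.assoc)
    have lw: "lag_abs p w t \<omega> \<le> lag_abs p u t \<omega> + (\<Sum>j=1..p. \<bar>\<xi> (t - int j) \<omega>\<bar>)"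
      unfolding lag_abs_def add.assoc sum.distrib[symmetric]
    proof (intro add_left_mono sum_mono)
      fix j
      show "\<bar>w (t - int j) \<omega>\<bar> \<le> \<bar>u (t - int j) \<omega>\<bar> + \<bar>\<xi> (t - int j) \<omega>\<bar>"
        using z01[of "t - int j" \<omega>] by (auto simp: w_def)
    qed
    have "\<bar>hw\<bar> \<le> s * (C * lag_abs p w t \<omega>)"
      using mult_left_mono[OF abs_lag_lin_le[OF C, where f = w and t = t and \<omega> = \<omega>] s] s by (simp add: hw_def abs_mult)
    also have "\<dots> \<le> s * (C * (lag_abs p u t \<omega> + (\<Sum>j=1..p. \<bar>\<xi> (t - int j) \<omega>\<bar>)))"
      using s C0 lw by (intro mult_left_mono)
    finally have "B * \<bar>hw\<bar> \<le> B * (s * (C * (lag_abs p u t \<omega> + (\<Sum>j=1..p. \<bar>\<xi> (t - int j) \<omega>\<bar>))))"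
      using B_nonneg by (intro mult_left_mono)
    also have "\<dots> = B * (s * C) * lag_abs p u t \<omega> + (\<Sum>j=1..p. \<bar>B * (s * C) * \<xi> (t - int j) \<omega>\<bar>)"
      using B_nonneg s C0 by (simp add: abs_mult sum_distrib_left algebra_simps)
    finally have Bhw: "B * \<bar>hw\<bar> \<le> B * (s * C) * lag_abs p u t \<omega> + (\<Sum>j=1..p. \<bar>B * (s * C) * \<xi> (t - int j) \<omega>\<bar>)" .
    have "\<bar>A (x + (hw + shift t \<omega>)) - A (x + shift t \<omega>)\<bar> \<le> min 1 (B * \<bar>hw\<bar>)"
      using A_diff_le_1 A_lipschitz[of "x + shift t \<omega>" hw] by (simp add: algebra_simps)
    also have "\<dots> \<le> min 1 (B * (s * C) * lag_abs p u t \<omega> + (\<Sum>j=1..p. \<bar>B * (s * C) * \<xi> (t - int j) \<omega>\<bar>))"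
      using Bhw by (intro min.mono) auto
    also have "\<dots> \<le> B * (s * C) * lag_abs p u t \<omega> + Y"
      unfolding Y_def using B_nonneg s C0 l0 by (intro min_one_add_sum_le) auto
    finally have "\<bar>A (x + (hw + shift t \<omega>)) - A (x + shift t \<omega>) - a x * hu\<bar> \<le> 2 * (B * (s * C)) * lag_abs p u t \<omega> + Y"
      using Bhu by (simp add: abs_le_iff)
    also have "\<dots> \<le> Zc t \<omega> * (2 * (B * (s * C)) * lag_abs p u t \<omega> + Y)"
      using 2 B_nonneg s C0 l0 Y0 by (intro mult_left_mono[of 1 "Zc t \<omega>", simplified mult_1_right mult.commute[of _ "Zc t \<omega>"]]) auto
    also have "\<dots> \<le> L * (s\<^sup>2 * (C\<^sup>2 * (lag_abs p u t \<omega>)\<^sup>2)) + Zc t \<omega> * (2 * (B * (s * C)) * lag_abs p u t \<omega> + Y)"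
      using L_nonneg by simp
    finally show ?thesis unfolding hu_def hw_def Y_def .
  qed
qed

text \<open>With at most one outlier the increment is additive and the error is zero. With
  \<open>k \<ge> 2\<close> outliers the error is at most \<open>1 + k\<close>, which is dominated by
  \<open>2 * (k\<^sup>2 - k)\<close>, an expression that vanishes for
  \<open>k \<le> 1\<close>.\<close>

lemma A_shift_bound:
  "\<bar>A (x + shift t \<omega>) - A x - (\<Sum>j=0..p. (A (x + b j * \<xi> (t - int j) \<omega>) - A x) * z (t - int j) \<omega>)\<bar>
    \<le> 2 * ((Zc t \<omega>)\<^sup>2 - Zc t \<omega>)"
proof -
  define S where "S = outliers t \<omega>"
  define q where "q = (\<lambda>j. A (x + b j * \<xi> (t - int j) \<omega>) - A x)"
  have sh: "shift t \<omega> = (\<Sum>j\<in>S. b j * \<xi> (t - int j) \<omega>)"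
    unfolding shift_def S_def using sum_z[of "\<lambda>j. b j * \<xi> (t - int j) \<omega>" t \<omega>] by simp
  have sq: "(\<Sum>j=0..p. q j * z (t - int j) \<omega>) = (\<Sum>j\<in>S. q j)"
    unfolding S_def by (rule sum_z)
  have fin: "finite S" by (simp add: S_def)
  have "\<bar>A (x + shift t \<omega>) - A x - (\<Sum>j\<in>S. q j)\<bar> \<le> 2 * ((real (card S))\<^sup>2 - real (card S))"
  proof (cases "card S \<ge> 2")
    case True
    have "\<bar>\<Sum>j\<in>S. q j\<bar> \<le> (\<Sum>j\<in>S. 1)"
      using A_diff_le_1 by (intro order_trans[OF sum_abs] sum_mono) (simp add: q_def)
    then have "\<bar>A (x + shift t \<omega>) - A x - (\<Sum>j\<in>S. q j)\<bar> \<le> 1 + real (card S)"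
      using A_diff_le_1[of "x + shift t \<omega>" x] by (simp add: abs_le_iff)
    also have "\<dots> \<le> 2 * (real (card S) * (real (card S) - 1))"
    proof -
      have "real (card S) * 1 \<le> real (card S) * (real (card S) - 1)" using True by (intro mult_left_mono) auto
      moreover have "real (card S) \<ge> 2" using True by simp
      ultimately show ?thesis by linarith
    qed
    finally show ?thesis by (simp add: power2_eq_square algebra_simps)
  next
    case False
    then consider "card S = 0" | "card S = 1" by linarith
    then show ?thesis
    proof cases
      case 1
      then show ?thesis using fin sh by simp
    next
      case 2
      then obtain i where "S = {i}" by (auto simp: card_1_singleton_iff)
      then show ?thesis using sh by (simp add: q_def)
    qed
  qed
  then show ?thesis unfolding Zc_card by (simp only: sq[unfolded q_def S_def] q_def S_def)
qed

text \<open>At a fixed lag, different times use disjoint pairs of \<open>z\<close> and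
  \<open>\<xi>\<close>, so the centred terms are uncorrelated. Before centering a term vanishes
  unless an outlier occurs, so its variance is at most \<open>g\<close>.\<close>

lemma single_outlier_fluctuation:
  assumes T: "finite T"
  shows "(LINT \<omega>|M. \<bar>\<Sum>t\<in>T. (A (x + r * \<xi> (t - k) \<omega>) - A x) * z (t - k) \<omega> - g * (LINT s|Q. A (x + r * s) - A x)\<bar>)
    \<le> sqrt (card T * g)"
proof -
  define q where "q = (\<lambda>s. A (x + r * s) - A x)"
  define \<kappa> where "\<kappa> = (LINT s|Q. q s)"
  define D where "D = (\<lambda>t \<omega>. q (\<xi> (t - k) \<omega>) * z (t - k) \<omega> - g * \<kappa>)"
  have [measurable]: "q \<in> borel_measurable borel" unfolding q_def by measurable
  have q1: "\<bar>q s\<bar> \<le> 1" for s using A_diff_le_1 by (simp add: q_def)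
  have \<kappa>_eq: "(LINT \<omega>|M. q (\<xi> t \<omega>)) = \<kappa>" for t
    unfolding \<kappa>_def law_\<xi>[of t, symmetric] by (subst integral_distr) auto
  have iq: "integrable M (\<lambda>\<omega>. q (\<xi> t \<omega>))" for t
    by (rule integrable_const_bound[where B = 1]) (use q1 in auto)
  have qz: "(LINT \<omega>|M. q (\<xi> t \<omega>) * z t \<omega>) = g * \<kappa>" for t
  proof -
    have 1: "(\<lambda>\<omega>. q (\<xi> t \<omega>)) \<in> borel_measurable (gen {(2, t)})"
      by (rule measurable_compose[OF gen_\<xi>]) auto
    show ?thesis
      using integral_mult_gen(1)[OF _ _ _ 1 iq gen_z[of t "{(1, t)}"] int_z]
      by (simp add: \<kappa>_eq z_mean mult.commute)
  qed
  have qzb: "\<bar>q (\<xi> t \<omega>) * z t \<omega>\<bar> \<le> 1" for t \<omega>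
    using mult_mono[OF q1 z_le_1[of t \<omega>], of "\<xi> t \<omega>"] z_nonneg[of t \<omega>] by (simp add: abs_mult)
  have iqz: "integrable M (\<lambda>\<omega>. q (\<xi> t \<omega>) * z t \<omega>)" for t
    by (rule integrable_const_bound[where B = 1]) (use qzb in auto)
  have "\<bar>g * \<kappa>\<bar> \<le> 1"
  proof -
    have "\<bar>LINT \<omega>|M. q (\<xi> 0 \<omega>) * z 0 \<omega>\<bar> \<le> (LINT \<omega>|M. \<bar>q (\<xi> 0 \<omega>) * z 0 \<omega>\<bar>)"
      by (rule integral_abs_bound)
    also have "\<dots> \<le> (LINT \<omega>|M. 1)" using iqz qzb by (intro integral_mono) auto
    finally show ?thesis by (simp add: qz prob_space)
  qed
  then have Db: "\<bar>D t \<omega>\<bar> \<le> 2" for t \<omega> using qzb[of "t - k" \<omega>] by (simp add: D_def abs_le_iff)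
  have DM: "D t \<in> borel_measurable M" for t unfolding D_def by measurable
  have iD: "integrable M (D t)" and D0: "(LINT \<omega>|M. D t \<omega>) = 0" for t
    unfolding D_def using iqz by (auto simp: qz prob_space)
  have Dg: "D t \<in> borel_measurable (gen ({1, 2} \<times> {t - k}))" for t
  proof -
    have [measurable]: "\<xi> (t - k) \<in> borel_measurable (gen ({1, 2} \<times> {t - k}))"
      "z (t - k) \<in> borel_measurable (gen ({1, 2} \<times> {t - k}))"
      by (auto intro!: gen_\<xi> gen_z)
    show ?thesis unfolding D_def by measurable
  qed
  have "(LINT \<omega>|M. \<bar>\<Sum>t\<in>T. D t \<omega>\<bar>) \<le> sqrt (card T * g)"
  proof (rule integral_abs_sum_uncorrelated[OF T DM Db])
    fix s t assume "s \<in> T" "t \<in> T" "s \<noteq> t"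
    then show "(LINT \<omega>|M. D s \<omega> * D t \<omega>) = 0"
      by (subst integral_mult_gen(1)[OF _ _ _ Dg iD Dg iD]) (auto simp: D0)
  next
    fix t
    have "(LINT \<omega>|M. (D t \<omega>)\<^sup>2) = (LINT \<omega>|M. (q (\<xi> (t - k) \<omega>) * z (t - k) \<omega>)\<^sup>2 - (2 * (g * \<kappa>) * (q (\<xi> (t - k) \<omega>) * z (t - k) \<omega>) - (g * \<kappa>)\<^sup>2))"
      by (simp add: D_def power2_diff algebra_simps)
    also have "\<dots> = (LINT \<omega>|M. (q (\<xi> (t - k) \<omega>) * z (t - k) \<omega>)\<^sup>2) - (g * \<kappa>)\<^sup>2"
    proof -
      have "integrable M (\<lambda>\<omega>. (q (\<xi> (t - k) \<omega>) * z (t - k) \<omega>)\<^sup>2)"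
        by (rule integrable_const_bound[where B = 1]) (use qzb in \<open>auto simp: abs_square_le_1 simp del: abs_mult\<close>)
      then show ?thesis using iqz[of "t - k"] by (simp add: qz prob_space power2_eq_square)
    qed
    also have "\<dots> \<le> (LINT \<omega>|M. (q (\<xi> (t - k) \<omega>) * z (t - k) \<omega>)\<^sup>2)" by simp
    also have "\<dots> \<le> (LINT \<omega>|M. z (t - k) \<omega>)"
    proof (rule integral_mono[OF _ int_z])
      show "integrable M (\<lambda>\<omega>. (q (\<xi> (t - k) \<omega>) * z (t - k) \<omega>)\<^sup>2)"
        by (rule integrable_const_bound[where B = 1]) (use qzb in \<open>auto simp: abs_square_le_1 simp del: abs_mult\<close>)
      fix \<omega>
      show "(q (\<xi> (t - k) \<omega>) * z (t - k) \<omega>)\<^sup>2 \<le> z (t - k) \<omega>"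
        using z01[of "t - k" \<omega>] q1[of "\<xi> (t - k) \<omega>"] by (auto simp: abs_square_le_1)
    qed
    finally show "(LINT \<omega>|M. (D t \<omega>)\<^sup>2) \<le> g" by (simp add: z_mean)
  qed
  then show ?thesis by (simp add: D_def q_def \<kappa>_def)
qed

lemma integral_abs_sum_le:
  fixes F :: "int \<Rightarrow> 'a \<Rightarrow> real"
  assumes "\<And>t. integrable M (G t)" "\<And>t. F t \<in> borel_measurable M" "\<And>t \<omega>. \<bar>F t \<omega>\<bar> \<le> G t \<omega>" "\<And>t. (LINT \<omega>|M. G t \<omega>) \<le> c"
  shows "(LINT \<omega>|M. \<bar>\<Sum>t\<in>T. F t \<omega>\<bar>) \<le> real (card T) * c" "integrable M (\<lambda>\<omega>. \<bar>\<Sum>t\<in>T. F t \<omega>\<bar>)"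
proof -
  have iF: "integrable M (F t)" for t
    by (rule Bochner_Integration.integrable_bound[OF assms(1)[of t] assms(2)])
      (use assms(3) in \<open>auto intro: order_trans[OF _ abs_ge_self]\<close>)
  then show i: "integrable M (\<lambda>\<omega>. \<bar>\<Sum>t\<in>T. F t \<omega>\<bar>)" by auto
  have "(LINT \<omega>|M. \<bar>\<Sum>t\<in>T. F t \<omega>\<bar>) \<le> (LINT \<omega>|M. (\<Sum>t\<in>T. G t \<omega>))"
    using i assms by (intro integral_mono order_trans[OF sum_abs] sum_mono) auto
  also have "\<dots> = (\<Sum>t\<in>T. LINT \<omega>|M. G t \<omega>)" using assms(1) by simp
  also have "\<dots> \<le> (\<Sum>t\<in>T. c)" using assms(4) by (intro sum_mono)
  finally show "(LINT \<omega>|M. \<bar>\<Sum>t\<in>T. F t \<omega>\<bar>) \<le> real (card T) * c" by simp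
qed

text \<open>For fixed \<open>c\<close> and \<open>d\<close> the perturbed threshold at time
  \<open>t\<close> belongs to \<open>past t\<close>, so the martingale estimate is available. What
  remains after subtracting the drift proportional to \<open>a x\<close> and the mean effect of
  single outliers is small in mean.\<close>

lemma linearization_error:
  fixes n :: nat
  assumes n: "n \<ge> 1" and C: "\<And>j. j \<le> p \<Longrightarrow> \<bar>c j\<bar> + \<bar>d\<bar> \<le> C"
    and T: "T = {1..int n}" and s: "s = 1 / sqrt n"
  shows "(LINT \<omega>|M. \<bar>s * (\<Sum>t\<in>T. indicator {..x + (s * lag_lin p c d w t \<omega> + shift t \<omega>)} (e t \<omega>) - indicator {..x} (e t \<omega>))
      - a x * (s\<^sup>2 * (\<Sum>t\<in>T. lag_lin p c d u t \<omega>))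
      - sqrt n * g * (\<Sum>j=0..p. LINT s|Q. A (x + b j * s) - A x)\<bar>)
    \<le> linearization_bound p B L V g C n (LINT y|Q. min 1 \<bar>B * (s * C) * y\<bar>)"
    and "integrable M (\<lambda>\<omega>. s * (\<Sum>t\<in>T. indicator {..x + (s * lag_lin p c d w t \<omega> + shift t \<omega>)} (e t \<omega>) - indicator {..x} (e t \<omega>))
      - a x * (s\<^sup>2 * (\<Sum>t\<in>T. lag_lin p c d u t \<omega>))
      - sqrt n * g * (\<Sum>j=0..p. LINT s|Q. A (x + b j * s) - A x))"
proof -
  let ?E = "\<lambda>\<omega>. s * (\<Sum>t\<in>T. indicator {..x + (s * lag_lin p c d w t \<omega> + shift t \<omega>)} (e t \<omega>) - indicator {..x} (e t \<omega>))
      - a x * (s\<^sup>2 * (\<Sum>t\<in>T. lag_lin p c d u t \<omega>))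
      - sqrt n * g * (\<Sum>j=0..p. LINT s|Q. A (x + b j * s) - A x)"
  define \<phi> where "\<phi> = (LINT y|Q. min 1 \<bar>B * (s * C) * y\<bar>)"
  define y where "y = (\<lambda>t \<omega>. s * lag_lin p c d w t \<omega> + shift t \<omega>)"
  define q where "q = (\<lambda>j v. A (x + b j * v) - A x)"
  define \<kappa> where "\<kappa> = (\<lambda>j. LINT v|Q. q j v)"
  define F1 where "F1 = (\<lambda>t \<omega>. indicator {..x + y t \<omega>} (e t \<omega>) - indicator {..x} (e t \<omega>) - (A (x + y t \<omega>) - A x))"
  define F2 where "F2 = (\<lambda>t \<omega>. A (x + y t \<omega>) - A (x + shift t \<omega>) - a x * (s * lag_lin p c d u t \<omega>))"
  define F3 where "F3 = (\<lambda>t \<omega>. A (x + shift t \<omega>) - A x - (\<Sum>j=0..p. q j (\<xi> (t - int j) \<omega>) * z (t - int j) \<omega>))"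
  define F4 where "F4 = (\<lambda>j t \<omega>. q j (\<xi> (t - int j) \<omega>) * z (t - int j) \<omega> - g * \<kappa> j)"
  have s0: "s \<ge> 0" and C0: "C \<ge> 0" using s C[of 0] by auto
  have sn: "s * n = sqrt n" "s\<^sup>2 = 1 / n" using n by (auto simp: s power_divide real_div_sqrt)
  have cardT: "card T = n" by (simp add: T)
  have [measurable]: "y t \<in> borel_measurable M" "lag_abs p u t \<in> borel_measurable M" "lag_lin p c d u t \<in> borel_measurable M" for t
    unfolding y_def by measurable
  have [measurable]: "q j \<in> borel_measurable borel" for j unfolding q_def by measurable
  have ind_m: "(\<lambda>\<omega>. indicator {..x + y t \<omega>} (e t \<omega>) :: real) \<in> borel_measurable M" "(\<lambda>\<omega>. indicator {..x} (e t \<omega>) :: real) \<in> borel_measurable M" for t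
    unfolding indicator_def atMost_iff by measurable
  have F1m: "F1 t \<in> borel_measurable M" for t
    unfolding F1_def by (intro borel_measurable_diff ind_m) measurable
  have F234m: "F2 t \<in> borel_measurable M" "F3 t \<in> borel_measurable M" "F4 j t \<in> borel_measurable M" for t j
    unfolding F2_def F3_def F4_def by measurable
  have hu: "(LINT \<omega>|M. \<bar>s * lag_lin p c d u t \<omega>\<bar>) \<le> s * (C * (1 + p * sqrt V))" "integrable M (\<lambda>\<omega>. \<bar>s * lag_lin p c d u t \<omega>\<bar>)" for t
  proof -
    show i: "integrable M (\<lambda>\<omega>. \<bar>s * lag_lin p c d u t \<omega>\<bar>)"
      using int_u int_lag_abs unfolding lag_lin_def by auto
    have "(LINT \<omega>|M. \<bar>s * lag_lin p c d u t \<omega>\<bar>) \<le> (LINT \<omega>|M. s * (C * lag_abs p u t \<omega>))"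
    proof (rule integral_mono[OF i])
      fix \<omega>
      show "\<bar>s * lag_lin p c d u t \<omega>\<bar> \<le> s * (C * lag_abs p u t \<omega>)"
        using mult_left_mono[OF abs_lag_lin_le[OF C, where f = u and t = t and \<omega> = \<omega>] s0] s0 by (simp add: abs_mult)
    qed (use int_lag_abs in auto)
    also have "\<dots> = s * (C * (LINT \<omega>|M. lag_abs p u t \<omega>))" by simp
    also have "\<dots> \<le> s * (C * (1 + p * sqrt V))" using s0 C0 lag_abs_mean by (intro mult_left_mono)
    finally show "(LINT \<omega>|M. \<bar>s * lag_lin p c d u t \<omega>\<bar>) \<le> s * (C * (1 + p * sqrt V))" .
  qed
  have E1: "(LINT \<omega>|M. \<bar>\<Sum>t\<in>T. F1 t \<omega>\<bar>) \<le> sqrt (n * ((real p + 1) * g + B * (s * (C * (1 + p * sqrt V)))))"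
    unfolding F1_def cardT[symmetric]
  proof (rule integral_abs_martingale_count)
    fix t
    have "u t' \<in> borel_measurable (gen (past t))" if "t' < t" for t'
      using that by (intro gen_u) (auto simp: past_def)
    moreover have "z t' \<in> borel_measurable (gen (past t))" "\<xi> t' \<in> borel_measurable (gen (past t))" for t'
      by (auto intro!: gen_z gen_\<xi> simp: past_def)
    \<comment> \<open>The linear form involves \<open>w\<close> at lags \<open>j \<ge> 1\<close>
      only, so autoregression values strictly before \<open>t\<close> are enough;
      \<open>shift t\<close> is built from outliers alone.\<close>
    ultimately have wm: "w t' \<in> borel_measurable (gen (past t))" if "t' < t" for t'
      using that unfolding w_def by (intro borel_measurable_add borel_measurable_times) auto
    have zx: "z t' \<in> borel_measurable (gen (past t))" "\<xi> t' \<in> borel_measurable (gen (past t))" for t'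
      by (auto intro!: gen_z gen_\<xi> simp: past_def)
    show "y t \<in> borel_measurable (gen (past t))"
      unfolding y_def lag_lin_def lag_abs_def shift_def
      by (intro borel_measurable_add borel_measurable_times borel_measurable_sum borel_measurable_abs borel_measurable_const wm zx) auto
    have "(LINT \<omega>|M. \<bar>A (x + y t \<omega>) - A x\<bar>) \<le> (LINT \<omega>|M. Zc t \<omega> + B * \<bar>s * lag_lin p c d u t \<omega>\<bar>)"
    proof (rule integral_mono)
      show "integrable M (\<lambda>\<omega>. \<bar>A (x + y t \<omega>) - A x\<bar>)"
        by (rule integrable_const_bound[where B = 1]) (use A_diff_le_1 in auto)
    qed (use int_Zc hu A_increment_bound in \<open>auto simp: y_def\<close>)
    also have "\<dots> = (real p + 1) * g + B * (LINT \<omega>|M. \<bar>s * lag_lin p c d u t \<omega>\<bar>)"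
      using int_Zc hu by (simp add: Zc_mean)
    also have "\<dots> \<le> (real p + 1) * g + B * (s * (C * (1 + p * sqrt V)))"
      using hu B_nonneg by (intro add_left_mono mult_left_mono)
    finally show "(LINT \<omega>|M. \<bar>A (x + y t \<omega>) - A x\<bar>) \<le> (real p + 1) * g + B * (s * (C * (1 + p * sqrt V)))" .
  qed (simp add: T)
  define G2 where "G2 = (\<lambda>t \<omega>. L * (s\<^sup>2 * (C\<^sup>2 * (lag_abs p u t \<omega>)\<^sup>2)) +
      Zc t \<omega> * (2 * (B * (s * C)) * lag_abs p u t \<omega> + (\<Sum>j=1..p. min 1 \<bar>B * (s * C) * \<xi> (t - int j) \<omega>\<bar>)))"
  have G2: "integrable M (G2 t)" "(LINT \<omega>|M. G2 t \<omega>) \<le> L * (s\<^sup>2 * (C\<^sup>2 * ((real p + 1) * (1 + p * V)))) +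
       (real p + 1) * g * (2 * (B * (s * C)) * (1 + p * sqrt V) + p * \<phi>)" for t
  proof -
    let ?N = "\<lambda>\<omega>. 2 * (B * (s * C)) * lag_abs p u t \<omega> + (\<Sum>j=1..p. min 1 \<bar>B * (s * C) * \<xi> (t - int j) \<omega>\<bar>)"
    have gN: "?N \<in> borel_measurable (gen ({0, 2} \<times> UNIV))"
    proof -
      have [measurable]: "u t' \<in> borel_measurable (gen ({0, 2} \<times> UNIV))" "\<xi> t' \<in> borel_measurable (gen ({0, 2} \<times> UNIV))" for t'
        by (rule gen_u, force) (rule gen_\<xi>, simp)
      show ?thesis unfolding lag_abs_def by measurable
    qed
    have gZ: "Zc t \<in> borel_measurable (gen ({1} \<times> UNIV))"
      unfolding Zc_def by (intro borel_measurable_sum gen_z) auto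
    have im: "integrable M (\<lambda>\<omega>. min 1 \<bar>B * (s * C) * \<xi> t' \<omega>\<bar>)" for t'
      by (rule integrable_const_bound[where B = 1]) auto
    have iN: "integrable M ?N" using int_lag_abs im by auto
    have "(LINT \<omega>|M. ?N \<omega>) = 2 * (B * (s * C)) * (LINT \<omega>|M. lag_abs p u t \<omega>) + (\<Sum>j=1..p. LINT \<omega>|M. min 1 \<bar>B * (s * C) * \<xi> (t - int j) \<omega>\<bar>)"
      using int_lag_abs im by simp
    also have "(\<Sum>j=1..p. LINT \<omega>|M. min 1 \<bar>B * (s * C) * \<xi> (t - int j) \<omega>\<bar>) = (\<Sum>j=1..p. \<phi>)"
    proof (intro sum.cong refl)
      fix j
      show "(LINT \<omega>|M. min 1 \<bar>B * (s * C) * \<xi> (t - int j) \<omega>\<bar>) = \<phi>"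
        unfolding \<phi>_def law_\<xi>[of "t - int j", symmetric] by (subst integral_distr) auto
    qed
    also have "2 * (B * (s * C)) * (LINT \<omega>|M. lag_abs p u t \<omega>) + (\<Sum>j=1..p. \<phi>) \<le> 2 * (B * (s * C)) * (1 + p * sqrt V) + p * \<phi>"
      using lag_abs_mean B_nonneg s0 C0 by (intro add_mono mult_left_mono) auto
    finally have N: "(LINT \<omega>|M. ?N \<omega>) \<le> 2 * (B * (s * C)) * (1 + p * sqrt V) + p * \<phi>" .
    \<comment> \<open>The number of outliers depends on \<open>z\<close> alone, the other factor on
      innovations and outlier sizes. Independence is what extracts the factor
      \<open>g\<close>.\<close>
    have ZN: "(LINT \<omega>|M. Zc t \<omega> * ?N \<omega>) = (real p + 1) * g * (LINT \<omega>|M. ?N \<omega>)" "integrable M (\<lambda>\<omega>. Zc t \<omega> * ?N \<omega>)"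
    proof -
      have d: "{1} \<times> UNIV \<subseteq> {..<3::nat} \<times> (UNIV :: int set)" "{0, 2} \<times> UNIV \<subseteq> {..<3::nat} \<times> (UNIV :: int set)"
        "({1} \<times> UNIV) \<inter> ({0, 2} \<times> UNIV) = ({} :: (nat \<times> int) set)" by auto
      show "(LINT \<omega>|M. Zc t \<omega> * ?N \<omega>) = (real p + 1) * g * (LINT \<omega>|M. ?N \<omega>)"
        unfolding integral_mult_gen(1)[OF d gZ int_Zc gN iN] Zc_mean ..
      show "integrable M (\<lambda>\<omega>. Zc t \<omega> * ?N \<omega>)" by (rule integral_mult_gen(2)[OF d gZ int_Zc gN iN])
    qed
    have iL: "integrable M (\<lambda>\<omega>. L * (s\<^sup>2 * (C\<^sup>2 * (lag_abs p u t \<omega>)\<^sup>2)))" using int_lag_abs_square by auto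
    show "integrable M (G2 t)" unfolding G2_def by (intro Bochner_Integration.integrable_add iL ZN(2))
    have "(LINT \<omega>|M. G2 t \<omega>) = L * (s\<^sup>2 * (C\<^sup>2 * (LINT \<omega>|M. (lag_abs p u t \<omega>)\<^sup>2))) + (real p + 1) * g * (LINT \<omega>|M. ?N \<omega>)"
      unfolding G2_def by (subst Bochner_Integration.integral_add[OF iL ZN(2)]) (simp add: ZN(1) del: One_nat_def)
    also have "\<dots> \<le> L * (s\<^sup>2 * (C\<^sup>2 * ((real p + 1) * (1 + p * V)))) + (real p + 1) * g * (2 * (B * (s * C)) * (1 + p * sqrt V) + p * \<phi>)"
      using L_nonneg g_range N lag_abs_square_mean by (intro add_mono mult_left_mono) auto
    finally show "(LINT \<omega>|M. G2 t \<omega>) \<le> L * (s\<^sup>2 * (C\<^sup>2 * ((real p + 1) * (1 + p * V)))) + (real p + 1) * g * (2 * (B * (s * C)) * (1 + p * sqrt V) + p * \<phi>)" .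
  qed
  note E2 = integral_abs_sum_le[of G2 F2 _ T, OF G2(1) F234m(1) _ G2(2), unfolded cardT]
  have F2G2: "\<bar>F2 t \<omega>\<bar> \<le> G2 t \<omega>" for t \<omega>
    unfolding F2_def G2_def y_def using A_taylor_bound[OF s0 C] .
  have iZ2: "integrable M (\<lambda>\<omega>. 2 * ((Zc t \<omega>)\<^sup>2 - Zc t \<omega>))" for t
  proof -
    have "integrable M (\<lambda>\<omega>. (Zc t \<omega>)\<^sup>2)"
      by (rule integrable_const_bound[where B = "(real p + 1)\<^sup>2"])
        (use Zc_nonneg Zc_le in \<open>auto intro!: power_mono AE_I2\<close>)
    then show ?thesis using int_Zc by simp
  qed
  have "(LINT \<omega>|M. 2 * ((Zc t \<omega>)\<^sup>2 - Zc t \<omega>)) \<le> 2 * ((real p + 1)\<^sup>2 * g\<^sup>2)" for t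
    unfolding integral_mult_right_zero using Zc_pair_mean[of t] by (intro mult_left_mono) auto
  note E3 = integral_abs_sum_le[of "\<lambda>t \<omega>. 2 * ((Zc t \<omega>)\<^sup>2 - Zc t \<omega>)" F3 _ T, OF iZ2 F234m(2) _ this, unfolded cardT]
  have F3G3: "\<bar>F3 t \<omega>\<bar> \<le> 2 * ((Zc t \<omega>)\<^sup>2 - Zc t \<omega>)" for t \<omega>
    unfolding F3_def q_def by (rule A_shift_bound)
  have E4: "(LINT \<omega>|M. \<bar>\<Sum>t\<in>T. F4 j t \<omega>\<bar>) \<le> sqrt (n * g)" for j
    unfolding F4_def q_def \<kappa>_def cardT[symmetric] by (rule single_outlier_fluctuation) (simp add: T)
  have bnd: "\<bar>F1 t \<omega>\<bar> \<le> 2" "\<bar>F4 j t \<omega>\<bar> \<le> 2 + \<bar>g * \<kappa> j\<bar>" for t \<omega> j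
  proof -
    show "\<bar>F1 t \<omega>\<bar> \<le> 2"
      using A_diff_le_1[of "x + y t \<omega>" x] by (auto simp: F1_def indicator_def)
    show "\<bar>F4 j t \<omega>\<bar> \<le> 2 + \<bar>g * \<kappa> j\<bar>"
      using A_diff_le_1[of "x + b j * \<xi> (t - int j) \<omega>" x] z01[of "t - int j" \<omega>] by (auto simp: F4_def q_def)
  qed
  have i1: "integrable M (\<lambda>\<omega>. \<Sum>t\<in>T. F1 t \<omega>)"
    by (intro Bochner_Integration.integrable_sum integrable_const_bound[OF _ F1m, where B = 2]) (use bnd in auto)
  have i4: "integrable M (\<lambda>\<omega>. \<Sum>t\<in>T. F4 j t \<omega>)" for j
    by (intro Bochner_Integration.integrable_sum integrable_const_bound[OF _ F234m(3), where B = "2 + \<bar>g * \<kappa> j\<bar>"]) (use bnd in auto)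
  have i2: "integrable M (\<lambda>\<omega>. \<Sum>t\<in>T. F2 t \<omega>)" and i3: "integrable M (\<lambda>\<omega>. \<Sum>t\<in>T. F3 t \<omega>)"
    using E2(2)[OF F2G2] E3(2)[OF F3G3] F234m by (auto simp: integrable_abs_iff)
  have \<kappa>q: "(\<Sum>j=0..p. LINT s|Q. A (x + b j * s) - A x) = (\<Sum>j=0..p. \<kappa> j)"
    by (simp add: \<kappa>_def q_def)
  \<comment> \<open>The quantities \<open>A (x + y t \<omega>)\<close>,
    \<open>A (x + shift t \<omega>)\<close> and the sum over single outliers are inserted one after
    the other; the last piece is centred by \<open>g * \<kappa> j\<close> at each time.\<close>
  have decomp: "?E \<omega> = s * (\<Sum>t\<in>T. F1 t \<omega>) + s * (\<Sum>t\<in>T. F2 t \<omega>) + s * (\<Sum>t\<in>T. F3 t \<omega>) + (\<Sum>j=0..p. s * (\<Sum>t\<in>T. F4 j t \<omega>))" for \<omega>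
  proof -
    have "(\<Sum>j=0..p. s * (\<Sum>t\<in>T. F4 j t \<omega>)) = s * (\<Sum>t\<in>T. \<Sum>j=0..p. q j (\<xi> (t - int j) \<omega>) * z (t - int j) \<omega>) - s * n * g * (\<Sum>j=0..p. \<kappa> j)"
      unfolding F4_def sum_subtractf sum_distrib_left[symmetric] cardT sum_constant
      by (subst sum.swap) (simp add: cardT right_diff_distrib sum_distrib_left[symmetric] mult_ac)
    moreover have "a x * (s\<^sup>2 * (\<Sum>t\<in>T. lag_lin p c d u t \<omega>)) = s * (\<Sum>t\<in>T. a x * (s * lag_lin p c d u t \<omega>))"
      by (simp add: power2_eq_square sum_distrib_left mult_ac)
    ultimately show ?thesis
      unfolding F1_def F2_def F3_def y_def \<kappa>q sum_subtractf sn(1)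
      by (simp add: algebra_simps)
  qed
  show "integrable M ?E"
    unfolding decomp using i1 i2 i3 i4 by auto
  have "(LINT \<omega>|M. \<bar>?E \<omega>\<bar>) \<le> (LINT \<omega>|M. s * \<bar>\<Sum>t\<in>T. F1 t \<omega>\<bar> + s * \<bar>\<Sum>t\<in>T. F2 t \<omega>\<bar> + s * \<bar>\<Sum>t\<in>T. F3 t \<omega>\<bar> + (\<Sum>j=0..p. s * \<bar>\<Sum>t\<in>T. F4 j t \<omega>\<bar>))"
  proof (rule integral_mono)
    show "integrable M (\<lambda>\<omega>. \<bar>?E \<omega>\<bar>)" unfolding decomp using i1 i2 i3 i4 by auto
    fix \<omega>
    have "\<bar>\<Sum>j=0..p. s * (\<Sum>t\<in>T. F4 j t \<omega>)\<bar> \<le> (\<Sum>j=0..p. s * \<bar>\<Sum>t\<in>T. F4 j t \<omega>\<bar>)"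
      using s0 by (intro order_trans[OF sum_abs]) (simp add: abs_mult)
    moreover have "\<bar>s * v\<bar> = s * \<bar>v\<bar>" for v using s0 by (simp add: abs_mult)
    ultimately show "\<bar>?E \<omega>\<bar> \<le> s * \<bar>\<Sum>t\<in>T. F1 t \<omega>\<bar> + s * \<bar>\<Sum>t\<in>T. F2 t \<omega>\<bar> + s * \<bar>\<Sum>t\<in>T. F3 t \<omega>\<bar> + (\<Sum>j=0..p. s * \<bar>\<Sum>t\<in>T. F4 j t \<omega>\<bar>)"
      unfolding decomp by (smt (verit) abs_triangle_ineq)
  qed (use i1 i2 i3 i4 in auto)
  also have "\<dots> = s * (LINT \<omega>|M. \<bar>\<Sum>t\<in>T. F1 t \<omega>\<bar>) + s * (LINT \<omega>|M. \<bar>\<Sum>t\<in>T. F2 t \<omega>\<bar>) + s * (LINT \<omega>|M. \<bar>\<Sum>t\<in>T. F3 t \<omega>\<bar>)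
      + (\<Sum>j=0..p. s * (LINT \<omega>|M. \<bar>\<Sum>t\<in>T. F4 j t \<omega>\<bar>))"
    using i1 i2 i3 i4 by simp
  also have "\<dots> \<le> s * sqrt (n * ((real p + 1) * g + B * (s * (C * (1 + p * sqrt V)))))
     + s * (n * (L * (s\<^sup>2 * (C\<^sup>2 * ((real p + 1) * (1 + p * V)))) + (real p + 1) * g * (2 * (B * (s * C)) * (1 + p * sqrt V) + p * \<phi>)))
     + s * (n * (2 * ((real p + 1)\<^sup>2 * g\<^sup>2))) + (\<Sum>j=0..p. s * sqrt (n * g))"
    by (intro add_mono sum_mono mult_left_mono s0 E1 E2(1)[OF F2G2] E3(1)[OF F3G3] E4)
  also have "\<dots> = linearization_bound p B L V g C n \<phi>"
  proof -
    have sq1: "s * sqrt (n * X) = sqrt X" for X :: real using n by (simp add: s real_sqrt_mult)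
    have sq2: "s * (n * X) = sqrt n * X" for X :: real using sn(1) by (metis mult.assoc)
    have e1: "B * (s * X) = B * X / sqrt n" and e2: "L * (s\<^sup>2 * X) = L * X / n"
      and e3: "2 * (B * (s * C)) * X = 2 * B * (C * X) / sqrt n" for X
      unfolding sn(2) by (simp_all add: s)
    show ?thesis
      unfolding sq1 sq2 e1 e2 e3 linearization_bound_def by (simp add: algebra_simps)
  qed
  finally show "(LINT \<omega>|M. \<bar>?E \<omega>\<bar>) \<le> linearization_bound p B L V g C n (LINT y|Q. min 1 \<bar>B * (s * C) * y\<bar>)"
    unfolding \<phi>_def .
qed

end

section \<open>Discretization of the coefficient space\<close>

definition coefficient_grid :: "nat \<Rightarrow> real \<Rightarrow> real \<Rightarrow> (nat \<Rightarrow> real) set" where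
  "coefficient_grid p d K = PiE {0..p} (\<lambda>_. (\<lambda>i::int. d * of_int i) ` {- \<lceil>K / d\<rceil>..\<lceil>K / d\<rceil>})"

lemma finite_coefficient_grid [simp]: "finite (coefficient_grid p d K)"
  unfolding coefficient_grid_def by (intro finite_PiE) auto

lemma coefficient_grid_bound:
  assumes d: "d > 0" and c: "c \<in> coefficient_grid p d K" and j: "j \<le> p"
  shows "\<bar>c j\<bar> \<le> K + d"
proof -
  obtain i :: int where i: "c j = d * of_int i" "- \<lceil>K / d\<rceil> \<le> i" "i \<le> \<lceil>K / d\<rceil>"
    using c j unfolding coefficient_grid_def by (force simp: PiE_iff)
  have "of_int \<bar>i\<bar> \<le> (of_int \<lceil>K / d\<rceil> :: real)" using i by linarith
  also have "\<dots> \<le> K / d + 1" by linarith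
  finally have "d * of_int \<bar>i\<bar> \<le> d * (K / d + 1)" using d by (intro mult_left_mono) auto
  then show ?thesis using d by (simp add: i(1) abs_mult distrib_left)
qed

lemma coefficient_grid_approx:
  assumes d: "d > 0" and \<tau>: "\<And>j. j \<le> p \<Longrightarrow> \<bar>\<tau> j\<bar> \<le> K"
  obtains c where "c \<in> coefficient_grid p d K" "\<And>j. j \<le> p \<Longrightarrow> \<bar>\<tau> j - c j\<bar> \<le> d"
proof
  define c where "c = (\<lambda>j\<in>{0..p}. d * of_int \<lfloor>\<tau> j / d\<rfloor>)"
  have "\<lfloor>\<tau> j / d\<rfloor> \<in> {- \<lceil>K / d\<rceil>..\<lceil>K / d\<rceil>}" if "j \<le> p" for j
  proof -
    have "- (K / d) \<le> \<tau> j / d" "\<tau> j / d \<le> K / d"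
      using \<tau>[OF that] d by (auto simp: field_simps abs_le_iff)
    then have "\<lfloor>- (K / d)\<rfloor> \<le> \<lfloor>\<tau> j / d\<rfloor>" "\<lfloor>\<tau> j / d\<rfloor> \<le> \<lceil>K / d\<rceil>"
      by (linarith+)
    then show ?thesis by (simp add: floor_minus)
  qed
  then show "c \<in> coefficient_grid p d K"
    unfolding coefficient_grid_def c_def by auto
  fix j assume "j \<le> p"
  have "\<bar>\<tau> j / d - of_int \<lfloor>\<tau> j / d\<rfloor>\<bar> \<le> 1" by linarith
  then have "d * \<bar>\<tau> j / d - of_int \<lfloor>\<tau> j / d\<rfloor>\<bar> \<le> d" using d by (intro mult_left_le) auto
  moreover have "\<tau> j - c j = d * (\<tau> j / d - of_int \<lfloor>\<tau> j / d\<rfloor>)"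
    using d \<open>j \<le> p\<close> by (simp add: c_def algebra_simps)
  ultimately show "\<bar>\<tau> j - c j\<bar> \<le> d" using d by (simp add: abs_mult)
qed

text \<open>The margin dominates a change of every coefficient by at most \<open>d\<close>, whatever
  the signs of the lagged values. The bracketing therefore holds for each \<open>\<omega>\<close>
  separately, which admits coefficients depending on the sample.\<close>

lemma lag_lin_sandwich:
  assumes \<tau>: "\<And>j. j \<le> p \<Longrightarrow> \<bar>\<tau> j - c j\<bar> \<le> d"
  shows "lag_lin p c (- d) f t \<omega> \<le> lag_lin p \<tau> 0 f t \<omega>" "lag_lin p \<tau> 0 f t \<omega> \<le> lag_lin p c d f t \<omega>"
proof -
  have "\<bar>lag_lin p \<tau> 0 f t \<omega> - lag_lin p c 0 f t \<omega>\<bar> = \<bar>(\<tau> 0 - c 0) + (\<Sum>j=1..p. (\<tau> j - c j) * f (t - int j) \<omega>)\<bar>"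
    by (simp add: lag_lin_def sum_subtractf left_diff_distrib algebra_simps)
  also have "\<dots> \<le> \<bar>\<tau> 0 - c 0\<bar> + (\<Sum>j=1..p. \<bar>(\<tau> j - c j) * f (t - int j) \<omega>\<bar>)"
    by (rule order_trans[OF abs_triangle_ineq]) (intro add_left_mono sum_abs)
  also have "\<dots> \<le> d + (\<Sum>j=1..p. d * \<bar>f (t - int j) \<omega>\<bar>)"
    unfolding abs_mult using \<tau> by (intro add_mono sum_mono mult_right_mono) auto
  also have "\<dots> = d * lag_abs p f t \<omega>"
    by (simp add: lag_abs_def sum_distrib_left distrib_left)
  finally have "\<bar>lag_lin p \<tau> 0 f t \<omega> - lag_lin p c 0 f t \<omega>\<bar> \<le> d * lag_abs p f t \<omega>" .
  moreover have "lag_lin p c d f t \<omega> = lag_lin p c 0 f t \<omega> + d * lag_abs p f t \<omega>"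
    "lag_lin p c (- d) f t \<omega> = lag_lin p c 0 f t \<omega> - d * lag_abs p f t \<omega>"
    by (simp_all add: lag_lin_def)
  ultimately show "lag_lin p c (- d) f t \<omega> \<le> lag_lin p \<tau> 0 f t \<omega>" "lag_lin p \<tau> 0 f t \<omega> \<le> lag_lin p c d f t \<omega>"
    unfolding abs_le_iff by linarith+
qed

section \<open>From fixed to estimated coefficients\<close>

context contaminated_ar
begin

definition outlier_effect :: "real \<Rightarrow> real" where
  "outlier_effect x = (\<Sum>j=0..p. LINT s|Q. A (x + b j * s) - A x)"

text \<open>The change in the normalized count of \<open>(- x, x]\<close> when innovations are
  replaced by residuals, less the mean effect of single outliers. The coefficients
  \<open>\<tau>\<close> are random and may depend on everything.\<close>

definition symmetric_remainder :: "nat \<Rightarrow> real \<Rightarrow> (nat \<Rightarrow> 'a \<Rightarrow> real) \<Rightarrow> 'a \<Rightarrow> real" where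
  "symmetric_remainder n x \<tau> \<omega> =
     1 / sqrt n * (\<Sum>t\<in>{1..int n}.
        (indicator {..x + (1 / sqrt n * lag_lin p (\<lambda>j. \<tau> j \<omega>) 0 w t \<omega> + shift t \<omega>)} (e t \<omega>) - indicator {..x} (e t \<omega>))
      - (indicator {..- x + (1 / sqrt n * lag_lin p (\<lambda>j. \<tau> j \<omega>) 0 w t \<omega> + shift t \<omega>)} (e t \<omega>) - indicator {..- x} (e t \<omega>)))
     - sqrt n * g * (outlier_effect x - outlier_effect (- x))"

text \<open>Because \<open>a\<close> is symmetric, the drift caused by the estimated coefficients cancels between
  \<open>x\<close> and \<open>- x\<close>; the random coefficients are compared with the deterministic ones of a grid of
  mesh \<open>d\<close>.\<close>

lemma symmetric_remainder_le:
  fixes n :: nat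
  assumes n: "n \<ge> 1" and sym: "a (- x) = a x" and d: "d > 0" and K: "K \<ge> 0"
    and \<tau>[measurable]: "\<And>j. j \<le> p \<Longrightarrow> \<tau> j \<in> borel_measurable M"
    and Ev: "Ev \<in> events" "\<And>j \<omega>. \<omega> \<in> Ev \<Longrightarrow> j \<le> p \<Longrightarrow> \<bar>\<tau> j \<omega>\<bar> \<le> K"
  shows "symmetric_remainder n x \<tau> \<in> borel_measurable M"
    and "(LINT \<omega>|M. min 1 \<bar>symmetric_remainder n x \<tau> \<omega>\<bar>) \<le> prob (space M - Ev) +
      card (coefficient_grid p d K) * (4 * linearization_bound p B L V g (K + 2 * d) n
         (LINT y|Q. min 1 \<bar>B * (1 / sqrt n * (K + 2 * d)) * y\<bar>))
      + 2 * B * d * (1 + p * sqrt V)"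
proof -
  define s where "s = 1 / sqrt n"
  define T where "T = {1..int n}"
  \<comment> \<open>A grid coefficient is at most \<open>K + d\<close> in absolute value, and the
    margin contributes another \<open>d\<close>.\<close>
  define C where "C = K + 2 * d"
  define lb where "lb = linearization_bound p B L V g C n (LINT y|Q. min 1 \<bar>B * (s * C) * y\<bar>)"
  define D where "D = (\<lambda>x c d \<omega>. s * (\<Sum>t\<in>T. indicator {..x + (s * lag_lin p c d w t \<omega> + shift t \<omega>)} (e t \<omega>) - indicator {..x} (e t \<omega>) :: real))"
  define Er where "Er = (\<lambda>x c d \<omega>. D x c d \<omega> - a x * (s\<^sup>2 * (\<Sum>t\<in>T. lag_lin p c d u t \<omega>)) - sqrt n * g * outlier_effect x)"
  define W where "W = (\<lambda>\<omega>. s\<^sup>2 * (\<Sum>t\<in>T. lag_abs p u t \<omega>))"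
  \<comment> \<open>The number of grid points does not depend on \<open>n\<close>, so the crude sum
    of errors over the grid still tends to 0.\<close>
  define grid where "grid = coefficient_grid p d K"
  \<comment> \<open>Bracketing a difference of counts from both sides calls for both margins at both
    points \<open>x\<close> and \<open>- x\<close>.\<close>
  define ER where "ER = (\<lambda>c \<omega>. \<bar>Er x c d \<omega>\<bar> + \<bar>Er x c (- d) \<omega>\<bar> + \<bar>Er (- x) c d \<omega>\<bar> + \<bar>Er (- x) c (- d) \<omega>\<bar>)"
  let ?R = "symmetric_remainder n x \<tau>"
  have s0: "s \<ge> 0" by (simp add: s_def)
  have sn: "s\<^sup>2 * n = 1" using n by (simp add: s_def power_divide)
  have R: "?R \<omega> = D x (\<lambda>j. \<tau> j \<omega>) 0 \<omega> - D (- x) (\<lambda>j. \<tau> j \<omega>) 0 \<omega> - sqrt n * g * (outlier_effect x - outlier_effect (- x))" for \<omega>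
    by (simp add: symmetric_remainder_def D_def s_def T_def sum_subtractf right_diff_distrib)
  show Rm[measurable]: "?R \<in> borel_measurable M"
  proof -
    have [measurable]: "(\<lambda>\<omega>. lag_lin p (\<lambda>j. \<tau> j \<omega>) 0 w t \<omega>) \<in> borel_measurable M" for t
    proof -
      have "\<tau> 0 \<in> borel_measurable M" by (rule \<tau>) simp
      then show ?thesis
        unfolding lag_lin_def lag_abs_def
        by (intro borel_measurable_add borel_measurable_times borel_measurable_sum borel_measurable_abs borel_measurable_const \<tau> meas_w) auto
    qed
    show ?thesis unfolding symmetric_remainder_def indicator_def atMost_iff by measurable
  qed
  have Erle: "(LINT \<omega>|M. \<bar>Er x' c d' \<omega>\<bar>) \<le> lb" "integrable M (Er x' c d')" if c: "c \<in> grid" and d': "\<bar>d'\<bar> = d" for x' c d'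
  proof -
    have "\<bar>c j\<bar> + \<bar>d'\<bar> \<le> C" if "j \<le> p" for j
      using coefficient_grid_bound[OF d c[unfolded grid_def] that] d' by (simp add: C_def)
    note * = linearization_error[OF n this T_def s_def, where x = x']
    show "(LINT \<omega>|M. \<bar>Er x' c d' \<omega>\<bar>) \<le> lb" "integrable M (Er x' c d')"
      using * unfolding Er_def D_def lb_def outlier_effect_def by auto
  qed
  have ER: "(LINT \<omega>|M. ER c \<omega>) \<le> 4 * lb" "integrable M (ER c)" if c: "c \<in> grid" for c
  proof -
    note i = Erle[OF c, of d] Erle[OF c, of "- d"]
    show "integrable M (ER c)" unfolding ER_def using i d by auto
    have "(LINT \<omega>|M. ER c \<omega>) = (LINT \<omega>|M. \<bar>Er x c d \<omega>\<bar>) + (LINT \<omega>|M. \<bar>Er x c (- d) \<omega>\<bar>) + (LINT \<omega>|M. \<bar>Er (- x) c d \<omega>\<bar>) + (LINT \<omega>|M. \<bar>Er (- x) c (- d) \<omega>\<bar>)"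
      unfolding ER_def using i d by simp
    also have "\<dots> \<le> lb + lb + lb + lb" using i d by (intro add_mono) auto
    finally show "(LINT \<omega>|M. ER c \<omega>) \<le> 4 * lb" by simp
  qed
  have W: "(LINT \<omega>|M. W \<omega>) \<le> 1 + p * sqrt V" "integrable M W"
  proof -
    show "integrable M W" unfolding W_def using int_lag_abs by auto
    have "(LINT \<omega>|M. W \<omega>) = s\<^sup>2 * (\<Sum>t\<in>T. LINT \<omega>|M. lag_abs p u t \<omega>)"
      unfolding W_def using int_lag_abs by simp
    also have "\<dots> \<le> s\<^sup>2 * (\<Sum>t\<in>T. 1 + p * sqrt V)"
      using lag_abs_mean by (intro mult_left_mono sum_mono) auto
    also have "\<dots> = (s\<^sup>2 * n) * (1 + p * sqrt V)" by (simp add: T_def)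
    finally show "(LINT \<omega>|M. W \<omega>) \<le> 1 + p * sqrt V" unfolding sn by simp
  qed
  have W0: "W \<omega> \<ge> 0" for \<omega>
    unfolding W_def by (intro mult_nonneg_nonneg sum_nonneg order_trans[OF zero_le_one lag_abs_ge_1]) simp
  have ER0: "ER c \<omega> \<ge> 0" for c \<omega> by (simp add: ER_def)
  have pw: "min 1 \<bar>?R \<omega>\<bar> \<le> indicator (space M - Ev) \<omega> + (\<Sum>c\<in>grid. ER c \<omega>) + 2 * B * d * W \<omega>" if \<omega>: "\<omega> \<in> space M" for \<omega>
  proof (cases "\<omega> \<in> Ev")
    case False
    have "0 \<le> (\<Sum>c\<in>grid. ER c \<omega>)" using ER0 by (intro sum_nonneg)
    moreover have "0 \<le> 2 * B * d * W \<omega>" using B_nonneg d W0[of \<omega>] by simp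
    ultimately show ?thesis using False \<omega> by (simp add: indicator_def)
  next
    case True
    from coefficient_grid_approx[OF d, of p "\<lambda>j. \<tau> j \<omega>" K] Ev(2)[OF True]
    obtain c where c: "c \<in> grid" "\<And>j. j \<le> p \<Longrightarrow> \<bar>\<tau> j \<omega> - c j\<bar> \<le> d" unfolding grid_def by blast
    have mono: "D x' c (- d) \<omega> \<le> D x' (\<lambda>j. \<tau> j \<omega>) 0 \<omega>" "D x' (\<lambda>j. \<tau> j \<omega>) 0 \<omega> \<le> D x' c d \<omega>" for x'
    proof -
      have ind_mono: "indicator {..v} y \<le> (indicator {..v'} y :: real)" if "v \<le> v'" for v v' y :: real
        using that by (auto simp: indicator_def)
      show "D x' c (- d) \<omega> \<le> D x' (\<lambda>j. \<tau> j \<omega>) 0 \<omega>" "D x' (\<lambda>j. \<tau> j \<omega>) 0 \<omega> \<le> D x' c d \<omega>"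
        unfolding D_def using s0 lag_lin_sandwich[OF c(2), where f = w and \<omega> = \<omega>]
        by (auto intro!: mult_left_mono sum_mono ind_mono)
    qed
    have lin: "s\<^sup>2 * (\<Sum>t\<in>T. lag_lin p c d u t \<omega>) = s\<^sup>2 * (\<Sum>t\<in>T. lag_lin p c (- d) u t \<omega>) + 2 * d * W \<omega>"
    proof -
      have "lag_lin p c d u t \<omega> = lag_lin p c (- d) u t \<omega> + 2 * d * lag_abs p u t \<omega>" for t
        by (simp add: lag_lin_def)
      then show ?thesis by (simp add: W_def sum.distrib sum_distrib_left algebra_simps)
    qed
    have aW: "a x * (2 * d * W \<omega>) \<le> 2 * B * d * W \<omega>" "- (a x * (2 * d * W \<omega>)) \<le> 2 * B * d * W \<omega>"
    proof -
      have "\<bar>a x * (2 * d * W \<omega>)\<bar> \<le> B * (2 * d * W \<omega>)"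
        using a_bound[of x] d W0[of \<omega>] by (simp add: abs_mult mult_right_mono)
      then show "a x * (2 * d * W \<omega>) \<le> 2 * B * d * W \<omega>" "- (a x * (2 * d * W \<omega>)) \<le> 2 * B * d * W \<omega>"
        by (simp_all add: abs_le_iff mult_ac)
    qed
    \<comment> \<open>The upper bracket at \<open>x\<close> is set against the lower bracket at
      \<open>- x\<close>. By \<open>a (- x) = a x\<close> the drifts cancel except for the gap
      between the two margins, which is \<open>2 * d * W \<omega>\<close>.\<close>
    have up: "?R \<omega> \<le> Er x c d \<omega> - Er (- x) c (- d) \<omega> + a x * (2 * d * W \<omega>)"
      using mono(2)[of x] mono(1)[of "- x"] unfolding R Er_def sym lin by (simp add: algebra_simps)
    have lo: "?R \<omega> \<ge> Er x c (- d) \<omega> - Er (- x) c d \<omega> - a x * (2 * d * W \<omega>)"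
      using mono(1)[of x] mono(2)[of "- x"] unfolding R Er_def sym lin by (simp add: algebra_simps)
    have "\<bar>?R \<omega>\<bar> \<le> ER c \<omega> + 2 * B * d * W \<omega>"
      using up lo aW unfolding ER_def by (smt (verit))
    moreover have "ER c \<omega> \<le> (\<Sum>c\<in>grid. ER c \<omega>)"
      using c(1) ER0 by (intro member_le_sum) (auto simp: grid_def)
    moreover have "indicator (space M - Ev) \<omega> = (0::real)" using True by simp
    ultimately show ?thesis by linarith
  qed
  have "(LINT \<omega>|M. min 1 \<bar>?R \<omega>\<bar>) \<le> (LINT \<omega>|M. indicator (space M - Ev) \<omega> + (\<Sum>c\<in>grid. ER c \<omega>) + 2 * B * d * W \<omega>)"
  proof (rule integral_mono[OF _ _ pw])
    show "integrable M (\<lambda>\<omega>. min 1 \<bar>?R \<omega>\<bar>)"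
      by (rule integrable_const_bound[where B = 1]) auto
  qed (use ER(2) W(2) Ev in \<open>auto simp: emeasure_eq_measure\<close>)
  also have "\<dots> = prob (space M - Ev) + (\<Sum>c\<in>grid. LINT \<omega>|M. ER c \<omega>) + 2 * B * d * (LINT \<omega>|M. W \<omega>)"
    using ER(2) W(2) Ev by (simp add: emeasure_eq_measure)
  also have "\<dots> \<le> prob (space M - Ev) + (\<Sum>c\<in>grid. 4 * lb) + 2 * B * d * (1 + p * sqrt V)"
    using ER(1) W(1) B_nonneg d by (intro add_mono sum_mono mult_left_mono) auto
  finally show "(LINT \<omega>|M. min 1 \<bar>?R \<omega>\<bar>) \<le> prob (space M - Ev) +
      card (coefficient_grid p d K) * (4 * linearization_bound p B L V g (K + 2 * d) n
         (LINT y|Q. min 1 \<bar>B * (1 / sqrt n * (K + 2 * d)) * y\<bar>))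
      + 2 * B * d * (1 + p * sqrt V)"
    by (simp add: lb_def C_def s_def grid_def)
qed

end

section \<open>Smooth symmetric distribution functions\<close>

lemma distribution_function_interval_measure:
  assumes "distribution_function F"
  shows "real_distribution (interval_measure F)" "cdf (interval_measure F) = F"
  using assms unfolding distribution_function_def
  by (auto intro!: real_distribution_interval_measure cdf_interval_measure dest: monoD)

lemma distribution_function_range:
  assumes "distribution_function F"
  shows "0 \<le> F x" "F x \<le> 1"
proof -
  interpret real_distribution "interval_measure F" by (rule distribution_function_interval_measure[OF assms])
  show "0 \<le> F x" "F x \<le> 1"
    using cdf_nonneg[of x] cdf_bounded_prob[of x] by (simp_all add: distribution_function_interval_measure(2)[OF assms])
qed

text \<open>Continuity excludes an atom at \<open>x\<close>, so the probability of
  \<open>{x..}\<close>, which reflection produces, equals that of the complement of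
  \<open>{..x}\<close>.\<close>

lemma symmetric_df_reflect:
  assumes F: "distribution_function F" "symmetric_about_zero F" and cont: "\<And>x. isCont F x"
  shows "F (- x) = 1 - F x"
proof -
  interpret N: real_distribution "interval_measure F" by (rule distribution_function_interval_measure[OF F(1)])
  note cdf = distribution_function_interval_measure(2)[OF F(1)]
  have pt: "measure (interval_measure F) {x} = 0" using N.isCont_cdf[of x] cont[of x] by (simp add: cdf)
  have Fm: "F y = measure (interval_measure F) {..y}" for y
    using fun_cong[OF cdf, of y] by (simp add: cdf_def)
  have "F (- x) = measure (interval_measure F) {..- x}" by (rule Fm)
  also have "\<dots> = measure (distr (interval_measure F) borel uminus) {..- x}"
    using F(2) unfolding symmetric_about_zero_def by simp
  also have "\<dots> = measure (interval_measure F) {x..}"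
    by (subst measure_distr) (auto intro!: arg_cong[where f = "measure (interval_measure F)"])
  also have "{x..} = {x} \<union> (space (interval_measure F) - {..x})" by auto
  also have "measure (interval_measure F) \<dots> = measure (interval_measure F) {x} + measure (interval_measure F) (space (interval_measure F) - {..x})"
    by (rule N.finite_measure_Union) auto
  also have "\<dots> = 1 - F x"
    using N.prob_compl[of "{..x}"] unfolding Fm[of x] pt by simp
  finally show ?thesis .
qed

text \<open>The bounded second derivative makes the density Lipschitz. The density is also bounded:
  on an interval of length 1 it takes, by the mean value theorem, a value equal to an increment of
  \<open>F\<close>, hence at most 1, and the Lipschitz bound carries this to the left end
  point.\<close>

lemma smooth_symmetric_df:
  assumes F: "distribution_function F" "symmetric_about_zero F" "twice_diff_bounded F"
  obtains f B L where "\<And>x. (F has_real_derivative f x) (at x)" "\<And>x. \<bar>f x\<bar> \<le> B" "\<And>x y. \<bar>f x - f y\<bar> \<le> L * \<bar>x - y\<bar>"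
    "\<And>x. f (- x) = f x" "\<And>x. F (- x) = 1 - F x"
proof -
  obtain f f' where f: "\<And>x. (F has_real_derivative f x) (at x)" "\<And>x. (f has_real_derivative f' x) (at x)" "bounded (range f')"
    using F(3) unfolding twice_diff_bounded_def by blast
  obtain L where L: "\<And>x. \<bar>f' x\<bar> \<le> L" using f(3) unfolding bounded_iff by auto
  have lip: "\<bar>f x - f y\<bar> \<le> L * \<bar>x - y\<bar>" for x y
    using field_differentiable_bound[of UNIV f f' L x y] f(2) L by (auto simp: has_field_derivative_at_within)
  have bd: "\<bar>f x\<bar> \<le> 1 + L" for x
  proof -
    obtain y where y: "x < y" "y < x + 1" "F (x + 1) - F x = (x + 1 - x) * f y"
      using MVT2[of x "x + 1" F f] f(1) by auto
    have "\<bar>f y\<bar> \<le> 1"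
      using y distribution_function_range[OF F(1), of x] distribution_function_range[OF F(1), of "x + 1"] by simp
    moreover have "\<bar>f x - f y\<bar> \<le> L * 1"
      using y L[of 0] by (intro order_trans[OF lip] mult_left_mono) auto
    ultimately show ?thesis by linarith
  qed
  have refl: "F (- x) = 1 - F x" for x
    by (rule symmetric_df_reflect[OF F(1,2)]) (rule DERIV_isCont[OF f(1)])
  have "f (- x) = f x" for x
  proof -
    have "((\<lambda>x. F (- x)) has_real_derivative f (- x) * - 1) (at x)"
      by (rule DERIV_chain'[OF _ f(1)]) (auto intro!: derivative_eq_intros)
    moreover have "((\<lambda>x. F (- x)) has_real_derivative - f x) (at x)"
      unfolding refl by (auto intro!: derivative_eq_intros f(1))
    ultimately show ?thesis by (metis DERIV_unique minus_equation_iff mult.right_neutral mult_minus_right)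
  qed
  then show ?thesis using that[OF f(1) bd lip] refl by blast
qed

section \<open>The stationary solution in the contaminated model\<close>

text \<open>Passing to \<open>u\<close> and \<open>z'\<close> alters the data on null sets only and
  makes causality and the values 0 and 1 hold everywhere. The variance bound adds the second moments
  of \<open>G\<close> and \<open>H\<close>, which makes it independent of the mixing weight
  \<open>r\<close>.\<close>

lemma ar_outlier_model_canonical:
  fixes \<beta> \<psi> :: "nat \<Rightarrow> real" and M :: "'a measure"
  assumes model: "ar_outlier_model M p \<beta> \<nu> A g Q \<epsilon> z \<xi> v"
    and p: "p \<ge> 1" and \<nu>: "\<nu> = (1 - (\<Sum>j=1..p. \<beta> j)) * \<mu>"
    and \<psi>: "\<And>k. \<psi> k = (if k = 0 then 1 else 0) + (\<Sum>j=1..p. if j \<le> k then \<beta> j * \<psi> (k - j) else 0)"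
    and sm: "summable (\<lambda>k. \<bar>\<psi> k\<bar>)"
    and GH: "distribution_function G" "distribution_function H" "centered_finite_variance G" "centered_finite_variance H"
    and A: "\<And>x. A x = (1 - r) * G x + r * H x" and r: "0 \<le> r" "r \<le> 1"
    and V: "V = (LINT x|interval_measure G. x\<^sup>2) + (LINT x|interval_measure H. x\<^sup>2)"
    and a: "\<And>x. (A has_real_derivative a x) (at x)" "\<And>x. \<bar>a x\<bar> \<le> B" "\<And>x y. \<bar>a x - a y\<bar> \<le> L * \<bar>x - y\<bar>"
  defines "u \<equiv> \<lambda>t \<omega>. \<Sum>k. \<psi> k * \<epsilon> (t - int k) \<omega>"
    and "z' \<equiv> \<lambda>t \<omega>. of_bool (z t \<omega> = 1) :: real"
  shows "contaminated_ar M \<epsilon> z' \<xi> u A a B L ((\<Sum>k. \<bar>\<psi> k\<bar>)\<^sup>2 * V) g Q"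
    and "AE \<omega> in M. \<forall>t. v t \<omega> = \<mu> + u t \<omega> \<and> z t \<omega> = z' t \<omega> \<and> u t \<omega> = (\<Sum>j=1..p. \<beta> j * u (t - int j) \<omega>) + \<epsilon> t \<omega>"
proof -
  interpret prob_space M using model by (simp add: ar_outlier_model_def)
  have cdfA: "cdf (distr M borel (\<epsilon> t)) = A" for t using model by (simp add: ar_outlier_model_def)
  have iid: "iid_sequence M \<epsilon>" "iid_sequence M z" "iid_sequence M \<xi>"
    and outer: "indep_vars (\<lambda>_. PiM UNIV (\<lambda>_. borel)) (\<lambda>k \<omega> t. ([\<epsilon>, z, \<xi>] ! k) t \<omega>) {..<3::nat}"
    using model by (simp_all add: ar_outlier_model_def)
  have [measurable]: "\<epsilon> t \<in> borel_measurable M" "z t \<in> borel_measurable M" "\<xi> t \<in> borel_measurable M" for t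
    using iid by (auto simp: iid_sequence_def indep_vars_def)
  have vstat: "strictly_stationary M v" using model by (simp add: ar_outlier_model_def)
  then have [measurable]: "v t \<in> borel_measurable M" for t by (simp add: strictly_stationary_def)
  have intsq: "integrable M (\<epsilon> t)" "integrable M (\<lambda>\<omega>. (\<epsilon> t \<omega>)\<^sup>2)" for t
    using model by (auto simp: ar_outlier_model_def)
  have inner: "indep_vars (\<lambda>_. borel) (([\<epsilon>, z, \<xi>] ! k)) UNIV" if "k \<in> {..<3}" for k
  proof -
    have "k = 0 \<or> k = 1 \<or> k = 2" using that by auto
    then show ?thesis using iid by (auto simp: iid_sequence_def)
  qed
  have ind0: "indep_vars (\<lambda>_. borel) (\<lambda>(k, t). ([\<epsilon>, z, \<xi>] ! k) t) ({..<3} \<times> UNIV)"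
    by (rule indep_vars_blocks[OF outer inner])
  \<comment> \<open>\<open>z'\<close> is a function of \<open>z\<close>, applied coordinate by
    coordinate in the block with index 1, so joint independence survives.\<close>
  have ind: "indep_vars (\<lambda>_. borel) (\<lambda>(k, t). ([\<epsilon>, z', \<xi>] ! k) t) ({..<3} \<times> UNIV)"
  proof -
    have "indep_vars (\<lambda>_. borel) (\<lambda>i \<omega>. (if fst i = 1 then of_bool ((case i of (k, t) \<Rightarrow> ([\<epsilon>, z, \<xi>] ! k) t) \<omega> = (1::real))
       else (case i of (k, t) \<Rightarrow> ([\<epsilon>, z, \<xi>] ! k) t) \<omega> :: real)) ({..<3} \<times> UNIV)"
      by (rule indep_vars_compose2[OF ind0, where Y = "\<lambda>i y. if fst i = 1 then of_bool (y = 1) else y"]) (simp add: of_bool_def)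
    then show ?thesis
    proof (rule indep_vars_cong[THEN iffD1, rotated -1])
      fix i :: "nat \<times> int" assume "i \<in> {..<3} \<times> UNIV"
      then have "fst i = 0 \<or> fst i = 1 \<or> fst i = 2" by auto
      then show "(\<lambda>\<omega>. (if fst i = 1 then of_bool ((case i of (k, t) \<Rightarrow> ([\<epsilon>, z, \<xi>] ! k) t) \<omega> = (1::real))
       else (case i of (k, t) \<Rightarrow> ([\<epsilon>, z, \<xi>] ! k) t) \<omega> :: real)) = (case i of (k, t) \<Rightarrow> ([\<epsilon>, z', \<xi>] ! k) t)"
        by (cases i) (auto simp: z'_def fun_eq_iff)
    qed auto
  qed
  have sq: "(LINT \<omega>|M. (\<epsilon> t \<omega>)\<^sup>2) \<le> V" for t
  proof -
    note G = distribution_function_interval_measure[OF GH(1)] and H = distribution_function_interval_measure[OF GH(2)]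
    have iG: "integrable (interval_measure G) (\<lambda>x. x\<^sup>2)" and iH: "integrable (interval_measure H) (\<lambda>x. x\<^sup>2)"
      using GH by (auto simp: centered_finite_variance_def)
    have "ennreal (LINT \<omega>|M. (\<epsilon> t \<omega>)\<^sup>2) = (\<integral>\<^sup>+\<omega>. ennreal ((\<epsilon> t \<omega>)\<^sup>2) \<partial>M)"
      using intsq by (intro nn_integral_eq_integral[symmetric]) auto
    also have "\<dots> = (\<integral>\<^sup>+x. ennreal (x\<^sup>2) \<partial>distr M borel (\<epsilon> t))"
      by (subst nn_integral_distr) auto
    also have "\<dots> = ennreal (1 - r) * (\<integral>\<^sup>+x. ennreal (x\<^sup>2) \<partial>interval_measure G) + ennreal r * (\<integral>\<^sup>+x. ennreal (x\<^sup>2) \<partial>interval_measure H)"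
      using A by (intro nn_integral_mixture G(1) H(1) r real_distribution_distr) (auto simp: cdfA G(2) H(2) fun_eq_iff)
    also have "\<dots> \<le> 1 * (\<integral>\<^sup>+x. ennreal (x\<^sup>2) \<partial>interval_measure G) + 1 * (\<integral>\<^sup>+x. ennreal (x\<^sup>2) \<partial>interval_measure H)"
      using r by (intro add_mono mult_right_mono) auto
    also have "\<dots> = ennreal (LINT x|interval_measure G. x\<^sup>2) + ennreal (LINT x|interval_measure H. x\<^sup>2)"
      using iG iH by (simp add: nn_integral_eq_integral)
    also have "\<dots> = ennreal V"
      unfolding V by (rule ennreal_plus[symmetric]) (auto intro!: Bochner_Integration.integral_nonneg)
    finally show ?thesis
      unfolding V by (subst (asm) ennreal_le_iff) (auto intro!: add_nonneg_nonneg Bochner_Integration.integral_nonneg)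
  qed
  have abs1: "(LINT \<omega>|M. \<bar>\<epsilon> t \<omega>\<bar>) \<le> sqrt V" for t
    by (rule integral_abs_le_sqrt(1)[OF _ intsq(2) sq]) measurable
  have summ: "AE \<omega> in M. summable (\<lambda>k. \<psi> k * \<epsilon> (t - int k) \<omega>)" for t
    by (rule AE_summable_linear_process[OF _ intsq(1) abs1 sm]) measurable
  have zmodel: "measure M {\<omega> \<in> space M. z t \<omega> = 1} = g" "measure M {\<omega> \<in> space M. z t \<omega> = 0} = 1 - g" for t
    using model by (auto simp: ar_outlier_model_def)
  have z'_mean: "(LINT \<omega>|M. z' t \<omega>) = g" for t
  proof -
    have "(LINT \<omega>|M. z' t \<omega>) = (LINT \<omega>|M. indicator {\<omega> \<in> space M. z t \<omega> = 1} \<omega>)"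
      by (intro Bochner_Integration.integral_cong) (auto simp: z'_def)
    then show ?thesis using zmodel(1)[of t] by simp
  qed
  have z_AE: "AE \<omega> in M. z t \<omega> = z' t \<omega>" for t
  proof -
    have "measure M ({\<omega> \<in> space M. z t \<omega> = 1} \<union> {\<omega> \<in> space M. z t \<omega> = 0}) = g + (1 - g)"
      by (subst finite_measure_Union) (auto simp: zmodel)
    then have "AE \<omega> in M. \<omega> \<in> {\<omega> \<in> space M. z t \<omega> = 1} \<union> {\<omega> \<in> space M. z t \<omega> = 0}"
      by (subst AE_in_set_eq_1) auto
    then show ?thesis by eventually_elim (auto simp: z'_def)
  qed
  show "contaminated_ar M \<epsilon> z' \<xi> u A a B L ((\<Sum>k. \<bar>\<psi> k\<bar>)\<^sup>2 * V) g Q"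
  proof (unfold_locales)
    show "distr M borel (\<xi> t) = Q" for t using model by (simp add: ar_outlier_model_def)
    show "z' t \<omega> \<in> {0, 1}" for t \<omega> by (auto simp: z'_def)
    show "u t \<in> borel_measurable (generated M (\<lambda>(k, t). ([\<epsilon>, z', \<xi>] ! k) t) ({0} \<times> {..t}))" for t
    proof -
      have "\<epsilon> (t - int k) \<in> borel_measurable (generated M (\<lambda>(k, t). ([\<epsilon>, z', \<xi>] ! k) t) ({0} \<times> {..t}))" for k
        using measurable_generated_component[of "(0, t - int k)" "{0} \<times> {..t}" "\<lambda>(k, t). ([\<epsilon>, z', \<xi>] ! k) t" M] by simp
      then show ?thesis unfolding u_def by measurable
    qed
    show "integrable M (\<lambda>\<omega>. (u t \<omega>)\<^sup>2)" "(LINT \<omega>|M. (u t \<omega>)\<^sup>2) \<le> (\<Sum>k. \<bar>\<psi> k\<bar>)\<^sup>2 * V" for t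
      unfolding u_def by (rule linear_process_second_moment[OF _ intsq(2) sq sm summ], measurable)+
  qed (fact ind cdfA a z'_mean)+
  \<comment> \<open>The relation between \<open>\<nu>\<close> and \<open>\<mu>\<close> is exactly
    what removes the intercept from the recursion of the centred process.\<close>
  define u0 where "u0 = (\<lambda>t \<omega>. v t \<omega> - \<mu>)"
  have u0rec: "AE \<omega> in M. u0 t \<omega> = (\<Sum>j=1..p. \<beta> j * u0 (t - int j) \<omega>) + \<epsilon> t \<omega>" for t
  proof -
    have "AE \<omega> in M. v t \<omega> = (\<Sum>j=1..p. \<beta> j * v (t - int j) \<omega>) + \<nu> + \<epsilon> t \<omega>"
      using model by (simp add: ar_outlier_model_def)
    then show ?thesis
      by eventually_elim (simp add: u0_def \<nu> right_diff_distrib sum_subtractf sum_distrib_left algebra_simps)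
  qed
  have stat: "distr M borel (u0 t) = distr M borel (u0 0)" for t
  proof -
    have m: "(\<lambda>\<omega> t. v (t + h) \<omega>) \<in> measurable M (PiM UNIV (\<lambda>_. borel))" for h
      using measurable_restrict[of UNIV "\<lambda>t. v (t + h)" M "\<lambda>_. borel"] by (simp add: restrict_UNIV)
    have "distr M (PiM UNIV (\<lambda>_. borel)) (\<lambda>\<omega> s. v (s + t) \<omega>) = distr M (PiM UNIV (\<lambda>_. borel)) (\<lambda>\<omega> s. v (s + 0) \<omega>)"
      using vstat by (simp add: strictly_stationary_def)
    from arg_cong[OF this, where f = "\<lambda>N. distr N borel (\<lambda>f. f 0 - \<mu>)"]
    show ?thesis
      using m[of t] m[of 0] by (simp add: distr_distr comp_def u0_def)
  qed
  have causal: "AE \<omega> in M. u0 t \<omega> = u t \<omega>" for t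
    unfolding u_def
    by (rule ar_causal_representation[OF \<psi> sm p _ _ intsq(1) abs1 stat u0rec]) (auto simp: u0_def)
  have "AE \<omega> in M. \<forall>t. u0 t \<omega> = u t \<omega>" "AE \<omega> in M. \<forall>t. z t \<omega> = z' t \<omega>"
    "AE \<omega> in M. \<forall>t. u0 t \<omega> = (\<Sum>j=1..p. \<beta> j * u0 (t - int j) \<omega>) + \<epsilon> t \<omega>"
    using causal z_AE u0rec by (simp_all add: AE_all_countable)
  then show "AE \<omega> in M. \<forall>t. v t \<omega> = \<mu> + u t \<omega> \<and> z t \<omega> = z' t \<omega> \<and> u t \<omega> = (\<Sum>j=1..p. \<beta> j * u (t - int j) \<omega>) + \<epsilon> t \<omega>"
  proof eventually_elim
    case (elim \<omega>)
    have "v t \<omega> = \<mu> + u t \<omega>" for t using elim(1)[rule_format, of t] by (simp add: u0_def)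
    moreover have "u t \<omega> = (\<Sum>j=1..p. \<beta> j * u (t - int j) \<omega>) + \<epsilon> t \<omega>" for t
      using elim(3)[rule_format, of t] unfolding elim(1)[rule_format] .
    ultimately show ?case using elim(2) by blast
  qed
qed

section \<open>Symmetric cells\<close>

lemma sum_diff_telescope:
  fixes f :: "nat \<Rightarrow> 'b::ab_group_add"
  shows "(\<Sum>j=1..m. f j - f (j - 1)) = f m - f 0"
  by (induction m) auto

text \<open>Half-open, to match the cells. A symmetric cell is the difference of two such nested
  sets, so sums over cells telescope; the outermost set is everything and the innermost one is
  empty.\<close>

definition sym_interval :: "ereal \<Rightarrow> real set" where
  "sym_interval y = {s. - y < ereal s \<and> ereal s \<le> y}"

lemma sym_interval_infinity [simp]: "sym_interval \<infinity> = UNIV"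
  and sym_interval_zero [simp]: "sym_interval 0 = {}"
  by (auto simp: sym_interval_def)

lemma sym_interval_mono: "y \<le> y' \<Longrightarrow> sym_interval y \<subseteq> sym_interval y'"
  unfolding sym_interval_def by (auto intro: order_trans le_less_trans[rotated] simp: ereal_uminus_le_reorder)

lemma sym_interval_real: "sym_interval (ereal r) = {- r<..r}"
  by (auto simp: sym_interval_def)

lemma sym_interval_borel [measurable]: "y \<ge> 0 \<Longrightarrow> sym_interval y \<in> sets borel"
  by (cases y) (auto simp: sym_interval_real)

lemma indicator_sym_interval:
  "r \<ge> 0 \<Longrightarrow> indicator (sym_interval (ereal r)) y = (indicator {..r} y - indicator {..- r} y :: real)"
  by (auto simp: sym_interval_real indicator_def)

lemma cell_boundaries_mono:
  assumes "cell_boundaries m x" "i \<le> j" "j \<le> m"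
  shows "x i \<le> x j"
  using assms(2,3)
proof (induction j rule: dec_induct)
  case (step j)
  have "x j \<le> x (Suc j)" using assms(1) step by (auto simp: cell_boundaries_def intro: less_imp_le)
  then show ?case using step by auto
qed simp

lemma cell_boundaries_cases:
  assumes "cell_boundaries m x" "j \<le> m"
  obtains "x j = \<infinity>" | r where "r \<ge> 0" "x j = ereal r"
proof -
  have "x j \<ge> 0" using cell_boundaries_mono[OF assms(1), of 0 j] assms by (simp add: cell_boundaries_def)
  then show ?thesis using that by (cases "x j") auto
qed

context
  fixes m :: nat and x :: "nat \<Rightarrow> ereal"
  assumes x: "cell_boundaries m x"
begin

lemma x0 [simp]: "x 0 = 0" and xm [simp]: "x m = \<infinity>"
  using x by (auto simp: cell_boundaries_def)

lemma x_nonneg: "j \<le> m \<Longrightarrow> x j \<ge> 0"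
  using cell_boundaries_mono[OF x, of 0 j] by simp

lemma sym_interval_step: "j \<in> {1..m} \<Longrightarrow> sym_interval (x (j - 1)) \<subseteq> sym_interval (x j)"
  by (intro sym_interval_mono cell_boundaries_mono[OF x]) auto

lemma symmetric_cell_eq:
  assumes "j \<in> {1..m}"
  shows "symmetric_cell x j = sym_interval (x j) - sym_interval (x (j - 1))"
proof -
  have le: "x (j - 1) \<le> x j" and nn: "0 \<le> x (j - 1)"
    using assms cell_boundaries_mono[OF x, of "j - 1" j] x_nonneg[of "j - 1"] by auto
  have 1: "- x j < ereal s" if "x (j - 1) < ereal s" for s
    using that nn le by (cases "x j"; cases "x (j - 1)") auto
  have 2: "ereal s \<le> x j" if "ereal s \<le> - x (j - 1)" for s
    using that nn le by (cases "x j"; cases "x (j - 1)") auto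
  show ?thesis
    unfolding symmetric_cell_def sym_interval_def using 1 2 by (auto simp: not_less not_le)
qed

lemma indicator_symmetric_cell:
  assumes "j \<in> {1..m}"
  shows "indicator (symmetric_cell x j) y = (indicator (sym_interval (x j)) y - indicator (sym_interval (x (j - 1))) y :: real)"
  using sym_interval_step[OF assms] unfolding symmetric_cell_eq[OF assms] by (auto simp: indicator_def)

lemma symmetric_cell_borel: "j \<in> {1..m} \<Longrightarrow> symmetric_cell x j \<in> sets borel"
  using x_nonneg[of j] x_nonneg[of "j - 1"] by (subst symmetric_cell_eq) auto

lemma symmetric_cell_disjoint: "disjoint_family_on (symmetric_cell x) {1..m}"
proof -
  have "symmetric_cell x i \<inter> symmetric_cell x j = {}" if "i \<in> {1..m}" "j \<in> {1..m}" "i < j" for i j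
  proof -
    have "sym_interval (x i) \<subseteq> sym_interval (x (j - 1))"
      using that by (intro sym_interval_mono cell_boundaries_mono[OF x]) auto
    then show ?thesis using that by (auto simp: symmetric_cell_eq)
  qed
  then show ?thesis unfolding disjoint_family_on_def by (metis Int_commute linorder_neqE_nat)
qed

lemma sum_indicator_symmetric_cell: "(\<Sum>j=1..m. indicator (symmetric_cell x j) y) = (1::real)"
proof -
  have "(\<Sum>j=1..m. indicator (symmetric_cell x j) y) = (\<Sum>j=1..m. indicator (sym_interval (x j)) y - indicator (sym_interval (x (j - 1))) y :: real)"
    using indicator_symmetric_cell by (intro sum.cong) auto
  also have "\<dots> = 1"
    using sum_diff_telescope[of "\<lambda>j. indicator (sym_interval (x j)) y :: real" m] by simp
  finally show ?thesis .
qed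

lemma symmetric_cell_Union: "(\<Union>j\<in>{1..m}. symmetric_cell x j) = UNIV"
proof (rule ccontr)
  assume "\<not> ?thesis"
  then obtain y where "y \<notin> (\<Union>j\<in>{1..m}. symmetric_cell x j)" by blast
  then have "(\<Sum>j=1..m. indicator (symmetric_cell x j) y) = (0::real)" by (intro sum.neutral) auto
  then show False using sum_indicator_symmetric_cell[of y] by simp
qed

lemma sum_cell_prob:
  assumes "F 0 = 1 / 2"
  shows "(\<Sum>j=1..m. cell_prob F x j) = 1"
  using sum_diff_telescope[of "\<lambda>j. df_at F (x j)" m] assms
  unfolding cell_prob_def sum_distrib_left[symmetric] by (simp add: df_at_def)

lemma sum_cell_shift: "(\<Sum>j=1..m. cell_shift G p \<beta> x Q j) = 0"
  using sum_diff_telescope[of "\<lambda>j. outlier_shift_sym G p \<beta> Q (x j)" m]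
  unfolding cell_shift_def sum_distrib_left[symmetric] by (simp add: outlier_shift_sym_def)

lemma measure_symmetric_cell:
  assumes N: "real_distribution N" and F: "cdf N = F" "\<And>y. F (- y) = 1 - F y" and j: "j \<in> {1..m}"
  shows "measure N (symmetric_cell x j) = cell_prob F x j"
proof -
  interpret N: real_distribution N by (rule N)
  have sym: "measure N (sym_interval (x i)) = 2 * df_at F (x i) - 1" if i: "i \<le> m" for i
  proof (cases rule: cell_boundaries_cases[OF x i])
    case 1
    then show ?thesis using N.prob_space by (simp add: df_at_def)
  next
    case (2 r)
    \<comment> \<open>The point \<open>r = 0\<close> is treated apart, since the interval formula
      asks for distinct end points; both sides vanish there.\<close>
    have "measure N {- r<..r} = F r - F (- r)"
      using N.cdf_diff_eq[of "- r" r] 2 F(1) by (cases "r = 0") auto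
    then show ?thesis using 2 F(2)[of r] by (simp add: df_at_def sym_interval_real)
  qed
  have "measure N (symmetric_cell x j) = measure N (sym_interval (x j)) - measure N (sym_interval (x (j - 1)))"
    unfolding symmetric_cell_eq[OF j]
    by (rule N.finite_measure_Diff) (use j x_nonneg[of j] x_nonneg[of "j - 1"] sym_interval_step[OF j] in auto)
  also have "\<dots> = cell_prob F x j" using sym[of j] sym[of "j - 1"] j by (auto simp: cell_prob_def)
  finally show ?thesis .
qed

lemma cell_count_eq:
  assumes j: "j \<in> {1..m}"
  shows "real (cell_count p n x m0 b y j) = (\<Sum>t\<in>{1..int n}. indicator (sym_interval (x j)) (residual p m0 b y t)
     - indicator (sym_interval (x (j - 1))) (residual p m0 b y t))"
proof -
  have "real (cell_count p n x m0 b y j) = (\<Sum>t\<in>{1..int n}. indicator (symmetric_cell x j) (residual p m0 b y t))"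
    unfolding cell_count_def by (simp add: indicator_def sum.If_cases Int_def)
  then show ?thesis by (simp only: indicator_symmetric_cell[OF j])
qed

end

lemma cell_prob_mixture:
  "cell_prob (\<lambda>y. (1 - r) * G y + r * H y) x j = cell_prob G x j + r * (cell_prob H x j - cell_prob G x j)"
  by (simp add: cell_prob_def df_at_def algebra_simps)

section \<open>Perturbation bounds and local rates\<close>

text \<open>The function is bounded by 1 and has slope at most \<open>sqrt l\<close>, because
  \<open>2 * s \<le> 1 + s\<^sup>2 \<le> exp (s\<^sup>2)\<close> for
  \<open>s = sqrt l * \<bar>y\<bar>\<close>. Thus a perturbation that is small in probability
  changes a Laplace transform little.\<close>

lemma exp_square_diff_le:
  fixes y y' l :: real
  assumes l: "l \<ge> 0"
  shows "\<bar>exp (- l * y\<^sup>2) - exp (- l * y'\<^sup>2)\<bar> \<le> max 1 (sqrt l) * min 1 \<bar>y - y'\<bar>"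
proof -
  have "\<bar>exp (- l * y\<^sup>2) - exp (- l * y'\<^sup>2)\<bar> \<le> sqrt l * \<bar>y - y'\<bar>"
  proof -
    have d: "((\<lambda>y. exp (- l * y\<^sup>2)) has_real_derivative exp (- l * y\<^sup>2) * (- l * (2 * y))) (at y within UNIV)" for y
      by (auto intro!: derivative_eq_intros)
    have b: "norm (exp (- l * y\<^sup>2) * (- l * (2 * y))) \<le> sqrt l" for y
    proof -
      define s where "s = sqrt l * \<bar>y\<bar>"
      have ly: "l * y\<^sup>2 = s\<^sup>2" using l by (simp add: s_def power_mult_distrib)
      have "2 * s \<le> 1 + s\<^sup>2" using zero_le_power2[of "s - 1"] unfolding power2_diff by simp
      also have "\<dots> \<le> exp (s\<^sup>2)" by (rule exp_ge_add_one_self)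
      finally have "2 * s * exp (- s\<^sup>2) \<le> exp (s\<^sup>2) * exp (- s\<^sup>2)" by (rule mult_right_mono) simp
      then have *: "2 * s * exp (- s\<^sup>2) \<le> 1" by (simp add: exp_add[symmetric])
      have "norm (exp (- l * y\<^sup>2) * (- l * (2 * y))) = sqrt l * (2 * s * exp (- s\<^sup>2))"
        using l ly by (simp add: abs_mult s_def)
      also have "\<dots> \<le> sqrt l * 1" using * l by (intro mult_left_mono) auto
      finally show ?thesis by simp
    qed
    show ?thesis using field_differentiable_bound[of UNIV, OF _ d b, of y y'] by simp
  qed
  also have "\<dots> \<le> max 1 (sqrt l) * \<bar>y - y'\<bar>" by (intro mult_right_mono) auto
  finally have 1: "\<bar>exp (- l * y\<^sup>2) - exp (- l * y'\<^sup>2)\<bar> \<le> max 1 (sqrt l) * \<bar>y - y'\<bar>" .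
  have e: "0 \<le> exp (- l * v\<^sup>2)" "exp (- l * v\<^sup>2) \<le> 1" for v using l by auto
  have "\<bar>exp (- l * y\<^sup>2) - exp (- l * y'\<^sup>2)\<bar> \<le> 1" using e[of y] e[of y'] by linarith
  also have "\<dots> \<le> max 1 (sqrt l) * 1" by simp
  finally show ?thesis using 1 by (simp add: min_def)
qed

lemma exp_sum_squares_diff_le:
  fixes y y' :: "'i \<Rightarrow> real"
  assumes l: "l \<ge> 0" and I: "finite I"
  shows "\<bar>exp (- l * (\<Sum>i\<in>I. (y i)\<^sup>2)) - exp (- l * (\<Sum>i\<in>I. (y' i)\<^sup>2))\<bar> \<le> max 1 (sqrt l) * (\<Sum>i\<in>I. min 1 \<bar>y i - y' i\<bar>)"
proof -
  have p: "exp (- l * (\<Sum>i\<in>I. (y i)\<^sup>2)) = (\<Prod>i\<in>I. exp (- l * (y i)\<^sup>2))" for y :: "'i \<Rightarrow> real"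
    using I by (simp add: exp_sum[symmetric] sum_distrib_left sum_negf)
  have "\<bar>exp (- l * (\<Sum>i\<in>I. (y i)\<^sup>2)) - exp (- l * (\<Sum>i\<in>I. (y' i)\<^sup>2))\<bar> \<le> (\<Sum>i\<in>I. \<bar>exp (- l * (y i)\<^sup>2) - exp (- l * (y' i)\<^sup>2)\<bar>)"
    unfolding p using norm_prod_diff[of I "\<lambda>i. exp (- l * (y i)\<^sup>2)" "\<lambda>i. exp (- l * (y' i)\<^sup>2)"] l by simp
  also have "\<dots> \<le> (\<Sum>i\<in>I. max 1 (sqrt l) * min 1 \<bar>y i - y' i\<bar>)"
    by (intro sum_mono exp_square_diff_le l)
  finally show ?thesis by (simp add: sum_distrib_left)
qed

text \<open>\<open>sqrt (n k) * g k\<close> converges, and every term keeps a further factor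
  \<open>g k\<close>, \<open>1 / sqrt (n k)\<close> or \<open>\<phi> k\<close>, possibly under a
  root.\<close>

lemma linearization_bound_tendsto_0:
  fixes n :: "nat \<Rightarrow> nat"
  assumes n: "filterlim n at_top sequentially" "\<And>k. n k \<ge> 1" and g: "(\<lambda>k. sqrt (n k) * g k) \<longlonglongrightarrow> \<gamma>" and \<phi>: "\<phi> \<longlonglongrightarrow> 0"
  shows "(\<lambda>k. linearization_bound p B L V (g k) C (n k) (\<phi> k)) \<longlonglongrightarrow> 0"
proof -
  note inv = tendsto_inverse_sqrt[OF n(1)]
  have g0: "g \<longlonglongrightarrow> 0"
  proof -
    have "(\<lambda>k. (sqrt (n k) * g k) * (1 / sqrt (n k))) \<longlonglongrightarrow> \<gamma> * 0" by (intro tendsto_mult g inv)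
    moreover have "(sqrt (n k) * g k) * (1 / sqrt (n k)) = g k" for k using n(2)[of k] by simp
    ultimately show ?thesis by simp
  qed
  have "(\<lambda>k. sqrt ((real p + 1) * g k + B * (C * (1 + p * sqrt V)) * (1 / sqrt (n k))) +
     (L * (C\<^sup>2 * ((real p + 1) * (1 + p * V))) * (1 / sqrt (n k)) +
       (real p + 1) * (sqrt (n k) * g k) * (2 * B * (C * (1 + p * sqrt V)) * (1 / sqrt (n k)) + p * \<phi> k)) +
     2 * ((real p + 1)\<^sup>2 * ((sqrt (n k) * g k) * g k)) + (real p + 1) * sqrt (g k)) \<longlonglongrightarrow>
     sqrt ((real p + 1) * 0 + B * (C * (1 + p * sqrt V)) * 0) +
     (L * (C\<^sup>2 * ((real p + 1) * (1 + p * V))) * 0 +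
       (real p + 1) * \<gamma> * (2 * B * (C * (1 + p * sqrt V)) * 0 + real p * 0)) +
     2 * ((real p + 1)\<^sup>2 * (\<gamma> * 0)) + (real p + 1) * sqrt 0"
    by (intro tendsto_intros g0 g inv \<phi>)
  moreover have "linearization_bound p B L V (g k) C (n k) (\<phi> k) =
     sqrt ((real p + 1) * g k + B * (C * (1 + p * sqrt V)) * (1 / sqrt (n k))) +
     (L * (C\<^sup>2 * ((real p + 1) * (1 + p * V))) * (1 / sqrt (n k)) +
       (real p + 1) * (sqrt (n k) * g k) * (2 * B * (C * (1 + p * sqrt V)) * (1 / sqrt (n k)) + p * \<phi> k)) +
     2 * ((real p + 1)\<^sup>2 * ((sqrt (n k) * g k) * g k)) + (real p + 1) * sqrt (g k)" for k
  proof -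
    have q: "sqrt (n k) * (X / n k) = X * (1 / sqrt (n k))" for X
      using sqrt_divide_self_eq[of "real (n k)"] by (simp add: divide_inverse mult.left_commute)
    then show ?thesis
      unfolding linearization_bound_def distrib_left[of "sqrt (n k)"] q by (simp add: power2_eq_square mult_ac)
  qed
  ultimately show ?thesis by simp
qed

lemma sqrt_local_rate_tendsto:
  fixes n :: "nat \<Rightarrow> nat"
  assumes n: "filterlim n at_top sequentially" "\<And>k. n k \<ge> 1" and c: "c \<longlonglongrightarrow> c0"
  shows "(\<lambda>k. sqrt (n k) * local_rate (c k) (n k)) \<longlonglongrightarrow> c0"
proof -
  have "(\<lambda>k. c k * (1 / sqrt (n k))) \<longlonglongrightarrow> c0 * 0"
    by (intro tendsto_mult c tendsto_inverse_sqrt n)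
  then have "eventually (\<lambda>k. c k / sqrt (n k) < 1) sequentially"
    by (intro order_tendstoD(2)[of _ 0]) auto
  then have "eventually (\<lambda>k. c k = sqrt (n k) * local_rate (c k) (n k)) sequentially"
  proof eventually_elim
    case (elim k)
    then show ?case using n(2)[of k] by (simp add: local_rate_def)
  qed
  then show ?thesis by (rule Lim_transform_eventually[OF c])
qed

lemma local_rate_range: "c \<ge> 0 \<Longrightarrow> 0 \<le> local_rate c n" "local_rate c n \<le> 1"
  by (auto simp: local_rate_def)

section \<open>Residuals as perturbed innovations\<close>

context contaminated_ar
begin

text \<open>The level error passes through the estimated filter, hence the factor
  \<open>1 - (\<Sum>j=1..p. c j)\<close> in \<open>\<tau> 0\<close>. With this choice the residual
  is exactly affine in \<open>\<tau>\<close>, and no product of errors is left over.\<close>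

lemma residual_representation:
  fixes n :: nat
  assumes n: "n \<ge> 1" and t: "t \<in> {1..int n}"
    and y: "\<And>s. s \<in> obs_times p n \<Longrightarrow> y s = \<mu> + w s \<omega>"
    and u: "u t \<omega> = (\<Sum>j=1..p. \<beta> j * u (t - int j) \<omega>) + e t \<omega>"
    and \<tau>: "\<tau> = (\<lambda>j. if j = 0 then sqrt n * (m0 - \<mu>) * (1 - (\<Sum>j=1..p. c j)) else sqrt n * (c j - \<beta> j))"
  shows "residual p m0 c y t = e t \<omega> - (1 / sqrt n * lag_lin p \<tau> 0 w t \<omega> + shift t \<omega>)"
proof -
  have yt: "y (t - int j) = \<mu> + w (t - int j) \<omega>" if "j \<le> p" for j
    using that t by (intro y) (auto simp: obs_times_def)
  have sh: "shift t \<omega> = - (\<xi> t \<omega> * z t \<omega>) + (\<Sum>j=1..p. \<beta> j * (\<xi> (t - int j) \<omega> * z (t - int j) \<omega>))"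
    unfolding shift_def b_def by (subst sum.atLeast_Suc_atMost) (auto simp: mult.assoc intro!: sum.cong)
  have lin: "1 / sqrt n * lag_lin p \<tau> 0 w t \<omega> = (m0 - \<mu>) * (1 - (\<Sum>j=1..p. c j)) + (\<Sum>j=1..p. (c j - \<beta> j) * w (t - int j) \<omega>)"
  proof -
    have "lag_lin p \<tau> 0 w t \<omega> = sqrt n * ((m0 - \<mu>) * (1 - (\<Sum>j=1..p. c j)) + (\<Sum>j=1..p. (c j - \<beta> j) * w (t - int j) \<omega>))"
      unfolding lag_lin_def \<tau> by (simp add: distrib_left sum_distrib_left mult.assoc)
    then show ?thesis using n by simp
  qed
  have "residual p m0 c y t = (w t \<omega> - (m0 - \<mu>)) - (\<Sum>j=1..p. c j * (w (t - int j) \<omega> - (m0 - \<mu>)))"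
    unfolding residual_def using yt[of 0] yt by (simp add: algebra_simps)
  also have "\<dots> = w t \<omega> - (\<Sum>j=1..p. \<beta> j * w (t - int j) \<omega>) - (1 / sqrt n * lag_lin p \<tau> 0 w t \<omega>)"
    unfolding lin by (simp add: algebra_simps sum_subtractf sum.distrib sum_distrib_left)
  also have "w t \<omega> - (\<Sum>j=1..p. \<beta> j * w (t - int j) \<omega>) = e t \<omega> - shift t \<omega>"
    unfolding w_def sh by (subst u) (simp add: algebra_simps sum.distrib)
  finally show ?thesis by simp
qed

lemma indicator_residual:
  "indicator {..v} (r - h) = (indicator {..v + h} r :: real)" for v r h :: real
  by (auto simp: indicator_def)

lemma count_difference:
  fixes n :: nat
  assumes n: "n \<ge> 1" and r: "r \<ge> 0"
    and y: "\<And>s. s \<in> obs_times p n \<Longrightarrow> y s = \<mu> + w s \<omega>"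
    and u: "\<And>t. u t \<omega> = (\<Sum>j=1..p. \<beta> j * u (t - int j) \<omega>) + e t \<omega>"
    and \<tau>: "(\<lambda>j. \<tau> j \<omega>) = (\<lambda>j. if j = 0 then sqrt n * (m0 - \<mu>) * (1 - (\<Sum>j=1..p. c j)) else sqrt n * (c j - \<beta> j))"
  shows "1 / sqrt n * (\<Sum>t\<in>{1..int n}. indicator (sym_interval (ereal r)) (residual p m0 c y t) - indicator (sym_interval (ereal r)) (e t \<omega>))
    = symmetric_remainder n r \<tau> \<omega> + sqrt n * g * (outlier_effect r - outlier_effect (- r))"
proof -
  have "residual p m0 c y t = e t \<omega> - (1 / sqrt n * lag_lin p (\<lambda>j. \<tau> j \<omega>) 0 w t \<omega> + shift t \<omega>)" if "t \<in> {1..int n}" for t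
    by (rule residual_representation[OF n that y u \<tau>])
  note res = this
  have "(\<Sum>t\<in>{1..int n}. indicator (sym_interval (ereal r)) (residual p m0 c y t) - indicator (sym_interval (ereal r)) (e t \<omega>) :: real)
     = (\<Sum>t\<in>{1..int n}.
        (indicator {..r + (1 / sqrt n * lag_lin p (\<lambda>j. \<tau> j \<omega>) 0 w t \<omega> + shift t \<omega>)} (e t \<omega>) - indicator {..r} (e t \<omega>))
      - (indicator {..- r + (1 / sqrt n * lag_lin p (\<lambda>j. \<tau> j \<omega>) 0 w t \<omega> + shift t \<omega>)} (e t \<omega>) - indicator {..- r} (e t \<omega>)))"
  proof (intro sum.cong refl)
    fix t assume t: "t \<in> {1..int n}"
    show "indicator (sym_interval (ereal r)) (residual p m0 c y t) - indicator (sym_interval (ereal r)) (e t \<omega>) =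
      (indicator {..r + (1 / sqrt n * lag_lin p (\<lambda>j. \<tau> j \<omega>) 0 w t \<omega> + shift t \<omega>)} (e t \<omega>) - indicator {..r} (e t \<omega>))
      - (indicator {..- r + (1 / sqrt n * lag_lin p (\<lambda>j. \<tau> j \<omega>) 0 w t \<omega> + shift t \<omega>)} (e t \<omega>) - indicator {..- r} (e t \<omega>) :: real)"
      unfolding res[OF t] indicator_sym_interval[OF r] indicator_residual by simp
  qed
  then show ?thesis unfolding symmetric_remainder_def by simp
qed

end

section \<open>Convergence along sequences of parameters\<close>

lemma min_one_scale_le: "min 1 \<bar>c * X\<bar> \<le> max 1 \<bar>c\<bar> * min 1 \<bar>X\<bar>" for c X :: real
proof (cases "\<bar>X\<bar> \<le> 1")
  case True
  have "\<bar>c * X\<bar> \<le> max 1 \<bar>c\<bar> * \<bar>X\<bar>" unfolding abs_mult by (intro mult_right_mono) auto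
  then show ?thesis using True by (simp add: min.coboundedI2)
qed simp

lemma outlier_shift_eq:
  assumes Q: "real_distribution Q" and G: "\<And>x. 0 \<le> G x" "\<And>x. G x \<le> 1" "G \<in> borel_measurable borel"
  shows "outlier_shift G p \<beta> Q x = (\<Sum>j=0..p. LINT s|Q. G (x + (if j = 0 then - 1 else \<beta> j) * s) - G x)"
proof -
  interpret Q: real_distribution Q by (rule Q)
  have "integrable Q (\<lambda>s. G (x + c * s))" for c
  proof (rule Q.integrable_const_bound[where B = 1])
    show "(\<lambda>s. G (x + c * s)) \<in> borel_measurable Q" by (rule measurable_compose[OF _ G(3)]) simp
  qed (use G in auto)
  then have "(LINT s|Q. G (x + c * s) - G x) = (LINT s|Q. G (x + c * s)) - G x" for c
    using Q.prob_space by simp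
  then show ?thesis unfolding outlier_shift_def by (simp only:)
qed

lemma outlier_shift_bound:
  assumes Q: "real_distribution Q" and G: "\<And>x. 0 \<le> G x" "\<And>x. G x \<le> 1" "G \<in> borel_measurable borel"
  shows "\<bar>outlier_shift G p \<beta> Q x\<bar> \<le> real p + 1"
proof -
  interpret Q: real_distribution Q by (rule Q)
  have [measurable]: "G \<in> borel_measurable Q" using G(3) by simp
  have m: "(\<lambda>s. G (x + c * s)) \<in> borel_measurable Q" for c
    by (rule measurable_compose[OF _ G(3)]) simp
  have "\<bar>LINT s|Q. G (x + c * s) - G x\<bar> \<le> 1" for c
  proof -
    have d: "\<bar>G v - G y\<bar> \<le> 1" for v y using G(1)[of v] G(2)[of v] G(1)[of y] G(2)[of y] by linarith
    have i: "integrable Q (\<lambda>s. G (x + c * s) - G x)"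
      by (rule Q.integrable_const_bound[where B = 1]) (use d m in auto)
    have "\<bar>LINT s|Q. G (x + c * s) - G x\<bar> \<le> (LINT s|Q. \<bar>G (x + c * s) - G x\<bar>)" by (rule integral_abs_bound)
    also have "\<dots> \<le> (LINT s|Q. 1)" using i d by (intro integral_mono) auto
    finally show ?thesis using Q.prob_space by simp
  qed
  then have "\<bar>outlier_shift G p \<beta> Q x\<bar> \<le> (\<Sum>j=0..p. 1)"
    unfolding outlier_shift_eq[OF assms] by (intro order_trans[OF sum_abs] sum_mono)
  then show ?thesis by simp
qed

lemma outlier_shift_mixture:
  assumes Q: "real_distribution Q" and G: "\<And>x. 0 \<le> G x" "\<And>x. G x \<le> 1" "G \<in> borel_measurable borel"
    and H: "\<And>x. 0 \<le> H x" "\<And>x. H x \<le> 1" "H \<in> borel_measurable borel"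
  shows "outlier_shift (\<lambda>y. (1 - r) * G y + r * H y) p \<beta> Q x = (1 - r) * outlier_shift G p \<beta> Q x + r * outlier_shift H p \<beta> Q x"
proof -
  interpret Q: real_distribution Q by (rule Q)
  have i: "integrable Q (\<lambda>s. F (x + c * s))" if F: "\<And>x. 0 \<le> F x" "\<And>x. F x \<le> 1" "F \<in> borel_measurable borel" for F :: "real \<Rightarrow> real" and c
  proof (rule Q.integrable_const_bound[where B = 1])
    show "(\<lambda>s. F (x + c * s)) \<in> borel_measurable Q" by (rule measurable_compose[OF _ F(3)]) simp
  qed (use F in auto)
  have "(LINT s|Q. (1 - r) * G (x + c * s) + r * H (x + c * s))
     = (1 - r) * (LINT s|Q. G (x + c * s)) + r * (LINT s|Q. H (x + c * s))" for c
    using i[OF G] i[OF H] by simp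
  note eq = this
  have "(LINT s|Q. (1 - r) * G (x + c * s) + r * H (x + c * s)) - ((1 - r) * G x + r * H x)
     = (1 - r) * ((LINT s|Q. G (x + c * s)) - G x) + r * ((LINT s|Q. H (x + c * s)) - H x)" for c
    unfolding eq by (simp add: right_diff_distrib)
  then show ?thesis
    unfolding outlier_shift_def by (simp only: sum.distrib sum_distrib_left)
qed

lemma uniformly_OP1_sequence:
  fixes n :: "nat \<Rightarrow> nat"
  assumes OP: "uniformly_OP1 M X \<Gamma> R" and n: "filterlim n at_top sequentially" and \<eta>: "\<eta> > 0"
    and \<gamma>: "\<And>k. \<gamma>s k \<in> {0..\<Gamma>}" and \<rho>: "\<And>k. \<rho>s k \<in> {0..R}"
  obtains C where "eventually (\<lambda>k. measure (M (n k) (\<gamma>s k) (\<rho>s k))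
     {\<omega> \<in> space (M (n k) (\<gamma>s k) (\<rho>s k)). \<bar>X (n k) (\<gamma>s k) (\<rho>s k) \<omega>\<bar> > C} < \<eta>) sequentially"
proof -
  let ?m = "\<lambda>C n \<gamma> \<rho>. measure (M n \<gamma> \<rho>) {\<omega> \<in> space (M n \<gamma> \<rho>). \<bar>X n \<gamma> \<rho> \<omega>\<bar> > C}"
  have "eventually (\<lambda>C. limsup (\<lambda>n. SUP \<gamma>\<in>{0..\<Gamma>}. SUP \<rho>\<in>{0..R}. ereal (?m C n \<gamma> \<rho>)) < ereal \<eta>) at_top"
    using OP \<eta> unfolding uniformly_OP1_def by (intro order_tendstoD(2)) auto
  then obtain C where "limsup (\<lambda>n. SUP \<gamma>\<in>{0..\<Gamma>}. SUP \<rho>\<in>{0..R}. ereal (?m C n \<gamma> \<rho>)) < ereal \<eta>"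
    by (auto simp: eventually_at_top_linorder)
  from Limsup_lessD[OF this]
  have "eventually (\<lambda>n. (SUP \<gamma>\<in>{0..\<Gamma>}. SUP \<rho>\<in>{0..R}. ereal (?m C n \<gamma> \<rho>)) < ereal \<eta>) sequentially" .
  from eventually_compose_filterlim[OF this n]
  have "eventually (\<lambda>k. ?m C (n k) (\<gamma>s k) (\<rho>s k) < \<eta>) sequentially"
  proof eventually_elim
    case (elim k)
    have "ereal (?m C (n k) (\<gamma>s k) (\<rho>s k)) \<le> (SUP \<rho>\<in>{0..R}. ereal (?m C (n k) (\<gamma>s k) \<rho>))"
      by (rule SUP_upper[OF \<rho>])
    also have "\<dots> \<le> (SUP \<gamma>\<in>{0..\<Gamma>}. SUP \<rho>\<in>{0..R}. ereal (?m C (n k) \<gamma> \<rho>))"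
      by (rule SUP_upper[OF \<gamma>])
    finally have "ereal (?m C (n k) (\<gamma>s k) (\<rho>s k)) < ereal \<eta>" using elim by (rule le_less_trans)
    then show ?case by simp
  qed
  then show ?thesis by (rule that)
qed

text \<open>One sequence of models with sample sizes tending to infinity and convergent parameters;
  convergence along all of these yields uniform convergence on compact parameter sets, given
  continuity of the limit. \<open>B\<close> and \<open>L\<close> serve both \<open>G\<close> and
  \<open>H\<close>, hence every mixture of them.\<close>

locale pearson_sequence =
  fixes p m :: nat and \<beta> \<psi> :: "nat \<Rightarrow> real" and \<nu> \<mu> :: real
    and G H f h :: "real \<Rightarrow> real" and B L :: real and Q :: "real measure" and x :: "nat \<Rightarrow> ereal"
    and P :: "nat \<Rightarrow> 'a measure" and n :: "nat \<Rightarrow> nat" and \<gamma>s \<rho>s :: "nat \<Rightarrow> real" and \<gamma> \<rho> :: real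
    and \<epsilon> z0 \<xi> v :: "nat \<Rightarrow> int \<Rightarrow> 'a \<Rightarrow> real" and Y :: "nat \<Rightarrow> 'a \<Rightarrow> int \<Rightarrow> real"
    and muhat :: "nat \<Rightarrow> (int \<Rightarrow> real) \<Rightarrow> real" and betahat :: "nat \<Rightarrow> (int \<Rightarrow> real) \<Rightarrow> nat \<Rightarrow> real"
  assumes p: "p \<ge> 1" and \<nu>: "\<nu> = (1 - (\<Sum>j=1..p. \<beta> j)) * \<mu>"
    and \<psi>: "\<And>k. \<psi> k = (if k = 0 then 1 else 0) + (\<Sum>j=1..p. if j \<le> k then \<beta> j * \<psi> (k - j) else 0)"
    and summable_\<psi>: "summable (\<lambda>k. \<bar>\<psi> k\<bar>)"
    and df: "distribution_function G" "distribution_function H"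
    and cfv: "centered_finite_variance G" "centered_finite_variance H"
    and G_deriv: "\<And>y. (G has_real_derivative f y) (at y)" "\<And>y. \<bar>f y\<bar> \<le> B" "\<And>y y'. \<bar>f y - f y'\<bar> \<le> L * \<bar>y - y'\<bar>"
      "\<And>y. f (- y) = f y" "\<And>y. G (- y) = 1 - G y"
    and H_deriv: "\<And>y. (H has_real_derivative h y) (at y)" "\<And>y. \<bar>h y\<bar> \<le> B" "\<And>y y'. \<bar>h y - h y'\<bar> \<le> L * \<bar>y - y'\<bar>"
      "\<And>y. h (- y) = h y" "\<And>y. H (- y) = 1 - H y"
    and Q: "real_distribution Q" and m: "m > 1" and x: "cell_boundaries m x"
    and cell_pos: "\<And>j. j \<in> {1..m} \<Longrightarrow> cell_prob G x j > 0"
    and n: "filterlim n at_top sequentially" "\<And>k. n k \<ge> 1"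
    and \<gamma>s: "\<And>k. \<gamma>s k \<ge> 0" "\<gamma>s \<longlonglongrightarrow> \<gamma>" and \<rho>s: "\<And>k. \<rho>s k \<ge> 0" "\<rho>s \<longlonglongrightarrow> \<rho>"
    and model: "\<And>k. ar_outlier_model (P k) p \<beta> \<nu> (local_alternative G H (\<rho>s k) (n k)) (local_rate (\<gamma>s k) (n k)) Q
             (\<epsilon> k) (z0 k) (\<xi> k) (v k)"
    and Y: "\<And>k. Y k = observations p (n k) (v k) (z0 k) (\<xi> k)"
    and muhat: "\<And>k. sample_statistic p (n k) (muhat k)"
    and betahat: "\<And>k j. j \<in> {1..p} \<Longrightarrow> sample_statistic p (n k) (\<lambda>y. betahat k y j)"
    and tight_mu: "\<And>\<eta>. \<eta> > 0 \<Longrightarrow> \<exists>C. eventually (\<lambda>k. measure (P k)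
        {\<omega> \<in> space (P k). \<bar>sqrt (n k) * (muhat k (Y k \<omega>) - \<mu>)\<bar> > C} < \<eta>) sequentially"
    and tight_beta: "\<And>\<eta>. \<eta> > 0 \<Longrightarrow> \<exists>C. eventually (\<lambda>k. measure (P k)
        {\<omega> \<in> space (P k). \<bar>L2_set (\<lambda>j. sqrt (n k) * (betahat k (Y k \<omega>) j - \<beta> j)) {1..p}\<bar> > C} < \<eta>) sequentially"
begin

definition "r k = local_rate (\<rho>s k) (n k)"
definition "g k = local_rate (\<gamma>s k) (n k)"
definition "A k = (\<lambda>y. (1 - r k) * G y + r k * H y)"
definition "a k = (\<lambda>y. (1 - r k) * f y + r k * h y)"
definition "z k t \<omega> = (of_bool (z0 k t \<omega> = 1) :: real)"
definition "u k t \<omega> = (\<Sum>i. \<psi> i * \<epsilon> k (t - int i) \<omega>)"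
definition "V = (\<Sum>k. \<bar>\<psi> k\<bar>)\<^sup>2 * ((LINT y|interval_measure G. y\<^sup>2) + (LINT y|interval_measure H. y\<^sup>2))"

definition "cnt k y \<omega> = 1 / sqrt (n k) * (\<Sum>t\<in>{1..int (n k)}.
   indicator (sym_interval y) (residual p (muhat k (Y k \<omega>)) (betahat k (Y k \<omega>)) (Y k \<omega>) t)
   - indicator (sym_interval y) (\<epsilon> k t \<omega>) :: real)"

definition "tau k j \<omega> = (if j = 0 then sqrt (n k) * (muhat k (Y k \<omega>) - \<mu>) * (1 - (\<Sum>j=1..p. betahat k (Y k \<omega>) j))
   else sqrt (n k) * (betahat k (Y k \<omega>) j - \<beta> j))"

lemma r_range: "0 \<le> r k" "r k \<le> 1" and g_range: "0 \<le> g k" "g k \<le> 1"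
  using \<rho>s(1) \<gamma>s(1) by (auto simp: r_def g_def local_rate_range)

lemma A_eq: "local_alternative G H (\<rho>s k) (n k) = A k"
  by (simp add: local_alternative_def A_def r_def fun_eq_iff)

lemma a_sym: "a k (- y) = a k y" by (simp add: a_def G_deriv H_deriv)

lemma A_sym: "A k (- y) = 1 - A k y" by (simp add: A_def G_deriv(5) H_deriv(5) algebra_simps)

lemma model_facts: "contaminated_ar (P k) (\<epsilon> k) (z k) (\<xi> k) (u k) (A k) (a k) B L V (g k) Q"
  "AE \<omega> in P k. \<forall>t. v k t \<omega> = \<mu> + u k t \<omega> \<and> z0 k t \<omega> = z k t \<omega> \<and> u k t \<omega> = (\<Sum>j=1..p. \<beta> j * u k (t - int j) \<omega>) + \<epsilon> k t \<omega>"
proof -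
  have conv: "\<bar>(1 - r k) * s + r k * t\<bar> \<le> c" if "\<bar>s\<bar> \<le> c" "\<bar>t\<bar> \<le> c" for s t c
  proof -
    have "\<bar>(1 - r k) * s + r k * t\<bar> \<le> (1 - r k) * \<bar>s\<bar> + r k * \<bar>t\<bar>"
      using r_range[of k] by (intro order_trans[OF abs_triangle_ineq]) (simp add: abs_mult)
    also have "\<dots> \<le> (1 - r k) * c + r k * c"
      using r_range[of k] that by (intro add_mono mult_left_mono) auto
    finally show ?thesis by (simp add: algebra_simps)
  qed
  have d: "(A k has_real_derivative a k y) (at y)" for y
    unfolding A_def a_def by (auto intro!: derivative_eq_intros G_deriv(1) H_deriv(1))
  have b: "\<bar>a k y\<bar> \<le> B" for y unfolding a_def by (intro conv G_deriv H_deriv)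
  have l: "\<bar>a k y - a k y'\<bar> \<le> L * \<bar>y - y'\<bar>" for y y'
  proof -
    have "a k y - a k y' = (1 - r k) * (f y - f y') + r k * (h y - h y')" by (simp add: a_def algebra_simps)
    then show ?thesis using conv[OF G_deriv(3) H_deriv(3)] by simp
  qed
  note * = ar_outlier_model_canonical[OF model[of k, unfolded A_eq] p \<nu> \<psi> summable_\<psi> df cfv _ r_range refl d b l]
  have Ax: "A k y = (1 - r k) * G y + r k * H y" for y by (simp add: A_def)
  show "contaminated_ar (P k) (\<epsilon> k) (z k) (\<xi> k) (u k) (A k) (a k) B L V (g k) Q"
    using *(1)[OF Ax] by (simp add: z_def[abs_def] u_def[abs_def] V_def g_def)
  show "AE \<omega> in P k. \<forall>t. v k t \<omega> = \<mu> + u k t \<omega> \<and> z0 k t \<omega> = z k t \<omega> \<and> u k t \<omega> = (\<Sum>j=1..p. \<beta> j * u k (t - int j) \<omega>) + \<epsilon> k t \<omega>"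
    using *(2)[OF Ax] by (simp add: z_def[abs_def] u_def[abs_def])
qed

lemma P_prob: "prob_space (P k)"
  using model_facts(1)[of k] by (simp add: contaminated_ar_def)

lemma iid_meas: "iid_sequence (P k) X \<Longrightarrow> X t \<in> borel_measurable (P k)"
  using prob_space.indep_vars_def[OF P_prob[of k], of "\<lambda>_. borel" X UNIV] by (auto simp: iid_sequence_def)

lemma base_meas: "\<epsilon> k t \<in> borel_measurable (P k)" "z0 k t \<in> borel_measurable (P k)" "\<xi> k t \<in> borel_measurable (P k)" "v k t \<in> borel_measurable (P k)"
  using model[of k] by (auto simp: ar_outlier_model_def strictly_stationary_def intro!: iid_meas)

lemma Y_meas: "Y k \<in> measurable (P k) (PiM (obs_times p (n k)) (\<lambda>_. borel))"
proof -
  note base_meas[measurable]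
  show ?thesis
    unfolding Y observations_def by (intro measurable_restrict) measurable
qed

lemma Y_comp_meas: "t \<in> obs_times p (n k) \<Longrightarrow> (\<lambda>\<omega>. Y k \<omega> t) \<in> borel_measurable (P k)"
  using measurable_compose[OF Y_meas measurable_component_singleton] by simp

lemma muhat_meas: "(\<lambda>\<omega>. muhat k (Y k \<omega>)) \<in> borel_measurable (P k)"
  and betahat_meas: "j \<in> {1..p} \<Longrightarrow> (\<lambda>\<omega>. betahat k (Y k \<omega>) j) \<in> borel_measurable (P k)"
  using measurable_compose[OF Y_meas] muhat betahat unfolding sample_statistic_def by blast+

lemma residual_meas:
  assumes "t \<in> {1..int (n k)}"
  shows "(\<lambda>\<omega>. residual p (muhat k (Y k \<omega>)) (betahat k (Y k \<omega>)) (Y k \<omega>) t) \<in> borel_measurable (P k)"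
  unfolding residual_def
  by (intro borel_measurable_diff borel_measurable_sum borel_measurable_times muhat_meas betahat_meas Y_comp_meas)
    (use assms in \<open>auto simp: obs_times_def\<close>)

lemma cnt_meas:
  assumes "y \<ge> 0"
  shows "cnt k y \<in> borel_measurable (P k)"
  unfolding cnt_def
  by (intro borel_measurable_times borel_measurable_const borel_measurable_sum borel_measurable_diff
      measurable_compose[OF residual_meas borel_measurable_indicator[OF sym_interval_borel[OF assms]]]
      measurable_compose[OF base_meas(1) borel_measurable_indicator[OF sym_interval_borel[OF assms]]])

lemma tau_meas: "j \<le> p \<Longrightarrow> tau k j \<in> borel_measurable (P k)"
proof -
  assume j: "j \<le> p"
  note muhat_meas[measurable]
  have [measurable]: "(\<lambda>\<omega>. \<Sum>j=1..p. betahat k (Y k \<omega>) j) \<in> borel_measurable (P k)"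
    by (intro borel_measurable_sum betahat_meas)
  show ?thesis
  proof (cases "j = 0")
    case True
    show ?thesis unfolding tau_def if_P[OF True] by measurable
  next
    case False
    then have [measurable]: "(\<lambda>\<omega>. betahat k (Y k \<omega>) j) \<in> borel_measurable (P k)" using j by (intro betahat_meas) auto
    show ?thesis using False unfolding tau_def by simp
  qed
qed

lemma rate_limits: "(\<lambda>k. sqrt (n k) * g k) \<longlonglongrightarrow> \<gamma>" "(\<lambda>k. sqrt (n k) * r k) \<longlonglongrightarrow> \<rho>" "r \<longlonglongrightarrow> 0"
proof -
  show "(\<lambda>k. sqrt (n k) * g k) \<longlonglongrightarrow> \<gamma>" unfolding g_def by (rule sqrt_local_rate_tendsto[OF n \<gamma>s(2)])
  show *: "(\<lambda>k. sqrt (n k) * r k) \<longlonglongrightarrow> \<rho>" unfolding r_def by (rule sqrt_local_rate_tendsto[OF n \<rho>s(2)])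
  have "(\<lambda>k. (sqrt (n k) * r k) * (1 / sqrt (n k))) \<longlonglongrightarrow> \<rho> * 0" by (intro tendsto_mult * tendsto_inverse_sqrt n)
  moreover have "(sqrt (n k) * r k) * (1 / sqrt (n k)) = r k" for k using n(2)[of k] by simp
  ultimately show "r \<longlonglongrightarrow> 0" by simp
qed

lemma tau_bound:
  assumes C: "C \<ge> 1" and mu: "\<bar>sqrt (n k) * (muhat k (Y k \<omega>) - \<mu>)\<bar> \<le> C"
    and be: "\<bar>L2_set (\<lambda>j. sqrt (n k) * (betahat k (Y k \<omega>) j - \<beta> j)) {1..p}\<bar> \<le> C" and j: "j \<le> p"
  shows "\<bar>tau k j \<omega>\<bar> \<le> C * (1 + (\<Sum>j=1..p. \<bar>\<beta> j\<bar> + C))"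
proof -
  have S0: "0 \<le> (\<Sum>j=1..p. \<bar>\<beta> j\<bar> + C)" using C by (intro sum_nonneg) auto
  have bj: "\<bar>sqrt (n k) * (betahat k (Y k \<omega>) j - \<beta> j)\<bar> \<le> C" if "j \<in> {1..p}" for j
  proof -
    have "(sqrt (n k) * (betahat k (Y k \<omega>) j - \<beta> j))\<^sup>2 \<le> (\<Sum>j=1..p. (sqrt (n k) * (betahat k (Y k \<omega>) j - \<beta> j))\<^sup>2)"
      using that by (intro member_le_sum) auto
    then have "\<bar>sqrt (n k) * (betahat k (Y k \<omega>) j - \<beta> j)\<bar> \<le> L2_set (\<lambda>j. sqrt (n k) * (betahat k (Y k \<omega>) j - \<beta> j)) {1..p}"
      unfolding L2_set_def by (metis real_sqrt_abs real_sqrt_le_mono)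
    then show ?thesis using be by linarith
  qed
  show ?thesis
  proof (cases "j = 0")
    case True
    have "\<bar>1 - (\<Sum>j=1..p. betahat k (Y k \<omega>) j)\<bar> \<le> 1 + (\<Sum>j=1..p. \<bar>betahat k (Y k \<omega>) j\<bar>)"
      using sum_abs[of "betahat k (Y k \<omega>)" "{1..p}"] by linarith
    also have "\<dots> \<le> 1 + (\<Sum>j=1..p. \<bar>\<beta> j\<bar> + C)"
    proof (intro add_left_mono sum_mono)
      fix j assume "j \<in> {1..p}"
      \<comment> \<open>Since \<open>sqrt (n k)\<close> is at least 1, the bound on the scaled error
        bounds the error itself, and with it the estimated coefficients entering the level
        term.\<close>
      have "1 \<le> sqrt (n k)" using n(2)[of k] by simp
      then have "1 * \<bar>betahat k (Y k \<omega>) j - \<beta> j\<bar> \<le> sqrt (n k) * \<bar>betahat k (Y k \<omega>) j - \<beta> j\<bar>"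
        by (intro mult_right_mono) auto
      also have "\<dots> \<le> C" using bj[OF \<open>j \<in> {1..p}\<close>] by (simp add: abs_mult)
      finally have "\<bar>betahat k (Y k \<omega>) j - \<beta> j\<bar> \<le> C" by simp
      then show "\<bar>betahat k (Y k \<omega>) j\<bar> \<le> \<bar>\<beta> j\<bar> + C" by linarith
    qed
    finally show ?thesis
      using mu C S0 True unfolding tau_def by (simp add: abs_mult mult_mono)
  next
    case False
    have "\<bar>tau k j \<omega>\<bar> \<le> C * 1" using bj[of j] j False by (simp add: tau_def)
    also have "\<dots> \<le> C * (1 + (\<Sum>j=1..p. \<bar>\<beta> j\<bar> + C))" using C S0 by (intro mult_left_mono) auto
    finally show ?thesis .
  qed
qed

text \<open>The order of the choices matters: tightness fixes the cube of half-width
  \<open>K\<close>, then the mesh \<open>d\<close> makes small the one term that does not decrease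
  with the sample size, and only then, with the grid fixed, \<open>k\<close> is taken large.\<close>

lemma remainder_tendsto:
  assumes y: "y \<ge> 0"
  shows "(\<lambda>k. LINT \<omega>|P k. min 1 \<bar>cnt k (ereal y) \<omega> - sqrt (n k) * g k * (outlier_shift (A k) p \<beta> Q y - outlier_shift (A k) p \<beta> Q (- y))\<bar>) \<longlonglongrightarrow> 0"
    (is "(\<lambda>k. ?E k) \<longlonglongrightarrow> 0")
proof (rule LIMSEQ_I)
  fix e :: real assume e: "e > 0"
  \<comment> \<open>There is one exceptional event for each estimator; together they use up a
    quarter of \<open>e\<close>.\<close>
  obtain C1 where C1: "eventually (\<lambda>k. measure (P k) {\<omega> \<in> space (P k). \<bar>sqrt (n k) * (muhat k (Y k \<omega>) - \<mu>)\<bar> > C1} < e / 8) sequentially"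
    using tight_mu[of "e / 8"] e by auto
  obtain C2 where C2: "eventually (\<lambda>k. measure (P k) {\<omega> \<in> space (P k). \<bar>L2_set (\<lambda>j. sqrt (n k) * (betahat k (Y k \<omega>) j - \<beta> j)) {1..p}\<bar> > C2} < e / 8) sequentially"
    using tight_beta[of "e / 8"] e by auto
  define C where "C = max 1 (max C1 C2)"
  define K where "K = C * (1 + (\<Sum>j=1..p. \<bar>\<beta> j\<bar> + C))"
  have C: "C \<ge> 1" by (simp add: C_def)
  have K: "K \<ge> 0" unfolding K_def using C by (intro mult_nonneg_nonneg add_nonneg_nonneg sum_nonneg) auto
  interpret C0: contaminated_ar "P 0" p \<beta> "\<epsilon> 0" "z 0" "\<xi> 0" "u 0" "A 0" "a 0" B L V "g 0" Q by (rule model_facts)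
  \<comment> \<open>The summand 1 keeps \<open>W\<close> positive if \<open>B = 0\<close>.\<close>
  define W where "W = 2 * B * (1 + p * sqrt V) + 1"
  have W: "W > 0" unfolding W_def using C0.B_nonneg C0.V_nonneg by (intro add_nonneg_pos mult_nonneg_nonneg) auto
  define d where "d = e / (4 * W)"
  have d: "d > 0" using e W by (simp add: d_def)
  have dW: "2 * B * d * (1 + p * sqrt V) \<le> e / 4"
  proof -
    have "2 * B * d * (1 + p * sqrt V) = d * (W - 1)" by (simp add: W_def algebra_simps)
    also have "\<dots> \<le> d * W" using d by (intro mult_left_mono) auto
    finally show ?thesis using W by (simp add: d_def)
  qed
  define lb where "lb = (\<lambda>k. linearization_bound p B L V (g k) (K + 2 * d) (n k) (LINT y|Q. min 1 \<bar>B * (1 / sqrt (n k) * (K + 2 * d)) * y\<bar>))"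
  have lb0: "lb \<longlonglongrightarrow> 0"
    unfolding lb_def
  proof (rule linearization_bound_tendsto_0[OF n rate_limits(1)])
    interpret Q: real_distribution Q by (rule Q)
    have "(\<lambda>k. B * (1 / sqrt (n k) * (K + 2 * d))) \<longlonglongrightarrow> B * (0 * (K + 2 * d))"
      by (intro tendsto_intros tendsto_inverse_sqrt n)
    then show "(\<lambda>k. LINT y|Q. min 1 \<bar>B * (1 / sqrt (n k) * (K + 2 * d)) * y\<bar>) \<longlonglongrightarrow> 0"
      by (intro tendsto_integral_min_scaled Q.prob_space_axioms) auto
  qed
  have "(\<lambda>k. card (coefficient_grid p d K) * (4 * lb k)) \<longlonglongrightarrow> real (card (coefficient_grid p d K)) * (4 * 0)"
    by (intro tendsto_intros lb0)
  then have "eventually (\<lambda>k. card (coefficient_grid p d K) * (4 * lb k) < e / 4) sequentially"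
    using e by (intro order_tendstoD(2)) auto
  then have "eventually (\<lambda>k. norm (?E k - 0) < e) sequentially"
    using C1 C2
  proof eventually_elim
    case (elim k)
    interpret C: contaminated_ar "P k" p \<beta> "\<epsilon> k" "z k" "\<xi> k" "u k" "A k" "a k" B L V "g k" Q by (rule model_facts)
    define X1 where "X1 = (\<lambda>\<omega>. sqrt (n k) * (muhat k (Y k \<omega>) - \<mu>))"
    define X2 where "X2 = (\<lambda>\<omega>. L2_set (\<lambda>j. sqrt (n k) * (betahat k (Y k \<omega>) j - \<beta> j)) {1..p})"
    have [measurable]: "X1 \<in> borel_measurable (P k)" unfolding X1_def using muhat_meas by measurable
    have [measurable]: "X2 \<in> borel_measurable (P k)" unfolding X2_def L2_set_def
      by (intro measurable_compose[OF _ borel_measurable_sqrt] borel_measurable_sum borel_measurable_power borel_measurable_times borel_measurable_diff borel_measurable_const betahat_meas)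
    define Ev where "Ev = {\<omega> \<in> space (P k). \<bar>X1 \<omega>\<bar> \<le> C \<and> \<bar>X2 \<omega>\<bar> \<le> C}"
    have Ev[measurable]: "Ev \<in> sets (P k)" unfolding Ev_def by measurable
    have "C.prob (space (P k) - Ev) \<le> C.prob ({\<omega> \<in> space (P k). \<bar>X1 \<omega>\<bar> > C1} \<union> {\<omega> \<in> space (P k). \<bar>X2 \<omega>\<bar> > C2})"
      by (intro C.finite_measure_mono) (auto simp: Ev_def C_def not_le)
    also have "\<dots> \<le> C.prob {\<omega> \<in> space (P k). \<bar>X1 \<omega>\<bar> > C1} + C.prob {\<omega> \<in> space (P k). \<bar>X2 \<omega>\<bar> > C2}"
      by (intro measure_Un_le) auto
    finally have Evp: "C.prob (space (P k) - Ev) < e / 4" using elim(2,3) by (simp add: X1_def X2_def)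
    have tb: "\<bar>tau k j \<omega>\<bar> \<le> K" if "\<omega> \<in> Ev" "j \<le> p" for j \<omega>
      unfolding K_def by (rule tau_bound[OF C _ _ that(2)]) (use that in \<open>auto simp: Ev_def X1_def X2_def\<close>)
    note sr = C.symmetric_remainder_le[OF n(2)[of k] a_sym[of k y] d K tau_meas Ev tb]
    have oe: "C.outlier_effect y' = outlier_shift (A k) p \<beta> Q y'" for y'
      unfolding C.outlier_effect_def C.b_def by (rule outlier_shift_eq[OF Q C.A_range C.A_meas, symmetric])
    \<comment> \<open>The recursion and the identification of \<open>v\<close> with
      \<open>\<mu> + u\<close> hold almost surely, so the integrands agree off a null set.\<close>
    have "AE \<omega> in P k. cnt k (ereal y) \<omega> - sqrt (n k) * g k * (outlier_shift (A k) p \<beta> Q y - outlier_shift (A k) p \<beta> Q (- y)) = C.symmetric_remainder (n k) y (tau k) \<omega>"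
      using model_facts(2)[of k]
    proof eventually_elim
      case (elim \<omega>)
      have vw: "v k s \<omega> = \<mu> + u k s \<omega>" "z0 k s \<omega> = z k s \<omega>" for s using elim by blast+
      have Yw: "Y k \<omega> s = \<mu> + C.w s \<omega>" if "s \<in> obs_times p (n k)" for s
        using that by (simp add: Y observations_def C.w_def vw)
      have uu: "u k t \<omega> = (\<Sum>j=1..p. \<beta> j * u k (t - int j) \<omega>) + \<epsilon> k t \<omega>" for t using elim by blast
      have "cnt k (ereal y) \<omega> = C.symmetric_remainder (n k) y (tau k) \<omega> + sqrt (n k) * g k * (C.outlier_effect y - C.outlier_effect (- y))"
        unfolding cnt_def by (rule C.count_difference[OF n(2) y Yw uu]) (auto simp: tau_def)
      then show ?case by (simp add: oe)
    qed
    then have "?E k = (LINT \<omega>|P k. min 1 \<bar>C.symmetric_remainder (n k) y (tau k) \<omega>\<bar>)"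
      using cnt_meas[of "ereal y" k] sr(1) y by (intro integral_cong_AE) (auto elim!: eventually_mono)
    also have "\<dots> \<le> C.prob (space (P k) - Ev) + card (coefficient_grid p d K) * (4 * lb k) + 2 * B * d * (1 + p * sqrt V)"
      unfolding lb_def by (rule sr(2))
    also have "\<dots> < e" using Evp elim(1) dW e by linarith
    finally have "?E k < e" .
    moreover have "?E k \<ge> 0" by (rule Bochner_Integration.integral_nonneg) simp
    ultimately show ?case by simp
  qed
  then show "\<exists>no. \<forall>k\<ge>no. norm (?E k - 0) < e" by (simp add: eventually_sequentially)
qed

end

section \<open>Normalized cell counts and the limit law of the statistic\<close>

context pearson_sequence
begin

lemma G_range: "0 \<le> G y" "G y \<le> 1" "G \<in> borel_measurable borel"
  and H_range: "0 \<le> H y" "H y \<le> 1" "H \<in> borel_measurable borel"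
  using distribution_function_range[OF df(1)] distribution_function_range[OF df(2)] df
  by (auto simp: distribution_function_def intro!: borel_measurable_mono)

lemma drift_tendsto:
  "(\<lambda>k. sqrt (n k) * g k * (outlier_shift (A k) p \<beta> Q y - outlier_shift (A k) p \<beta> Q (- y)))
    \<longlonglongrightarrow> \<gamma> * (outlier_shift G p \<beta> Q y - outlier_shift G p \<beta> Q (- y))"
proof -
  have "(\<lambda>k. sqrt (n k) * g k * (((1 - r k) * outlier_shift G p \<beta> Q y + r k * outlier_shift H p \<beta> Q y)
      - ((1 - r k) * outlier_shift G p \<beta> Q (- y) + r k * outlier_shift H p \<beta> Q (- y))))
    \<longlonglongrightarrow> \<gamma> * (((1 - 0) * outlier_shift G p \<beta> Q y + 0 * outlier_shift H p \<beta> Q y)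
      - ((1 - 0) * outlier_shift G p \<beta> Q (- y) + 0 * outlier_shift H p \<beta> Q (- y)))"
    by (intro tendsto_intros rate_limits)
  then show ?thesis
    unfolding A_def outlier_shift_mixture[OF Q G_range H_range] by simp
qed

lemma cnt_tendsto:
  assumes j: "j \<le> m"
  shows "(\<lambda>k. LINT \<omega>|P k. min 1 \<bar>cnt k (x j) \<omega> - 2 * \<gamma> * outlier_shift_sym G p \<beta> Q (x j)\<bar>) \<longlonglongrightarrow> 0"
proof (cases rule: cell_boundaries_cases[OF x j])
  case 1
  then show ?thesis by (simp add: cnt_def outlier_shift_sym_def)
next
  case (2 y)
  let ?D = "\<lambda>k. sqrt (n k) * g k * (outlier_shift (A k) p \<beta> Q y - outlier_shift (A k) p \<beta> Q (- y))"
  let ?c = "2 * \<gamma> * outlier_shift_sym G p \<beta> Q (x j)"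
  have c: "?c = \<gamma> * (outlier_shift G p \<beta> Q y - outlier_shift G p \<beta> Q (- y))"
    by (simp add: 2 outlier_shift_sym_def)
  have "?D \<longlonglongrightarrow> ?c" unfolding c by (rule drift_tendsto)
  then have "(\<lambda>k. \<bar>?D k - ?c\<bar>) \<longlonglongrightarrow> \<bar>?c - ?c\<bar>"
    by (intro tendsto_rabs tendsto_diff tendsto_const)
  then have D: "(\<lambda>k. \<bar>?D k - ?c\<bar>) \<longlonglongrightarrow> 0" by simp
  show ?thesis
  proof (rule Lim_null_comparison)
    show "eventually (\<lambda>k. norm (LINT \<omega>|P k. min 1 \<bar>cnt k (x j) \<omega> - ?c\<bar>)
      \<le> (LINT \<omega>|P k. min 1 \<bar>cnt k (ereal y) \<omega> - ?D k\<bar>) + \<bar>?D k - ?c\<bar>) sequentially"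
    proof (intro always_eventually allI)
      fix k
      interpret Pk: prob_space "P k" by (rule P_prob)
      have [measurable]: "cnt k (ereal y) \<in> borel_measurable (P k)" using 2 by (intro cnt_meas) auto
      have "(LINT \<omega>|P k. min 1 \<bar>cnt k (ereal y) \<omega> - ?c\<bar>)
        \<le> (LINT \<omega>|P k. min 1 \<bar>cnt k (ereal y) \<omega> - ?D k\<bar>) + (LINT \<omega>|P k. min 1 \<bar>?D k - ?c\<bar>)"
      proof (rule Pk.integral_min_one_le_add)
        show "AE \<omega> in P k. \<bar>cnt k (ereal y) \<omega> - ?c\<bar> \<le> \<bar>cnt k (ereal y) \<omega> - ?D k\<bar> + \<bar>?D k - ?c\<bar>"
        proof (rule AE_I2)
          fix \<omega>
          show "\<bar>cnt k (ereal y) \<omega> - ?c\<bar> \<le> \<bar>cnt k (ereal y) \<omega> - ?D k\<bar> + \<bar>?D k - ?c\<bar>"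
            using abs_triangle_ineq[of "cnt k (ereal y) \<omega> - ?D k" "?D k - ?c"] by (simp only: diff_add_cancel add_diff_eq)
        qed
      qed measurable
      also have "(LINT \<omega>|P k. min 1 \<bar>?D k - ?c\<bar>) = min 1 \<bar>?D k - ?c\<bar>" using Pk.prob_space by simp
      also have "\<dots> \<le> \<bar>?D k - ?c\<bar>" by simp
      finally show "norm (LINT \<omega>|P k. min 1 \<bar>cnt k (x j) \<omega> - ?c\<bar>)
      \<le> (LINT \<omega>|P k. min 1 \<bar>cnt k (ereal y) \<omega> - ?D k\<bar>) + \<bar>?D k - ?c\<bar>"
        by (simp add: 2 Bochner_Integration.integral_nonneg)
    qed
    show "(\<lambda>k. (LINT \<omega>|P k. min 1 \<bar>cnt k (ereal y) \<omega> - ?D k\<bar>) + \<bar>?D k - ?c\<bar>) \<longlonglongrightarrow> 0"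
      using tendsto_add[OF remainder_tendsto D] 2 by simp
  qed
qed

definition "pr j = cell_prob G x j"
text \<open>The standardized counts of the true innovations. Estimation and outliers are collected
  in \<open>perturbation\<close>, whose limit in probability is the constant \<open>bias\<close>;
  \<open>drift\<close> is the effect of the local alternative on the cell probabilities.\<close>

definition "dev k j \<omega> = (real (card {t \<in> {1..int (n k)}. \<epsilon> k t \<omega> \<in> symmetric_cell x j}) - card {1..int (n k)} * pr j)
   / sqrt (card {1..int (n k)} * pr j)"
definition "perturbation k j \<omega> = (cnt k (x j) \<omega> - cnt k (x (j - 1)) \<omega>) / sqrt (pr j)"
definition "bias j = \<gamma> * cell_shift G p \<beta> x Q j / sqrt (pr j)"
definition "drift j = \<rho> * (cell_prob H x j - pr j)"
definition "stat k \<omega> = pearson_statistic G m x p (n k) (muhat k (Y k \<omega>)) (betahat k (Y k \<omega>)) (Y k \<omega>)"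

lemma pr_pos: "j \<in> {1..m} \<Longrightarrow> pr j > 0"
  by (simp add: pr_def cell_pos)

lemma sum_pr: "(\<Sum>j=1..m. pr j) = 1"
  unfolding pr_def by (rule sum_cell_prob[OF x]) (use G_deriv(5)[of 0] in simp)

lemma perturbation_tendsto:
  assumes j: "j \<in> {1..m}"
  shows "(\<lambda>k. LINT \<omega>|P k. min 1 \<bar>perturbation k j \<omega> - bias j\<bar>) \<longlonglongrightarrow> 0"
proof -
  let ?c = "\<lambda>j. 2 * \<gamma> * outlier_shift_sym G p \<beta> Q (x j)"
  let ?K = "max 1 \<bar>1 / sqrt (pr j)\<bar>"
  have b: "perturbation k j \<omega> - bias j = 1 / sqrt (pr j) * ((cnt k (x j) \<omega> - ?c j) - (cnt k (x (j - 1)) \<omega> - ?c (j - 1)))" for k \<omega>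
    by (simp add: perturbation_def bias_def cell_shift_def algebra_simps diff_divide_distrib add_divide_distrib)
  show ?thesis
  proof (rule Lim_null_comparison)
    show "eventually (\<lambda>k. norm (LINT \<omega>|P k. min 1 \<bar>perturbation k j \<omega> - bias j\<bar>)
       \<le> ?K * ((LINT \<omega>|P k. min 1 \<bar>cnt k (x j) \<omega> - ?c j\<bar>) + (LINT \<omega>|P k. min 1 \<bar>cnt k (x (j - 1)) \<omega> - ?c (j - 1)\<bar>))) sequentially"
    proof (intro always_eventually allI)
      fix k
      interpret Pk: prob_space "P k" by (rule P_prob)
      have cm[measurable]: "cnt k (x i) \<in> borel_measurable (P k)" if "i \<le> m" for i
        using that by (intro cnt_meas x_nonneg[OF x])
      have jm: "j \<le> m" "j - 1 \<le> m" using j by auto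
      let ?X = "\<lambda>\<omega>. (cnt k (x j) \<omega> - ?c j) - (cnt k (x (j - 1)) \<omega> - ?c (j - 1))"
      have Xm: "?X \<in> borel_measurable (P k)" using jm by measurable
      have "(LINT \<omega>|P k. min 1 \<bar>perturbation k j \<omega> - bias j\<bar>) \<le> (LINT \<omega>|P k. ?K * min 1 \<bar>?X \<omega>\<bar>)"
        unfolding b
        by (intro integral_mono min_one_scale_le integrable_mult_right Pk.integrable_const_bound[where B = 1]) (use Xm in auto)
      also have "\<dots> = ?K * (LINT \<omega>|P k. min 1 \<bar>?X \<omega>\<bar>)" by simp
      also have "\<dots> \<le> ?K * ((LINT \<omega>|P k. min 1 \<bar>cnt k (x j) \<omega> - ?c j\<bar>) + (LINT \<omega>|P k. min 1 \<bar>cnt k (x (j - 1)) \<omega> - ?c (j - 1)\<bar>))"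
      proof (intro mult_left_mono Pk.integral_min_one_le_add Xm)
        show "AE \<omega> in P k. \<bar>?X \<omega>\<bar> \<le> \<bar>cnt k (x j) \<omega> - ?c j\<bar> + \<bar>cnt k (x (j - 1)) \<omega> - ?c (j - 1)\<bar>"
          by (intro AE_I2 abs_triangle_ineq4)
      qed (use cm[OF jm(1)] cm[OF jm(2)] in auto)
      finally show "norm (LINT \<omega>|P k. min 1 \<bar>perturbation k j \<omega> - bias j\<bar>)
       \<le> ?K * ((LINT \<omega>|P k. min 1 \<bar>cnt k (x j) \<omega> - ?c j\<bar>) + (LINT \<omega>|P k. min 1 \<bar>cnt k (x (j - 1)) \<omega> - ?c (j - 1)\<bar>))"
        by (simp add: Bochner_Integration.integral_nonneg)
    qed
    have "(\<lambda>k. ?K * ((LINT \<omega>|P k. min 1 \<bar>cnt k (x j) \<omega> - ?c j\<bar>) + (LINT \<omega>|P k. min 1 \<bar>cnt k (x (j - 1)) \<omega> - ?c (j - 1)\<bar>)))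
       \<longlonglongrightarrow> ?K * (0 + 0)"
      by (intro tendsto_mult tendsto_add tendsto_const cnt_tendsto) (use j in auto)
    then show "(\<lambda>k. ?K * ((LINT \<omega>|P k. min 1 \<bar>cnt k (x j) \<omega> - ?c j\<bar>) + (LINT \<omega>|P k. min 1 \<bar>cnt k (x (j - 1)) \<omega> - ?c (j - 1)\<bar>)))
       \<longlonglongrightarrow> 0" by simp
  qed
qed

lemma card_cell: "j \<in> {1..m} \<Longrightarrow> real (card {t \<in> {1..int (n k)}. \<epsilon> k t \<omega> \<in> symmetric_cell x j}) =
    (\<Sum>t\<in>{1..int (n k)}. indicator (symmetric_cell x j) (\<epsilon> k t \<omega>))"
  by (simp add: indicator_def sum.If_cases Int_def)

lemma stat_eq: "stat k \<omega> = (\<Sum>j=1..m. (dev k j \<omega> + perturbation k j \<omega>)\<^sup>2)"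
  unfolding stat_def pearson_statistic_def
proof (intro sum.cong refl)
  fix j assume j: "j \<in> {1..m}"
  let ?c = "cell_count p (n k) x (muhat k (Y k \<omega>)) (betahat k (Y k \<omega>)) (Y k \<omega>) j"
  have sn: "sqrt (n k) > 0" using n(2)[of k] by simp
  have "real ?c - real (card {t \<in> {1..int (n k)}. \<epsilon> k t \<omega> \<in> symmetric_cell x j})
     = sqrt (n k) * (cnt k (x j) \<omega> - cnt k (x (j - 1)) \<omega>)"
    unfolding cell_count_eq[OF x j] card_cell[OF j] indicator_symmetric_cell[OF x j] cnt_def
    using sn by (simp add: sum_subtractf right_diff_distrib)
  then have "real ?c - n k * pr j = (real (card {t \<in> {1..int (n k)}. \<epsilon> k t \<omega> \<in> symmetric_cell x j}) - n k * pr j)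
     + sqrt (n k) * (cnt k (x j) \<omega> - cnt k (x (j - 1)) \<omega>)" by simp
  then have "(real ?c - n k * pr j) / sqrt (n k * pr j) = (real (card {t \<in> {1..int (n k)}. \<epsilon> k t \<omega> \<in> symmetric_cell x j}) - n k * pr j) / sqrt (n k * pr j)
     + sqrt (n k) * (cnt k (x j) \<omega> - cnt k (x (j - 1)) \<omega>) / sqrt (n k * pr j)"
    by (simp only: add_divide_distrib)
  also have "sqrt (n k) * (cnt k (x j) \<omega> - cnt k (x (j - 1)) \<omega>) / sqrt (n k * pr j) = perturbation k j \<omega>"
    using sn by (simp add: perturbation_def real_sqrt_mult)
  finally have "(real ?c - n k * pr j) / sqrt (n k * pr j) = dev k j \<omega> + perturbation k j \<omega>"
    by (simp add: dev_def)
  moreover have "((real ?c - n k * pr j) / sqrt (n k * pr j))\<^sup>2 = (real ?c - n k * pr j)\<^sup>2 / (n k * pr j)"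
    using pr_pos[OF j] by (simp add: power_divide)
  ultimately show "(real ?c - n k * cell_prob G x j)\<^sup>2 / (n k * cell_prob G x j) = (dev k j \<omega> + perturbation k j \<omega>)\<^sup>2"
    by (simp add: pr_def)
qed

lemma dev_meas: "j \<in> {1..m} \<Longrightarrow> dev k j \<in> borel_measurable (P k)"
  unfolding dev_def card_cell
  by (intro borel_measurable_divide borel_measurable_diff borel_measurable_sum borel_measurable_const
      measurable_compose[OF base_meas(1) borel_measurable_indicator[OF symmetric_cell_borel[OF x]]])

lemma perturbation_meas: "j \<in> {1..m} \<Longrightarrow> perturbation k j \<in> borel_measurable (P k)"
  unfolding perturbation_def
  by (intro borel_measurable_divide borel_measurable_diff borel_measurable_const cnt_meas x_nonneg[OF x]) auto

text \<open>Each innovation falls into exactly one cell, so the counts add up to \<open>n k\<close>.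
  The vector of the \<open>sqrt (pr j)\<close> is the unit normal of the hyperplane carrying the
  deviations.\<close>

lemma dev_orthogonal: "(\<Sum>j=1..m. sqrt (pr j) * dev k j \<omega>) = 0"
proof -
  have "sqrt (pr j) * dev k j \<omega> = (real (card {t \<in> {1..int (n k)}. \<epsilon> k t \<omega> \<in> symmetric_cell x j}) - n k * pr j) / sqrt (n k)"
    if "j \<in> {1..m}" for j
    using pr_pos[OF that] by (simp add: dev_def real_sqrt_mult)
  then have "(\<Sum>j=1..m. sqrt (pr j) * dev k j \<omega>)
    = (\<Sum>j=1..m. (real (card {t \<in> {1..int (n k)}. \<epsilon> k t \<omega> \<in> symmetric_cell x j}) - n k * pr j) / sqrt (n k))"
    by (rule sum.cong[OF refl])
  also have "\<dots> = ((\<Sum>j=1..m. real (card {t \<in> {1..int (n k)}. \<epsilon> k t \<omega> \<in> symmetric_cell x j})) - n k * (\<Sum>j=1..m. pr j)) / sqrt (n k)"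
    by (simp add: sum_divide_distrib[symmetric] sum_subtractf sum_distrib_left)
  also have "(\<Sum>j=1..m. real (card {t \<in> {1..int (n k)}. \<epsilon> k t \<omega> \<in> symmetric_cell x j}))
     = (\<Sum>j=1..m. \<Sum>t\<in>{1..int (n k)}. indicator (symmetric_cell x j) (\<epsilon> k t \<omega>))"
    by (intro sum.cong refl card_cell)
  also have "\<dots> = (\<Sum>t\<in>{1..int (n k)}. \<Sum>j=1..m. indicator (symmetric_cell x j) (\<epsilon> k t \<omega>))" by (rule sum.swap)
  also have "\<dots> = n k" unfolding sum_indicator_symmetric_cell[OF x] by simp
  finally show ?thesis unfolding sum_pr by simp
qed

lemma dev_cf_tendsto:
  "(\<lambda>k. LINT \<omega>|P k. iexp (\<Sum>j=1..m. w j * (dev k j \<omega> + bias j))) \<longlonglongrightarrow>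
    iexp (\<Sum>j=1..m. w j * (drift j / sqrt (pr j) + bias j)) *
      of_real (exp (- ((\<Sum>j=1..m. (w j)\<^sup>2) - (\<Sum>j=1..m. sqrt (pr j) * w j)\<^sup>2) / 2))"
proof -
  have cn: "card {1..int (n k)} = n k" for k by simp
  have "(\<lambda>k. LINT \<omega>|P k. iexp (\<Sum>j=1..m. w j * dev k j \<omega>)) \<longlonglongrightarrow>
    iexp (\<Sum>j=1..m. w j * (drift j / sqrt (pr j))) *
      of_real (exp (- ((\<Sum>j=1..m. (w j)\<^sup>2) - (\<Sum>j=1..m. sqrt (pr j) * w j)\<^sup>2) / 2))"
    unfolding dev_def
  proof (rule multinomial_cf_tendsto[where pk = "\<lambda>k j. cell_prob (A k) x j"])
    show "filterlim (\<lambda>k. card {1..int (n k)}) at_top sequentially" using n(1) by simp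
    show "prob_space.indep_vars (P k) (\<lambda>_. borel) (\<epsilon> k) {1..int (n k)}" for k
      using model[of k] prob_space.indep_vars_subset[OF P_prob, of k "\<lambda>_. borel" "\<epsilon> k" UNIV]
      by (auto simp: ar_outlier_model_def iid_sequence_def)
    show "measure (P k) {\<omega> \<in> space (P k). \<epsilon> k t \<omega> \<in> symmetric_cell x j} = cell_prob (A k) x j" if j: "j \<in> {1..m}" for k t j
    proof -
      interpret Pk: prob_space "P k" by (rule P_prob)
      have cdf: "cdf (distr (P k) borel (\<epsilon> k t)) = A k" using model[of k] by (simp add: ar_outlier_model_def A_eq)
      have "measure (distr (P k) borel (\<epsilon> k t)) (symmetric_cell x j) = cell_prob (A k) x j"
        by (rule measure_symmetric_cell[OF x _ cdf A_sym j]) (intro Pk.real_distribution_distr base_meas)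
      then show ?thesis
        using base_meas(1)[of k t] symmetric_cell_borel[OF x j]
        by (subst (asm) measure_distr) (auto simp: vimage_def Int_def conj_commute)
    qed
    show "(\<lambda>k. sqrt (card {1..int (n k)}) * (cell_prob (A k) x j - pr j)) \<longlonglongrightarrow> drift j" for j
    proof -
      have "(\<lambda>k. (sqrt (n k) * r k) * (cell_prob H x j - pr j)) \<longlonglongrightarrow> drift j"
        unfolding drift_def by (intro tendsto_intros rate_limits)
      then show ?thesis unfolding A_def cell_prob_mixture cn by (simp add: pr_def mult.assoc)
    qed
    show "(\<Sum>j=1..m. cell_prob (A k) x j) = 1" for k
      by (rule sum_cell_prob[OF x]) (use A_sym[of k 0] in simp)
  qed (use P_prob symmetric_cell_borel[OF x] symmetric_cell_disjoint[OF x] symmetric_cell_Union[OF x] pr_pos sum_pr in auto)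
  note lim = this
  \<comment> \<open>The bias is constant and leaves the expectation as a phase.\<close>
  have split: "iexp (\<Sum>j=1..m. w j * (y j + bias j)) = iexp (\<Sum>j=1..m. w j * bias j) * iexp (\<Sum>j=1..m. w j * y j)" for y
  proof -
    have "(\<Sum>j=1..m. w j * (y j + bias j)) = (\<Sum>j=1..m. w j * bias j) + (\<Sum>j=1..m. w j * y j)"
      by (simp add: distrib_left sum.distrib)
    then show ?thesis by (simp only: of_real_add distrib_left exp_add)
  qed
  show ?thesis
    unfolding split integral_mult_right_zero mult.assoc
    by (rule tendsto_mult[OF tendsto_const lim])
qed

lemma bias_orthogonal: "(\<Sum>j=1..m. sqrt (pr j) * bias j) = 0"
proof -
  have "sqrt (pr j) * bias j = \<gamma> * cell_shift G p \<beta> x Q j" if "j \<in> {1..m}" for j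
    using pr_pos[OF that] by (simp add: bias_def)
  then have "(\<Sum>j=1..m. sqrt (pr j) * bias j) = \<gamma> * (\<Sum>j=1..m. cell_shift G p \<beta> x Q j)"
    by (simp add: sum_distrib_left)
  then show ?thesis unfolding sum_cell_shift[OF x] by simp
qed

lemma drift_orthogonal: "(\<Sum>j=1..m. sqrt (pr j) * (drift j / sqrt (pr j))) = 0"
proof -
  have "sqrt (pr j) * (drift j / sqrt (pr j)) = drift j" if "j \<in> {1..m}" for j
    using pr_pos[OF that] by simp
  then have "(\<Sum>j=1..m. sqrt (pr j) * (drift j / sqrt (pr j))) = \<rho> * ((\<Sum>j=1..m. cell_prob H x j) - (\<Sum>j=1..m. pr j))"
    by (simp add: drift_def sum_distrib_left[symmetric] sum_subtractf)
  also have "(\<Sum>j=1..m. cell_prob H x j) = 1"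
    by (rule sum_cell_prob[OF x]) (use H_deriv(5)[of 0] in simp)
  finally show ?thesis unfolding sum_pr by simp
qed

lemma noncentrality_eq: "noncentrality G H p \<beta> m x \<rho> \<gamma> Q = (\<Sum>j=1..m. (drift j / sqrt (pr j) + bias j)\<^sup>2)"
  unfolding noncentrality_def L2_set_def
  by (subst real_sqrt_pow2) (auto intro!: sum_nonneg sum.cong simp: drift_def bias_def pr_def add_divide_distrib)

text \<open>The perturbations depend on the deviations in an unspecified way, but they converge in
  probability to constants, so they may be replaced by \<open>bias\<close> inside the transform.
  That constant shift is orthogonal to the vector of the \<open>sqrt (pr j)\<close>, so the
  hyperplane is kept.\<close>

lemma laplace_stat_tendsto:
  assumes l: "l \<ge> 0"
  shows "(\<lambda>k. LINT \<omega>|P k. exp (- l * stat k \<omega>)) \<longlonglongrightarrow>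
    exp (- l * noncentrality G H p \<beta> m x \<rho> \<gamma> Q / (1 + 2 * l)) / sqrt (1 + 2 * l) ^ (m - 1)"
proof -
  let ?S = "\<lambda>k j \<omega>. dev k j \<omega> + bias j"
  have lim: "(\<lambda>k. LINT \<omega>|P k. exp (- l * (\<Sum>j=1..m. (?S k j \<omega>)\<^sup>2))) \<longlonglongrightarrow>
    exp (- l * (\<Sum>j=1..m. (drift j / sqrt (pr j) + bias j)\<^sup>2) / (1 + 2 * l)) / sqrt (1 + 2 * l) ^ (card {1..m} - 1)"
  proof (rule laplace_transform_degenerate_gauss_limit[where s = "\<lambda>j. sqrt (pr j)" and S = ?S])
    show "?S k j \<in> borel_measurable (P k)" if "j \<in> {1..m}" for k j
      using dev_meas[OF that] by measurable
    show "(\<Sum>j=1..m. (sqrt (pr j))\<^sup>2) = 1"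
    proof -
      have "(\<Sum>j=1..m. (sqrt (pr j))\<^sup>2) = (\<Sum>j=1..m. pr j)"
        using pr_pos by (intro sum.cong refl) (simp add: less_imp_le)
      then show ?thesis unfolding sum_pr .
    qed
    show "(\<Sum>j=1..m. sqrt (pr j) * (drift j / sqrt (pr j) + bias j)) = 0"
      unfolding distrib_left sum.distrib by (simp only: drift_orthogonal bias_orthogonal)
    show "(\<Sum>j=1..m. sqrt (pr j) * ?S k j \<omega>) = 0" for k \<omega>
      unfolding distrib_left sum.distrib by (simp only: dev_orthogonal bias_orthogonal)
    show "(\<lambda>k. LINT \<omega>|P k. iexp (\<Sum>j=1..m. w j * ?S k j \<omega>)) \<longlonglongrightarrow>
        iexp (\<Sum>j=1..m. w j * (drift j / sqrt (pr j) + bias j)) *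
        of_real (exp (- ((\<Sum>j=1..m. (w j)\<^sup>2) - (\<Sum>j=1..m. sqrt (pr j) * w j)\<^sup>2) / 2))" for w
      by (rule dev_cf_tendsto)
  qed (use l P_prob in auto)
  have "(\<lambda>k. (LINT \<omega>|P k. exp (- l * stat k \<omega>)) - (LINT \<omega>|P k. exp (- l * (\<Sum>j=1..m. (?S k j \<omega>)\<^sup>2)))) \<longlonglongrightarrow> 0"
  proof (rule Lim_null_comparison)
    show "eventually (\<lambda>k. norm ((LINT \<omega>|P k. exp (- l * stat k \<omega>)) - (LINT \<omega>|P k. exp (- l * (\<Sum>j=1..m. (?S k j \<omega>)\<^sup>2))))
      \<le> max 1 (sqrt l) * (\<Sum>j=1..m. LINT \<omega>|P k. min 1 \<bar>perturbation k j \<omega> - bias j\<bar>)) sequentially"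
    proof (intro always_eventually allI)
      fix k
      interpret Pk: prob_space "P k" by (rule P_prob)
      have sm: "stat k \<in> borel_measurable (P k)"
        unfolding stat_eq[abs_def] by (intro borel_measurable_sum borel_measurable_power borel_measurable_add dev_meas perturbation_meas)
      have Sm: "(\<lambda>\<omega>. \<Sum>j=1..m. (?S k j \<omega>)\<^sup>2) \<in> borel_measurable (P k)"
        by (intro borel_measurable_sum borel_measurable_power borel_measurable_add dev_meas borel_measurable_const)
      have nn: "0 \<le> stat k \<omega>" "0 \<le> (\<Sum>j=1..m. (?S k j \<omega>)\<^sup>2)" for \<omega>
        unfolding stat_eq by (auto intro!: sum_nonneg)
      have i1: "integrable (P k) (\<lambda>\<omega>. exp (- l * stat k \<omega>))"
        by (rule Pk.integrable_const_bound[where B = 1]) (use sm nn l in auto)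
      have i2: "integrable (P k) (\<lambda>\<omega>. exp (- l * (\<Sum>j=1..m. (?S k j \<omega>)\<^sup>2)))"
      proof (rule Pk.integrable_const_bound[where B = 1])
        show "(\<lambda>\<omega>. exp (- l * (\<Sum>j=1..m. (?S k j \<omega>)\<^sup>2))) \<in> borel_measurable (P k)" using Sm by measurable
        show "AE \<omega> in P k. norm (exp (- l * (\<Sum>j=1..m. (?S k j \<omega>)\<^sup>2))) \<le> 1"
          using nn l by (intro AE_I2) (simp add: mult_nonneg_nonneg)
      qed
      have i3: "integrable (P k) (\<lambda>\<omega>. min 1 \<bar>perturbation k j \<omega> - bias j\<bar>)" if "j \<in> {1..m}" for j
        by (rule Pk.integrable_const_bound[where B = 1]) (use perturbation_meas[OF that] in auto)
      have "norm ((LINT \<omega>|P k. exp (- l * stat k \<omega>)) - (LINT \<omega>|P k. exp (- l * (\<Sum>j=1..m. (?S k j \<omega>)\<^sup>2))))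
        = \<bar>LINT \<omega>|P k. exp (- l * stat k \<omega>) - exp (- l * (\<Sum>j=1..m. (?S k j \<omega>)\<^sup>2))\<bar>"
        using i1 i2 by simp
      also have "\<dots> \<le> (LINT \<omega>|P k. \<bar>exp (- l * stat k \<omega>) - exp (- l * (\<Sum>j=1..m. (?S k j \<omega>)\<^sup>2))\<bar>)"
        by (rule integral_abs_bound)
      also have "\<dots> \<le> (LINT \<omega>|P k. max 1 (sqrt l) * (\<Sum>j=1..m. min 1 \<bar>perturbation k j \<omega> - bias j\<bar>))"
      proof (rule integral_mono)
        fix \<omega>
        show "\<bar>exp (- l * stat k \<omega>) - exp (- l * (\<Sum>j=1..m. (?S k j \<omega>)\<^sup>2))\<bar>
          \<le> max 1 (sqrt l) * (\<Sum>j=1..m. min 1 \<bar>perturbation k j \<omega> - bias j\<bar>)"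
          unfolding stat_eq
          using exp_sum_squares_diff_le[OF l, of "{1..m}" "\<lambda>j. dev k j \<omega> + perturbation k j \<omega>" "\<lambda>j. ?S k j \<omega>"]
          by simp
      qed (use i1 i2 i3 in \<open>auto intro!: Bochner_Integration.integrable_sum integrable_mult_right\<close>)
      also have "\<dots> = max 1 (sqrt l) * (\<Sum>j=1..m. LINT \<omega>|P k. min 1 \<bar>perturbation k j \<omega> - bias j\<bar>)"
        using i3 by (simp add: Bochner_Integration.integral_sum)
      finally show "norm ((LINT \<omega>|P k. exp (- l * stat k \<omega>)) - (LINT \<omega>|P k. exp (- l * (\<Sum>j=1..m. (?S k j \<omega>)\<^sup>2))))
        \<le> max 1 (sqrt l) * (\<Sum>j=1..m. LINT \<omega>|P k. min 1 \<bar>perturbation k j \<omega> - bias j\<bar>)" .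
    qed
    have "(\<lambda>k. max 1 (sqrt l) * (\<Sum>j=1..m. LINT \<omega>|P k. min 1 \<bar>perturbation k j \<omega> - bias j\<bar>)) \<longlonglongrightarrow> max 1 (sqrt l) * (\<Sum>j=1..m. 0)"
      by (intro tendsto_mult tendsto_const tendsto_sum perturbation_tendsto)
    then show "(\<lambda>k. max 1 (sqrt l) * (\<Sum>j=1..m. LINT \<omega>|P k. min 1 \<bar>perturbation k j \<omega> - bias j\<bar>)) \<longlonglongrightarrow> 0" by simp
  qed
  from tendsto_add[OF this lim] show ?thesis by (simp add: noncentrality_eq)
qed

text \<open>Laplace transforms at the natural numbers identify the limit law, and as this law has no
  atoms the convergence holds at every \<open>q\<close>.\<close>

lemma power_tendsto:
  "(\<lambda>k. measure (P k) {\<omega> \<in> space (P k). stat k \<omega> > q}) \<longlonglongrightarrow>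
     1 - noncentral_chi_square_cdf (m - 1) q (noncentrality G H p \<beta> m x \<rho> \<gamma> Q)"
proof -
  define l where "l = noncentrality G H p \<beta> m x \<rho> \<gamma> Q"
  define N where "N = noncentral_chi_square (m - 1) (\<lambda>i. if i = 0 then sqrt l else 0)"
  have l: "l \<ge> 0" by (simp add: l_def noncentrality_def)
  have "(\<Sum>i<m - 1. (if i = 0 then sqrt l else 0)\<^sup>2) = (\<Sum>i<m - 1. if i = 0 then l else 0)"
    using l by (intro sum.cong) auto
  \<comment> \<open>\<open>m > 1\<close> guarantees that coordinate 0, which carries the shift, is
    present.\<close>
  also have "\<dots> = l" using m by simp
  finally have sl: "(\<Sum>i<m - 1. (if i = 0 then sqrt l else 0)\<^sup>2) = l" .
  have "(\<lambda>k. measure (P k) {\<omega> \<in> space (P k). stat k \<omega> > q}) \<longlonglongrightarrow> 1 - cdf N q"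
  proof (rule laplace_transform_continuity)
    show "stat k \<in> borel_measurable (P k)" for k
      unfolding stat_eq[abs_def] by (intro borel_measurable_sum borel_measurable_power borel_measurable_add dev_meas perturbation_meas)
    show "stat k \<omega> \<ge> 0" for k \<omega> unfolding stat_eq by (auto intro!: sum_nonneg)
    show "(\<lambda>k. LINT \<omega>|P k. exp (- real i * stat k \<omega>)) \<longlonglongrightarrow> (LINT y|N. exp (- real i * y))" for i
      unfolding N_def noncentral_chi_square_laplace[OF of_nat_0_le_iff] sl
      using laplace_stat_tendsto[of "real i"] by (simp add: l_def)
    show "measure N {q} = 0" unfolding N_def using m by (intro noncentral_chi_square_singleton) auto
    show "AE y in N. y \<ge> 0" unfolding N_def by (rule noncentral_chi_square_nonneg)
  qed (auto simp: N_def P_prob real_distribution_noncentral_chi_square)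
  then show ?thesis unfolding N_def noncentral_chi_square_cdf_def l_def[symmetric] .
qed

end

section \<open>The limiting power\<close>

text \<open>The root of the noncentrality is the norm of a vector linear in \<open>\<rho>\<close>
  and in the multiples by \<open>\<gamma>\<close> of the cell shifts, so the reverse triangle
  inequality applies. The bound serves twice: for continuity in the parameters and for
  robustness.\<close>

lemma limit_power_lipschitz:
  assumes m: "m > 1"
  shows "\<bar>limit_power G H p \<beta> m x \<alpha> \<rho> \<gamma> Q - limit_power G H p \<beta> m x \<alpha> \<rho>' \<gamma>' Q'\<bar> \<le>
    (\<Sum>j=1..m. \<bar>(\<rho> - \<rho>') * (cell_prob H x j - cell_prob G x j) + (\<gamma> * cell_shift G p \<beta> x Q j - \<gamma>' * cell_shift G p \<beta> x Q' j)\<bar>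
        / \<bar>sqrt (cell_prob G x j)\<bar>)"
proof -
  define s where "s = (\<lambda>\<rho> \<gamma> Q j. (\<rho> * (cell_prob H x j - cell_prob G x j) + \<gamma> * cell_shift G p \<beta> x Q j) / sqrt (cell_prob G x j))"
  have root: "sqrt (noncentrality G H p \<beta> m x \<rho> \<gamma> Q) = L2_set (s \<rho> \<gamma> Q) {1..m}" for \<rho> \<gamma> Q
    by (simp add: noncentrality_def s_def L2_set_nonneg)
  have tri: "L2_set s1 {1..m} \<le> L2_set s2 {1..m} + (\<Sum>j=1..m. \<bar>s1 j - s2 j\<bar>)" for s1 s2 :: "nat \<Rightarrow> real"
  proof -
    have "L2_set (\<lambda>j. s2 j + (s1 j - s2 j)) {1..m} \<le> L2_set s2 {1..m} + L2_set (\<lambda>j. s1 j - s2 j) {1..m}"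
      by (rule L2_set_triangle_ineq)
    also have "L2_set (\<lambda>j. s1 j - s2 j) {1..m} \<le> (\<Sum>j=1..m. \<bar>s1 j - s2 j\<bar>)" by (rule L2_set_le_sum_abs)
    finally show ?thesis by simp
  qed
  have "\<bar>limit_power G H p \<beta> m x \<alpha> \<rho> \<gamma> Q - limit_power G H p \<beta> m x \<alpha> \<rho>' \<gamma>' Q'\<bar>
     \<le> \<bar>L2_set (s \<rho> \<gamma> Q) {1..m} - L2_set (s \<rho>' \<gamma>' Q') {1..m}\<bar>"
    using noncentral_chi_square_cdf_lipschitz[of "m - 1" "chi_square_quantile (m - 1) (1 - \<alpha>)"
        "noncentrality G H p \<beta> m x \<rho>' \<gamma>' Q'" "noncentrality G H p \<beta> m x \<rho> \<gamma> Q"] m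
    unfolding limit_power_def root by (simp add: abs_minus_commute)
  also have "\<dots> \<le> (\<Sum>j=1..m. \<bar>s \<rho> \<gamma> Q j - s \<rho>' \<gamma>' Q' j\<bar>)"
    using tri[of "s \<rho> \<gamma> Q" "s \<rho>' \<gamma>' Q'"] tri[of "s \<rho>' \<gamma>' Q'" "s \<rho> \<gamma> Q"]
    by (simp add: abs_le_iff abs_minus_commute)
  also have "\<dots> = (\<Sum>j=1..m. \<bar>(\<rho> - \<rho>') * (cell_prob H x j - cell_prob G x j) + (\<gamma> * cell_shift G p \<beta> x Q j - \<gamma>' * cell_shift G p \<beta> x Q' j)\<bar>
        / \<bar>sqrt (cell_prob G x j)\<bar>)"
  proof (intro sum.cong refl)
    fix j
    have "s \<rho> \<gamma> Q j - s \<rho>' \<gamma>' Q' j = ((\<rho> - \<rho>') * (cell_prob H x j - cell_prob G x j)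
        + (\<gamma> * cell_shift G p \<beta> x Q j - \<gamma>' * cell_shift G p \<beta> x Q' j)) / sqrt (cell_prob G x j)"
      unfolding s_def diff_divide_distrib[symmetric] by (simp add: left_diff_distrib)
    then show "\<bar>s \<rho> \<gamma> Q j - s \<rho>' \<gamma>' Q' j\<bar> = \<bar>(\<rho> - \<rho>') * (cell_prob H x j - cell_prob G x j)
        + (\<gamma> * cell_shift G p \<beta> x Q j - \<gamma>' * cell_shift G p \<beta> x Q' j)\<bar> / \<bar>sqrt (cell_prob G x j)\<bar>"
      by (simp only: abs_divide)
  qed
  finally show ?thesis .
qed

text \<open>Differences of values of \<open>G\<close> are at most 1, whatever \<open>Q\<close> is;
  uniformity over outlier laws comes from here. The 4 is the weight 2 times the two cell
  boundaries.\<close>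

lemma cell_shift_bound:
  assumes Q: "real_distribution Q" and G: "\<And>x. 0 \<le> G x" "\<And>x. G x \<le> 1" "G \<in> borel_measurable borel"
  shows "\<bar>cell_shift G p \<beta> x Q j\<bar> \<le> 4 * (real p + 1)"
proof -
  have "\<bar>outlier_shift_sym G p \<beta> Q y\<bar> \<le> real p + 1" for y
  proof (cases "y = \<infinity>")
    case False
    then show ?thesis
      using outlier_shift_bound[OF assms, of p \<beta> "real_of_ereal y"] outlier_shift_bound[OF assms, of p \<beta> "- real_of_ereal y"]
      by (simp add: outlier_shift_sym_def abs_le_iff)
  qed (simp add: outlier_shift_sym_def)
  from this[of "x j"] this[of "x (j - 1)"] show ?thesis
    unfolding cell_shift_def by (simp add: abs_le_iff)
qed

text \<open>With the same \<open>\<rho>\<close> on both sides its terms cancel in the Lipschitz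
  bound. What is left is \<open>\<gamma> * K\<close> with \<open>K\<close> free of \<open>Q'\<close>
  and \<open>\<rho>\<close>, so the unbounded range of \<open>\<rho>\<close> does no harm.\<close>

lemma limit_power_robust:
  assumes m: "m > 1" and G: "\<And>x. 0 \<le> G x" "\<And>x. G x \<le> 1" "G \<in> borel_measurable borel"
    and Q: "real_distribution (Q :: real measure)"
  shows "((\<lambda>\<gamma>. SUP (Q', \<rho>) \<in> Collect real_distribution \<times> {0..}.
      \<bar>limit_power G H p \<beta> m x \<alpha> \<rho> \<gamma> Q' - limit_power G H p \<beta> m x \<alpha> \<rho> 0 Q'\<bar>) \<longlongrightarrow> 0) (at_right 0)"
    (is "(?S \<longlongrightarrow> 0) _")
proof -
  define K where "K = (\<Sum>j=1..m. 4 * (real p + 1) / \<bar>sqrt (cell_prob G x j)\<bar>)"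
  let ?f = "\<lambda>\<gamma> (Q', \<rho>). \<bar>limit_power G H p \<beta> m x \<alpha> \<rho> \<gamma> Q' - limit_power G H p \<beta> m x \<alpha> \<rho> 0 Q'\<bar>"
  have le: "?f \<gamma> q \<le> \<gamma> * K" if \<gamma>: "\<gamma> \<ge> 0" and qin: "q \<in> Collect real_distribution \<times> {0..}" for \<gamma> q
  proof -
    obtain Q' \<rho> where q: "q = (Q', \<rho>)" "real_distribution Q'" using qin by auto
    have "?f \<gamma> q \<le> (\<Sum>j=1..m. \<bar>\<gamma> * cell_shift G p \<beta> x Q' j\<bar> / \<bar>sqrt (cell_prob G x j)\<bar>)"
      using limit_power_lipschitz[OF m, of G H p \<beta> x \<alpha> \<rho> \<gamma> Q' \<rho> 0 Q'] by (simp add: q)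
    also have "\<dots> \<le> (\<Sum>j=1..m. (\<gamma> * (4 * (real p + 1))) / \<bar>sqrt (cell_prob G x j)\<bar>)"
      using \<gamma> cell_shift_bound[OF q(2) G] by (intro sum_mono divide_right_mono) (auto simp: abs_mult intro!: mult_left_mono)
    also have "\<dots> = \<gamma> * K" by (simp add: K_def sum_distrib_left)
    finally show ?thesis .
  qed
  \<comment> \<open>The supremum is taken in the reals, so the index set has to be nonempty, with
    \<open>Q\<close> as witness, and the values bounded.\<close>
  have ne: "Collect real_distribution \<times> {0..} \<noteq> ({} :: (real measure \<times> real) set)" using Q by auto
  have "eventually (\<lambda>\<gamma>. norm (?S \<gamma>) \<le> \<gamma> * K) (at_right 0)"
    unfolding eventually_at_right_field
  proof (intro exI[of _ 1] conjI allI impI)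
    fix \<gamma> :: real assume "0 < \<gamma>"
    then have le': "\<And>q. q \<in> Collect real_distribution \<times> {0..} \<Longrightarrow> ?f \<gamma> q \<le> \<gamma> * K" using le by simp
    have "?S \<gamma> \<le> \<gamma> * K" using ne le' by (rule cSUP_least)
    moreover have "0 \<le> ?S \<gamma>"
    proof -
      have "0 \<le> ?f \<gamma> (Q, 0)" by simp
      also have "\<dots> \<le> ?S \<gamma>"
        by (rule cSUP_upper) (use Q le' in \<open>auto intro!: bdd_aboveI2[where M = "\<gamma> * K"]\<close>)
      finally show ?thesis .
    qed
    ultimately show "norm (?S \<gamma>) \<le> \<gamma> * K" by simp
  qed simp
  moreover have "((\<lambda>\<gamma>. \<gamma> * K) \<longlongrightarrow> 0 * K) (at_right 0)" by (intro tendsto_intros)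
  ultimately show ?thesis by (intro Lim_null_comparison[of ?S "\<lambda>\<gamma>. \<gamma> * K"]) auto
qed

theorem mainTheorem5:
  fixes p m :: nat and \<beta> :: "nat \<Rightarrow> real" and \<nu> \<mu> \<alpha> :: real
    and G\<^sub>0 H :: "real \<Rightarrow> real" and Q :: "real measure" and x :: "nat \<Rightarrow> ereal"
    and M :: "nat \<Rightarrow> real \<Rightarrow> real \<Rightarrow> 'a measure"
    and \<epsilon> z \<xi> v :: "nat \<Rightarrow> real \<Rightarrow> real \<Rightarrow> int \<Rightarrow> 'a \<Rightarrow> real"
    and Y :: "nat \<Rightarrow> real \<Rightarrow> real \<Rightarrow> 'a \<Rightarrow> int \<Rightarrow> real"
    and muhat :: "nat \<Rightarrow> (int \<Rightarrow> real) \<Rightarrow> real"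
    and betahat :: "nat \<Rightarrow> (int \<Rightarrow> real) \<Rightarrow> nat \<Rightarrow> real"
  assumes "p \<ge> 1" and "stable_coefficients p \<beta>" and "\<nu> = (1 - (\<Sum>j=1..p. \<beta> j)) * \<mu>"
    and "distribution_function G\<^sub>0" and "distribution_function H"
    and "centered_finite_variance G\<^sub>0" and "centered_finite_variance H"
    and "twice_diff_bounded G\<^sub>0" and "twice_diff_bounded H"
    and "symmetric_about_zero G\<^sub>0" and "symmetric_about_zero H"
    and "real_distribution Q"
    and "m > 1" and "cell_boundaries m x"
    and "\<And>j. j \<in> {1..m} \<Longrightarrow> df_at G\<^sub>0 (x j) - df_at G\<^sub>0 (x (j - 1)) > 0"
    and "\<And>n \<gamma> \<rho>. n \<ge> 1 \<Longrightarrow> \<gamma> \<ge> 0 \<Longrightarrow> \<rho> \<ge> 0 \<Longrightarrow>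
           ar_outlier_model (M n \<gamma> \<rho>) p \<beta> \<nu> (local_alternative G\<^sub>0 H \<rho> n) (local_rate \<gamma> n) Q
             (\<epsilon> n \<gamma> \<rho>) (z n \<gamma> \<rho>) (\<xi> n \<gamma> \<rho>) (v n \<gamma> \<rho>)"
    and "\<And>n \<gamma> \<rho>. Y n \<gamma> \<rho> = observations p n (v n \<gamma> \<rho>) (z n \<gamma> \<rho>) (\<xi> n \<gamma> \<rho>)"
    and "\<And>n. n \<ge> 1 \<Longrightarrow> sample_statistic p n (muhat n)"
    and "\<And>n j. n \<ge> 1 \<Longrightarrow> j \<in> {1..p} \<Longrightarrow> sample_statistic p n (\<lambda>y. betahat n y j)"
    and "\<And>\<Gamma> R. \<Gamma> \<ge> 0 \<Longrightarrow> R \<ge> 0 \<Longrightarrow>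
           uniformly_OP1 M (\<lambda>n \<gamma> \<rho> \<omega>. sqrt (real n) * (muhat n (Y n \<gamma> \<rho> \<omega>) - \<mu>)) \<Gamma> R"
    and "\<And>\<Gamma> R. \<Gamma> \<ge> 0 \<Longrightarrow> R \<ge> 0 \<Longrightarrow>
           uniformly_OP1 M
             (\<lambda>n \<gamma> \<rho> \<omega>. L2_set (\<lambda>j. sqrt (real n) * (betahat n (Y n \<gamma> \<rho> \<omega>) j - \<beta> j)) {1..p}) \<Gamma> R"
    and "0 < \<alpha>" and "\<alpha> < 1"
  shows "(\<forall>\<Gamma>\<ge>0. \<forall>R\<ge>0. uniform_limit ({0..\<Gamma>} \<times> {0..R})
            (\<lambda>n (\<gamma>, \<rho>). measure (M n \<gamma> \<rho>)
               {\<omega> \<in> space (M n \<gamma> \<rho>).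
                  pearson_statistic G\<^sub>0 m x p n (muhat n (Y n \<gamma> \<rho> \<omega>)) (betahat n (Y n \<gamma> \<rho> \<omega>)) (Y n \<gamma> \<rho> \<omega>)
                  > chi_square_quantile (m - 1) (1 - \<alpha>)})
            (\<lambda>(\<gamma>, \<rho>). limit_power G\<^sub>0 H p \<beta> m x \<alpha> \<rho> \<gamma> Q) sequentially)
       \<and> limit_power G\<^sub>0 H p \<beta> m x \<alpha> 0 0 Q = \<alpha>
       \<and> ((\<lambda>\<gamma>. SUP (Q', \<rho>) \<in> Collect real_distribution \<times> {0..}.
              \<bar>limit_power G\<^sub>0 H p \<beta> m x \<alpha> \<rho> \<gamma> Q' - limit_power G\<^sub>0 H p \<beta> m x \<alpha> \<rho> 0 Q'\<bar>)
            \<longlongrightarrow> 0) (at_right 0)"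
proof (intro conjI allI impI)
  note a = assms
  have G_range: "0 \<le> G\<^sub>0 y" "G\<^sub>0 y \<le> 1" "G\<^sub>0 \<in> borel_measurable borel" for y
    using distribution_function_range[OF a(4)] a(4) by (auto simp: distribution_function_def intro!: borel_measurable_mono)
  show "((\<lambda>\<gamma>. SUP (Q', \<rho>) \<in> Collect real_distribution \<times> {0..}.
              \<bar>limit_power G\<^sub>0 H p \<beta> m x \<alpha> \<rho> \<gamma> Q' - limit_power G\<^sub>0 H p \<beta> m x \<alpha> \<rho> 0 Q'\<bar>)
            \<longlongrightarrow> 0) (at_right 0)"
    by (rule limit_power_robust[OF a(13) G_range a(12)])
  \<comment> \<open>Without outliers and alternative the shift vector is zero, and the central
    distribution function takes the value \<open>1 - \<alpha>\<close> at its quantile.\<close>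
  show "limit_power G\<^sub>0 H p \<beta> m x \<alpha> 0 0 Q = \<alpha>"
    using noncentral_chi_square_cdf_quantile[of "m - 1" "1 - \<alpha>"] a(13) \<open>0 < \<alpha>\<close> \<open>\<alpha> < 1\<close>
    by (simp add: limit_power_def noncentrality_def L2_set_def)
  fix \<Gamma> R :: real assume \<Gamma>R: "\<Gamma> \<ge> 0" "R \<ge> 0"
  let ?W = "\<lambda>n \<gamma> \<rho>. measure (M n \<gamma> \<rho>) {\<omega> \<in> space (M n \<gamma> \<rho>).
      pearson_statistic G\<^sub>0 m x p n (muhat n (Y n \<gamma> \<rho> \<omega>)) (betahat n (Y n \<gamma> \<rho> \<omega>)) (Y n \<gamma> \<rho> \<omega>)
      > chi_square_quantile (m - 1) (1 - \<alpha>)}"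
  let ?L = "\<lambda>\<gamma> \<rho>. limit_power G\<^sub>0 H p \<beta> m x \<alpha> \<rho> \<gamma> Q"
  obtain f B1 L1 where f: "\<And>y. (G\<^sub>0 has_real_derivative f y) (at y)" "\<And>y. \<bar>f y\<bar> \<le> B1" "\<And>y y'. \<bar>f y - f y'\<bar> \<le> L1 * \<bar>y - y'\<bar>"
    "\<And>y. f (- y) = f y" "\<And>y. G\<^sub>0 (- y) = 1 - G\<^sub>0 y"
    using smooth_symmetric_df[OF a(4,10,8)] by blast
  obtain h B2 L2 where h: "\<And>y. (H has_real_derivative h y) (at y)" "\<And>y. \<bar>h y\<bar> \<le> B2" "\<And>y y'. \<bar>h y - h y'\<bar> \<le> L2 * \<bar>y - y'\<bar>"
    "\<And>y. h (- y) = h y" "\<And>y. H (- y) = 1 - H y"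
    using smooth_symmetric_df[OF a(5,11,9)] by blast
  obtain \<psi> where \<psi>: "\<And>k. \<psi> k = (if k = 0 then 1 else 0) + (\<Sum>j=1..p. if j \<le> k then \<beta> j * \<psi> (k - j) else 0)"
    "summable (\<lambda>k. \<bar>\<psi> k\<bar>)"
    using stable_coefficients_impulse_response[OF a(2)] by blast
  \<comment> \<open>The parameters are confined to one rectangle, because tightness of the
    estimators is uniform on each rectangle separately.\<close>
  have seq: "(\<lambda>k. ?W (n k) (\<gamma>s k) (\<rho>s k)) \<longlonglongrightarrow> ?L \<gamma> \<rho>"
    if n: "filterlim n at_top sequentially" "\<And>k. n k \<ge> 1" and \<gamma>s: "\<And>k. \<gamma>s k \<in> {0..\<Gamma>}" "\<gamma>s \<longlonglongrightarrow> \<gamma>"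
      and \<rho>s: "\<And>k. \<rho>s k \<in> {0..R}" "\<rho>s \<longlonglongrightarrow> \<rho>" for n \<gamma>s \<rho>s \<gamma> \<rho>
  proof -
    interpret S: pearson_sequence p m \<beta> \<psi> \<nu> \<mu> G\<^sub>0 H f h "max B1 B2" "max L1 L2" Q x "\<lambda>k. M (n k) (\<gamma>s k) (\<rho>s k)" n \<gamma>s \<rho>s \<gamma> \<rho>
      "\<lambda>k. \<epsilon> (n k) (\<gamma>s k) (\<rho>s k)" "\<lambda>k. z (n k) (\<gamma>s k) (\<rho>s k)" "\<lambda>k. \<xi> (n k) (\<gamma>s k) (\<rho>s k)" "\<lambda>k. v (n k) (\<gamma>s k) (\<rho>s k)"
      "\<lambda>k. Y (n k) (\<gamma>s k) (\<rho>s k)" "\<lambda>k. muhat (n k)" "\<lambda>k. betahat (n k)"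
    proof (rule pearson_sequence.intro)
      show "\<bar>f y\<bar> \<le> max B1 B2" "\<bar>h y\<bar> \<le> max B1 B2" for y using f(2)[of y] h(2)[of y] by auto
      show "\<bar>f y - f y'\<bar> \<le> max L1 L2 * \<bar>y - y'\<bar>" for y y'
        by (rule order_trans[OF f(3) mult_right_mono]) auto
      show "\<bar>h y - h y'\<bar> \<le> max L1 L2 * \<bar>y - y'\<bar>" for y y'
        by (rule order_trans[OF h(3) mult_right_mono]) auto
      show "cell_prob G\<^sub>0 x j > 0" if "j \<in> {1..m}" for j using a(15)[OF that] by (simp add: cell_prob_def)
      show "\<gamma>s k \<ge> 0" "\<rho>s k \<ge> 0" for k using \<gamma>s(1)[of k] \<rho>s(1)[of k] by auto
      then show "ar_outlier_model (M (n k) (\<gamma>s k) (\<rho>s k)) p \<beta> \<nu> (local_alternative G\<^sub>0 H (\<rho>s k) (n k)) (local_rate (\<gamma>s k) (n k)) Q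
        (\<epsilon> (n k) (\<gamma>s k) (\<rho>s k)) (z (n k) (\<gamma>s k) (\<rho>s k)) (\<xi> (n k) (\<gamma>s k) (\<rho>s k)) (v (n k) (\<gamma>s k) (\<rho>s k))" for k
        using n(2) by (intro a(16)) auto
      show "\<exists>C. eventually (\<lambda>k. measure (M (n k) (\<gamma>s k) (\<rho>s k)) {\<omega> \<in> space (M (n k) (\<gamma>s k) (\<rho>s k)).
          \<bar>sqrt (n k) * (muhat (n k) (Y (n k) (\<gamma>s k) (\<rho>s k) \<omega>) - \<mu>)\<bar> > C} < \<eta>) sequentially" if "\<eta> > 0" for \<eta>
        by (rule uniformly_OP1_sequence[OF a(20)[OF \<Gamma>R] n(1) that \<gamma>s(1) \<rho>s(1)]) (rule exI)
      show "\<exists>C. eventually (\<lambda>k. measure (M (n k) (\<gamma>s k) (\<rho>s k)) {\<omega> \<in> space (M (n k) (\<gamma>s k) (\<rho>s k)).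
          \<bar>L2_set (\<lambda>j. sqrt (n k) * (betahat (n k) (Y (n k) (\<gamma>s k) (\<rho>s k) \<omega>) j - \<beta> j)) {1..p}\<bar> > C} < \<eta>) sequentially" if "\<eta> > 0" for \<eta>
        by (rule uniformly_OP1_sequence[OF a(21)[OF \<Gamma>R] n(1) that \<gamma>s(1) \<rho>s(1)]) (rule exI)
      show "\<psi> k = (if k = 0 then 1 else 0) + (\<Sum>j=1..p. if j \<le> k then \<beta> j * \<psi> (k - j) else 0)" for k by (rule \<psi>(1))
      show "Y (n k) (\<gamma>s k) (\<rho>s k) = observations p (n k) (v (n k) (\<gamma>s k) (\<rho>s k)) (z (n k) (\<gamma>s k) (\<rho>s k)) (\<xi> (n k) (\<gamma>s k) (\<rho>s k))" for k
        by (rule a(17))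
      show "sample_statistic p (n k) (muhat (n k))" for k by (rule a(18)[OF n(2)])
      show "sample_statistic p (n k) (\<lambda>y. betahat (n k) y j)" if "j \<in> {1..p}" for k j by (rule a(19)[OF n(2) that])
    qed (fact a(1) a(3) a(4) a(5) a(6) a(7) a(12) a(13) a(14) \<psi>(2) f(1) f(4) f(5) h(1) h(4) h(5) n \<gamma>s(2) \<rho>s(2))+
    show ?thesis
      using S.power_tendsto[of "chi_square_quantile (m - 1) (1 - \<alpha>)"] unfolding S.stat_def limit_power_def .
  qed
  show "uniform_limit ({0..\<Gamma>} \<times> {0..R}) (\<lambda>n (\<gamma>, \<rho>). ?W n \<gamma> \<rho>) (\<lambda>(\<gamma>, \<rho>). ?L \<gamma> \<rho>) sequentially"
  proof (rule ccontr)
    \<comment> \<open>Failure of uniformity supplies bad parameters at arbitrarily large sample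
      sizes. By compactness of the rectangle some subsequence of them converges, and
      \<open>seq\<close> gives a contradiction.\<close>
    assume "\<not> ?thesis"
    then obtain e where e: "e > 0" and not_ev: "\<not> eventually (\<lambda>n. \<forall>q\<in>{0..\<Gamma>} \<times> {0..R}. dist (case q of (\<gamma>, \<rho>) \<Rightarrow> ?W n \<gamma> \<rho>) (case q of (\<gamma>, \<rho>) \<Rightarrow> ?L \<gamma> \<rho>) < e) sequentially"
      unfolding uniform_limit_iff by blast
    define bad where "bad n q \<longleftrightarrow> q \<in> {0..\<Gamma>} \<times> {0..R} \<and>
      dist (case q of (\<gamma>, \<rho>) \<Rightarrow> ?W n \<gamma> \<rho>) (case q of (\<gamma>, \<rho>) \<Rightarrow> ?L \<gamma> \<rho>) \<ge> e" for n q
    \<comment> \<open>The bound \<open>Suc k\<close> makes the sample sizes at least 1 and drives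
      them to infinity.\<close>
    have "\<exists>nq. fst nq \<ge> Suc k \<and> bad (fst nq) (snd nq)" for k
    proof (rule ccontr)
      assume no: "\<not> ?thesis"
      have good: "dist (case q of (\<gamma>, \<rho>) \<Rightarrow> ?W n \<gamma> \<rho>) (case q of (\<gamma>, \<rho>) \<Rightarrow> ?L \<gamma> \<rho>) < e"
        if "n \<ge> Suc k" "q \<in> {0..\<Gamma>} \<times> {0..R}" for n q
      proof (rule ccontr)
        assume "\<not> ?thesis"
        then have "bad n q" using that(2) unfolding bad_def not_less by (rule conjI[rotated])
        then show False using no that(1) by (metis fst_conv snd_conv)
      qed
      show False
        using not_ev unfolding eventually_sequentially by (rule notE) (intro exI[of _ "Suc k"] allI impI ballI good)
    qed
    then obtain nq where nq0: "\<And>k. fst (nq k) \<ge> Suc k \<and> bad (fst (nq k)) (snd (nq k))" by metis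
    define n where "n k = fst (nq k)" for k
    define \<gamma>s where "\<gamma>s k = fst (snd (nq k))" for k
    define \<rho>s where "\<rho>s k = snd (snd (nq k))" for k
    have nq: "n k \<ge> Suc k" "(\<gamma>s k, \<rho>s k) \<in> {0..\<Gamma>} \<times> {0..R}" "dist (?W (n k) (\<gamma>s k) (\<rho>s k)) (?L (\<gamma>s k) (\<rho>s k)) \<ge> e" for k
      using nq0[of k] unfolding bad_def n_def \<gamma>s_def \<rho>s_def by (simp_all add: case_prod_beta)
    have "compact ({0..\<Gamma>} \<times> {0..R})" by (intro compact_Times compact_Icc)
    from this[unfolded compact_def, rule_format, of "\<lambda>k. (\<gamma>s k, \<rho>s k)", OF nq(2)]
    obtain q \<phi> where \<phi>: "strict_mono \<phi>" "(\<lambda>k. (\<gamma>s (\<phi> k), \<rho>s (\<phi> k))) \<longlonglongrightarrow> q"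
      unfolding comp_def by blast
    define \<gamma> \<rho> where "\<gamma> = fst q" and "\<rho> = snd q"
    have lim: "(\<lambda>k. \<gamma>s (\<phi> k)) \<longlonglongrightarrow> \<gamma>" "(\<lambda>k. \<rho>s (\<phi> k)) \<longlonglongrightarrow> \<rho>"
      using tendsto_fst[OF \<phi>(2)] tendsto_snd[OF \<phi>(2)] by (simp_all add: \<gamma>_def \<rho>_def)
    have nlim: "filterlim (\<lambda>k. n (\<phi> k)) at_top sequentially"
    proof (rule filterlim_at_top_mono[OF filterlim_subseq[OF \<phi>(1)]])
      show "eventually (\<lambda>k. \<phi> k \<le> n (\<phi> k)) sequentially"
        using nq(1) by (intro always_eventually allI) (meson Suc_leD)
    qed
    have W: "(\<lambda>k. ?W (n (\<phi> k)) (\<gamma>s (\<phi> k)) (\<rho>s (\<phi> k))) \<longlonglongrightarrow> ?L \<gamma> \<rho>"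
    proof (rule seq[OF nlim _ _ lim(1) _ lim(2)])
      show "n (\<phi> k) \<ge> 1" for k using nq(1)[of "\<phi> k"] by linarith
    qed (use nq(2) in auto)
    \<comment> \<open>The limit power is evaluated at moving parameters, whereas \<open>W\<close>
      gives its value at their limit; the Lipschitz bound closes the gap.\<close>
    have L: "(\<lambda>k. ?L (\<gamma>s (\<phi> k)) (\<rho>s (\<phi> k)) - ?L \<gamma> \<rho>) \<longlonglongrightarrow> 0"
    proof (rule Lim_null_comparison)
      let ?B = "\<lambda>k. (\<Sum>j=1..m. \<bar>(\<rho>s (\<phi> k) - \<rho>) * (cell_prob H x j - cell_prob G\<^sub>0 x j)
        + (\<gamma>s (\<phi> k) * cell_shift G\<^sub>0 p \<beta> x Q j - \<gamma> * cell_shift G\<^sub>0 p \<beta> x Q j)\<bar> / \<bar>sqrt (cell_prob G\<^sub>0 x j)\<bar>)"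
      show "eventually (\<lambda>k. norm (?L (\<gamma>s (\<phi> k)) (\<rho>s (\<phi> k)) - ?L \<gamma> \<rho>) \<le> ?B k) sequentially"
        unfolding real_norm_def by (intro always_eventually allI limit_power_lipschitz a(13))
      have "?B \<longlonglongrightarrow> (\<Sum>j=1..m. \<bar>(\<rho> - \<rho>) * (cell_prob H x j - cell_prob G\<^sub>0 x j)
        + (\<gamma> * cell_shift G\<^sub>0 p \<beta> x Q j - \<gamma> * cell_shift G\<^sub>0 p \<beta> x Q j)\<bar> * inverse \<bar>sqrt (cell_prob G\<^sub>0 x j)\<bar>)"
        unfolding divide_inverse by (intro tendsto_intros lim)
      then show "?B \<longlonglongrightarrow> 0" by simp
    qed
    have "(\<lambda>k. (?W (n (\<phi> k)) (\<gamma>s (\<phi> k)) (\<rho>s (\<phi> k)) - ?L \<gamma> \<rho>) - (?L (\<gamma>s (\<phi> k)) (\<rho>s (\<phi> k)) - ?L \<gamma> \<rho>)) \<longlonglongrightarrow> (?L \<gamma> \<rho> - ?L \<gamma> \<rho>) - 0"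
      by (rule tendsto_diff[OF tendsto_diff[OF W tendsto_const] L])
    then have "(\<lambda>k. ?W (n (\<phi> k)) (\<gamma>s (\<phi> k)) (\<rho>s (\<phi> k)) - ?L (\<gamma>s (\<phi> k)) (\<rho>s (\<phi> k))) \<longlonglongrightarrow> 0"
      by simp
    from LIMSEQ_D[OF this e] obtain k where "norm (?W (n (\<phi> k)) (\<gamma>s (\<phi> k)) (\<rho>s (\<phi> k)) - ?L (\<gamma>s (\<phi> k)) (\<rho>s (\<phi> k)) - 0) < e"
      by blast
    then show False using nq(3)[of "\<phi> k"] by (simp add: dist_norm)
  qed
qed

end
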